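(* Consider the $N$-player stochastic differential game described in the context. Assume the system is mean-square stabilizable, that only strategy tuples in $\mathcal K$ are considered (in particular $\boldsymbol K^\star\in\mathcal K$ below), and that $\boldsymbol Q_i\in\mathbb S^n_{++}$, $\boldsymbol R_{ii}\in\mathbb S^{m_i}_{++}$, $\boldsymbol R_{ij}\in\mathbb S^{m_j}_+$ for all $i\in\mathcal I$, $j\in\mathcal I\setminus\{i\}$. For a tuple $\boldsymbol K^\star=(\boldsymbol K_1^\star,\dots,\boldsymbol K_N^\star)\in\mathcal K$ and $(\boldsymbol P_1,\dots,\boldsymbol P_N)$ with $\boldsymbol P_i\in\mathbb S^n_{++}$, consider the coupled stochastic algebraic Riccati equations, for all $i\in\mathcal I$, $$\boldsymbol 0=\boldsymbol P_i\boldsymbol A_{cl}(\boldsymbol K^\star)+\boldsymbol A_{cl}(\boldsymbol K^\star)^\top\boldsymbol P_i+\boldsymbol C_{cl}(\boldsymbol K^\star)^\top\boldsymbol P_i\boldsymbol C_{cl}(\boldsymbol K^\star)+\boldsymbol Q_i+\sum_{j\in\mathcal I}\boldsymbol K_j^{\star\top}\boldsymbol R_{ij}\boldsymbol K_j^\star\qquad(\mathrm a)$$ with $$\boldsymbol K_i^\star=\bigl(\boldsymbol R_{ii}+\boldsymbol D_i^\top\boldsymbol P_i\boldsymbol D_i\bigr)^{-1}\Bigl(\boldsymbol B_i^\top\boldsymbol P_i+\boldsymbol D_i^\top\boldsymbol P_i\boldsymbol C-\sum_{k\in\mathcal I\setminus\{i\}}\boldsymbol D_i^\top\boldsymbol P_i\boldsymbol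 D_k\boldsymbol K_k^\star\Bigr).\qquad(\mathrm b)$$ (Sufficiency) If there exists an $N$-tuple $(\boldsymbol P_1,\dots,\boldsymbol P_N)$ with $\boldsymbol P_i\in\mathbb S^n_{++}$ for all $i\in\mathcal I$ such that (a) and (b) hold for all $i\in\mathcal I$, then $\boldsymbol K^\star$ is a stabilizing linear feedback Nash equilibrium, and $J_i(\boldsymbol x_0,\boldsymbol K^\star)=\boldsymbol x_0^\top\boldsymbol P_i\boldsymbol x_0$ for all $i\in\mathcal I$ (and all $\boldsymbol x_0\in\mathbb R^n$). (Necessity) Conversely, if $\boldsymbol K^\star$ is a stabilizing linear feedback Nash equilibrium, then the set of equations (a) with (b), $i\in\mathcal I$, has a stabilizing solution, i.e. there exist $\boldsymbol P_i\in\mathbb S^n_{++}$, $i\in\mathcal I$, such that (a) and (b) hold for all $i\in\mathcal I$ with this $\boldsymbol K^\star\in\mathcal K$.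
   Context: Let $(\Omega,\mathcal F,\mathbb P)$ be a probability space with a right-continuous filtration $\{\mathcal F_t\}_{t\ge0}$ such that $\mathcal F_0$ contains all $\mathbb P$-null sets, and let $\omega$ be an adapted one-dimensional standard Wiener process. Players: $\mathcal I=\{1,\dots,N\}$. Dynamics, with adapted state $\boldsymbol x(t)\in\mathbb R^n$, deterministic initial state $\boldsymbol x(0)=\boldsymbol x_0$, and controls $\boldsymbol u_i(t)\in\mathbb R^{m_i}$: $$d\boldsymbol x=\Bigl(\boldsymbol A\boldsymbol x+\sum_{j\in\mathcal I}\boldsymbol B_j\boldsymbol u_j\Bigr)dt+\Bigl(\boldsymbol C\boldsymbol x+\sum_{j\in\mathcal I}\boldsymbol D_j\boldsymbol u_j\Bigr)d\omega,$$ with $\boldsymbol A,\boldsymbol C\in\mathbb R^{n\times n}$, $\boldsymbol B_i,\boldsymbol D_i\in\mathbb R^{n\times m_i}$. Players use constant linear feedback strategies $\boldsymbol u_i(t)=-\boldsymbol K_i\boldsymbol x(t)$, $\boldsymbol K_i\in\mathbb R^{m_i\times n}$; $\boldsymbol K=(\boldsymbol K_1,\dots,\boldsymbol K_N)$. Put $\boldsymbol A_{cl}(\boldsymbol K)=\boldsymbol A-\sum_j\boldsymbol B_j\boldsymbol K_j$, $\boldsymbol C_{cl}(\boldsymbol K)=\boldsymbol C-\sum_j\boldsymbol D_j\boldsymbol K_j$; the closed-loop system is $d\boldsymbol x=\boldsymbol A_{cl}(\boldsymbol K)\boldsymbol x\,dt+\boldsymbol C_{cl}(\boldsymbol K)\boldsymbol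 x\,d\omega$. It is mean-square stable if $\lim_{t\to\infty}\mathbb E[\|\boldsymbol x(t)\|^2]=0$ for all $\boldsymbol x_0\in\mathbb R^n$. $\mathcal K$ is the set of tuples $\boldsymbol K$ for which the closed-loop system is mean-square stable; the system is mean-square stabilizable if $\mathcal K\neq\varnothing$. Cost of player $i$ (to be minimized): $$J_i=\mathbb E\Bigl[\int_0^\infty\boldsymbol x^\top\boldsymbol Q_i\boldsymbol x+\sum_{j\in\mathcal I}\boldsymbol u_j^\top\boldsymbol R_{ij}\boldsymbol u_j\,dt\Bigr],$$ written $J_i(\boldsymbol x_0,\boldsymbol K)=J_i(\boldsymbol x_0,\boldsymbol K_i,\boldsymbol K_{\neg i})$ under feedback strategies, where $\boldsymbol K_{\neg i}=(\boldsymbol K_j)_{j\ne i}$. $\mathbb S^k_{++}$ (resp. $\mathbb S^k_+$) denotes the symmetric positive definite (resp. positive semidefinite) real $k\times k$ matrices. A tuple $\boldsymbol K^\star\in\mathcal K$ is a (stabilizing) linear feedback Nash equilibrium if for all $i\in\mathcal I$ and all $\boldsymbol K_i$ with $(\boldsymbol K_i,\boldsymbol K^\star_{\neg i})\in\mathcal K$ one has $J_i(\boldsymbol x_0,\boldsymbol K_i^\star,\boldsymbol K^\star_{\neg i})\le J_i(\boldsymbol x_0,\boldsymbol K_i,\boldsymbol K^\star_{\neg i})$ for all $\boldsymbol x_0\in\mathbb R^n$. *)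

theory Defs
  imports "HOL-Probability.Probability" "Jordan_Normal_Form.Gauss_Jordan_Elimination"
begin

no_notation vec_nth (infixl \<open>$\<close> 90)
unbundle no inner_syntax
hide_type (open) Finite_Cartesian_Product.vec
hide_const (open) Finite_Cartesian_Product.vec

section \<open>Matrices\<close>

definition quad_form :: "real mat \<Rightarrow> real vec \<Rightarrow> real" where
  "quad_form S v = v \<bullet> (S *\<^sub>v v)"

definition pos_def_mats :: "nat \<Rightarrow> real mat set" where
  "pos_def_mats k =
     {S \<in> carrier_mat k k. S\<^sup>T = S \<and> (\<forall>v \<in> carrier_vec k. v \<noteq> 0\<^sub>v k \<longrightarrow> quad_form S v > 0)}"

definition pos_semidef_mats :: "nat \<Rightarrow> real mat set" where
  "pos_semidef_mats k =
     {S \<in> carrier_mat k k. S\<^sup>T = S \<and> (\<forall>v \<in> carrier_vec k. quad_form S v \<ge> 0)}"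

(* The library's matrix type has dimension-dependent zeros, hence no instance of
   comm_monoid_add and no big sums; the sum of r x c matrices is formed entrywise. *)
definition mat_sum :: "nat \<Rightarrow> nat \<Rightarrow> ('i \<Rightarrow> real mat) \<Rightarrow> 'i set \<Rightarrow> real mat" where
  "mat_sum r c S I = mat r c (\<lambda>(a, b). \<Sum>i\<in>I. S i $$ (a, b))"

section \<open>Wiener process and Ito integral\<close>

(* Only the time parameters t >= 0 of F and w are constrained.  As usual for a Wiener
   process adapted to a given filtration, the increments after time s are independent
   of the whole sigma-algebra F s, not merely of the past of w. *)
locale wiener_setting = prob_space M
  for M :: "'a measure" and F :: "real \<Rightarrow> 'a measure" and w :: "real \<Rightarrow> 'a \<Rightarrow> real" +
  assumes F_sub: "\<And>t. 0 \<le> t \<Longrightarrow> subalgebra M (F t)"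
    and F_mono: "\<And>s t. 0 \<le> s \<Longrightarrow> s \<le> t \<Longrightarrow> subalgebra (F t) (F s)"
    and F_right_continuous: "\<And>t. 0 \<le> t \<Longrightarrow> sets (F t) = (\<Inter>s\<in>{t<..}. sets (F s))"
    and F_null_sets: "null_sets M \<subseteq> sets (F 0)"
    and w_adapted: "\<And>t. 0 \<le> t \<Longrightarrow> w t \<in> borel_measurable (F t)"
    and w_zero: "AE \<omega> in M. w 0 \<omega> = 0"
    and w_continuous: "AE \<omega> in M. continuous_on {0..} (\<lambda>t. w t \<omega>)"
    and w_normal: "\<And>s t. 0 \<le> s \<Longrightarrow> s < t \<Longrightarrow>
           distributed M lborel (\<lambda>\<omega>. w t \<omega> - w s \<omega>) (normal_density 0 (sqrt (t - s)))"
    and w_indep: "\<And>s t. 0 \<le> s \<Longrightarrow> s < t \<Longrightarrow>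
           indep_set (sets (F s)) (sets (vimage_algebra (space M) (\<lambda>\<omega>. w t \<omega> - w s \<omega>) borel))"

definition square_integrable_adapted ::
  "'a measure \<Rightarrow> (real \<Rightarrow> 'a measure) \<Rightarrow> real \<Rightarrow> (real \<Rightarrow> 'a \<Rightarrow> real) \<Rightarrow> bool" where
  "square_integrable_adapted M F T H \<longleftrightarrow>
     (\<forall>t\<in>{0..T}. H t \<in> borel_measurable (F t)) \<and>
     (\<lambda>(t, \<omega>). H t \<omega>) \<in> borel_measurable (restrict_space lborel {0..T} \<Otimes>\<^sub>M M) \<and>
     (\<integral>\<^sup>+\<omega>. (\<integral>\<^sup>+t\<in>{0..T}. ennreal ((H t \<omega>)\<^sup>2) \<partial>lborel) \<partial>M) < \<infinity>"

(* A simple process on [0, T] with grid tau 0 <= ... <= tau m takes the bounded,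
   F (tau k)-measurable value xi k on the interval (tau k, tau (k + 1)]. *)
definition simple_process ::
  "'a measure \<Rightarrow> (real \<Rightarrow> 'a measure) \<Rightarrow> real \<Rightarrow> nat \<Rightarrow> (nat \<Rightarrow> real) \<Rightarrow> (nat \<Rightarrow> 'a \<Rightarrow> real) \<Rightarrow> bool"
where
  "simple_process M F T m \<tau> \<xi> \<longleftrightarrow>
     0 \<le> \<tau> 0 \<and> \<tau> m \<le> T \<and>
     (\<forall>k<m. \<tau> k \<le> \<tau> (Suc k) \<and> \<xi> k \<in> borel_measurable (F (\<tau> k)) \<and> bounded (\<xi> k ` space M))"

definition simple_value ::
  "nat \<Rightarrow> (nat \<Rightarrow> real) \<Rightarrow> (nat \<Rightarrow> 'a \<Rightarrow> real) \<Rightarrow> real \<Rightarrow> 'a \<Rightarrow> real" where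
  "simple_value m \<tau> \<xi> t \<omega> = (\<Sum>k<m. \<xi> k \<omega> * indicator {\<tau> k<..\<tau> (Suc k)} t)"

definition simple_integral ::
  "(real \<Rightarrow> 'a \<Rightarrow> real) \<Rightarrow> nat \<Rightarrow> (nat \<Rightarrow> real) \<Rightarrow> (nat \<Rightarrow> 'a \<Rightarrow> real) \<Rightarrow> 'a \<Rightarrow> real" where
  "simple_integral w m \<tau> \<xi> \<omega> = (\<Sum>k<m. \<xi> k \<omega> * (w (\<tau> (Suc k)) \<omega> - w (\<tau> k) \<omega>))"

(* Y is (a version of) the Ito integral of H over [0, T]: the L2-limit of the integrals of
   simple processes that converge to H in L2 of (Lebesgue measure on [0, T]) x M. *)
definition has_ito_integral ::
  "'a measure \<Rightarrow> (real \<Rightarrow> 'a measure) \<Rightarrow> (real \<Rightarrow> 'a \<Rightarrow> real) \<Rightarrow> real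
     \<Rightarrow> (real \<Rightarrow> 'a \<Rightarrow> real) \<Rightarrow> ('a \<Rightarrow> real) \<Rightarrow> bool" where
  "has_ito_integral M F w T H Y \<longleftrightarrow>
     square_integrable_adapted M F T H \<and> Y \<in> borel_measurable M \<and>
     (\<exists>m \<tau> \<xi>. (\<forall>l. simple_process M F T (m l) (\<tau> l) (\<xi> l)) \<and>
        (\<lambda>l. \<integral>\<^sup>+\<omega>. (\<integral>\<^sup>+t\<in>{0..T}. ennreal ((H t \<omega> - simple_value (m l) (\<tau> l) (\<xi> l) t \<omega>)\<^sup>2) \<partial>lborel) \<partial>M)
          \<longlonglongrightarrow> 0 \<and>
        (\<lambda>l. \<integral>\<^sup>+\<omega>. ennreal ((Y \<omega> - simple_integral w (m l) (\<tau> l) (\<xi> l) \<omega>)\<^sup>2) \<partial>M) \<longlonglongrightarrow> 0)"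

section \<open>The linear-quadratic stochastic differential game\<close>

record lq_game =
  nplayers :: nat
  xdim :: nat
  udim :: "nat \<Rightarrow> nat"
  Amat :: "real mat"
  Bmat :: "nat \<Rightarrow> real mat"
  Cmat :: "real mat"
  Dmat :: "nat \<Rightarrow> real mat"
  Qmat :: "nat \<Rightarrow> real mat"
  Rmat :: "nat \<Rightarrow> nat \<Rightarrow> real mat"

definition players :: "lq_game \<Rightarrow> nat set" where
  "players G = {1..nplayers G}"

definition game_dims :: "lq_game \<Rightarrow> bool" where
  "game_dims G \<longleftrightarrow>
     Amat G \<in> carrier_mat (xdim G) (xdim G) \<and> Cmat G \<in> carrier_mat (xdim G) (xdim G) \<and>
     (\<forall>i\<in>players G. Bmat G i \<in> carrier_mat (xdim G) (udim G i) \<and>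
                     Dmat G i \<in> carrier_mat (xdim G) (udim G i) \<and>
                     Qmat G i \<in> carrier_mat (xdim G) (xdim G) \<and>
                     (\<forall>j\<in>players G. Rmat G i j \<in> carrier_mat (udim G j) (udim G j)))"

definition drift :: "lq_game \<Rightarrow> real vec \<Rightarrow> (nat \<Rightarrow> real vec) \<Rightarrow> real vec" where
  "drift G x u = Amat G *\<^sub>v x + finsum_vec TYPE(real) (xdim G) (\<lambda>j. Bmat G j *\<^sub>v u j) (players G)"

definition diffusion :: "lq_game \<Rightarrow> real vec \<Rightarrow> (nat \<Rightarrow> real vec) \<Rightarrow> real vec" where
  "diffusion G x u = Cmat G *\<^sub>v x + finsum_vec TYPE(real) (xdim G) (\<lambda>j. Dmat G j *\<^sub>v u j) (players G)"

(* Strong solutions on [0, oo) with continuous paths in the class of locally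
   square-integrable adapted processes; the equation is read coordinatewise. *)
definition state_process ::
  "'a measure \<Rightarrow> (real \<Rightarrow> 'a measure) \<Rightarrow> (real \<Rightarrow> 'a \<Rightarrow> real) \<Rightarrow> lq_game \<Rightarrow> real vec
     \<Rightarrow> (nat \<Rightarrow> real \<Rightarrow> 'a \<Rightarrow> real vec) \<Rightarrow> (real \<Rightarrow> 'a \<Rightarrow> real vec) \<Rightarrow> bool" where
  "state_process M F w G x0 u x \<longleftrightarrow>
     (\<forall>t\<ge>0. \<forall>\<omega>\<in>space M. x t \<omega> \<in> carrier_vec (xdim G) \<and>
        (\<forall>j\<in>players G. u j t \<omega> \<in> carrier_vec (udim G j))) \<and>
     (\<forall>T\<ge>0. \<forall>r<xdim G. square_integrable_adapted M F T (\<lambda>t \<omega>. x t \<omega> $ r)) \<and>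
     (\<forall>T\<ge>0. \<forall>j\<in>players G. \<forall>r<udim G j. square_integrable_adapted M F T (\<lambda>t \<omega>. u j t \<omega> $ r)) \<and>
     (\<forall>\<omega>\<in>space M. \<forall>r<xdim G. continuous_on {0..} (\<lambda>t. x t \<omega> $ r)) \<and>
     (\<forall>t\<ge>0. \<forall>r<xdim G. \<exists>Y.
        has_ito_integral M F w t (\<lambda>s \<omega>. diffusion G (x s \<omega>) (\<lambda>j. u j s \<omega>) $ r) Y \<and>
        (AE \<omega> in M. x t \<omega> $ r =
           x0 $ r + (LBINT s:{0..t}. drift G (x s \<omega>) (\<lambda>j. u j s \<omega>) $ r) + Y \<omega>))"

(* Under feedback the solution exists and is unique up to indistinguishability, so the
   choice affects none of the expectations below. *)
definition closed_loop_state ::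
  "'a measure \<Rightarrow> (real \<Rightarrow> 'a measure) \<Rightarrow> (real \<Rightarrow> 'a \<Rightarrow> real) \<Rightarrow> lq_game \<Rightarrow> (nat \<Rightarrow> real mat)
     \<Rightarrow> real vec \<Rightarrow> real \<Rightarrow> 'a \<Rightarrow> real vec" where
  "closed_loop_state M F w G K x0 =
     (SOME x. state_process M F w G x0 (\<lambda>j t \<omega>. - (K j *\<^sub>v x t \<omega>)) x)"

definition mean_square_stable ::
  "'a measure \<Rightarrow> (real \<Rightarrow> 'a measure) \<Rightarrow> (real \<Rightarrow> 'a \<Rightarrow> real) \<Rightarrow> lq_game \<Rightarrow> (nat \<Rightarrow> real mat) \<Rightarrow> bool" where
  "mean_square_stable M F w G K \<longleftrightarrow>
     (\<forall>x0\<in>carrier_vec (xdim G).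
        ((\<lambda>t. \<integral>\<^sup>+\<omega>. ennreal (closed_loop_state M F w G K x0 t \<omega> \<bullet> closed_loop_state M F w G K x0 t \<omega>) \<partial>M)
           \<longlongrightarrow> 0) at_top)"

definition stabilizing_tuples ::
  "'a measure \<Rightarrow> (real \<Rightarrow> 'a measure) \<Rightarrow> (real \<Rightarrow> 'a \<Rightarrow> real) \<Rightarrow> lq_game \<Rightarrow> (nat \<Rightarrow> real mat) set" where
  "stabilizing_tuples M F w G =
     {K. (\<forall>i\<in>players G. K i \<in> carrier_mat (udim G i) (xdim G)) \<and> mean_square_stable M F w G K}"

definition mean_square_stabilizable ::
  "'a measure \<Rightarrow> (real \<Rightarrow> 'a measure) \<Rightarrow> (real \<Rightarrow> 'a \<Rightarrow> real) \<Rightarrow> lq_game \<Rightarrow> bool" where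
  "mean_square_stabilizable M F w G \<longleftrightarrow> stabilizing_tuples M F w G \<noteq> {}"

(* With values in [0, oo]: for positive semidefinite weights the running cost is
   nonnegative, so ennreal does not truncate it. *)
definition cost ::
  "'a measure \<Rightarrow> lq_game \<Rightarrow> nat \<Rightarrow> (nat \<Rightarrow> real \<Rightarrow> 'a \<Rightarrow> real vec) \<Rightarrow> (real \<Rightarrow> 'a \<Rightarrow> real vec) \<Rightarrow> ennreal"
where
  "cost M G i u x =
     (\<integral>\<^sup>+\<omega>. (\<integral>\<^sup>+t\<in>{0..}. ennreal (quad_form (Qmat G i) (x t \<omega>) +
                  (\<Sum>j\<in>players G. quad_form (Rmat G i j) (u j t \<omega>))) \<partial>lborel) \<partial>M)"

definition feedback_cost ::
  "'a measure \<Rightarrow> (real \<Rightarrow> 'a measure) \<Rightarrow> (real \<Rightarrow> 'a \<Rightarrow> real) \<Rightarrow> lq_game \<Rightarrow> nat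
     \<Rightarrow> real vec \<Rightarrow> (nat \<Rightarrow> real mat) \<Rightarrow> ennreal" where
  "feedback_cost M F w G i x0 K =
     (let x = closed_loop_state M F w G K x0
      in cost M G i (\<lambda>j t \<omega>. - (K j *\<^sub>v x t \<omega>)) x)"

definition feedback_nash_equilibrium ::
  "'a measure \<Rightarrow> (real \<Rightarrow> 'a measure) \<Rightarrow> (real \<Rightarrow> 'a \<Rightarrow> real) \<Rightarrow> lq_game \<Rightarrow> (nat \<Rightarrow> real mat) \<Rightarrow> bool" where
  "feedback_nash_equilibrium M F w G K \<longleftrightarrow>
     K \<in> stabilizing_tuples M F w G \<and>
     (\<forall>i\<in>players G. \<forall>Ki. K(i := Ki) \<in> stabilizing_tuples M F w G \<longrightarrow>
        (\<forall>x0\<in>carrier_vec (xdim G).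
           feedback_cost M F w G i x0 K \<le> feedback_cost M F w G i x0 (K(i := Ki))))"

section \<open>Coupled stochastic algebraic Riccati equations\<close>

definition A_cl :: "lq_game \<Rightarrow> (nat \<Rightarrow> real mat) \<Rightarrow> real mat" where
  "A_cl G K = Amat G - mat_sum (xdim G) (xdim G) (\<lambda>j. Bmat G j * K j) (players G)"

definition C_cl :: "lq_game \<Rightarrow> (nat \<Rightarrow> real mat) \<Rightarrow> real mat" where
  "C_cl G K = Cmat G - mat_sum (xdim G) (xdim G) (\<lambda>j. Dmat G j * K j) (players G)"

definition riccati_equation :: "lq_game \<Rightarrow> (nat \<Rightarrow> real mat) \<Rightarrow> (nat \<Rightarrow> real mat) \<Rightarrow> nat \<Rightarrow> bool" where
  "riccati_equation G K P i \<longleftrightarrow>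
     0\<^sub>m (xdim G) (xdim G) =
       P i * A_cl G K + (A_cl G K)\<^sup>T * P i + (C_cl G K)\<^sup>T * P i * C_cl G K + Qmat G i
       + mat_sum (xdim G) (xdim G) (\<lambda>j. (K j)\<^sup>T * Rmat G i j * K j) (players G)"

(* The inverted matrix is positive definite in the situation of interest, so mat_inverse
   returns Some inverse there. *)
definition riccati_gain :: "lq_game \<Rightarrow> (nat \<Rightarrow> real mat) \<Rightarrow> (nat \<Rightarrow> real mat) \<Rightarrow> nat \<Rightarrow> bool" where
  "riccati_gain G K P i \<longleftrightarrow>
     K i = the (mat_inverse (Rmat G i i + (Dmat G i)\<^sup>T * P i * Dmat G i)) *
       ((Bmat G i)\<^sup>T * P i + (Dmat G i)\<^sup>T * P i * Cmat G
        - mat_sum (udim G i) (xdim G) (\<lambda>k. (Dmat G i)\<^sup>T * P i * Dmat G k * K k) (players G - {i}))"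

end

theory Submission
  imports Defs "Jordan_Normal_Form.Determinant"
begin

text \<open>Along the closed loop the second moments of the state obey a linear differential equation: by the Ito
  product rule, the derivative of E[x' P x] is E[x' L(P) x], where L is the Lyapunov operator of the closed loop.
  If P > 0 and L(P) + W = 0 for the running weight W of player i, integrating to infinity under mean-square
  stability gives the cost x0' P x0. When player i alone changes his gain by Delta, completing the square turns
  L(P) + W into twice the symmetric part of Delta' H plus Delta' S Delta, where S > 0 and H is the amount by which
  the gain equation (b) fails. If H = 0, no deviation lowers the cost. Conversely, stability makes L injective
  on symmetric matrices, so L(P) + W = 0 is solvable, and P > 0; a small step Delta = - eps H keeps P as a
  Lyapunov function, hence is stabilizing, and it lowers the cost strictly unless H = 0.

  The state is chosen by a SOME operator, so strong solutions have to be constructed for any of this to apply.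
  The Picard iterates are modified to be integrals of simple processes, which have pathwise continuous versions
  by definition.\<close>

section \<open>Square-integrable functions\<close>

text \<open>The definitions ask for more than L2 theory alone gives: adapted solutions with every
  path continuous, and Ito integrals reached by simple processes on ordered grids. Since
  \<open>F 0\<close> contains the null sets, a process may be altered on a null set and stay
  adapted; this happens once for the paths on which \<open>w\<close> is discontinuous and once for
  those on which the iterates fail to converge. The diffusion term of the k-th iterate is matched on
  [0, k + 1] up to a squared error (1/16)^k, and a weight exp (l t) makes the squared Picard
  increments shrink at the same rate. Doob's inequality and Borel-Cantelli at level (1/2)^k then
  cost (1/16)^k / (1/4)^k = (1/4)^k, which is summable. Whatever is said about the closed loop is
  derived from the equation it solves, hence holds for whichever solution the choice operator
  returns. In the last step eps is 1 / c, with c a bound of the form S by the squared norm, so that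
  - 2 eps + c eps^2 = - eps.\<close>

definition square_integrable :: "'b measure \<Rightarrow> ('b \<Rightarrow> real) \<Rightarrow> bool" where
  "square_integrable N f \<longleftrightarrow> f \<in> borel_measurable N \<and> integrable N (\<lambda>z. (f z)\<^sup>2)"

lemma square_integrable_measurable: "square_integrable N f \<Longrightarrow> f \<in> borel_measurable N"
  by (simp add: square_integrable_def)

lemma square_integrable_sq: "square_integrable N f \<Longrightarrow> integrable N (\<lambda>z. (f z)\<^sup>2)"
  by (simp add: square_integrable_def)

lemma abs_mult_le_sum_squares: "\<bar>a * b\<bar> \<le> a\<^sup>2 + (b::real)\<^sup>2"
proof -
  have "2 * \<bar>a * b\<bar> \<le> a\<^sup>2 + b\<^sup>2"
    using sum_squares_bound[of "\<bar>a\<bar>" "\<bar>b\<bar>"] by (simp add: abs_mult)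
  then show ?thesis using abs_ge_zero[of "a * b"] by linarith
qed

lemma square_integrable_mult:
  assumes "square_integrable N f" "square_integrable N g"
  shows "integrable N (\<lambda>z. f z * g z)"
proof (rule Bochner_Integration.integrable_bound)
  show "integrable N (\<lambda>z. (f z)\<^sup>2 + (g z)\<^sup>2)"
    using assms by (auto simp: square_integrable_def)
  show "(\<lambda>z. f z * g z) \<in> borel_measurable N"
    using assms by (auto simp: square_integrable_def)
  show "AE z in N. norm (f z * g z) \<le> norm ((f z)\<^sup>2 + (g z)\<^sup>2)"
    using abs_mult_le_sum_squares by (auto intro!: AE_I2)
qed

lemma square_integrable_cmult: "square_integrable N f \<Longrightarrow> square_integrable N (\<lambda>z. c * f z)"
  by (auto simp: square_integrable_def power_mult_distrib)

lemma square_integrable_add: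
  assumes "square_integrable N f" "square_integrable N g"
  shows "square_integrable N (\<lambda>z. f z + g z)"
  using square_integrable_mult[OF assms] assms
  by (auto simp: square_integrable_def power2_sum mult.assoc)

lemma square_integrable_uminus: "square_integrable N f \<Longrightarrow> square_integrable N (\<lambda>z. - f z)"
  by (auto simp: square_integrable_def)

lemma square_integrable_diff:
  assumes "square_integrable N f" "square_integrable N g"
  shows "square_integrable N (\<lambda>z. f z - g z)"
  using square_integrable_add[OF assms(1) square_integrable_uminus[OF assms(2)]] by simp

lemma square_integrable_zero: "square_integrable N (\<lambda>z. 0)"
  by (auto simp: square_integrable_def)

lemma square_integrable_sum:
  assumes "\<And>i. i \<in> I \<Longrightarrow> square_integrable N (f i)"
  shows "square_integrable N (\<lambda>z. \<Sum>i\<in>I. f i z)"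
  using assms
  by (induction I rule: infinite_finite_induct)
    (auto intro: square_integrable_add square_integrable_zero)

lemma square_integrable_bounded:
  assumes "finite_measure N" "f \<in> borel_measurable N" "\<And>z. z \<in> space N \<Longrightarrow> \<bar>f z\<bar> \<le> b"
  shows "square_integrable N f"
  unfolding square_integrable_def
proof (intro conjI finite_measure.integrable_const_bound[OF assms(1), where B = "b\<^sup>2"] AE_I2)
  fix z assume "z \<in> space N"
  then show "norm ((f z)\<^sup>2) \<le> b\<^sup>2"
    using assms(3)[of z] by (metis abs_ge_zero abs_power2 order_trans power2_abs power_mono real_norm_def)
qed (use assms(2) in auto)

lemma square_integrable_integrable:
  assumes "finite_measure N" "square_integrable N f"
  shows "integrable N f"
  using square_integrable_mult[OF assms(2) square_integrable_bounded[OF assms(1), of "\<lambda>_. 1" 1]] by simp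

lemma square_integrable_cong:
  assumes "\<And>z. z \<in> space N \<Longrightarrow> f z = g z" "square_integrable N f"
  shows "square_integrable N g"
  using assms unfolding square_integrable_def
  by (metis (mono_tags, lifting) Bochner_Integration.integrable_cong measurable_cong)

lemma square_integrable_cong_AE:
  assumes "square_integrable N f" "g \<in> borel_measurable N" "AE z in N. f z = g z"
  shows "square_integrable N g"
proof -
  have "integrable N (\<lambda>z. (g z)\<^sup>2)"
    by (rule integrable_cong_AE_imp[OF square_integrable_sq[OF assms(1)]]) (use assms in auto)
  then show ?thesis using assms by (simp add: square_integrable_def)
qed

lemma square_integrable_iff_nn_integral:
  assumes "f \<in> borel_measurable N"
  shows "square_integrable N f \<longleftrightarrow> (\<integral>\<^sup>+z. ennreal ((f z)\<^sup>2) \<partial>N) < \<infinity>"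
  using assms by (auto simp: square_integrable_def integrable_iff_bounded)

section \<open>Cauchy-Schwarz and convergence in L2\<close>

lemma integral_mult_square_le:
  assumes f: "square_integrable N f" and g: "square_integrable N g"
  shows "(\<integral>z. f z * g z \<partial>N)\<^sup>2 \<le> (\<integral>z. (f z)\<^sup>2 \<partial>N) * (\<integral>z. (g z)\<^sup>2 \<partial>N)"
proof -
  define a b c where "a = (\<integral>z. (f z)\<^sup>2 \<partial>N)" "b = (\<integral>z. (g z)\<^sup>2 \<partial>N)" "c = (\<integral>z. f z * g z \<partial>N)"
  note fi = square_integrable_sq[OF f] and gi = square_integrable_sq[OF g]
    and fg = square_integrable_mult[OF f g]
  \<comment> \<open>The form (x, y) |-> integral of (x f + y g)^2 is nonnegative; Cauchy-Schwarz
    says that its discriminant is not positive.\<close>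
  have quad: "0 \<le> x\<^sup>2 * a + 2 * x * y * c + y\<^sup>2 * b" for x y
  proof -
    have "0 \<le> (\<integral>z. (x * f z + y * g z)\<^sup>2 \<partial>N)" by simp
    also have "\<dots> = (\<integral>z. x\<^sup>2 * (f z)\<^sup>2 + (2 * x * y) * (f z * g z) + y\<^sup>2 * (g z)\<^sup>2 \<partial>N)"
      by (intro Bochner_Integration.integral_cong) (auto simp: power2_eq_square algebra_simps)
    also have "\<dots> = x\<^sup>2 * a + 2 * x * y * c + y\<^sup>2 * b"
      using fi gi fg by (simp add: a_b_c_def)
    finally show ?thesis .
  qed
  have b0: "0 \<le> b" by (simp add: a_b_c_def)
  have "c\<^sup>2 \<le> a * b"
  proof (cases "b = 0")
    case True
    have "c = 0"
    proof (rule ccontr)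
      assume "c \<noteq> 0"
      \<comment> \<open>With \<open>b = 0\<close> the form is affine in \<open>y\<close>; this
        \<open>y\<close> makes it a - (a + 1) = - 1.\<close>
      moreover have "0 \<le> a + 2 * (- (a + 1) / (2 * c)) * c"
        using quad[of 1 "- (a + 1) / (2 * c)"] True by simp
      ultimately show False by (simp add: field_simps)
    qed
    then show ?thesis using True by simp
  next
    case False
    \<comment> \<open>The minimizing direction (x, y) = (b, - c).\<close>
    have "0 \<le> b * (a * b - c\<^sup>2)"
      using quad[of b "- c"] by (simp add: power2_eq_square algebra_simps)
    then show ?thesis using b0 False by (simp add: zero_le_mult_iff)
  qed
  then show ?thesis by (simp add: a_b_c_def)
qed

text \<open>A triangle inequality for squared norms, free of square roots. Its factor 2 is where the
  constants 4, 5, 8 and 10 of the Picard estimates come from.\<close>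

lemma integral_square_add_le:
  assumes f: "square_integrable N f" and g: "square_integrable N g"
  shows "(\<integral>z. (f z + g z)\<^sup>2 \<partial>N) \<le> 2 * (\<integral>z. (f z)\<^sup>2 \<partial>N) + 2 * (\<integral>z. (g z)\<^sup>2 \<partial>N)"
proof -
  have "(\<integral>z. (f z + g z)\<^sup>2 \<partial>N) \<le> (\<integral>z. 2 * (f z)\<^sup>2 + 2 * (g z)\<^sup>2 \<partial>N)"
  proof (rule integral_mono)
    show "integrable N (\<lambda>z. (f z + g z)\<^sup>2)"
      using square_integrable_add[OF f g] by (rule square_integrable_sq)
    show "integrable N (\<lambda>z. 2 * (f z)\<^sup>2 + 2 * (g z)\<^sup>2)"
      using f g by (auto simp: square_integrable_def)
    show "(f z + g z)\<^sup>2 \<le> 2 * (f z)\<^sup>2 + 2 * (g z)\<^sup>2" for z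
      using sum_squares_bound[of "f z" "g z"] by (simp add: power2_sum)
  qed
  also have "\<dots> = 2 * (\<integral>z. (f z)\<^sup>2 \<partial>N) + 2 * (\<integral>z. (g z)\<^sup>2 \<partial>N)"
    using f g by (simp add: square_integrable_def)
  finally show ?thesis .
qed

text \<open>Square integrability is part of the notion because the Bochner integral of a
  non-integrable function is 0, so that the limit condition alone could hold vacuously.\<close>

definition l2_tendsto :: "'b measure \<Rightarrow> (nat \<Rightarrow> 'b \<Rightarrow> real) \<Rightarrow> ('b \<Rightarrow> real) \<Rightarrow> bool" where
  "l2_tendsto N f g \<longleftrightarrow> (\<forall>l. square_integrable N (f l)) \<and> square_integrable N g \<and>
     (\<lambda>l. \<integral>z. (f l z - g z)\<^sup>2 \<partial>N) \<longlonglongrightarrow> 0"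

text \<open>Cauchy-Schwarz. The hypothesis is on the product of the squared norms, so it covers two
  null sequences as well as a null sequence against a constant one.\<close>

lemma integral_mult_tendsto_0:
  assumes "\<And>l. square_integrable N (u l)" "\<And>l. square_integrable N (v l)"
    and "(\<lambda>l. (\<integral>z. (u l z)\<^sup>2 \<partial>N) * (\<integral>z. (v l z)\<^sup>2 \<partial>N)) \<longlonglongrightarrow> 0"
  shows "(\<lambda>l. \<integral>z. u l z * v l z \<partial>N) \<longlonglongrightarrow> 0"
proof -
  have "(\<lambda>l. (\<integral>z. u l z * v l z \<partial>N)\<^sup>2) \<longlonglongrightarrow> 0"
    by (rule tendsto_sandwich[OF _ _ tendsto_const assms(3)])
      (use integral_mult_square_le[OF assms(1,2)] in auto)
  from tendsto_real_sqrt[OF this] show ?thesis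
    by (simp add: tendsto_rabs_zero_iff)
qed

text \<open>f g - F G = (f - F)(g - G) + F (g - G) + (f - F) G, and each term is controlled by
  \<open>integral_mult_tendsto_0\<close>. This is how the isometry passes to limits.\<close>

lemma l2_tendsto_integral_mult:
  assumes f: "l2_tendsto N f F" and g: "l2_tendsto N g G"
  shows "(\<lambda>l. \<integral>z. f l z * g l z \<partial>N) \<longlonglongrightarrow> (\<integral>z. F z * G z \<partial>N)"
proof -
  note fs = f[unfolded l2_tendsto_def] and gs = g[unfolded l2_tendsto_def]
  have df: "square_integrable N (\<lambda>z. f l z - F z)" and dg: "square_integrable N (\<lambda>z. g l z - G z)" for l
    using fs gs by (auto intro: square_integrable_diff)
  have 1: "(\<lambda>l. \<integral>z. (f l z - F z) * (g l z - G z) \<partial>N) \<longlonglongrightarrow> 0"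
    using fs gs by (intro integral_mult_tendsto_0 df dg tendsto_mult_zero) auto
  have 2: "(\<lambda>l. \<integral>z. F z * (g l z - G z) \<partial>N) \<longlonglongrightarrow> 0"
    using fs gs by (intro integral_mult_tendsto_0 df dg tendsto_mult_right_zero) auto
  have 3: "(\<lambda>l. \<integral>z. (f l z - F z) * G z \<partial>N) \<longlonglongrightarrow> 0"
    using fs gs by (intro integral_mult_tendsto_0 df dg tendsto_mult_left_zero) auto
  have "(\<integral>z. f l z * g l z \<partial>N) = (\<integral>z. (f l z - F z) * (g l z - G z) \<partial>N)
      + (\<integral>z. F z * (g l z - G z) \<partial>N) + (\<integral>z. (f l z - F z) * G z \<partial>N) + (\<integral>z. F z * G z \<partial>N)" for l
  proof -
    have "(\<integral>z. f l z * g l z \<partial>N) = (\<integral>z. (f l z - F z) * (g l z - G z) + F z * (g l z - G z)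
        + (f l z - F z) * G z + F z * G z \<partial>N)"
      by (intro Bochner_Integration.integral_cong) (auto simp: algebra_simps)
    also have "\<dots> = (\<integral>z. (f l z - F z) * (g l z - G z) \<partial>N)
      + (\<integral>z. F z * (g l z - G z) \<partial>N) + (\<integral>z. (f l z - F z) * G z \<partial>N) + (\<integral>z. F z * G z \<partial>N)"
      using square_integrable_mult[OF df dg] square_integrable_mult[OF _ dg, of F]
        square_integrable_mult[OF df, of G] square_integrable_mult[of N F G] fs gs
      by simp
    finally show ?thesis .
  qed
  with tendsto_add[OF tendsto_add[OF tendsto_add[OF 1 2] 3] tendsto_const[of "\<integral>z. F z * G z \<partial>N"]]
  show ?thesis by simp
qed

lemma l2_tendsto_const: "square_integrable N f \<Longrightarrow> l2_tendsto N (\<lambda>_. f) f"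
  by (simp add: l2_tendsto_def)

text \<open>Convergence in the definitions is stated with \<open>nn_integral\<close>, which makes
  sense before the limit is known to be square integrable. That it is follows from one index at
  which the distance is below 1.\<close>

lemma l2_tendsto_of_nn_integral:
  assumes "\<And>l. square_integrable N (f l)" "g \<in> borel_measurable N"
    and "(\<lambda>l. \<integral>\<^sup>+z. ennreal ((g z - f l z)\<^sup>2) \<partial>N) \<longlonglongrightarrow> 0"
  shows "l2_tendsto N f g"
proof -
  have [measurable]: "f l \<in> borel_measurable N" "g \<in> borel_measurable N" for l
    using assms by (auto simp: square_integrable_def)
  have "eventually (\<lambda>l. (\<integral>\<^sup>+z. ennreal ((g z - f l z)\<^sup>2) \<partial>N) < 1) sequentially"
    using order_tendstoD(2)[OF assms(3), of 1] by simp
  then obtain l where "(\<integral>\<^sup>+z. ennreal ((g z - f l z)\<^sup>2) \<partial>N) < 1"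
    by (auto simp: eventually_sequentially)
  then have "square_integrable N (\<lambda>z. g z - f l z)"
    by (subst square_integrable_iff_nn_integral) (auto intro: less_trans)
  from square_integrable_add[OF this assms(1)[of l]] have g: "square_integrable N g" by simp
  have "(\<integral>\<^sup>+z. ennreal ((g z - f l z)\<^sup>2) \<partial>N) = ennreal (\<integral>z. (f l z - g z)\<^sup>2 \<partial>N)" for l
    using square_integrable_sq[OF square_integrable_diff[OF assms(1)[of l] g]]
    by (subst nn_integral_eq_integral) (auto simp: power2_commute)
  then have "(\<lambda>l. ennreal (\<integral>z. (f l z - g z)\<^sup>2 \<partial>N)) \<longlonglongrightarrow> ennreal 0"
    using assms(3) by simp
  then have "(\<lambda>l. \<integral>z. (f l z - g z)\<^sup>2 \<partial>N) \<longlonglongrightarrow> 0"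
    by (subst (asm) tendsto_ennreal_iff) auto
  then show ?thesis using assms(1) g by (simp add: l2_tendsto_def)
qed

lemma nn_integral_of_l2_tendsto:
  assumes "l2_tendsto N f g"
  shows "(\<lambda>l. \<integral>\<^sup>+z. ennreal ((g z - f l z)\<^sup>2) \<partial>N) \<longlonglongrightarrow> 0"
proof -
  have "(\<integral>\<^sup>+z. ennreal ((g z - f l z)\<^sup>2) \<partial>N) = ennreal (\<integral>z. (f l z - g z)\<^sup>2 \<partial>N)" for l
    using square_integrable_sq[OF square_integrable_diff] assms
    by (subst nn_integral_eq_integral) (auto simp: power2_commute l2_tendsto_def)
  moreover have "(\<lambda>l. ennreal (\<integral>z. (f l z - g z)\<^sup>2 \<partial>N)) \<longlonglongrightarrow> ennreal 0"
    using assms by (intro tendsto_ennrealI) (simp add: l2_tendsto_def)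
  ultimately show ?thesis by simp
qed

text \<open>The limit is known almost everywhere, and Fatou's lemma in \<open>d\<close> turns the
  bound on \<open>f (k + d) - f k\<close> into one on \<open>g - f k\<close>. Only the steps from
  \<open>k0\<close> on are controlled, as the estimates of the iteration begin late.\<close>

lemma l2_tendsto_geometric:
  assumes f: "\<And>k. square_integrable N (f k)" and g: "g \<in> borel_measurable N"
    and lim: "AE z in N. (\<lambda>k. f k z) \<longlonglongrightarrow> g z"
    and step: "\<And>k. k \<ge> k0 \<Longrightarrow> (\<integral>z. (f (Suc k) z - f k z)\<^sup>2 \<partial>N) \<le> C * (1/16)^k"
  shows "l2_tendsto N f g"
proof -
  have [measurable]: "f k \<in> borel_measurable N" "g \<in> borel_measurable N" for k
    using assms by (auto simp: square_integrable_def)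
  have "0 \<le> (\<integral>z. (f (Suc k0) z - f k0 z)\<^sup>2 \<partial>N)" by simp
  also have "\<dots> \<le> C * (1/16)^k0" using step[of k0] by simp
  finally have C: "0 \<le> C"
    using mult_neg_pos[of C "(1/16)^k0"] by (intro leI notI) simp
  \<comment> \<open>The factor 4 is reproduced by the induction: 2 (4 C / 16) + 2 C = 5 C / 2 \<le>
    4 C.\<close>
  have bound: "(\<integral>z. (f (k + d) z - f k z)\<^sup>2 \<partial>N) \<le> 4 * C * (1/16)^k" if "k \<ge> k0" for k d
    using that
  proof (induction d arbitrary: k)
    case 0
    then show ?case using C by simp
  next
    case (Suc d)
    have "(\<integral>z. (f (k + Suc d) z - f k z)\<^sup>2 \<partial>N)
       = (\<integral>z. ((f (Suc k + d) z - f (Suc k) z) + (f (Suc k) z - f k z))\<^sup>2 \<partial>N)"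
      by simp
    also have "\<dots> \<le> 2 * (\<integral>z. (f (Suc k + d) z - f (Suc k) z)\<^sup>2 \<partial>N) + 2 * (\<integral>z. (f (Suc k) z - f k z)\<^sup>2 \<partial>N)"
      by (intro integral_square_add_le square_integrable_diff f)
    also have "\<dots> \<le> 2 * (4 * C * (1/16)^(Suc k)) + 2 * (C * (1/16)^k)"
      using Suc.IH[of "Suc k"] step[of k] Suc.prems by simp
    also have "\<dots> \<le> 4 * C * (1/16)^k"
      using C by simp
    finally show ?case .
  qed
  have nn: "(\<integral>\<^sup>+z. ennreal ((g z - f k z)\<^sup>2) \<partial>N) \<le> ennreal (4 * C * (1/16)^k)" if k: "k \<ge> k0" for k
  proof -
    have "(\<integral>\<^sup>+z. ennreal ((g z - f k z)\<^sup>2) \<partial>N) = (\<integral>\<^sup>+z. liminf (\<lambda>d. ennreal ((f (k + d) z - f k z)\<^sup>2)) \<partial>N)"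
    proof (intro nn_integral_cong_AE, use lim in eventually_elim)
      case (elim z)
      then have "(\<lambda>d. f (k + d) z) \<longlonglongrightarrow> g z"
        by (subst add.commute) (rule LIMSEQ_ignore_initial_segment)
      then have "(\<lambda>d. ennreal ((f (k + d) z - f k z)\<^sup>2)) \<longlonglongrightarrow> ennreal ((g z - f k z)\<^sup>2)"
        by (intro tendsto_ennrealI tendsto_power tendsto_diff tendsto_const)
      then show ?case
        by (intro lim_imp_Liminf[symmetric] sequentially_bot)
    qed
    also have "\<dots> \<le> liminf (\<lambda>d. \<integral>\<^sup>+z. ennreal ((f (k + d) z - f k z)\<^sup>2) \<partial>N)"
      by (intro nn_integral_liminf) measurable
    also have "\<dots> \<le> ennreal (4 * C * (1/16)^k)"
    proof (rule Liminf_le[OF sequentially_bot always_eventually], rule allI)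
      fix d
      have "(\<integral>\<^sup>+z. ennreal ((f (k + d) z - f k z)\<^sup>2) \<partial>N) = ennreal (\<integral>z. (f (k + d) z - f k z)\<^sup>2 \<partial>N)"
        by (intro nn_integral_eq_integral square_integrable_sq square_integrable_diff f) simp
      then show "(\<integral>\<^sup>+z. ennreal ((f (k + d) z - f k z)\<^sup>2) \<partial>N) \<le> ennreal (4 * C * (1/16)^k)"
        using bound[OF k, of d] by (simp add: ennreal_leI)
    qed
    finally show ?thesis .
  qed
  have "(\<lambda>k. (1/16::real)^k) \<longlonglongrightarrow> 0" by (rule LIMSEQ_power_zero) simp
  from tendsto_ennrealI[OF tendsto_mult_right_zero[OF this, of "4 * C"]]
  have lim0: "(\<lambda>k. ennreal (4 * C * (1/16)^k)) \<longlonglongrightarrow> 0" by (simp only: ennreal_0)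
  have "(\<lambda>k. \<integral>\<^sup>+z. ennreal ((g z - f k z)\<^sup>2) \<partial>N) \<longlonglongrightarrow> 0"
  proof (rule tendsto_sandwich[OF _ _ tendsto_const lim0])
    show "\<forall>\<^sub>F k in sequentially. (\<integral>\<^sup>+z. ennreal ((g z - f k z)\<^sup>2) \<partial>N) \<le> ennreal (4 * C * (1/16)^k)"
      using nn by (rule eventually_sequentiallyI)
  qed (intro always_eventually allI zero_le)
  then show ?thesis
    by (rule l2_tendsto_of_nn_integral[OF f g])
qed

section \<open>The Ito integral\<close>

lemma square_integrable_bounded_mult:
  assumes "square_integrable N f" "h \<in> borel_measurable N" "\<And>z. z \<in> space N \<Longrightarrow> \<bar>h z\<bar> \<le> b"
  shows "square_integrable N (\<lambda>z. h z * f z)"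
  unfolding square_integrable_def
proof (intro conjI)
  have [measurable]: "f \<in> borel_measurable N" "h \<in> borel_measurable N"
    using assms by (auto simp: square_integrable_def)
  show "(\<lambda>z. h z * f z) \<in> borel_measurable N" by measurable
  show "integrable N (\<lambda>z. (h z * f z)\<^sup>2)"
  proof (rule Bochner_Integration.integrable_bound)
    show "integrable N (\<lambda>z. b\<^sup>2 * (f z)\<^sup>2)"
      using assms(1) by (auto simp: square_integrable_def)
    show "AE z in N. norm ((h z * f z)\<^sup>2) \<le> norm (b\<^sup>2 * (f z)\<^sup>2)"
    proof (rule AE_I2)
      fix z assume "z \<in> space N"
      then have "\<bar>h z\<bar>\<^sup>2 \<le> b\<^sup>2" using assms(3) by (intro power_mono) auto
      then show "norm ((h z * f z)\<^sup>2) \<le> norm (b\<^sup>2 * (f z)\<^sup>2)"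
        by (simp add: power_mult_distrib mult_right_mono)
    qed
  qed measurable
qed

abbreviation time_lebesgue :: "real \<Rightarrow> real measure" where
  "time_lebesgue T \<equiv> restrict_space lborel {0..T}"

lemma finite_measure_time_lebesgue: "finite_measure (time_lebesgue T)"
  by (rule finite_measureI) (simp add: emeasure_restrict_space space_restrict_space emeasure_lborel_Icc_eq)

lemma measurable_restrict_pair:
  assumes "f \<in> borel_measurable (L \<Otimes>\<^sub>M N)"
  shows "f \<in> borel_measurable (restrict_space L A \<Otimes>\<^sub>M N)"
proof -
  have "(\<lambda>z. (fst z, snd z)) \<in> (restrict_space L A \<Otimes>\<^sub>M N) \<rightarrow>\<^sub>M (L \<Otimes>\<^sub>M N)"
    by (intro measurable_Pair measurable_compose[OF measurable_fst measurable_restrict_space1]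
        measurable_snd measurable_ident_sets refl)
  from measurable_compose[OF this assms] show ?thesis by simp
qed

lemma time_lebesgue_integral: "integral\<^sup>L (time_lebesgue T) f = (LBINT s:{0..T}. f s)" for f :: "real \<Rightarrow> real"
  by (subst integral_restrict_space) (auto simp: set_lebesgue_integral_def)

section \<open>Increments of the Wiener process\<close>

context wiener_setting
begin

abbreviation time_space :: "real \<Rightarrow> (real \<times> 'a) measure" where
  "time_space T \<equiv> time_lebesgue T \<Otimes>\<^sub>M M"

lemma pair_sigma_finite_time: "pair_sigma_finite (time_lebesgue T) M"
  using finite_measure_time_lebesgue[of T]
  by (intro pair_sigma_finite.intro) (auto simp: finite_measure_def sigma_finite_measure_axioms)

lemma finite_measure_time_space: "finite_measure (time_space T)"
  by (intro finite_measure_pair_measure finite_measure_axioms finite_measure_time_lebesgue)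

lemma space_F: "0 \<le> t \<Longrightarrow> space (F t) = space M"
  using F_sub by (auto simp: subalgebra_def)

lemma measurable_F: "0 \<le> t \<Longrightarrow> f \<in> borel_measurable (F t) \<Longrightarrow> f \<in> borel_measurable M"
  using F_sub measurable_from_subalg by blast

lemma measurable_F_mono: "0 \<le> s \<Longrightarrow> s \<le> t \<Longrightarrow> f \<in> borel_measurable (F s) \<Longrightarrow> f \<in> borel_measurable (F t)"
  using F_mono measurable_from_subalg by blast

lemma w_measurable: "0 \<le> s \<Longrightarrow> s \<le> t \<Longrightarrow> w s \<in> borel_measurable (F t)"
  using w_adapted measurable_F_mono by blast

lemma increment_moments:
  assumes "0 \<le> s" "s < t"
  shows "square_integrable M (\<lambda>\<omega>. w t \<omega> - w s \<omega>)"
    and "expectation (\<lambda>\<omega>. w t \<omega> - w s \<omega>) = 0"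
    and "expectation (\<lambda>\<omega>. (w t \<omega> - w s \<omega>)\<^sup>2) = t - s"
proof -
  note D = w_normal[OF assms]
  have pos: "sqrt (t - s) > 0" using assms by simp
  have meas: "(\<lambda>\<omega>. w t \<omega> - w s \<omega>) \<in> borel_measurable M"
    using distributed_measurable[OF D] by simp
  have "integrable M (\<lambda>\<omega>. (w t \<omega> - w s \<omega>)\<^sup>2)"
    using integrable_normal_moment[OF pos, of 0 2] distributed_integrable[OF D, of "\<lambda>x. x\<^sup>2"] by simp
  then show "square_integrable M (\<lambda>\<omega>. w t \<omega> - w s \<omega>)"
    using meas by (simp add: square_integrable_def)
  show e: "expectation (\<lambda>\<omega>. w t \<omega> - w s \<omega>) = 0"
    using normal_distributed_expectation[OF pos D] by simp
  show "expectation (\<lambda>\<omega>. (w t \<omega> - w s \<omega>)\<^sup>2) = t - s"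
    using normal_distributed_variance[OF pos D] e assms by simp
qed

lemma increment_indep:
  assumes "0 \<le> s" "s < t" "X \<in> borel_measurable (F s)"
  shows "indep_var borel X borel (\<lambda>\<omega>. w t \<omega> - w s \<omega>)"
proof -
  have X: "X \<in> borel_measurable M" using measurable_F assms by blast
  have D: "(\<lambda>\<omega>. w t \<omega> - w s \<omega>) \<in> borel_measurable M"
    using distributed_measurable[OF w_normal[OF assms(1,2)]] by simp
  \<comment> \<open>\<open>X\<close> generates a sub-sigma-algebra of \<open>F s\<close>, so
    independence from all of \<open>F s\<close> restricts to it.\<close>
  have sub: "sigma_sets (space M) {X -` A \<inter> space M |A. A \<in> sets borel} \<subseteq> sets (F s)"
    using sets.sigma_sets_subset[of "{X -` A \<inter> space M |A. A \<in> sets borel}" "F s"]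
      measurable_sets[OF assms(3)] space_F[OF assms(1)] by auto
  have "indep_set (sigma_sets (space M) {X -` A \<inter> space M |A. A \<in> sets borel})
     (sigma_sets (space M) {(\<lambda>\<omega>. w t \<omega> - w s \<omega>) -` A \<inter> space M |A. A \<in> sets borel})"
    using w_indep[OF assms(1,2)] unfolding indep_set_def sets_vimage_algebra
    by (rule indep_sets_mono_sets) (use sub in \<open>auto split: bool.split\<close>)
  then show ?thesis
    unfolding indep_var_eq using X D by auto
qed

text \<open>Independence of the increment from \<open>F s\<close> factorizes the expectations. The
  case \<open>s = t\<close> is included so that stopped intervals, which may be degenerate, are
  covered.\<close>

lemma increment_product:
  assumes "0 \<le> s" "s \<le> t" "X \<in> borel_measurable (F s)" "integrable M X"
  shows "integrable M (\<lambda>\<omega>. X \<omega> * (w t \<omega> - w s \<omega>))"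
    and "expectation (\<lambda>\<omega>. X \<omega> * (w t \<omega> - w s \<omega>)) = 0"
    and "integrable M (\<lambda>\<omega>. X \<omega> * (w t \<omega> - w s \<omega>)\<^sup>2)"
    and "expectation (\<lambda>\<omega>. X \<omega> * (w t \<omega> - w s \<omega>)\<^sup>2) = expectation X * (t - s)"
proof -
  have "integrable M (\<lambda>\<omega>. X \<omega> * (w t \<omega> - w s \<omega>)) \<and> expectation (\<lambda>\<omega>. X \<omega> * (w t \<omega> - w s \<omega>)) = 0
      \<and> integrable M (\<lambda>\<omega>. X \<omega> * (w t \<omega> - w s \<omega>)\<^sup>2)
      \<and> expectation (\<lambda>\<omega>. X \<omega> * (w t \<omega> - w s \<omega>)\<^sup>2) = expectation X * (t - s)"
  proof (cases "s = t")
    case False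
    then have st: "s < t" using assms by simp
    note mom = increment_moments[OF assms(1) st]
    have i1: "integrable M (\<lambda>\<omega>. w t \<omega> - w s \<omega>)"
      by (rule square_integrable_integrable[OF finite_measure_axioms mom(1)])
    have i2: "integrable M (\<lambda>\<omega>. (w t \<omega> - w s \<omega>)\<^sup>2)"
      by (rule square_integrable_sq[OF mom(1)])
    note ind = increment_indep[OF assms(1) st assms(3)]
    have ind2: "indep_var borel X borel (\<lambda>\<omega>. (w t \<omega> - w s \<omega>)\<^sup>2)"
      using indep_var_compose[OF ind, of "\<lambda>x. x" borel "\<lambda>x. x\<^sup>2" borel] by (simp add: comp_def)
    show ?thesis
      using indep_var_integrable[OF ind assms(4) i1] indep_var_lebesgue_integral[OF ind assms(4) i1]
        indep_var_integrable[OF ind2 assms(4) i2] indep_var_lebesgue_integral[OF ind2 assms(4) i2] mom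
      by simp
  qed simp
  then show "integrable M (\<lambda>\<omega>. X \<omega> * (w t \<omega> - w s \<omega>))"
    and "expectation (\<lambda>\<omega>. X \<omega> * (w t \<omega> - w s \<omega>)) = 0"
    and "integrable M (\<lambda>\<omega>. X \<omega> * (w t \<omega> - w s \<omega>)\<^sup>2)"
    and "expectation (\<lambda>\<omega>. X \<omega> * (w t \<omega> - w s \<omega>)\<^sup>2) = expectation X * (t - s)"
    by blast+
qed

lemma increment_square_integrable:
  assumes "0 \<le> s" "s \<le> t"
  shows "square_integrable M (\<lambda>\<omega>. w t \<omega> - w s \<omega>)"
  using increment_moments(1)[OF assms(1), of t] assms square_integrable_zero
  by (cases "s = t") auto

lemma bounded_F_bound:
  assumes "bounded (\<xi> ` space M)"
  obtains B where "\<And>\<omega>. \<omega> \<in> space M \<Longrightarrow> \<bar>\<xi> \<omega> :: real\<bar> \<le> B"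
  using assms by (auto simp: bounded_iff)

text \<open>With \<open>a \<le> c\<close> the product of the coefficients is \<open>F c\<close>
  measurable. Cutting both intervals at \<open>c\<close> and at the end of the overlap leaves one
  squared increment, whose mean is its length, and products of increments over intervals without
  overlap.\<close>

lemma rectangle_isometry_aux:
  assumes ab: "0 \<le> a" "a \<le> b" and cd: "c \<le> d" and ac: "a \<le> c"
    and x: "\<xi> \<in> borel_measurable (F a)" "bounded (\<xi> ` space M)"
    and y: "\<eta> \<in> borel_measurable (F c)" "bounded (\<eta> ` space M)"
  shows "expectation (\<lambda>\<omega>. (\<xi> \<omega> * (w b \<omega> - w a \<omega>)) * (\<eta> \<omega> * (w d \<omega> - w c \<omega>)))
    = expectation (\<lambda>\<omega>. \<xi> \<omega> * \<eta> \<omega>) * max 0 (min b d - max a c)"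
proof -
  define Z where "Z \<omega> = \<xi> \<omega> * \<eta> \<omega>" for \<omega>
  have c0: "0 \<le> c" using ab ac by simp
  have Zm: "Z \<in> borel_measurable (F c)"
    unfolding Z_def using measurable_F_mono[OF ab(1) ac x(1)] y(1) by measurable
  obtain B1 B2 where "\<And>\<omega>. \<omega> \<in> space M \<Longrightarrow> \<bar>\<xi> \<omega>\<bar> \<le> B1" "\<And>\<omega>. \<omega> \<in> space M \<Longrightarrow> \<bar>\<eta> \<omega>\<bar> \<le> B2"
    using bounded_F_bound[OF x(2)] bounded_F_bound[OF y(2)] by metis
  then have ZB: "\<bar>Z \<omega>\<bar> \<le> \<bar>B1\<bar> * \<bar>B2\<bar>" if "\<omega> \<in> space M" for \<omega>
    using that unfolding Z_def abs_mult by (intro mult_mono) (fastforce intro: order_trans[OF _ abs_ge_self])+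
  have ZM: "Z \<in> borel_measurable M" by (rule measurable_F[OF c0 Zm])
  have Zint: "integrable M Z"
    by (rule square_integrable_integrable[OF finite_measure_axioms
          square_integrable_bounded[OF finite_measure_axioms ZM ZB]])
  have Zsq: "square_integrable M (\<lambda>\<omega>. Z \<omega> * (w q \<omega> - w p \<omega>))" if "0 \<le> p" "p \<le> q" for p q
    by (rule square_integrable_bounded_mult[OF increment_square_integrable[OF that] ZM ZB])
  have Zsq_mult: "integrable M (\<lambda>\<omega>. Z \<omega> * (w q \<omega> - w p \<omega>) * (w q' \<omega> - w p' \<omega>))"
    if "0 \<le> p" "p \<le> q" "0 \<le> p'" "p' \<le> q'" for p q p' q'
    by (rule square_integrable_mult[OF Zsq[OF that(1,2)] increment_square_integrable[OF that(3,4)]])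
  have wm: "w p \<in> borel_measurable (F q)" if "0 \<le> p" "p \<le> q" for p q
    using w_measurable that by blast
  \<comment> \<open>\<open>Z\<close> and the earlier increment are known at time \<open>p'\<close>,
    where the later increment, of mean zero, starts; \<open>c \<le> p'\<close> is what makes
    \<open>Z\<close> known there.\<close>
  have disj: "expectation (\<lambda>\<omega>. Z \<omega> * (w q \<omega> - w p \<omega>) * (w q' \<omega> - w p' \<omega>)) = 0"
    if "0 \<le> p" "p \<le> q" "q \<le> p'" "p' \<le> q'" "c \<le> p'" for p q p' q'
  proof (rule increment_product(2))
    show "(\<lambda>\<omega>. Z \<omega> * (w q \<omega> - w p \<omega>)) \<in> borel_measurable (F p')"
    proof -
      have [measurable]: "w q \<in> borel_measurable (F p')" "w p \<in> borel_measurable (F p')"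
        "Z \<in> borel_measurable (F p')"
        using that by (auto intro!: wm measurable_F_mono[OF c0 that(5) Zm])
      show ?thesis by measurable
    qed
    show "integrable M (\<lambda>\<omega>. Z \<omega> * (w q \<omega> - w p \<omega>))"
      by (rule square_integrable_integrable[OF finite_measure_axioms Zsq[OF that(1,2)]])
  qed (use that in auto)
  show ?thesis
  proof (cases "b \<le> c")
    case True
    have "expectation (\<lambda>\<omega>. (\<xi> \<omega> * (w b \<omega> - w a \<omega>)) * (\<eta> \<omega> * (w d \<omega> - w c \<omega>)))
        = expectation (\<lambda>\<omega>. Z \<omega> * (w b \<omega> - w a \<omega>) * (w d \<omega> - w c \<omega>))"
      by (intro Bochner_Integration.integral_cong) (auto simp: Z_def)
    also have "\<dots> = 0" using True ab cd by (intro disj) auto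
    finally show ?thesis using True ac by simp
  next
    case False
    \<comment> \<open>The right end of the overlap (c, m].\<close>
    define m where "m = min b d"
    have m: "c \<le> m" "m \<le> b" "m \<le> d" "0 \<le> m" using False cd c0 by (auto simp: m_def)
    have "expectation (\<lambda>\<omega>. (\<xi> \<omega> * (w b \<omega> - w a \<omega>)) * (\<eta> \<omega> * (w d \<omega> - w c \<omega>)))
        = expectation (\<lambda>\<omega>. Z \<omega> * (w c \<omega> - w a \<omega>) * (w d \<omega> - w c \<omega>)
            + Z \<omega> * (w m \<omega> - w c \<omega>)\<^sup>2
            + Z \<omega> * (w m \<omega> - w c \<omega>) * (w d \<omega> - w m \<omega>)
            + Z \<omega> * (w b \<omega> - w m \<omega>) * (w d \<omega> - w c \<omega>))"
      by (intro Bochner_Integration.integral_cong) (auto simp: Z_def power2_eq_square algebra_simps)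
    also have "\<dots> = expectation (\<lambda>\<omega>. Z \<omega> * (w c \<omega> - w a \<omega>) * (w d \<omega> - w c \<omega>))
            + expectation (\<lambda>\<omega>. Z \<omega> * (w m \<omega> - w c \<omega>)\<^sup>2)
            + expectation (\<lambda>\<omega>. Z \<omega> * (w m \<omega> - w c \<omega>) * (w d \<omega> - w m \<omega>))
            + expectation (\<lambda>\<omega>. Z \<omega> * (w b \<omega> - w m \<omega>) * (w d \<omega> - w c \<omega>))"
      using ab ac cd m c0 Zsq_mult[of a c c d] Zsq_mult[of c m m d] Zsq_mult[of m b c d]
        increment_product(3)[OF c0 m(1) Zm Zint]
      by simp
    also have "expectation (\<lambda>\<omega>. Z \<omega> * (w c \<omega> - w a \<omega>) * (w d \<omega> - w c \<omega>)) = 0"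
      using ab ac cd by (intro disj) auto
    also have "expectation (\<lambda>\<omega>. Z \<omega> * (w m \<omega> - w c \<omega>) * (w d \<omega> - w m \<omega>)) = 0"
      using m c0 by (intro disj) auto
    also have "expectation (\<lambda>\<omega>. Z \<omega> * (w m \<omega> - w c \<omega>)\<^sup>2) = expectation Z * (m - c)"
      by (rule increment_product(4)[OF c0 m(1) Zm Zint])
    \<comment> \<open>Either \<open>m = b\<close> and the first increment is 0, or
      \<open>m = d\<close> and (c, d] precedes (d, b].\<close>
    also have "expectation (\<lambda>\<omega>. Z \<omega> * (w b \<omega> - w m \<omega>) * (w d \<omega> - w c \<omega>)) = 0"
    proof (cases "m = b")
      case False
      then have md: "m = d" by (auto simp: m_def)
      have "expectation (\<lambda>\<omega>. Z \<omega> * (w b \<omega> - w m \<omega>) * (w d \<omega> - w c \<omega>))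
         = expectation (\<lambda>\<omega>. Z \<omega> * (w d \<omega> - w c \<omega>) * (w b \<omega> - w m \<omega>))"
        by (simp add: mult_ac)
      also have "\<dots> = 0" using md m c0 by (intro disj) auto
      finally show ?thesis .
    qed simp
    finally show ?thesis using m ac by (simp add: Z_def[abs_def] m_def max_def)
  qed
qed

lemma rectangle_isometry:
  assumes ab: "0 \<le> a" "a \<le> b" and cd: "0 \<le> c" "c \<le> d"
    and x: "\<xi> \<in> borel_measurable (F a)" "bounded (\<xi> ` space M)"
    and y: "\<eta> \<in> borel_measurable (F c)" "bounded (\<eta> ` space M)"
  shows "expectation (\<lambda>\<omega>. (\<xi> \<omega> * (w b \<omega> - w a \<omega>)) * (\<eta> \<omega> * (w d \<omega> - w c \<omega>)))
    = expectation (\<lambda>\<omega>. \<xi> \<omega> * \<eta> \<omega>) * max 0 (min b d - max a c)"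
proof (cases "a \<le> c")
  case True
  then show ?thesis using rectangle_isometry_aux assms by blast
next
  case False
  then have "c \<le> a" by simp
  from rectangle_isometry_aux[OF cd ab(2) this y x] show ?thesis
    by (simp add: mult.commute min.commute max.commute)
qed

end

section \<open>Elementary integrals: martingale property and isometry\<close>

context wiener_setting
begin

lemma integral_time_space_product:
  assumes f: "f \<in> borel_measurable lborel" "\<And>s. \<bar>f s\<bar> \<le> (B::real)"
    and g: "integrable M g"
  shows "integral\<^sup>L (time_space t) (\<lambda>(s, \<omega>). f s * g \<omega>) = (LBINT s:{0..t}. f s) * expectation g"
proof -
  interpret P: pair_sigma_finite "time_lebesgue t" M by (rule pair_sigma_finite_time)
  interpret T: finite_measure "time_lebesgue t" by (rule finite_measure_time_lebesgue)
  have fm: "f \<in> borel_measurable (time_lebesgue t)"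
    using f(1) by (rule measurable_restrict_space1)
  have fi: "integrable (time_lebesgue t) f"
    using fm f(2) by (intro T.integrable_const_bound[of _ B]) auto
  have [measurable]: "f \<in> borel_measurable (time_lebesgue t)" "g \<in> borel_measurable M"
    using fm g by auto
  have "integrable (time_space t) (\<lambda>(s, \<omega>). f s * g \<omega>)"
  proof (rule P.Fubini_integrable)
    show "(\<lambda>(s, \<omega>). f s * g \<omega>) \<in> borel_measurable (time_space t)" by measurable
    have "integrable (time_lebesgue t) (\<lambda>s. \<bar>f s\<bar> * expectation (\<lambda>\<omega>. \<bar>g \<omega>\<bar>))"
      by (intro integrable_mult_left integrable_abs fi)
    then show "integrable (time_lebesgue t) (\<lambda>s. \<integral>\<omega>. norm (case (s, \<omega>) of (s, \<omega>) \<Rightarrow> f s * g \<omega>) \<partial>M)"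
      by (simp only: case_prod_conv real_norm_def abs_mult integral_mult_right_zero)
    show "AE s in time_lebesgue t. integrable M (\<lambda>\<omega>. case (s, \<omega>) of (s, \<omega>) \<Rightarrow> f s * g \<omega>)"
      using g by (intro AE_I2) (simp only: case_prod_conv integrable_mult_right)
  qed
  from P.integral_fst'[OF this]
  have "integral\<^sup>L (time_space t) (\<lambda>(s, \<omega>). f s * g \<omega>) = (\<integral>s. f s * expectation g \<partial>time_lebesgue t)"
    using g by simp
  then show ?thesis using fi by (simp add: time_lebesgue_integral)
qed

text \<open>An integrand together with its whole integral process. Rectangles may overlap and come
  in any order, unlike the cells of the ordered grid of \<open>simple_process\<close>, so sums and
  differences are formed without refining grids. Stopping the increments at \<open>t\<close> makes
  \<open>J\<close> a process in time.\<close>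

inductive elementary :: "(real \<Rightarrow> 'a \<Rightarrow> real) \<Rightarrow> (real \<Rightarrow> 'a \<Rightarrow> real) \<Rightarrow> bool" where
  zero: "elementary (\<lambda>_ _. 0) (\<lambda>_ _. 0)"
| step: "elementary S J \<Longrightarrow> 0 \<le> a \<Longrightarrow> a \<le> b \<Longrightarrow> \<xi> \<in> borel_measurable (F a) \<Longrightarrow> bounded (\<xi> ` space M) \<Longrightarrow>
    elementary (\<lambda>t \<omega>. S t \<omega> + \<xi> \<omega> * indicator {a<..b} t)
      (\<lambda>t \<omega>. J t \<omega> + \<xi> \<omega> * (w (min b t) \<omega> - w (min a t) \<omega>))"

lemma elementary_add:
  assumes "elementary S' J'" "elementary S J"
  shows "elementary (\<lambda>t \<omega>. S t \<omega> + S' t \<omega>) (\<lambda>t \<omega>. J t \<omega> + J' t \<omega>)"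
  using assms
proof (induction rule: elementary.induct)
  case zero
  then show ?case by simp
next
  case (step S' J' a b \<xi>)
  from elementary.step[OF step.IH[OF step.prems] step.hyps(2-5)]
  show ?case by (simp add: add.assoc)
qed

lemma elementary_uminus:
  assumes "elementary S J"
  shows "elementary (\<lambda>t \<omega>. - S t \<omega>) (\<lambda>t \<omega>. - J t \<omega>)"
  using assms
proof (induction rule: elementary.induct)
  case zero
  then show ?case using elementary.zero by simp
next
  case (step S J a b \<xi>)
  have "(\<lambda>\<omega>. - \<xi> \<omega>) \<in> borel_measurable (F a)" "bounded ((\<lambda>\<omega>. - \<xi> \<omega>) ` space M)"
    using step.hyps by (auto simp: bounded_iff)
  from elementary.step[OF step.IH step.hyps(2,3) this]
  show ?case by (simp add: algebra_simps)
qed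

lemma elementary_diff:
  assumes "elementary S J" "elementary S' J'"
  shows "elementary (\<lambda>t \<omega>. S t \<omega> - S' t \<omega>) (\<lambda>t \<omega>. J t \<omega> - J' t \<omega>)"
  using elementary_add[OF elementary_uminus[OF assms(2)] assms(1)] by simp

lemma rectangle_integrand_measurable:
  fixes \<xi> :: "'a \<Rightarrow> real"
  assumes "0 \<le> a" "\<xi> \<in> borel_measurable (F a)"
  shows "(\<lambda>(t, \<omega>). \<xi> \<omega> * indicator {a<..b} t) \<in> borel_measurable (lborel \<Otimes>\<^sub>M M)"
proof -
  have x: "\<xi> \<in> borel_measurable M" using measurable_F assms by blast
  have i: "(indicator {a<..b} :: real \<Rightarrow> real) \<in> borel_measurable lborel" by simp
  have "(\<lambda>z. \<xi> (snd z) * indicator {a<..b} (fst z)) \<in> borel_measurable (lborel \<Otimes>\<^sub>M M)"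
    using measurable_compose[OF measurable_snd x] measurable_compose[OF measurable_fst i]
    by (rule borel_measurable_times)
  then show ?thesis by (simp add: case_prod_beta')
qed

lemma elementary_integrand_measurable:
  assumes "elementary S J"
  shows "(\<lambda>(t, \<omega>). S t \<omega>) \<in> borel_measurable (lborel \<Otimes>\<^sub>M M)"
  using assms
proof (induction rule: elementary.induct)
  case (step S J a b \<xi>)
  note [measurable] = step.IH rectangle_integrand_measurable[OF step.hyps(2,4), of b]
  have "(\<lambda>z. (case z of (t, \<omega>) \<Rightarrow> S t \<omega>) + (case z of (t, \<omega>) \<Rightarrow> \<xi> \<omega> * indicator {a<..b} t))
     \<in> borel_measurable (lborel \<Otimes>\<^sub>M M)"
    by measurable
  then show ?case by (simp add: split_beta)
qed simp

lemma elementary_integrand_bounded: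
  assumes "elementary S J"
  shows "\<exists>B. \<forall>t. \<forall>\<omega>\<in>space M. \<bar>S t \<omega>\<bar> \<le> B"
  using assms
proof (induction rule: elementary.induct)
  case zero
  then show ?case by (auto intro: exI[of _ 0])
next
  case (step S J a b \<xi>)
  then obtain B where B: "\<And>t \<omega>. \<omega> \<in> space M \<Longrightarrow> \<bar>S t \<omega>\<bar> \<le> B" by blast
  obtain B' where B': "\<And>\<omega>. \<omega> \<in> space M \<Longrightarrow> \<bar>\<xi> \<omega>\<bar> \<le> B'"
    using bounded_F_bound[OF step.hyps(5)] by blast
  have "\<bar>S t \<omega> + \<xi> \<omega> * indicator {a<..b} t\<bar> \<le> B + B'" if "\<omega> \<in> space M" for t \<omega>
    using B[OF that, of t] B'[OF that] by (auto simp: indicator_def)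
  then show ?case by blast
qed

lemma elementary_integrand_square_integrable:
  assumes "elementary S J"
  shows "square_integrable (time_space T) (\<lambda>(t, \<omega>). S t \<omega>)"
proof -
  obtain B where B: "\<And>t \<omega>. \<omega> \<in> space M \<Longrightarrow> \<bar>S t \<omega>\<bar> \<le> B"
    using elementary_integrand_bounded[OF assms] by blast
  show ?thesis
    by (rule square_integrable_bounded[OF finite_measure_time_space
          measurable_restrict_pair[OF elementary_integrand_measurable[OF assms]], of _ B])
      (auto simp: space_pair_measure intro: B)
qed

lemma rectangle_integral_adapted:
  assumes "0 \<le> a" "a \<le> b" "\<xi> \<in> borel_measurable (F a)" "0 \<le> t"
  shows "(\<lambda>\<omega>. \<xi> \<omega> * (w (min b t) \<omega> - w (min a t) \<omega>)) \<in> borel_measurable (F t)"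
proof (cases "a \<le> t")
  case True
  have [measurable]: "\<xi> \<in> borel_measurable (F t)" "w (min b t) \<in> borel_measurable (F t)"
    "w (min a t) \<in> borel_measurable (F t)"
    using assms True by (auto intro!: w_measurable intro: measurable_F_mono)
  show ?thesis by measurable
next
  \<comment> \<open>Before time \<open>a\<close> the coefficient need not be \<open>F t\<close>
    measurable, but the stopped increment is 0.\<close>
  case False
  then have "min a t = t" "min b t = t" using assms by auto
  then show ?thesis by simp
qed

lemma rectangle_integral_square_integrable:
  assumes "0 \<le> a" "a \<le> b" "\<xi> \<in> borel_measurable (F a)" "bounded (\<xi> ` space M)" "0 \<le> t"
  shows "square_integrable M (\<lambda>\<omega>. \<xi> \<omega> * (w (min b t) \<omega> - w (min a t) \<omega>))"
proof -
  obtain B where "\<And>\<omega>. \<omega> \<in> space M \<Longrightarrow> \<bar>\<xi> \<omega>\<bar> \<le> B"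
    using bounded_F_bound[OF assms(4)] by blast
  then show ?thesis
    using assms by (intro square_integrable_bounded_mult[of _ _ _ B] increment_square_integrable)
      (auto intro: measurable_F)
qed

lemma elementary_integral_adapted:
  assumes "elementary S J" "0 \<le> t"
  shows "J t \<in> borel_measurable (F t)"
  using assms
proof (induction rule: elementary.induct)
  case (step S J a b \<xi>)
  note [measurable] = step.IH[OF step.prems] rectangle_integral_adapted[OF step.hyps(2-4) step.prems]
  show ?case by measurable
qed simp

lemma elementary_integral_square_integrable:
  assumes "elementary S J" "0 \<le> t"
  shows "square_integrable M (J t)"
  using assms
proof (induction rule: elementary.induct)
  case (step S J a b \<xi>)
  show ?case
    by (rule square_integrable_add[OF step.IH[OF step.prems]
          rectangle_integral_square_integrable[OF step.hyps(2-5) step.prems]])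
qed (rule square_integrable_zero)

lemma elementary_integral_continuous:
  assumes "elementary S J" "continuous_on {0..} (\<lambda>t. w t \<omega>)"
  shows "continuous_on {0..} (\<lambda>t. J t \<omega>)"
  using assms
proof (induction rule: elementary.induct)
  case (step S J a b \<xi>)
  have "continuous_on {0..} (\<lambda>t. w (min c t) \<omega>)" if "0 \<le> c" for c
    by (rule continuous_on_compose2[OF step.prems])
      (use that in \<open>auto intro!: continuous_intros\<close>)
  then show ?case
    using step by (auto intro!: continuous_intros)
qed simp

text \<open>The martingale property in the form in which it is applied: tested against a
  square-integrable \<open>Z\<close> known at time \<open>s\<close>, in place of a conditional
  expectation. By linearity one rectangle at a time suffices.\<close>

lemma elementary_martingale:
  assumes "elementary S J" "0 \<le> s" "s \<le> t" "Z \<in> borel_measurable (F s)" "square_integrable M Z"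
  shows "expectation (\<lambda>\<omega>. Z \<omega> * J t \<omega>) = expectation (\<lambda>\<omega>. Z \<omega> * J s \<omega>)"
  using assms
proof (induction rule: elementary.induct)
  case (step S J a b \<xi>)
  define R where "R u \<omega> = \<xi> \<omega> * (w (min b u) \<omega> - w (min a u) \<omega>)" for u \<omega>
  have t0: "0 \<le> t" using step.prems by simp
  have Jint: "integrable M (\<lambda>\<omega>. Z \<omega> * J u \<omega>)" if "0 \<le> u" for u
    by (rule square_integrable_mult[OF step.prems(4) elementary_integral_square_integrable[OF step.hyps(1) that]])
  have Rint: "integrable M (\<lambda>\<omega>. Z \<omega> * R u \<omega>)" if "0 \<le> u" for u
    unfolding R_def
    by (rule square_integrable_mult[OF step.prems(4) rectangle_integral_square_integrable[OF step.hyps(2-5) that]])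
  obtain B where B: "\<And>\<omega>. \<omega> \<in> space M \<Longrightarrow> \<bar>\<xi> \<omega>\<bar> \<le> B"
    using bounded_F_bound[OF step.hyps(5)] by blast
  have xM: "\<xi> \<in> borel_measurable M" by (rule measurable_F[OF step.hyps(2,4)])
  have Zx: "integrable M (\<lambda>\<omega>. Z \<omega> * \<xi> \<omega>)"
    by (rule square_integrable_mult[OF step.prems(4)
          square_integrable_bounded[OF finite_measure_axioms xM B]])
  have "expectation (\<lambda>\<omega>. Z \<omega> * R t \<omega>) = expectation (\<lambda>\<omega>. Z \<omega> * R s \<omega>)"
  proof (cases "a \<le> s")
    case True
    have ms: "(\<lambda>\<omega>. Z \<omega> * \<xi> \<omega>) \<in> borel_measurable (F (min b t))" if "s \<le> min b t"
    proof -
      have [measurable]: "Z \<in> borel_measurable (F (min b t))" "\<xi> \<in> borel_measurable (F (min b t))"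
        using measurable_F_mono[OF step.prems(1) that step.prems(3)]
          measurable_F_mono[OF step.hyps(2) _ step.hyps(4)] True that by auto
      show ?thesis by measurable
    qed
    \<comment> \<open>Both stopped left ends are \<open>a\<close> here, so the difference is carried
      by the increment of \<open>w\<close> from \<open>min b s\<close> to
      \<open>min b t\<close>.\<close>
    have "expectation (\<lambda>\<omega>. Z \<omega> * R t \<omega>) - expectation (\<lambda>\<omega>. Z \<omega> * R s \<omega>)
        = expectation (\<lambda>\<omega>. Z \<omega> * R t \<omega> - Z \<omega> * R s \<omega>)"
      using Rint[OF t0] Rint[OF step.prems(1)] by simp
    also have "\<dots> = expectation (\<lambda>\<omega>. (Z \<omega> * \<xi> \<omega>) * (w (min b t) \<omega> - w (min b s) \<omega>))"
      using True step.prems by (intro Bochner_Integration.integral_cong) (auto simp: R_def algebra_simps min_def)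
    also have "\<dots> = 0"
    proof (cases "b \<le> s")
      case True
      then show ?thesis using step.prems by (simp add: min_def)
    next
      case False
      then have "min b s = s" by simp
      moreover have "(\<lambda>\<omega>. Z \<omega> * \<xi> \<omega>) \<in> borel_measurable (F s)"
      proof -
        have [measurable]: "Z \<in> borel_measurable (F s)" "\<xi> \<in> borel_measurable (F s)"
          using step.prems measurable_F_mono[OF step.hyps(2) True step.hyps(4)] by auto
        show ?thesis by measurable
      qed
      ultimately show ?thesis
        using increment_product(2)[of s "min b t" "\<lambda>\<omega>. Z \<omega> * \<xi> \<omega>"] step.prems Zx False by simp
    qed
    finally show ?thesis by simp
  next
    \<comment> \<open>The rectangle begins after \<open>s\<close>. If it has begun by
      \<open>t\<close>, then \<open>Z\<close> and its coefficient are known at \<open>a\<close>,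
      where the increment starts.\<close>
    case False
    then have R0: "R s \<omega> = 0" for \<omega> using step.hyps by (simp add: R_def min_def)
    have "expectation (\<lambda>\<omega>. Z \<omega> * R t \<omega>) = 0"
    proof (cases "a \<le> t")
      case True
      have "(\<lambda>\<omega>. Z \<omega> * \<xi> \<omega>) \<in> borel_measurable (F a)"
      proof -
        have [measurable]: "Z \<in> borel_measurable (F a)" "\<xi> \<in> borel_measurable (F a)"
          using measurable_F_mono[OF step.prems(1) _ step.prems(3), of a] step.hyps False by auto
        show ?thesis by measurable
      qed
      then show ?thesis
        using increment_product(2)[of a "min b t" "\<lambda>\<omega>. Z \<omega> * \<xi> \<omega>"] True step.hyps Zx
        by (simp add: R_def mult.assoc)
    next
      case False
      then show ?thesis using step.hyps by (simp add: R_def min_def)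
    qed
    then show ?thesis by (simp add: R0)
  qed
  then show ?case
    using step.IH[OF step.prems] Jint[OF t0] Jint[OF step.prems(1)] Rint[OF t0] Rint[OF step.prems(1)]
    by (simp add: R_def[symmetric] distrib_left)
qed simp

text \<open>Both sides equal the mean of \<xi> \<eta> times the length of that part of the overlap
  which lies before \<open>t\<close>.\<close>

lemma rectangle_integral_isometry:
  assumes ab: "0 \<le> a" "a \<le> b" and cd: "0 \<le> c" "c \<le> d" and t: "0 \<le> t"
    and x: "\<xi> \<in> borel_measurable (F a)" "bounded (\<xi> ` space M)"
    and y: "\<eta> \<in> borel_measurable (F c)" "bounded (\<eta> ` space M)"
  shows "expectation (\<lambda>\<omega>. (\<xi> \<omega> * (w (min b t) \<omega> - w (min a t) \<omega>)) * (\<eta> \<omega> * (w (min d t) \<omega> - w (min c t) \<omega>)))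
    = integral\<^sup>L (time_space t) (\<lambda>(s, \<omega>). (\<xi> \<omega> * indicator {a<..b} s) * (\<eta> \<omega> * indicator {c<..d} s))"
proof -
  obtain B1 B2 where B: "\<And>\<omega>. \<omega> \<in> space M \<Longrightarrow> \<bar>\<xi> \<omega>\<bar> \<le> B1" "\<And>\<omega>. \<omega> \<in> space M \<Longrightarrow> \<bar>\<eta> \<omega>\<bar> \<le> B2"
    using bounded_F_bound[OF x(2)] bounded_F_bound[OF y(2)] by metis
  have int: "integrable M (\<lambda>\<omega>. \<xi> \<omega> * \<eta> \<omega>)"
  proof (rule square_integrable_mult)
    show "square_integrable M \<xi>"
      using finite_measure_axioms measurable_F[OF ab(1) x(1)] B(1) by (rule square_integrable_bounded)
    show "square_integrable M \<eta>"
      using finite_measure_axioms measurable_F[OF cd(1) y(1)] B(2) by (rule square_integrable_bounded)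
  qed
  have "integral\<^sup>L (time_space t) (\<lambda>(s, \<omega>). (\<xi> \<omega> * indicator {a<..b} s) * (\<eta> \<omega> * indicator {c<..d} s))
    = integral\<^sup>L (time_space t) (\<lambda>(s, \<omega>). (indicator {a<..b} s * indicator {c<..d} s) * (\<xi> \<omega> * \<eta> \<omega>))"
    by (intro Bochner_Integration.integral_cong) (auto simp: mult_ac)
  also have "\<dots> = (LBINT s:{0..t}. indicator {a<..b} s * indicator {c<..d} s) * expectation (\<lambda>\<omega>. \<xi> \<omega> * \<eta> \<omega>)"
    by (rule integral_time_space_product[where B=1]) (auto simp: int indicator_def)
  also have "(LBINT s:{0..t}. indicator {a<..b} s * indicator {c<..d} s)
      = integral\<^sup>L lborel (indicat_real {max a c<..min (min b d) t})"
    unfolding set_lebesgue_integral_def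
    using ab(1) cd(1)
    by (intro Bochner_Integration.integral_cong) (auto simp: indicator_def max_less_iff_conj split: if_splits)
  also have "\<dots> = max 0 (min (min b d) t - max a c)"
  proof (cases "max a c \<le> min (min b d) t")
    case True
    then have "measure lborel {max a c<..min (min b d) t} = min (min b d) t - max a c"
      by (rule measure_lborel_Ioc)
    then have "integral\<^sup>L lborel (indicat_real {max a c<..min (min b d) t}) = min (min b d) t - max a c"
      by (simp only: Bochner_Integration.integral_indicator space_lborel space_borel Int_UNIV_right)
    moreover have "0 \<le> min (min b d) t - max a c" using True by (simp only: diff_ge_0_iff_ge)
    ultimately show ?thesis by (simp only: max_absorb2)
  next
    case False
    then have le: "min (min b d) t \<le> max a c" by linarith
    then have "{max a c<..min (min b d) t} = {}" by (rule greaterThanAtMost_empty)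
    moreover have "max 0 (min (min b d) t - max a c) = 0"
      using le by (simp only: max_absorb1 diff_le_0_iff_le)
    ultimately show ?thesis by (simp only: Bochner_Integration.integral_indicator Int_empty_left measure_empty)
  qed
  finally have R: "integral\<^sup>L (time_space t) (\<lambda>(s, \<omega>). (\<xi> \<omega> * indicator {a<..b} s) * (\<eta> \<omega> * indicator {c<..d} s))
      = expectation (\<lambda>\<omega>. \<xi> \<omega> * \<eta> \<omega>) * max 0 (min (min b d) t - max a c)"
    by simp
  show ?thesis
  proof (cases "a \<le> t \<and> c \<le> t")
    case True
    then have e: "min a t = a" "min c t = c" "min (min b t) (min d t) = min (min b d) t"
      by (simp_all add: min.absorb1 min.assoc min.left_commute)
    have "a \<le> min b t" "c \<le> min d t" using ab cd True by simp_all
    from rectangle_isometry[OF ab(1) this(1) cd(1) this(2) x y]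
    show ?thesis unfolding R e .
  next
    case False
    then have le: "min (min b d) t \<le> max a c"
      by (metis linorder_linear max.coboundedI1 max.coboundedI2 min.coboundedI2)
    \<comment> \<open>If \<open>t\<close> precedes the start of one rectangle, its stopped increment
      is 0, and the overlap before \<open>t\<close> is empty as well.\<close>
    have "(min a t = t \<and> min b t = t) \<or> (min c t = t \<and> min d t = t)"
      using False ab(2) cd(2) by (metis linorder_linear min.absorb2 order_trans)
    then have "expectation (\<lambda>\<omega>. (\<xi> \<omega> * (w (min b t) \<omega> - w (min a t) \<omega>)) * (\<eta> \<omega> * (w (min d t) \<omega> - w (min c t) \<omega>))) = 0"
      by (elim disjE conjE) (simp_all only: diff_self mult_zero_right mult_zero_left Bochner_Integration.integral_zero)
    then show ?thesis using R le by (simp only: max_absorb1 diff_le_0_iff_le mult_zero_right)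
  qed
qed

text \<open>The isometry is bilinear: this is the induction over the second factor,
  \<open>elementary_isometry\<close> the one over the first. Products of two different integrals are
  treated because covariances of coordinates are needed later.\<close>

lemma rectangle_elementary_isometry:
  assumes "elementary S J" and ab: "0 \<le> a" "a \<le> b" and t: "0 \<le> t"
    and x: "\<xi> \<in> borel_measurable (F a)" "bounded (\<xi> ` space M)"
  shows "expectation (\<lambda>\<omega>. (\<xi> \<omega> * (w (min b t) \<omega> - w (min a t) \<omega>)) * J t \<omega>)
    = integral\<^sup>L (time_space t) (\<lambda>(s, \<omega>). (\<xi> \<omega> * indicator {a<..b} s) * S s \<omega>)"
  using assms(1)
proof (induction rule: elementary.induct)
  case (step S J c d \<eta>)
  note Rs = rectangle_integral_square_integrable[OF ab x t]
  have "elementary (\<lambda>t \<omega>. 0 + \<xi> \<omega> * indicator {a<..b} t)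
      (\<lambda>t \<omega>. 0 + \<xi> \<omega> * (w (min b t) \<omega> - w (min a t) \<omega>))"
    by (rule elementary.step[OF elementary.zero ab x])
  from elementary_integrand_square_integrable[OF this]
  have r: "square_integrable (time_space t) (\<lambda>(s, \<omega>). \<xi> \<omega> * indicator {a<..b} s)" by simp
  have "elementary (\<lambda>t \<omega>. 0 + \<eta> \<omega> * indicator {c<..d} t)
      (\<lambda>t \<omega>. 0 + \<eta> \<omega> * (w (min d t) \<omega> - w (min c t) \<omega>))"
    by (rule elementary.step[OF elementary.zero step.hyps(2-5)])
  from elementary_integrand_square_integrable[OF this]
  have r': "square_integrable (time_space t) (\<lambda>(s, \<omega>). \<eta> \<omega> * indicator {c<..d} s)" by simp
  have i1: "integrable (time_space t) (\<lambda>(s, \<omega>). (\<xi> \<omega> * indicator {a<..b} s) * S s \<omega>)"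
    using square_integrable_mult[OF r elementary_integrand_square_integrable[OF step.hyps(1)]]
    by (simp add: case_prod_beta')
  have i2: "integrable (time_space t) (\<lambda>(s, \<omega>). (\<xi> \<omega> * indicator {a<..b} s) * (\<eta> \<omega> * indicator {c<..d} s))"
    using square_integrable_mult[OF r r'] by (simp add: case_prod_beta')
  have "expectation (\<lambda>\<omega>. (\<xi> \<omega> * (w (min b t) \<omega> - w (min a t) \<omega>)) * (J t \<omega> + \<eta> \<omega> * (w (min d t) \<omega> - w (min c t) \<omega>)))
     = expectation (\<lambda>\<omega>. (\<xi> \<omega> * (w (min b t) \<omega> - w (min a t) \<omega>)) * J t \<omega>)
      + expectation (\<lambda>\<omega>. (\<xi> \<omega> * (w (min b t) \<omega> - w (min a t) \<omega>)) * (\<eta> \<omega> * (w (min d t) \<omega> - w (min c t) \<omega>)))"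
    using square_integrable_mult[OF Rs elementary_integral_square_integrable[OF step.hyps(1) t]]
      square_integrable_mult[OF Rs rectangle_integral_square_integrable[OF step.hyps(2-5) t]]
    by (subst Bochner_Integration.integral_add[symmetric]) (auto simp: distrib_left)
  also have "\<dots> = integral\<^sup>L (time_space t) (\<lambda>(s, \<omega>). (\<xi> \<omega> * indicator {a<..b} s) * S s \<omega>)
     + integral\<^sup>L (time_space t) (\<lambda>(s, \<omega>). (\<xi> \<omega> * indicator {a<..b} s) * (\<eta> \<omega> * indicator {c<..d} s))"
    using step.IH rectangle_integral_isometry[OF ab step.hyps(2,3) t x step.hyps(4,5)] by simp
  also have "\<dots> = integral\<^sup>L (time_space t) (\<lambda>(s, \<omega>). (\<xi> \<omega> * indicator {a<..b} s) * (S s \<omega> + \<eta> \<omega> * indicator {c<..d} s))"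
    using Bochner_Integration.integral_add[OF i1 i2] by (simp add: split_beta' distrib_left)
  finally show ?case .
qed (simp add: split_beta')

lemma elementary_isometry:
  assumes "elementary S J" "elementary S' J'" "0 \<le> t"
  shows "expectation (\<lambda>\<omega>. J t \<omega> * J' t \<omega>) = integral\<^sup>L (time_space t) (\<lambda>(s, \<omega>). S s \<omega> * S' s \<omega>)"
  using assms
proof (induction rule: elementary.induct)
  case (step S J a b \<xi>)
  note t = step.prems(2)
  note S' = elementary_integrand_square_integrable[OF step.prems(1), of t]
  have "elementary (\<lambda>t \<omega>. 0 + \<xi> \<omega> * indicator {a<..b} t)
      (\<lambda>t \<omega>. 0 + \<xi> \<omega> * (w (min b t) \<omega> - w (min a t) \<omega>))"
    by (rule elementary.step[OF elementary.zero step.hyps(2-5)])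
  from elementary_integrand_square_integrable[OF this]
  have r: "square_integrable (time_space t) (\<lambda>(s, \<omega>). \<xi> \<omega> * indicator {a<..b} s)" by simp
  have i1: "integrable (time_space t) (\<lambda>(s, \<omega>). S s \<omega> * S' s \<omega>)"
    using square_integrable_mult[OF elementary_integrand_square_integrable[OF step.hyps(1)] S']
    by (simp add: case_prod_beta')
  have i2: "integrable (time_space t) (\<lambda>(s, \<omega>). (\<xi> \<omega> * indicator {a<..b} s) * S' s \<omega>)"
    using square_integrable_mult[OF r S'] by (simp add: case_prod_beta')
  note J' = elementary_integral_square_integrable[OF step.prems]
  have "expectation (\<lambda>\<omega>. (J t \<omega> + \<xi> \<omega> * (w (min b t) \<omega> - w (min a t) \<omega>)) * J' t \<omega>)
     = expectation (\<lambda>\<omega>. J t \<omega> * J' t \<omega>)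
      + expectation (\<lambda>\<omega>. (\<xi> \<omega> * (w (min b t) \<omega> - w (min a t) \<omega>)) * J' t \<omega>)"
    using square_integrable_mult[OF elementary_integral_square_integrable[OF step.hyps(1) t] J']
      square_integrable_mult[OF rectangle_integral_square_integrable[OF step.hyps(2-5) t] J']
    by (subst Bochner_Integration.integral_add[symmetric]) (auto simp: distrib_right)
  also have "\<dots> = integral\<^sup>L (time_space t) (\<lambda>(s, \<omega>). S s \<omega> * S' s \<omega>)
     + integral\<^sup>L (time_space t) (\<lambda>(s, \<omega>). (\<xi> \<omega> * indicator {a<..b} s) * S' s \<omega>)"
    using step.IH[OF step.prems] rectangle_elementary_isometry[OF step.prems(1) step.hyps(2,3) t step.hyps(4,5)]
    by simp
  also have "\<dots> = integral\<^sup>L (time_space t) (\<lambda>(s, \<omega>). (S s \<omega> + \<xi> \<omega> * indicator {a<..b} s) * S' s \<omega>)"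
    using Bochner_Integration.integral_add[OF i1 i2] by (simp add: split_beta' distrib_right)
  finally show ?case .
qed (simp add: split_beta')

end

section \<open>Joint measurability of continuous processes\<close>

lemma continuous_process_measurable:
  fixes f :: "real \<Rightarrow> 'b \<Rightarrow> real"
  assumes f: "\<And>t. f t \<in> borel_measurable N"
    and cont: "\<And>\<omega>. \<omega> \<in> space N \<Longrightarrow> continuous_on UNIV (\<lambda>t. f t \<omega>)"
  shows "(\<lambda>(t, \<omega>). f t \<omega>) \<in> borel_measurable (lborel \<Otimes>\<^sub>M N)"
proof (rule borel_measurable_LIMSEQ_real)
  \<comment> \<open>Left-point sampling on the grid of mesh 1 / (i + 1). The sampling time takes
    countably many values, so joint measurability reduces to that of each \<open>f t\<close>;
    continuity gives convergence as the mesh shrinks.\<close>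
  define u where "u i z = f (real_of_int \<lfloor>fst z * real (Suc i)\<rfloor> / real (Suc i)) (snd z)" for i :: nat and z :: "real \<times> 'b"
  show "u i \<in> borel_measurable (lborel \<Otimes>\<^sub>M N)" for i
    unfolding u_def[abs_def]
  proof (rule measurable_compose_countable[where g = "\<lambda>z. \<lfloor>fst z * real (Suc i)\<rfloor>"
        and f = "\<lambda>k z. f (real_of_int k / real (Suc i)) (snd z)"])
    show "(\<lambda>z. f (real_of_int k / real (Suc i)) (snd z)) \<in> borel_measurable (lborel \<Otimes>\<^sub>M N)" for k
      by (rule measurable_compose[OF measurable_snd f])
    have "(\<lambda>x. \<lfloor>x * real (Suc i)\<rfloor>) \<in> lborel \<rightarrow>\<^sub>M count_space UNIV" by measurable
    from measurable_compose[OF measurable_fst this]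
    show "(\<lambda>z. \<lfloor>fst z * real (Suc i)\<rfloor>) \<in> lborel \<Otimes>\<^sub>M N \<rightarrow>\<^sub>M count_space UNIV" .
  qed
  fix z :: "real \<times> 'b" assume "z \<in> space (lborel \<Otimes>\<^sub>M N)"
  then have z: "snd z \<in> space N" by (auto simp: space_pair_measure)
  have "(\<lambda>i. real_of_int \<lfloor>fst z * real (Suc i)\<rfloor> / real (Suc i) - fst z) \<longlonglongrightarrow> 0"
  proof (rule Lim_null_comparison)
    show "\<forall>\<^sub>F i in sequentially. norm (real_of_int \<lfloor>fst z * real (Suc i)\<rfloor> / real (Suc i) - fst z) \<le> 1 / real (Suc i)"
    proof (rule always_eventually, rule allI)
      fix i
      have "real_of_int \<lfloor>fst z * real (Suc i)\<rfloor> / real (Suc i) - fst z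
          = (real_of_int \<lfloor>fst z * real (Suc i)\<rfloor> - fst z * real (Suc i)) / real (Suc i)"
        by (simp add: diff_divide_distrib)
      also have "norm \<dots> \<le> 1 / real (Suc i)"
        unfolding real_norm_def abs_divide
        by (rule frac_le) (use floor_correct[of "fst z * real (Suc i)"] in linarith)+
      finally show "norm (real_of_int \<lfloor>fst z * real (Suc i)\<rfloor> / real (Suc i) - fst z) \<le> 1 / real (Suc i)" .
    qed
    show "(\<lambda>i. 1 / real (Suc i)) \<longlonglongrightarrow> 0" by (rule LIMSEQ_Suc[OF lim_1_over_n])
  qed
  then have "(\<lambda>i. real_of_int \<lfloor>fst z * real (Suc i)\<rfloor> / real (Suc i)) \<longlonglongrightarrow> fst z"
    by (simp add: LIM_zero_iff)
  from continuous_on_tendsto_compose[OF cont[OF z] this]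
  show "(\<lambda>i. u i z) \<longlonglongrightarrow> (case z of (t, \<omega>) \<Rightarrow> f t \<omega>)"
    by (simp add: u_def split_beta)
qed

lemma continuous_process_measurable_Icc:
  fixes f :: "real \<Rightarrow> 'b \<Rightarrow> real"
  assumes T: "0 \<le> T" and f: "\<And>t. 0 \<le> t \<Longrightarrow> t \<le> T \<Longrightarrow> f t \<in> borel_measurable N"
    and cont: "\<And>\<omega>. \<omega> \<in> space N \<Longrightarrow> continuous_on {0..T} (\<lambda>t. f t \<omega>)"
  shows "(\<lambda>(t, \<omega>). f t \<omega>) \<in> borel_measurable (time_lebesgue T \<Otimes>\<^sub>M N)"
proof -
  \<comment> \<open>Clamping time to [0, T] gives a process continuous on the whole line; outside
    [0, T] nothing is known of \<open>f\<close>.\<close>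
  define g where "g t = f (max 0 (min t T))" for t
  have "(\<lambda>(t, \<omega>). g t \<omega>) \<in> borel_measurable (lborel \<Otimes>\<^sub>M N)"
  proof (rule continuous_process_measurable)
    show "g t \<in> borel_measurable N" for t unfolding g_def using T by (intro f) auto
    show "continuous_on UNIV (\<lambda>t. g t \<omega>)" if "\<omega> \<in> space N" for \<omega>
      unfolding g_def by (rule continuous_on_compose2[OF cont[OF that]])
        (use T in \<open>auto intro!: continuous_intros\<close>)
  qed
  then have "(\<lambda>(t, \<omega>). g t \<omega>) \<in> borel_measurable (time_lebesgue T \<Otimes>\<^sub>M N)"
    by (rule measurable_restrict_pair)
  then show ?thesis
    by (rule measurable_cong[THEN iffD1, rotated]) (auto simp: g_def space_pair_measure space_restrict_space)
qed

lemma measurable_time_lebesgue_mono: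
  assumes "f \<in> borel_measurable (time_lebesgue t \<Otimes>\<^sub>M N)" "s \<le> t"
  shows "f \<in> borel_measurable (time_lebesgue s \<Otimes>\<^sub>M N)"
proof -
  have "(\<lambda>x. x) \<in> time_lebesgue s \<rightarrow>\<^sub>M time_lebesgue t"
    by (rule measurable_restrict_mono[OF measurable_ident_sets[OF refl]]) (use assms in auto)
  then have "(\<lambda>z. (fst z, snd z)) \<in> (time_lebesgue s \<Otimes>\<^sub>M N) \<rightarrow>\<^sub>M (time_lebesgue t \<Otimes>\<^sub>M N)"
    by (intro measurable_Pair measurable_snd measurable_compose[OF measurable_fst])
  from measurable_compose[OF this assms(1)] show ?thesis by simp
qed

section \<open>Simple processes stopped at a time\<close>

definition running_integral ::
  "(real \<Rightarrow> 'a \<Rightarrow> real) \<Rightarrow> nat \<Rightarrow> (nat \<Rightarrow> real) \<Rightarrow> (nat \<Rightarrow> 'a \<Rightarrow> real) \<Rightarrow> real \<Rightarrow> 'a \<Rightarrow> real" where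
  "running_integral w m \<tau> \<xi> t \<omega> =
     (\<Sum>k<m. \<xi> k \<omega> * (w (min (\<tau> (Suc k)) t) \<omega> - w (min (\<tau> k) t) \<omega>))"

lemma simple_process_grid_mono:
  assumes "simple_process M F T m \<tau> \<xi>" "i \<le> j" "j \<le> m"
  shows "\<tau> i \<le> \<tau> j"
  using assms(2,3)
proof (induction j rule: dec_induct)
  case (step j)
  have "\<tau> j \<le> \<tau> (Suc j)" using assms(1) step by (auto simp: simple_process_def)
  with step show ?case by auto
qed simp

lemma running_integral_end:
  assumes "simple_process M F T m \<tau> \<xi>" "T \<le> t"
  shows "running_integral w m \<tau> \<xi> t = simple_integral w m \<tau> \<xi>"
proof -
  have "min (\<tau> k) t = \<tau> k" if "k \<le> m" for k
    using simple_process_grid_mono[OF assms(1) that] assms by (auto simp: simple_process_def)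
  then show ?thesis
    by (auto simp: running_integral_def simple_integral_def fun_eq_iff intro!: sum.cong)
qed

text \<open>Lets an approximation on a long horizon serve on [0, t]. Coefficients of cells that
  start at or after \<open>t\<close> are set to 0: their stopped grid point is \<open>t\<close>, at
  which they need not be measurable, and the stopped cell is empty anyway.\<close>

lemma simple_process_truncate:
  assumes sp: "simple_process M F T m \<tau> \<xi>" and t: "0 \<le> t"
  defines "\<tau>' \<equiv> \<lambda>k. min (\<tau> k) t" and "\<xi>' \<equiv> \<lambda>k \<omega>. if \<tau> k < t then \<xi> k \<omega> else 0"
  shows "simple_process M F t m \<tau>' \<xi>'"
    and "s \<le> t \<Longrightarrow> simple_value m \<tau>' \<xi>' s \<omega> = simple_value m \<tau> \<xi> s \<omega>"
    and "simple_integral w m \<tau>' \<xi>' = running_integral w m \<tau> \<xi> t"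
proof -
  show "simple_process M F t m \<tau>' \<xi>'"
    unfolding simple_process_def
  proof (intro conjI allI impI)
    fix k assume k: "k < m"
    show "\<tau>' k \<le> \<tau>' (Suc k)"
      using sp k by (auto simp: simple_process_def \<tau>'_def min.coboundedI1)
    show "\<xi>' k \<in> borel_measurable (F (\<tau>' k))"
      using sp k by (cases "\<tau> k < t") (auto simp: simple_process_def \<tau>'_def \<xi>'_def min.absorb1)
    show "bounded (\<xi>' k ` space M)"
      using sp k by (cases "\<tau> k < t") (auto simp: simple_process_def \<xi>'_def bounded_iff)
  qed (use sp t in \<open>auto simp: simple_process_def \<tau>'_def\<close>)
  show "simple_value m \<tau>' \<xi>' s \<omega> = simple_value m \<tau> \<xi> s \<omega>" if "s \<le> t"
    unfolding simple_value_def
  proof (rule sum.cong[OF refl])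
    fix k
    have "s \<in> {\<tau>' k<..\<tau>' (Suc k)} \<longleftrightarrow> s \<in> {\<tau> k<..\<tau> (Suc k)}"
      using that by (auto simp: \<tau>'_def)
    moreover have "\<tau> k < t" if "s \<in> {\<tau> k<..\<tau> (Suc k)}" using that \<open>s \<le> t\<close> by auto
    ultimately show "\<xi>' k \<omega> * indicator {\<tau>' k<..\<tau>' (Suc k)} s = \<xi> k \<omega> * indicator {\<tau> k<..\<tau> (Suc k)} s"
      by (simp add: \<xi>'_def indicator_def)
  qed
  show "simple_integral w m \<tau>' \<xi>' = running_integral w m \<tau> \<xi> t"
  proof
    fix \<omega>
    have "\<xi>' k \<omega> * (w (\<tau>' (Suc k)) \<omega> - w (\<tau>' k) \<omega>) = \<xi> k \<omega> * (w (min (\<tau> (Suc k)) t) \<omega> - w (min (\<tau> k) t) \<omega>)"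
      if "k < m" for k
    proof (cases "\<tau> k < t")
      case False
      have "\<tau> k \<le> \<tau> (Suc k)" using sp that by (auto simp: simple_process_def)
      with False have "min (\<tau> (Suc k)) t = t" "min (\<tau> k) t = t" by auto
      with False show ?thesis by (simp add: \<xi>'_def)
    qed (simp add: \<xi>'_def \<tau>'_def)
    then show "simple_integral w m \<tau>' \<xi>' \<omega> = running_integral w m \<tau> \<xi> t \<omega>"
      unfolding simple_integral_def running_integral_def by (intro sum.cong) auto
  qed
qed

section \<open>Ito integrals as L2 limits\<close>

context wiener_setting
begin

lemma simple_process_elementary:
  assumes "simple_process M F T m \<tau> \<xi>"
  shows "elementary (simple_value m \<tau> \<xi>) (running_integral w m \<tau> \<xi>)"
proof -
  have "elementary (simple_value k \<tau> \<xi>) (running_integral w k \<tau> \<xi>)" if "k \<le> m" for k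
    using that
  proof (induction k)
    case 0
    show ?case using elementary.zero by (simp add: simple_value_def[abs_def] running_integral_def[abs_def])
  next
    case (Suc k)
    have t0: "0 \<le> \<tau> k"
      using simple_process_grid_mono[OF assms, of 0 k] Suc.prems assms by (auto simp: simple_process_def)
    have st: "\<tau> k \<le> \<tau> (Suc k)" "\<xi> k \<in> borel_measurable (F (\<tau> k))" "bounded (\<xi> k ` space M)"
      using assms Suc.prems by (auto simp: simple_process_def)
    from elementary.step[OF Suc.IH[OF Suc_leD[OF Suc.prems]] t0 st]
    show ?case
      unfolding simple_value_def[abs_def] running_integral_def[abs_def] sum.lessThan_Suc .
  qed
  then show ?thesis by simp
qed

lemma nn_integral_time_space:
  assumes "(\<lambda>(t, \<omega>). g t \<omega>) \<in> borel_measurable (time_space T)"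
  shows "(\<integral>\<^sup>+\<omega>. (\<integral>\<^sup>+t\<in>{0..T}. ennreal (g t \<omega>) \<partial>lborel) \<partial>M)
    = (\<integral>\<^sup>+z. ennreal (case z of (t, \<omega>) \<Rightarrow> g t \<omega>) \<partial>time_space T)"
proof -
  interpret P: pair_sigma_finite "time_lebesgue T" M by (rule pair_sigma_finite_time)
  have "(\<lambda>z. ennreal (case z of (t, \<omega>) \<Rightarrow> g t \<omega>)) \<in> borel_measurable (time_space T)"
    using assms by measurable
  from P.nn_integral_snd[OF this] show ?thesis
    by (simp add: nn_integral_restrict_space)
qed

text \<open>Tonelli turns the iterated integral of the definition into one over the product space.
  If joint measurability fails, both sides are false.\<close>

lemma square_integrable_adapted_iff:
  "square_integrable_adapted M F T H \<longleftrightarrow>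
     (\<forall>t\<in>{0..T}. H t \<in> borel_measurable (F t)) \<and> square_integrable (time_space T) (\<lambda>(t, \<omega>). H t \<omega>)"
proof (cases "(\<lambda>(t, \<omega>). H t \<omega>) \<in> borel_measurable (time_space T)")
  case True
  then have "(\<lambda>(t, \<omega>). (H t \<omega>)\<^sup>2) \<in> borel_measurable (time_space T)"
    by (simp add: split_beta')
  from nn_integral_time_space[OF this]
  have eq: "(\<integral>\<^sup>+\<omega>. (\<integral>\<^sup>+t\<in>{0..T}. ennreal ((H t \<omega>)\<^sup>2) \<partial>lborel) \<partial>M)
     = (\<integral>\<^sup>+z. ennreal ((case z of (t, \<omega>) \<Rightarrow> H t \<omega>)\<^sup>2) \<partial>time_space T)"
    by (simp only: split_beta')
  show ?thesis
    unfolding square_integrable_adapted_def square_integrable_iff_nn_integral[OF True] eq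
    using True by simp
next
  case False
  then show ?thesis by (simp add: square_integrable_adapted_def square_integrable_def)
qed

lemma time_space_integral_mono:
  fixes g :: "real \<Rightarrow> 'a \<Rightarrow> real"
  assumes g: "integrable (time_space t) (\<lambda>(s, \<omega>). g s \<omega>)" "\<And>s \<omega>. 0 \<le> g s \<omega>" and st: "s \<le> t"
  shows "integrable (time_space s) (\<lambda>(s, \<omega>). g s \<omega>)"
    and "integral\<^sup>L (time_space s) (\<lambda>(s, \<omega>). g s \<omega>) \<le> integral\<^sup>L (time_space t) (\<lambda>(s, \<omega>). g s \<omega>)"
proof -
  have mt: "(\<lambda>(s, \<omega>). g s \<omega>) \<in> borel_measurable (time_space t)" using g(1) by auto
  have ms: "(\<lambda>(s, \<omega>). g s \<omega>) \<in> borel_measurable (time_space s)"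
    by (rule measurable_time_lebesgue_mono[OF mt st])
  have le: "(\<integral>\<^sup>+z. ennreal (case z of (t, \<omega>) \<Rightarrow> g t \<omega>) \<partial>time_space s) \<le>
     (\<integral>\<^sup>+z. ennreal (case z of (t, \<omega>) \<Rightarrow> g t \<omega>) \<partial>time_space t)"
    unfolding nn_integral_time_space[OF mt, symmetric] nn_integral_time_space[OF ms, symmetric]
    by (intro nn_integral_mono) (use st in \<open>auto simp: indicator_def\<close>)
  show int: "integrable (time_space s) (\<lambda>(s, \<omega>). g s \<omega>)"
  proof -
    have n: "norm (case z of (t, \<omega>) \<Rightarrow> g t \<omega>) = (case z of (t, \<omega>) \<Rightarrow> g t \<omega>)" for z
      using g(2) by (simp add: split_beta')
    have "(\<integral>\<^sup>+z. ennreal (case z of (t, \<omega>) \<Rightarrow> g t \<omega>) \<partial>time_space t) < \<infinity>"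
      using g(1) unfolding integrable_iff_bounded n by (rule conjunct2)
    from le_less_trans[OF le this] show ?thesis
      unfolding integrable_iff_bounded n using ms by (intro conjI)
  qed
  have "ennreal (integral\<^sup>L (time_space s) (\<lambda>(s, \<omega>). g s \<omega>)) \<le> ennreal (integral\<^sup>L (time_space t) (\<lambda>(s, \<omega>). g s \<omega>))"
  proof -
    have nonneg: "AE z in N. 0 \<le> (case z of (s, \<omega>) \<Rightarrow> g s \<omega>)" for N
      using g(2) by (intro AE_I2) (simp add: split_beta')
    show ?thesis
      using le unfolding nn_integral_eq_integral[OF int nonneg] nn_integral_eq_integral[OF g(1) nonneg] .
  qed
  then show "integral\<^sup>L (time_space s) (\<lambda>(s, \<omega>). g s \<omega>) \<le> integral\<^sup>L (time_space t) (\<lambda>(s, \<omega>). g s \<omega>)"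
    using g(2) by (subst (asm) ennreal_le_iff) (auto intro!: Bochner_Integration.integral_nonneg simp: split_beta')
qed

lemma square_integrable_time_mono:
  assumes "square_integrable (time_space t) (\<lambda>(s, \<omega>). f s \<omega>)" "s \<le> t"
  shows "square_integrable (time_space s) (\<lambda>(s, \<omega>). f s \<omega>)"
proof -
  have "integrable (time_space t) (\<lambda>(s, \<omega>). (f s \<omega>)\<^sup>2)"
    using square_integrable_sq[OF assms(1)] by (simp only: split_beta')
  from time_space_integral_mono(1)[OF this _ assms(2)]
  have "integrable (time_space s) (\<lambda>z. (case z of (s, \<omega>) \<Rightarrow> f s \<omega>)\<^sup>2)"
    by (simp add: split_beta')
  then show ?thesis
    using measurable_time_lebesgue_mono[OF square_integrable_measurable[OF assms(1)] assms(2)]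
    by (simp only: square_integrable_def simp_thms)
qed

lemma l2_tendsto_time_mono:
  assumes "l2_tendsto (time_space t) (\<lambda>l (s, \<omega>). f l s \<omega>) (\<lambda>(s, \<omega>). g s \<omega>)" "s \<le> t"
  shows "l2_tendsto (time_space s) (\<lambda>l (s, \<omega>). f l s \<omega>) (\<lambda>(s, \<omega>). g s \<omega>)"
proof -
  note a = assms(1)[unfolded l2_tendsto_def]
  have sq: "square_integrable (time_space t) (\<lambda>(s, \<omega>). f l s \<omega> - g s \<omega>)" for l
    using square_integrable_diff[of "time_space t" "\<lambda>(s, \<omega>). f l s \<omega>" "\<lambda>(s, \<omega>). g s \<omega>"] a
    by (simp add: split_beta')
  have "(\<lambda>l. integral\<^sup>L (time_space s) (\<lambda>(s, \<omega>). (f l s \<omega> - g s \<omega>)\<^sup>2)) \<longlonglongrightarrow> 0"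
  proof (rule tendsto_sandwich[OF _ _ tendsto_const])
    show "(\<lambda>l. integral\<^sup>L (time_space t) (\<lambda>(s, \<omega>). (f l s \<omega> - g s \<omega>)\<^sup>2)) \<longlonglongrightarrow> 0"
      using a by (simp add: split_beta')
    have "integral\<^sup>L (time_space s) (\<lambda>(s, \<omega>). (f l s \<omega> - g s \<omega>)\<^sup>2)
      \<le> integral\<^sup>L (time_space t) (\<lambda>(s, \<omega>). (f l s \<omega> - g s \<omega>)\<^sup>2)" for l
    proof (rule time_space_integral_mono(2)[OF _ _ assms(2)])
      show "integrable (time_space t) (\<lambda>(s, \<omega>). (f l s \<omega> - g s \<omega>)\<^sup>2)"
        using square_integrable_sq[OF sq[of l]] by (simp only: split_beta')
    qed simp
    then show "\<forall>\<^sub>F l in sequentially. integral\<^sup>L (time_space s) (\<lambda>(s, \<omega>). (f l s \<omega> - g s \<omega>)\<^sup>2)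
      \<le> integral\<^sup>L (time_space t) (\<lambda>(s, \<omega>). (f l s \<omega> - g s \<omega>)\<^sup>2)" by simp
  qed (auto intro!: always_eventually Bochner_Integration.integral_nonneg)
  then have "(\<lambda>l. \<integral>z. ((case z of (s, \<omega>) \<Rightarrow> f l s \<omega>) - (case z of (s, \<omega>) \<Rightarrow> g s \<omega>))\<^sup>2 \<partial>time_space s) \<longlonglongrightarrow> 0"
    by (simp only: split_beta')
  then show ?thesis
    using a square_integrable_time_mono[OF _ assms(2)] unfolding l2_tendsto_def by blast
qed

lemma time_space_Fubini:
  fixes g :: "real \<Rightarrow> 'a \<Rightarrow> real"
  assumes "integrable (time_space t) (\<lambda>(s, \<omega>). g s \<omega>)"
  shows "integral\<^sup>L (time_space t) (\<lambda>(s, \<omega>). g s \<omega>) = (LBINT s:{0..t}. expectation (g s))"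
    and "set_integrable lborel {0..t} (\<lambda>s. expectation (g s))"
proof -
  interpret P: pair_sigma_finite "time_lebesgue t" M by (rule pair_sigma_finite_time)
  show "integral\<^sup>L (time_space t) (\<lambda>(s, \<omega>). g s \<omega>) = (LBINT s:{0..t}. expectation (g s))"
    using P.integral_fst'[OF assms] by (simp add: time_lebesgue_integral)
  have "integrable (time_lebesgue t) (\<lambda>s. expectation (g s))"
    using P.integrable_fst'[OF assms] by simp
  then show "set_integrable lborel {0..t} (\<lambda>s. expectation (g s))"
    unfolding set_integrable_def by (subst (asm) integrable_restrict_space) auto
qed

lemma time_space_Fubini_swap:
  fixes g :: "real \<Rightarrow> 'a \<Rightarrow> real"
  assumes "integrable (time_space t) (\<lambda>(s, \<omega>). g s \<omega>)"
  shows "integral\<^sup>L (time_space t) (\<lambda>(s, \<omega>). g s \<omega>) = expectation (\<lambda>\<omega>. LBINT s:{0..t}. g s \<omega>)"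
proof -
  interpret P: pair_sigma_finite "time_lebesgue t" M by (rule pair_sigma_finite_time)
  show ?thesis
    using P.integral_snd[of "\<lambda>s \<omega>. g s \<omega>"] assms by (simp add: time_lebesgue_integral)
qed

text \<open>A weaker form of \<open>has_ito_integral\<close> that is easier to combine: the
  approximating integrands are elementary rather than simple, may live beyond \<open>T\<close>, and
  have their integrals evaluated at \<open>T\<close>. Isometry and martingale property are proved
  for this form.\<close>

definition ito_limit :: "real \<Rightarrow> (real \<Rightarrow> 'a \<Rightarrow> real) \<Rightarrow> ('a \<Rightarrow> real) \<Rightarrow> bool" where
  "ito_limit T H Y \<longleftrightarrow> (\<exists>S J. (\<forall>l. elementary (S l) (J l)) \<and>
     l2_tendsto (time_space T) (\<lambda>l (t, \<omega>). S l t \<omega>) (\<lambda>(t, \<omega>). H t \<omega>) \<and>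
     l2_tendsto M (\<lambda>l. J l T) Y)"

lemma has_ito_integral_imp_limit:
  assumes "has_ito_integral M F w T H Y" "0 \<le> T"
  shows "ito_limit T H Y"
proof -
  from assms(1) obtain m \<tau> \<xi> where H: "square_integrable_adapted M F T H" and Y: "Y \<in> borel_measurable M"
    and sp: "\<And>l. simple_process M F T (m l) (\<tau> l) (\<xi> l)"
    and lim1: "(\<lambda>l. \<integral>\<^sup>+\<omega>. (\<integral>\<^sup>+t\<in>{0..T}. ennreal ((H t \<omega> - simple_value (m l) (\<tau> l) (\<xi> l) t \<omega>)\<^sup>2) \<partial>lborel) \<partial>M)
          \<longlonglongrightarrow> 0"
    and lim2: "(\<lambda>l. \<integral>\<^sup>+\<omega>. ennreal ((Y \<omega> - simple_integral w (m l) (\<tau> l) (\<xi> l) \<omega>)\<^sup>2) \<partial>M) \<longlonglongrightarrow> 0"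
    unfolding has_ito_integral_def by blast
  define S where "S l = simple_value (m l) (\<tau> l) (\<xi> l)" for l
  define J where "J l = running_integral w (m l) (\<tau> l) (\<xi> l)" for l
  have el: "elementary (S l) (J l)" for l
    unfolding S_def J_def by (rule simple_process_elementary[OF sp])
  have JT: "J l T = simple_integral w (m l) (\<tau> l) (\<xi> l)" for l
    unfolding J_def by (rule running_integral_end[OF sp order_refl])
  note Ssq = elementary_integrand_square_integrable[OF el]
  have Hm: "(\<lambda>(t, \<omega>). H t \<omega>) \<in> borel_measurable (time_space T)"
    using H by (simp add: square_integrable_adapted_def)
  have "(\<integral>\<^sup>+\<omega>. (\<integral>\<^sup>+t\<in>{0..T}. ennreal ((H t \<omega> - S l t \<omega>)\<^sup>2) \<partial>lborel) \<partial>M)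
      = (\<integral>\<^sup>+z. ennreal (((case z of (t, \<omega>) \<Rightarrow> H t \<omega>) - (case z of (t, \<omega>) \<Rightarrow> S l t \<omega>))\<^sup>2) \<partial>time_space T)" for l
  proof -
    have "(\<lambda>(t, \<omega>). (H t \<omega> - S l t \<omega>)\<^sup>2) \<in> borel_measurable (time_space T)"
      using Hm square_integrable_measurable[OF Ssq[of T l]] by (simp add: split_beta')
    from nn_integral_time_space[OF this] show ?thesis by (simp add: split_beta')
  qed
  then have 1: "l2_tendsto (time_space T) (\<lambda>l (t, \<omega>). S l t \<omega>) (\<lambda>(t, \<omega>). H t \<omega>)"
    using lim1[folded S_def] by (intro l2_tendsto_of_nn_integral Ssq Hm) simp
  have 2: "l2_tendsto M (\<lambda>l. J l T) Y"
    using lim2 by (intro l2_tendsto_of_nn_integral Y elementary_integral_square_integrable[OF el assms(2)])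
      (simp add: JT)
  show ?thesis unfolding ito_limit_def using el 1 2 by blast
qed

lemma ito_limit_square_integrable: "ito_limit T H Y \<Longrightarrow> square_integrable M Y"
  by (auto simp: ito_limit_def l2_tendsto_def)

lemma ito_limit_cong_AE:
  assumes "ito_limit T H Y" "Y' \<in> borel_measurable M" "AE \<omega> in M. Y \<omega> = Y' \<omega>"
  shows "ito_limit T H Y'"
proof -
  from assms(1) obtain S J where el: "\<And>l. elementary (S l) (J l)"
    and 1: "l2_tendsto (time_space T) (\<lambda>l (t, \<omega>). S l t \<omega>) (\<lambda>(t, \<omega>). H t \<omega>)"
    and 2: "l2_tendsto M (\<lambda>l. J l T) Y"
    unfolding ito_limit_def by blast
  have [measurable]: "Y \<in> borel_measurable M" "J l T \<in> borel_measurable M" "Y' \<in> borel_measurable M" for l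
    using 2 assms(2) by (auto simp: l2_tendsto_def square_integrable_def)
  have "expectation (\<lambda>\<omega>. (J l T \<omega> - Y \<omega>)\<^sup>2) = expectation (\<lambda>\<omega>. (J l T \<omega> - Y' \<omega>)\<^sup>2)" for l
    by (rule integral_cong_AE) (use assms(3) in auto)
  then have "l2_tendsto M (\<lambda>l. J l T) Y'"
    using 2 square_integrable_cong_AE[OF _ assms(2,3)] by (simp add: l2_tendsto_def)
  then show ?thesis unfolding ito_limit_def using el 1 by blast
qed

text \<open>The isometry of the approximations, and continuity of the L2 inner product on both
  sides.\<close>

lemma ito_isometry:
  assumes "ito_limit T H Y" "ito_limit T H' Y'" "0 \<le> T"
  shows "expectation (\<lambda>\<omega>. Y \<omega> * Y' \<omega>) = integral\<^sup>L (time_space T) (\<lambda>(t, \<omega>). H t \<omega> * H' t \<omega>)"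
proof -
  from assms(1) obtain S J where el: "\<And>l. elementary (S l) (J l)"
    and Sl: "l2_tendsto (time_space T) (\<lambda>l (t, \<omega>). S l t \<omega>) (\<lambda>(t, \<omega>). H t \<omega>)"
    and Jl: "l2_tendsto M (\<lambda>l. J l T) Y"
    unfolding ito_limit_def by blast
  from assms(2) obtain S' J' where el': "\<And>l. elementary (S' l) (J' l)"
    and Sl': "l2_tendsto (time_space T) (\<lambda>l (t, \<omega>). S' l t \<omega>) (\<lambda>(t, \<omega>). H' t \<omega>)"
    and Jl': "l2_tendsto M (\<lambda>l. J' l T) Y'"
    unfolding ito_limit_def by blast
  have "(\<lambda>l. expectation (\<lambda>\<omega>. J l T \<omega> * J' l T \<omega>)) \<longlonglongrightarrow> expectation (\<lambda>\<omega>. Y \<omega> * Y' \<omega>)"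
    by (rule l2_tendsto_integral_mult[OF Jl Jl'])
  moreover have "(\<lambda>l. expectation (\<lambda>\<omega>. J l T \<omega> * J' l T \<omega>)) \<longlonglongrightarrow>
      integral\<^sup>L (time_space T) (\<lambda>(t, \<omega>). H t \<omega> * H' t \<omega>)"
    using l2_tendsto_integral_mult[OF Sl Sl'] elementary_isometry[OF el el' assms(3)]
    by (simp add: split_beta')
  ultimately show ?thesis by (rule LIMSEQ_unique)
qed

text \<open>The two integrals come with unrelated approximations. On [0, s] both sequences of
  integrands tend to \<open>H\<close>, so by the isometry their integrals at \<open>s\<close> draw
  together, and the elementary martingale property carries the first sequence from \<open>t\<close>
  back to \<open>s\<close>.\<close>

lemma ito_martingale:
  assumes "ito_limit t H Y" "ito_limit s H Y'" "0 \<le> s" "s \<le> t"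
    and Z: "Z \<in> borel_measurable (F s)" "square_integrable M Z"
  shows "expectation (\<lambda>\<omega>. Z \<omega> * Y \<omega>) = expectation (\<lambda>\<omega>. Z \<omega> * Y' \<omega>)"
proof -
  from assms(1) obtain S J where el: "\<And>l. elementary (S l) (J l)"
    and Sl: "l2_tendsto (time_space t) (\<lambda>l (t, \<omega>). S l t \<omega>) (\<lambda>(t, \<omega>). H t \<omega>)"
    and Jl: "l2_tendsto M (\<lambda>l. J l t) Y"
    unfolding ito_limit_def by blast
  from assms(2) obtain S' J' where el': "\<And>l. elementary (S' l) (J' l)"
    and Sl': "l2_tendsto (time_space s) (\<lambda>l (t, \<omega>). S' l t \<omega>) (\<lambda>(t, \<omega>). H t \<omega>)"
    and Jl': "l2_tendsto M (\<lambda>l. J' l s) Y'"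
    unfolding ito_limit_def by blast
  have t: "0 \<le> t" using assms by simp
  note el_diff = elementary_diff[OF el el']
  have iso: "expectation (\<lambda>\<omega>. (J l s \<omega> - J' l s \<omega>)\<^sup>2) =
      integral\<^sup>L (time_space s) (\<lambda>(u, \<omega>). (S l u \<omega> - S' l u \<omega>)\<^sup>2)" for l
    using elementary_isometry[OF el_diff el_diff assms(3), of l l l l] by (simp add: power2_eq_square)
  note S_s = l2_tendsto_time_mono[OF Sl assms(4)]
  have "(\<lambda>l. integral\<^sup>L (time_space s) (\<lambda>(u, \<omega>). (S l u \<omega> - S' l u \<omega>)\<^sup>2)) \<longlonglongrightarrow> 0"
  proof (rule tendsto_sandwich[OF _ _ tendsto_const])
    define A where "A l = integral\<^sup>L (time_space s) (\<lambda>z. ((case z of (u, \<omega>) \<Rightarrow> S l u \<omega>) - (case z of (u, \<omega>) \<Rightarrow> H u \<omega>))\<^sup>2)" for l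
    define B where "B l = integral\<^sup>L (time_space s) (\<lambda>z. ((case z of (u, \<omega>) \<Rightarrow> S' l u \<omega>) - (case z of (u, \<omega>) \<Rightarrow> H u \<omega>))\<^sup>2)" for l
    have "A \<longlonglongrightarrow> 0" "B \<longlonglongrightarrow> 0" using S_s Sl' by (auto simp: l2_tendsto_def A_def[abs_def] B_def[abs_def])
    from tendsto_add[OF tendsto_mult_right_zero[OF this(1), of 2] tendsto_mult_right_zero[OF this(2), of 2]]
    show "(\<lambda>l. 2 * A l + 2 * B l) \<longlonglongrightarrow> 0" by simp
    have "integral\<^sup>L (time_space s) (\<lambda>(u, \<omega>). (S l u \<omega> - S' l u \<omega>)\<^sup>2) \<le> 2 * A l + 2 * B l" for l
    proof -
      have "square_integrable (time_space s) (\<lambda>z. (case z of (u, \<omega>) \<Rightarrow> S l u \<omega>) - (case z of (u, \<omega>) \<Rightarrow> H u \<omega>))"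
        "square_integrable (time_space s) (\<lambda>z. (case z of (u, \<omega>) \<Rightarrow> H u \<omega>) - (case z of (u, \<omega>) \<Rightarrow> S' l u \<omega>))"
        using S_s Sl' unfolding l2_tendsto_def by (blast intro: square_integrable_diff)+
      from integral_square_add_le[OF this] show ?thesis
        by (simp add: A_def B_def split_beta' power2_commute)
    qed
    then show "\<forall>\<^sub>F l in sequentially. integral\<^sup>L (time_space s) (\<lambda>(u, \<omega>). (S l u \<omega> - S' l u \<omega>)\<^sup>2) \<le> 2 * A l + 2 * B l"
      by simp
  qed (auto intro!: always_eventually Bochner_Integration.integral_nonneg)
  then have d0: "(\<lambda>l. expectation (\<lambda>\<omega>. Z \<omega> * (J l s \<omega> - J' l s \<omega>))) \<longlonglongrightarrow> 0"
    by (intro integral_mult_tendsto_0 Z tendsto_mult_right_zero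
        elementary_integral_square_integrable[OF el_diff assms(3)]) (simp add: iso)
  have "(\<lambda>l. expectation (\<lambda>\<omega>. Z \<omega> * J l t \<omega>) - expectation (\<lambda>\<omega>. Z \<omega> * J' l s \<omega>))
       \<longlonglongrightarrow> expectation (\<lambda>\<omega>. Z \<omega> * Y \<omega>) - expectation (\<lambda>\<omega>. Z \<omega> * Y' \<omega>)"
    by (intro tendsto_diff l2_tendsto_integral_mult l2_tendsto_const Z Jl Jl')
  moreover have "expectation (\<lambda>\<omega>. Z \<omega> * J l t \<omega>) - expectation (\<lambda>\<omega>. Z \<omega> * J' l s \<omega>)
      = expectation (\<lambda>\<omega>. Z \<omega> * (J l s \<omega> - J' l s \<omega>))" for l
    using elementary_martingale[OF el assms(3,4) Z]
      square_integrable_mult[OF Z(2) elementary_integral_square_integrable[OF el assms(3)]]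
      square_integrable_mult[OF Z(2) elementary_integral_square_integrable[OF el' assms(3)]]
    by (simp add: right_diff_distrib)
  ultimately have "(\<lambda>l. expectation (\<lambda>\<omega>. Z \<omega> * (J l s \<omega> - J' l s \<omega>)))
       \<longlonglongrightarrow> expectation (\<lambda>\<omega>. Z \<omega> * Y \<omega>) - expectation (\<lambda>\<omega>. Z \<omega> * Y' \<omega>)"
    by simp
  from LIMSEQ_unique[OF this d0] show ?thesis by simp
qed

end

section \<open>Ito processes\<close>

text \<open>The sigma-algebra \<open>N\<close> is left free: \<open>M\<close> gives random
  variables, \<open>F t\<close> gives adapted drift integrals.\<close>

lemma time_integral_measurable:
  fixes b :: "real \<Rightarrow> 'b \<Rightarrow> real"
  assumes "0 \<le> t" "\<And>s. 0 \<le> s \<Longrightarrow> s \<le> t \<Longrightarrow> b s \<in> borel_measurable N"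
    and "\<And>\<omega>. \<omega> \<in> space N \<Longrightarrow> continuous_on {0..t} (\<lambda>s. b s \<omega>)"
  shows "(\<lambda>\<omega>. LBINT s:{0..t}. b s \<omega>) \<in> borel_measurable N"
proof -
  interpret finite_measure "time_lebesgue t" by (rule finite_measure_time_lebesgue)
  have "(\<lambda>(s, \<omega>). b s \<omega>) \<in> borel_measurable (time_lebesgue t \<Otimes>\<^sub>M N)"
    using assms by (rule continuous_process_measurable_Icc)
  from measurable_compose[OF measurable_pair_swap' this]
  have "(\<lambda>(\<omega>, s). b s \<omega>) \<in> borel_measurable (N \<Otimes>\<^sub>M time_lebesgue t)"
    by (simp add: split_beta')
  from borel_measurable_lebesgue_integral[OF this] show ?thesis
    by (simp only: time_lebesgue_integral)
qed

lemma time_integral_0: "(LBINT s:{0..0::real}. f s) = (0::real)"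
proof -
  have "AE s in lborel. indicator {0..0::real} s *\<^sub>R f s = 0"
    using AE_lborel_singleton[of "0::real"] by eventually_elim simp
  then show ?thesis
    unfolding set_lebesgue_integral_def by (rule integral_eq_zero_AE)
qed

lemma continuous_square_integrable_time:
  assumes "continuous_on {0..t} (f :: real \<Rightarrow> real)"
  shows "square_integrable (time_lebesgue t) f"
proof -
  have "integrable (time_lebesgue t) (\<lambda>s. (f s)\<^sup>2)"
  proof (subst integrable_restrict_space)
    show "integrable lborel (\<lambda>s. indicat_real {0..t} s *\<^sub>R (f s)\<^sup>2)"
      using borel_integrable_atLeastAtMost'[of 0 t "\<lambda>s. (f s)\<^sup>2"] assms
      by (auto simp: set_integrable_def intro: continuous_intros)
  qed simp
  moreover have "f \<in> borel_measurable (time_lebesgue t)"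
    using borel_measurable_continuous_on_restrict[OF assms]
    by (simp cong: measurable_cong_sets add: sets_restrict_space)
  ultimately show ?thesis by (simp add: square_integrable_def)
qed

lemma time_integral_square_le:
  assumes "continuous_on {0..t} (f :: real \<Rightarrow> real)" "0 \<le> t"
  shows "(LBINT s:{0..t}. f s)\<^sup>2 \<le> t * (LBINT s:{0..t}. (f s)\<^sup>2)"
proof -
  have "(integral\<^sup>L (time_lebesgue t) (\<lambda>s. 1 * f s))\<^sup>2
      \<le> integral\<^sup>L (time_lebesgue t) (\<lambda>s. 1\<^sup>2) * integral\<^sup>L (time_lebesgue t) (\<lambda>s. (f s)\<^sup>2)"
    by (intro integral_mult_square_le continuous_square_integrable_time assms(1) continuous_on_const)
  moreover have "integral\<^sup>L (time_lebesgue t) (\<lambda>s. 1\<^sup>2 :: real) = t"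
    unfolding time_lebesgue_integral set_lebesgue_integral_def using assms(2) by simp
  ultimately show ?thesis
    by (simp add: time_lebesgue_integral)
qed

text \<open>Passes to the gauge integral, whose fundamental theorem supplies the derivative within a
  closed interval, one-sided at its ends.\<close>

lemma continuous_time_integral_derivative:
  assumes "continuous_on {0..} (f :: real \<Rightarrow> real)" "0 \<le> s" "s \<le> t"
  shows "((\<lambda>u. LBINT s:{0..u}. f s) has_vector_derivative f s) (at s within {0..t})"
proof -
  have c: "continuous_on {0..u} f" for u
    by (rule continuous_on_subset[OF assms(1)]) auto
  have eq: "(LBINT s:{0..u}. f s) = integral {0..u} f" for u
    by (rule set_borel_integral_eq_integral(2)[OF borel_integrable_atLeastAtMost'[OF c]])
  have "((\<lambda>u. integral {0..u} f) has_vector_derivative f s) (at s within {0..t})"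
    by (rule integral_has_vector_derivative[OF c]) (use assms in auto)
  then show ?thesis by (simp only: eq)
qed

lemma continuous_time_integral:
  assumes "continuous_on {0..} (f :: real \<Rightarrow> real)"
  shows "continuous_on {0..} (\<lambda>u. LBINT s:{0..u}. f s)"
proof -
  have "continuous (at s within {0..}) (\<lambda>u. LBINT s:{0..u}. f s)" if "0 \<le> s" for s
  proof -
    have "continuous (at s within {0..s + 1}) (\<lambda>u. LBINT s:{0..u}. f s)"
      by (rule has_vector_derivative_continuous[OF continuous_time_integral_derivative[OF assms that]]) simp
    moreover have "at s within {0..s + 1} = at s within {0..}"
      by (rule at_within_nhd[of s "{..<s + 1}"]) auto
    ultimately show ?thesis by simp
  qed
  then show ?thesis by (auto simp: continuous_on_eq_continuous_within)
qed

text \<open>The pathwise part of the product formula; the initial values are built into both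
  factors.\<close>

lemma time_integral_by_parts:
  fixes f g :: "real \<Rightarrow> real" and x y :: real
  assumes f: "continuous_on {0..} f" and g: "continuous_on {0..} g" and t: "0 \<le> t"
  defines "I \<equiv> \<lambda>u. x + (LBINT s:{0..u}. f s)" and "J \<equiv> \<lambda>u. y + (LBINT s:{0..u}. g s)"
  shows "I t * J t = x * y + (LBINT s:{0..t}. f s * J s + I s * g s)"
proof -
  have ci: "continuous_on {0..} I" and cj: "continuous_on {0..} J"
    unfolding I_def J_def by (intro continuous_intros continuous_time_integral f g)+
  have "integral\<^sup>L lborel (\<lambda>s. indicator {0..t} s *\<^sub>R (f s * J s + I s * g s)) = I t * J t - I 0 * J 0"
  proof (rule integral_FTC_atLeastAtMost[OF t])
    fix s assume s: "0 \<le> s" "s \<le> t"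
    have dI: "(I has_vector_derivative f s) (at s within {0..t})"
      unfolding I_def using has_vector_derivative_add[OF has_vector_derivative_const
        continuous_time_integral_derivative[OF f s]] by simp
    have dJ: "(J has_vector_derivative g s) (at s within {0..t})"
      unfolding J_def using has_vector_derivative_add[OF has_vector_derivative_const
        continuous_time_integral_derivative[OF g s]] by simp
    from has_vector_derivative_mult[OF dI dJ]
    show "((\<lambda>s. I s * J s) has_vector_derivative f s * J s + I s * g s) (at s within {0..t})"
      by (simp add: add.commute)
  next
    show "continuous_on {0..t} (\<lambda>s. f s * J s + I s * g s)"
      by (rule continuous_on_subset[of "{0..}"]) (auto intro!: continuous_intros f g ci cj)
  qed
  moreover have "I 0 = x" "J 0 = y"
    by (simp_all only: I_def J_def time_integral_0 add_0_right)
  ultimately show ?thesis by (simp add: set_lebesgue_integral_def)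
qed

section \<open>Processes with a drift and an Ito integral\<close>

context wiener_setting
begin

lemma square_integrable_time_of_bounded:
  assumes m: "(\<lambda>(s, \<omega>). f s \<omega>) \<in> borel_measurable (time_space t)"
    and sq: "\<And>s. 0 \<le> s \<Longrightarrow> s \<le> t \<Longrightarrow> square_integrable M (f s)"
    and B: "\<And>s. 0 \<le> s \<Longrightarrow> s \<le> t \<Longrightarrow> expectation (\<lambda>\<omega>. (f s \<omega>)\<^sup>2) \<le> B"
  shows "square_integrable (time_space t) (\<lambda>(s, \<omega>). f s \<omega>)"
proof -
  have m2: "(\<lambda>z. ennreal ((case z of (s, \<omega>) \<Rightarrow> f s \<omega>)\<^sup>2)) \<in> borel_measurable (time_space t)"
    using m by measurable
  have "(\<integral>\<^sup>+z. ennreal ((case z of (s, \<omega>) \<Rightarrow> f s \<omega>)\<^sup>2) \<partial>time_space t)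
      = (\<integral>\<^sup>+s. \<integral>\<^sup>+\<omega>. ennreal ((f s \<omega>)\<^sup>2) \<partial>M \<partial>time_lebesgue t)"
    using nn_integral_fst[OF m2] by simp
  also have "\<dots> \<le> (\<integral>\<^sup>+s. ennreal B \<partial>time_lebesgue t)"
  proof (rule nn_integral_mono)
    fix s assume "s \<in> space (time_lebesgue t)"
    then have s: "0 \<le> s" "s \<le> t" by (auto simp: space_restrict_space)
    have "(\<integral>\<^sup>+\<omega>. ennreal ((f s \<omega>)\<^sup>2) \<partial>M) = ennreal (expectation (\<lambda>\<omega>. (f s \<omega>)\<^sup>2))"
      by (rule nn_integral_eq_integral[OF square_integrable_sq[OF sq[OF s]]]) simp
    then show "(\<integral>\<^sup>+\<omega>. ennreal ((f s \<omega>)\<^sup>2) \<partial>M) \<le> ennreal B"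
      using B[OF s] by (simp add: ennreal_leI)
  qed
  also have "\<dots> < \<infinity>"
    using finite_measure.emeasure_finite[OF finite_measure_time_lebesgue, of t "space (time_lebesgue t)"]
    by (simp add: ennreal_mult_less_top top.not_eq_extremum)
  finally show ?thesis
    by (subst square_integrable_iff_nn_integral[OF m])
qed

text \<open>Cauchy-Schwarz on each path, then Fubini; the factor \<open>t\<close> is the squared
  norm of the constant 1 on [0, t].\<close>

lemma time_integral_square_integrable:
  assumes t: "0 \<le> t" and b: "square_integrable (time_space t) (\<lambda>(s, \<omega>). b s \<omega>)"
    and m: "\<And>s. 0 \<le> s \<Longrightarrow> s \<le> t \<Longrightarrow> b s \<in> borel_measurable M"
    and c: "\<And>\<omega>. \<omega> \<in> space M \<Longrightarrow> continuous_on {0..t} (\<lambda>s. b s \<omega>)"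
  shows "square_integrable M (\<lambda>\<omega>. LBINT s:{0..t}. b s \<omega>)"
    and "expectation (\<lambda>\<omega>. (LBINT s:{0..t}. b s \<omega>)\<^sup>2) \<le> t * integral\<^sup>L (time_space t) (\<lambda>(s, \<omega>). (b s \<omega>)\<^sup>2)"
proof -
  interpret P: pair_sigma_finite "time_lebesgue t" M by (rule pair_sigma_finite_time)
  have meas: "(\<lambda>\<omega>. LBINT s:{0..t}. b s \<omega>) \<in> borel_measurable M"
    by (rule time_integral_measurable[OF t m c])
  have i: "integrable (time_space t) (\<lambda>(s, \<omega>). (b s \<omega>)\<^sup>2)"
    using square_integrable_sq[OF b] by (simp only: split_beta')
  have swap: "integral\<^sup>L (time_space t) (\<lambda>(s, \<omega>). (b s \<omega>)\<^sup>2) = expectation (\<lambda>\<omega>. LBINT s:{0..t}. (b s \<omega>)\<^sup>2)"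
    by (rule time_space_Fubini_swap[OF i])
  have "integrable M (\<lambda>\<omega>. LBINT s:{0..t}. (b s \<omega>)\<^sup>2)"
    using P.integrable_snd[OF i] by (simp only: time_lebesgue_integral)
  then have i2: "integrable M (\<lambda>\<omega>. t * (LBINT s:{0..t}. (b s \<omega>)\<^sup>2))" by simp
  note le = time_integral_square_le[OF c t]
  have nn: "0 \<le> (LBINT s:{0..t}. (b s \<omega>)\<^sup>2)" for \<omega>
    unfolding time_lebesgue_integral[symmetric] by (rule Bochner_Integration.integral_nonneg) simp
  have i3: "integrable M (\<lambda>\<omega>. (LBINT s:{0..t}. b s \<omega>)\<^sup>2)"
  proof (rule Bochner_Integration.integrable_bound[OF i2])
    show "(\<lambda>\<omega>. (LBINT s:{0..t}. b s \<omega>)\<^sup>2) \<in> borel_measurable M"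
      using meas by measurable
    show "AE \<omega> in M. norm ((LBINT s:{0..t}. b s \<omega>)\<^sup>2) \<le> norm (t * (LBINT s:{0..t}. (b s \<omega>)\<^sup>2))"
      using le nn t by (intro AE_I2) (simp add: abs_mult)
  qed
  then show "square_integrable M (\<lambda>\<omega>. LBINT s:{0..t}. b s \<omega>)"
    using meas by (simp add: square_integrable_def)
  have "expectation (\<lambda>\<omega>. (LBINT s:{0..t}. b s \<omega>)\<^sup>2) \<le> expectation (\<lambda>\<omega>. t * (LBINT s:{0..t}. (b s \<omega>)\<^sup>2))"
    by (rule integral_mono[OF i3 i2 le])
  then show "expectation (\<lambda>\<omega>. (LBINT s:{0..t}. b s \<omega>)\<^sup>2) \<le> t * integral\<^sup>L (time_space t) (\<lambda>(s, \<omega>). (b s \<omega>)\<^sup>2)"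
    by (simp add: swap)
qed

text \<open>The stochastic integral gets no name of its own: it is \<open>X\<close> minus its
  absolutely continuous part, hence defined at every point and jointly measurable along with
  \<open>X\<close>.\<close>

definition ito_process ::
  "real \<Rightarrow> (real \<Rightarrow> 'a \<Rightarrow> real) \<Rightarrow> (real \<Rightarrow> 'a \<Rightarrow> real) \<Rightarrow> (real \<Rightarrow> 'a \<Rightarrow> real) \<Rightarrow> bool" where
  "ito_process x0 b \<sigma> X \<longleftrightarrow>
     (\<forall>T\<ge>0. square_integrable_adapted M F T X \<and> square_integrable_adapted M F T b) \<and>
     (\<forall>\<omega>\<in>space M. continuous_on {0..} (\<lambda>t. X t \<omega>) \<and> continuous_on {0..} (\<lambda>t. b t \<omega>)) \<and>
     (\<forall>t\<ge>0. ito_limit t \<sigma> (\<lambda>\<omega>. X t \<omega> - (x0 + (LBINT s:{0..t}. b s \<omega>))))"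

text \<open>Tested against the constant 1, the martingale property moves the mean to time 0, where
  the isometry over the null interval {0..0} forces the integral to vanish.\<close>

lemma ito_limit_expectation:
  assumes "ito_limit t \<sigma> Y" "ito_limit 0 \<sigma> Y0" "0 \<le> t"
  shows "expectation Y = 0"
proof -
  have one: "square_integrable M (\<lambda>_. 1)" "(\<lambda>_. 1) \<in> borel_measurable (F 0)"
    by (auto intro!: square_integrable_bounded[OF finite_measure_axioms, of _ 1])
  have s0: "integrable (time_space 0) (\<lambda>(s, \<omega>). \<sigma> s \<omega> * \<sigma> s \<omega>)"
    using assms(2) square_integrable_mult[of "time_space 0" "\<lambda>(s, \<omega>). \<sigma> s \<omega>" "\<lambda>(s, \<omega>). \<sigma> s \<omega>"]
    by (auto simp: ito_limit_def l2_tendsto_def split_beta')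
  have "expectation (\<lambda>\<omega>. Y0 \<omega> * Y0 \<omega>) = (LBINT s:{0..0}. expectation (\<lambda>\<omega>. \<sigma> s \<omega> * \<sigma> s \<omega>))"
    using ito_isometry[OF assms(2,2)] time_space_Fubini(1)[OF s0] by simp
  also have "\<dots> = 0" by (rule time_integral_0)
  finally have "expectation (\<lambda>\<omega>. (Y0 \<omega>)\<^sup>2) = 0" by (simp add: power2_eq_square)
  then have "(expectation (\<lambda>\<omega>. 1 * Y0 \<omega>))\<^sup>2 \<le> 0"
    using integral_mult_square_le[OF one(1) ito_limit_square_integrable[OF assms(2)]] by simp
  moreover have "expectation (\<lambda>\<omega>. 1 * Y \<omega>) = expectation (\<lambda>\<omega>. 1 * Y0 \<omega>)"
    by (rule ito_martingale[OF assms(1,2) order_refl assms(3) one(2,1)])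
  ultimately show ?thesis by simp
qed

lemma ito_process_square_integrable:
  assumes X: "ito_process x0 b \<sigma> X" and t: "0 \<le> t"
  shows "square_integrable M (X t)"
    and "square_integrable M (\<lambda>\<omega>. LBINT s:{0..t}. b s \<omega>)"
proof -
  have bm: "b s \<in> borel_measurable M" if "0 \<le> s" for s
    using X that measurable_F[of s "b s"] by (auto simp: ito_process_def square_integrable_adapted_def)
  have bc: "continuous_on {0..t} (\<lambda>s. b s \<omega>)" if "\<omega> \<in> space M" for \<omega>
    using X that by (auto simp: ito_process_def intro: continuous_on_subset)
  have bs: "square_integrable (time_space t) (\<lambda>(s, \<omega>). b s \<omega>)"
    using X t by (auto simp: ito_process_def square_integrable_adapted_iff)
  show I: "square_integrable M (\<lambda>\<omega>. LBINT s:{0..t}. b s \<omega>)"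
    by (rule time_integral_square_integrable(1)[OF t bs bm bc])
  have c: "square_integrable M (\<lambda>_. x0)"
    by (auto intro!: square_integrable_bounded[OF finite_measure_axioms])
  note z = square_integrable_add[OF c I]
  have "square_integrable M (\<lambda>\<omega>. X t \<omega> - (x0 + (LBINT s:{0..t}. b s \<omega>)))"
    using X t by (auto simp: ito_process_def intro: ito_limit_square_integrable)
  from square_integrable_add[OF this z] show "square_integrable M (X t)" by simp
qed

end

section \<open>The product formula for second moments\<close>

context wiener_setting
begin

lemma square_integrable_time_mult:
  assumes "square_integrable (time_space t) (\<lambda>(s, \<omega>). f s \<omega>)"
    and "square_integrable (time_space t) (\<lambda>(s, \<omega>). g s \<omega>)"
  shows "integrable (time_space t) (\<lambda>(s, \<omega>). f s \<omega> * g s \<omega>)"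
  using square_integrable_mult[OF assms] by (simp only: split_beta')

lemma square_integrable_time_diff:
  assumes "square_integrable (time_space t) (\<lambda>(s, \<omega>). f s \<omega>)"
    and "square_integrable (time_space t) (\<lambda>(s, \<omega>). g s \<omega>)"
  shows "square_integrable (time_space t) (\<lambda>(s, \<omega>). f s \<omega> - g s \<omega>)"
  using square_integrable_diff[OF assms] by (simp only: split_beta')

lemma ito_process_drift:
  assumes X: "ito_process x0 b \<sigma> X" and t: "0 \<le> t"
  shows "square_integrable (time_space t) (\<lambda>(s, \<omega>). b s \<omega>)"
    and "b t \<in> borel_measurable (F t)" "X t \<in> borel_measurable (F t)"
    and "\<omega> \<in> space M \<Longrightarrow> continuous_on {0..} (\<lambda>s. b s \<omega>)"
    and "\<omega> \<in> space M \<Longrightarrow> continuous_on {0..} (\<lambda>s. X s \<omega>)"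
    and "square_integrable (time_space t) (\<lambda>(s, \<omega>). X s \<omega>)"
    and "ito_limit t \<sigma> (\<lambda>\<omega>. X t \<omega> - (x0 + (LBINT s:{0..t}. b s \<omega>)))"
    and "square_integrable (time_space t) (\<lambda>(s, \<omega>). \<sigma> s \<omega>)"
proof -
  show lim: "ito_limit t \<sigma> (\<lambda>\<omega>. X t \<omega> - (x0 + (LBINT s:{0..t}. b s \<omega>)))"
    using X t by (simp add: ito_process_def)
  then show "square_integrable (time_space t) (\<lambda>(s, \<omega>). \<sigma> s \<omega>)"
    unfolding ito_limit_def l2_tendsto_def by blast
qed (use X t in \<open>auto simp: ito_process_def square_integrable_adapted_iff\<close>)

text \<open>By the isometry the second moment of the martingale part at \<open>s\<close> is the
  integral of \<sigma>^2 over [0, s], hence at most its value at \<open>t\<close>. Path continuity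
  of the drift part supplies joint measurability.\<close>

lemma ito_process_decomposition:
  assumes X: "ito_process x0 b \<sigma> X" and t: "0 \<le> t"
  shows "square_integrable (time_space t) (\<lambda>(s, \<omega>). X s \<omega> - (x0 + (LBINT u:{0..s}. b u \<omega>)))"
    and "square_integrable (time_space t) (\<lambda>(s, \<omega>). x0 + (LBINT u:{0..s}. b u \<omega>))"
proof -
  note X_props = ito_process_drift[OF X]
  have Im: "(\<lambda>\<omega>. x0 + (LBINT u:{0..s}. b u \<omega>)) \<in> borel_measurable M" if "0 \<le> s" for s
    using square_integrable_measurable[OF ito_process_square_integrable(2)[OF X that]] by measurable
  have Ij: "(\<lambda>(s, \<omega>). x0 + (LBINT u:{0..s}. b u \<omega>)) \<in> borel_measurable (time_space t)"
  proof (rule continuous_process_measurable_Icc[OF t])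
    show "continuous_on {0..t} (\<lambda>s. x0 + (LBINT u:{0..s}. b u \<omega>))" if "\<omega> \<in> space M" for \<omega>
      by (rule continuous_on_subset[of "{0..}"])
        (auto intro!: continuous_intros continuous_time_integral X_props(4)[OF t that])
  qed (use Im in auto)
  note Xj = square_integrable_measurable[OF X_props(6)[OF t]]
  have "(\<lambda>z. (case z of (s, \<omega>) \<Rightarrow> X s \<omega>) - (case z of (s, \<omega>) \<Rightarrow> x0 + (LBINT u:{0..s}. b u \<omega>)))
      \<in> borel_measurable (time_space t)"
    using Xj Ij by measurable
  then have Yj: "(\<lambda>(s, \<omega>). X s \<omega> - (x0 + (LBINT u:{0..s}. b u \<omega>))) \<in> borel_measurable (time_space t)"
    by (simp only: split_beta')
  show Y: "square_integrable (time_space t) (\<lambda>(s, \<omega>). X s \<omega> - (x0 + (LBINT u:{0..s}. b u \<omega>)))"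
  proof (rule square_integrable_time_of_bounded[OF Yj])
    fix s assume s: "0 \<le> s" "s \<le> t"
    note lim = X_props(7)[OF s(1)]
    show "square_integrable M (\<lambda>\<omega>. X s \<omega> - (x0 + (LBINT u:{0..s}. b u \<omega>)))"
      by (rule ito_limit_square_integrable[OF lim])
    have "expectation (\<lambda>\<omega>. (X s \<omega> - (x0 + (LBINT u:{0..s}. b u \<omega>)))\<^sup>2)
        = integral\<^sup>L (time_space s) (\<lambda>(u, \<omega>). \<sigma> u \<omega> * \<sigma> u \<omega>)"
      using ito_isometry[OF lim lim s(1)] by (simp only: power2_eq_square)
    also have "\<dots> \<le> integral\<^sup>L (time_space t) (\<lambda>(u, \<omega>). \<sigma> u \<omega> * \<sigma> u \<omega>)"
      by (rule time_space_integral_mono(2)[OF square_integrable_time_mult[OF X_props(8)[OF t] X_props(8)[OF t]] _ s(2)])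
        simp
    finally show "expectation (\<lambda>\<omega>. (X s \<omega> - (x0 + (LBINT u:{0..s}. b u \<omega>)))\<^sup>2)
       \<le> integral\<^sup>L (time_space t) (\<lambda>(u, \<omega>). \<sigma> u \<omega> * \<sigma> u \<omega>)" .
  qed
  from square_integrable_time_diff[OF X_props(6)[OF t] Y]
  show "square_integrable (time_space t) (\<lambda>(s, \<omega>). x0 + (LBINT u:{0..s}. b u \<omega>))"
    by simp
qed

text \<open>The drift part is a time integral, and the mean of b_s Y_t equals that of b_s Y_s by the
  martingale property. The initial value drops out because Y_t has mean 0.\<close>

lemma ito_process_cross_expectation:
  assumes X: "ito_process x0 b \<sigma> X" and X': "ito_process x0' b' \<sigma>' X'" and t: "0 \<le> t"
  defines "Y \<equiv> \<lambda>s \<omega>. X' s \<omega> - (x0' + (LBINT u:{0..s}. b' u \<omega>))"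
  shows "expectation (\<lambda>\<omega>. (x0 + (LBINT u:{0..t}. b u \<omega>)) * Y t \<omega>)
    = integral\<^sup>L (time_space t) (\<lambda>(s, \<omega>). b s \<omega> * Y s \<omega>)"
proof -
  interpret P: pair_sigma_finite "time_lebesgue t" M by (rule pair_sigma_finite_time)
  note Xp = ito_process_drift[OF X] and X'p = ito_process_drift[OF X']
  have Ylim: "ito_limit s \<sigma>' (Y s)" if "0 \<le> s" for s
    using X'p(7)[OF that] by (simp add: Y_def)
  note Ysq = ito_limit_square_integrable[OF Ylim]
  have Yts: "square_integrable (time_space t) (\<lambda>(s, \<omega>). Y s \<omega>)"
    unfolding Y_def by (rule ito_process_decomposition(1)[OF X' t])
  have EY: "expectation (Y t) = 0"
    by (rule ito_limit_expectation[OF Ylim[OF t] Ylim[OF order_refl] t])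
  have Yt: "square_integrable (time_space t) (\<lambda>(s, \<omega>). Y t \<omega>)"
  proof (rule square_integrable_time_of_bounded)
    have "Y t \<in> borel_measurable M" by (rule square_integrable_measurable[OF Ysq[OF t]])
    then show "(\<lambda>(s, \<omega>). Y t \<omega>) \<in> borel_measurable (time_space t)" by measurable
    show "expectation (\<lambda>\<omega>. (Y t \<omega>)\<^sup>2) \<le> expectation (\<lambda>\<omega>. (Y t \<omega>)\<^sup>2)" by simp
  qed (rule Ysq[OF t])
  note bsq = Xp(1)[OF t]
  note I = ito_process_square_integrable(2)[OF X t]
  note i1 = square_integrable_time_mult[OF bsq Yt]
  note i2 = square_integrable_time_mult[OF bsq Yts]
  have "expectation (\<lambda>\<omega>. (x0 + (LBINT u:{0..t}. b u \<omega>)) * Y t \<omega>)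
     = x0 * expectation (Y t) + expectation (\<lambda>\<omega>. (LBINT u:{0..t}. b u \<omega>) * Y t \<omega>)"
    using square_integrable_integrable[OF finite_measure_axioms Ysq[OF t]] square_integrable_mult[OF I Ysq[OF t]]
    by (simp add: distrib_right)
  also have "\<dots> = expectation (\<lambda>\<omega>. LBINT u:{0..t}. b u \<omega> * Y t \<omega>)"
    by (simp add: EY)
  also have "\<dots> = integral\<^sup>L (time_space t) (\<lambda>(s, \<omega>). b s \<omega> * Y t \<omega>)"
    by (rule time_space_Fubini_swap[OF i1, symmetric])
  also have "\<dots> = (\<integral>s. expectation (\<lambda>\<omega>. b s \<omega> * Y t \<omega>) \<partial>time_lebesgue t)"
    using P.integral_fst'[OF i1] by simp
  also have "\<dots> = (\<integral>s. expectation (\<lambda>\<omega>. b s \<omega> * Y s \<omega>) \<partial>time_lebesgue t)"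
  proof (rule integral_cong_AE)
    show "(\<lambda>s. expectation (\<lambda>\<omega>. b s \<omega> * Y t \<omega>)) \<in> borel_measurable (time_lebesgue t)"
      using P.integrable_fst'[OF i1] by auto
    show "(\<lambda>s. expectation (\<lambda>\<omega>. b s \<omega> * Y s \<omega>)) \<in> borel_measurable (time_lebesgue t)"
      using P.integrable_fst'[OF i2] by auto
    \<comment> \<open>\<open>ito_process\<close> bounds \<open>b\<close> on the product space, so
      square integrability at a fixed time is available for almost every \<open>s\<close>.\<close>
    have "AE s in time_lebesgue t. integrable M (\<lambda>\<omega>. (b s \<omega>)\<^sup>2)"
      using P.AE_integrable_fst'[OF square_integrable_sq[OF bsq]] by simp
    moreover have "AE s in time_lebesgue t. s \<in> {0..t}"
      by (rule AE_I2) (simp add: space_restrict_space)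
    ultimately show "AE s in time_lebesgue t. expectation (\<lambda>\<omega>. b s \<omega> * Y t \<omega>) = expectation (\<lambda>\<omega>. b s \<omega> * Y s \<omega>)"
    proof eventually_elim
      case (elim s)
      then have s: "0 \<le> s" "s \<le> t" by auto
      have "square_integrable M (b s)"
        using elim(1) measurable_F[OF s(1) Xp(2)[OF s(1)]] by (simp add: square_integrable_def)
      from ito_martingale[OF Ylim[OF t] Ylim[OF s(1)] s Xp(2)[OF s(1)] this] show ?case .
    qed
  qed
  also have "\<dots> = integral\<^sup>L (time_space t) (\<lambda>(s, \<omega>). b s \<omega> * Y s \<omega>)"
    using P.integral_fst'[OF i2] by simp
  finally show ?thesis .
qed

text \<open>This replaces the Ito formula: after splitting both factors into their absolutely continuous
  and martingale parts, only the isometry, the martingale property and Fubini are needed.\<close>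

lemma ito_process_product:
  assumes X: "ito_process x0 b \<sigma> X" and X': "ito_process x0' b' \<sigma>' X'" and t: "0 \<le> t"
  shows "expectation (\<lambda>\<omega>. X t \<omega> * X' t \<omega>) = x0 * x0' + (LBINT s:{0..t}.
      expectation (\<lambda>\<omega>. b s \<omega> * X' s \<omega>) + expectation (\<lambda>\<omega>. X s \<omega> * b' s \<omega>) + expectation (\<lambda>\<omega>. \<sigma> s \<omega> * \<sigma>' s \<omega>))"
proof -
  define I where "I s \<omega> = x0 + (LBINT u:{0..s}. b u \<omega>)" for s \<omega>
  define I' where "I' s \<omega> = x0' + (LBINT u:{0..s}. b' u \<omega>)" for s \<omega>
  define Y where "Y s \<omega> = X s \<omega> - I s \<omega>" for s \<omega>
  define Y' where "Y' s \<omega> = X' s \<omega> - I' s \<omega>" for s \<omega>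
  note Xp = ito_process_drift[OF X t] and X'p = ito_process_drift[OF X' t]
  have Ylim: "ito_limit t \<sigma> (Y t)" and Y'lim: "ito_limit t \<sigma>' (Y' t)"
    using Xp(7) X'p(7) by (simp_all add: Y_def[abs_def] Y'_def[abs_def] I_def I'_def)
  have Ysq: "square_integrable M (Y t)" "square_integrable M (Y' t)"
    using Ylim Y'lim by (auto intro: ito_limit_square_integrable)
  have Isq: "square_integrable M (I t)" "square_integrable M (I' t)"
    using square_integrable_diff[OF ito_process_square_integrable(1)[OF X t] Ysq(1)]
      square_integrable_diff[OF ito_process_square_integrable(1)[OF X' t] Ysq(2)]
    by (simp_all add: Y_def[abs_def] Y'_def[abs_def])
  have Yts: "square_integrable (time_space t) (\<lambda>(s, \<omega>). Y s \<omega>)" "square_integrable (time_space t) (\<lambda>(s, \<omega>). Y' s \<omega>)"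
    unfolding Y_def Y'_def I_def I'_def
    by (rule ito_process_decomposition(1)[OF X t] ito_process_decomposition(1)[OF X' t])+
  have Its: "square_integrable (time_space t) (\<lambda>(s, \<omega>). I s \<omega>)" "square_integrable (time_space t) (\<lambda>(s, \<omega>). I' s \<omega>)"
    unfolding I_def I'_def
    by (rule ito_process_decomposition(2)[OF X t] ito_process_decomposition(2)[OF X' t])+
  note j = square_integrable_time_mult
  have "expectation (\<lambda>\<omega>. X t \<omega> * X' t \<omega>) = expectation (\<lambda>\<omega>. I t \<omega> * I' t \<omega> + I t \<omega> * Y' t \<omega> + I' t \<omega> * Y t \<omega> + Y t \<omega> * Y' t \<omega>)"
    by (intro Bochner_Integration.integral_cong refl) (simp add: Y_def Y'_def algebra_simps)
  also have "\<dots> = expectation (\<lambda>\<omega>. I t \<omega> * I' t \<omega>) + expectation (\<lambda>\<omega>. I t \<omega> * Y' t \<omega>)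
      + expectation (\<lambda>\<omega>. I' t \<omega> * Y t \<omega>) + expectation (\<lambda>\<omega>. Y t \<omega> * Y' t \<omega>)"
    using square_integrable_mult[OF Isq] square_integrable_mult[OF Isq(1) Ysq(2)]
      square_integrable_mult[OF Isq(2) Ysq(1)] square_integrable_mult[OF Ysq]
    by simp
  also have "expectation (\<lambda>\<omega>. I t \<omega> * I' t \<omega>)
      = x0 * x0' + integral\<^sup>L (time_space t) (\<lambda>(s, \<omega>). b s \<omega> * I' s \<omega> + I s \<omega> * b' s \<omega>)"
  proof -
    have i: "integrable (time_space t) (\<lambda>(s, \<omega>). b s \<omega> * I' s \<omega> + I s \<omega> * b' s \<omega>)"
      using Bochner_Integration.integrable_add[OF j[OF Xp(1) Its(2)] j[OF Its(1) X'p(1)]]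
      by (simp only: split_beta')
    have "expectation (\<lambda>\<omega>. I t \<omega> * I' t \<omega>)
        = expectation (\<lambda>\<omega>. x0 * x0' + (LBINT s:{0..t}. b s \<omega> * I' s \<omega> + I s \<omega> * b' s \<omega>))"
      unfolding I_def I'_def
      by (intro Bochner_Integration.integral_cong refl time_integral_by_parts Xp(4) X'p(4) t)
    also have "\<dots> = x0 * x0' + expectation (\<lambda>\<omega>. LBINT s:{0..t}. b s \<omega> * I' s \<omega> + I s \<omega> * b' s \<omega>)"
    proof -
      interpret P: pair_sigma_finite "time_lebesgue t" M by (rule pair_sigma_finite_time)
      have "integrable M (\<lambda>\<omega>. LBINT s:{0..t}. b s \<omega> * I' s \<omega> + I s \<omega> * b' s \<omega>)"
        using P.integrable_snd[OF i] by (simp only: time_lebesgue_integral)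
      then show ?thesis by (simp add: prob_space)
    qed
    finally show ?thesis by (simp only: time_space_Fubini_swap[OF i])
  qed
  also have "expectation (\<lambda>\<omega>. I t \<omega> * Y' t \<omega>) = integral\<^sup>L (time_space t) (\<lambda>(s, \<omega>). b s \<omega> * Y' s \<omega>)"
    unfolding I_def Y'_def I'_def by (rule ito_process_cross_expectation[OF X X' t])
  also have "expectation (\<lambda>\<omega>. I' t \<omega> * Y t \<omega>) = integral\<^sup>L (time_space t) (\<lambda>(s, \<omega>). b' s \<omega> * Y s \<omega>)"
    unfolding I_def Y_def I'_def by (rule ito_process_cross_expectation[OF X' X t])
  also have "expectation (\<lambda>\<omega>. Y t \<omega> * Y' t \<omega>) = integral\<^sup>L (time_space t) (\<lambda>(s, \<omega>). \<sigma> s \<omega> * \<sigma>' s \<omega>)"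
    by (rule ito_isometry[OF Ylim Y'lim t])
  \<comment> \<open>Regroups by I' + Y' = X' in the \<open>b\<close> terms and by I + Y = X in the
    \<open>b'\<close> terms.\<close>
  also have "x0 * x0' + integral\<^sup>L (time_space t) (\<lambda>(s, \<omega>). b s \<omega> * I' s \<omega> + I s \<omega> * b' s \<omega>)
      + integral\<^sup>L (time_space t) (\<lambda>(s, \<omega>). b s \<omega> * Y' s \<omega>)
      + integral\<^sup>L (time_space t) (\<lambda>(s, \<omega>). b' s \<omega> * Y s \<omega>)
      + integral\<^sup>L (time_space t) (\<lambda>(s, \<omega>). \<sigma> s \<omega> * \<sigma>' s \<omega>)
    = x0 * x0' + integral\<^sup>L (time_space t) (\<lambda>(s, \<omega>). b s \<omega> * X' s \<omega>)
      + integral\<^sup>L (time_space t) (\<lambda>(s, \<omega>). X s \<omega> * b' s \<omega>)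
      + integral\<^sup>L (time_space t) (\<lambda>(s, \<omega>). \<sigma> s \<omega> * \<sigma>' s \<omega>)"
  proof -
    have e1: "integral\<^sup>L (time_space t) (\<lambda>(s, \<omega>). b s \<omega> * I' s \<omega> + I s \<omega> * b' s \<omega>)
       = integral\<^sup>L (time_space t) (\<lambda>(s, \<omega>). b s \<omega> * I' s \<omega>) + integral\<^sup>L (time_space t) (\<lambda>(s, \<omega>). I s \<omega> * b' s \<omega>)"
      using Bochner_Integration.integral_add[OF j[OF Xp(1) Its(2)] j[OF Its(1) X'p(1)]]
      by (simp only: split_beta')
    have e2: "integral\<^sup>L (time_space t) (\<lambda>(s, \<omega>). b s \<omega> * I' s \<omega>) + integral\<^sup>L (time_space t) (\<lambda>(s, \<omega>). b s \<omega> * Y' s \<omega>)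
       = integral\<^sup>L (time_space t) (\<lambda>(s, \<omega>). b s \<omega> * X' s \<omega>)"
      unfolding Bochner_Integration.integral_add[OF j[OF Xp(1) Its(2)] j[OF Xp(1) Yts(2)], symmetric]
      by (intro Bochner_Integration.integral_cong refl) (simp add: split_beta' Y'_def algebra_simps)
    have e3: "integral\<^sup>L (time_space t) (\<lambda>(s, \<omega>). I s \<omega> * b' s \<omega>) + integral\<^sup>L (time_space t) (\<lambda>(s, \<omega>). b' s \<omega> * Y s \<omega>)
       = integral\<^sup>L (time_space t) (\<lambda>(s, \<omega>). X s \<omega> * b' s \<omega>)"
      unfolding Bochner_Integration.integral_add[OF j[OF Its(1) X'p(1)] j[OF X'p(1) Yts(1)], symmetric]
      by (intro Bochner_Integration.integral_cong refl) (simp add: split_beta' Y_def algebra_simps)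
    show ?thesis using e1 e2 e3 by linarith
  qed
  finally have main: "expectation (\<lambda>\<omega>. X t \<omega> * X' t \<omega>) = x0 * x0' + integral\<^sup>L (time_space t) (\<lambda>(s, \<omega>). b s \<omega> * X' s \<omega>)
      + integral\<^sup>L (time_space t) (\<lambda>(s, \<omega>). X s \<omega> * b' s \<omega>)
      + integral\<^sup>L (time_space t) (\<lambda>(s, \<omega>). \<sigma> s \<omega> * \<sigma>' s \<omega>)" .
  note f1 = time_space_Fubini[OF j[OF Xp(1) X'p(6)]]
  note f2 = time_space_Fubini[OF j[OF Xp(6) X'p(1)]]
  note f3 = time_space_Fubini[OF j[OF Xp(8) X'p(8)]]
  show ?thesis
    unfolding main f1(1) f2(1) f3(1)
      set_integral_add(2)[OF set_integral_add(1)[OF f1(2) f2(2)] f3(2)] set_integral_add(2)[OF f1(2) f2(2)]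
    by simp
qed

text \<open>The closed-loop equation with the controls substituted, in real coordinates with index
  below \<open>n\<close>. This form is the target of the existence proof.\<close>

definition linear_sde ::
  "nat \<Rightarrow> (nat \<Rightarrow> nat \<Rightarrow> real) \<Rightarrow> (nat \<Rightarrow> nat \<Rightarrow> real) \<Rightarrow> (nat \<Rightarrow> real) \<Rightarrow> (nat \<Rightarrow> real \<Rightarrow> 'a \<Rightarrow> real) \<Rightarrow> bool" where
  "linear_sde n a c x0 X \<longleftrightarrow>
     (\<forall>T\<ge>0. \<forall>r<n. square_integrable_adapted M F T (X r)) \<and>
     (\<forall>\<omega>\<in>space M. \<forall>r<n. continuous_on {0..} (\<lambda>t. X r t \<omega>)) \<and>
     (\<forall>t\<ge>0. \<forall>r<n. \<exists>Y. has_ito_integral M F w t (\<lambda>s \<omega>. \<Sum>q<n. c r q * X q s \<omega>) Y \<and>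
        (AE \<omega> in M. X r t \<omega> = x0 r + (LBINT s:{0..t}. \<Sum>q<n. a r q * X q s \<omega>) + Y \<omega>))"

lemma square_integrable_adapted_linear:
  assumes "\<And>q. q < n \<Longrightarrow> square_integrable_adapted M F T (X q)"
  shows "square_integrable_adapted M F T (\<lambda>s \<omega>. \<Sum>q<n. a q * X q s \<omega>)"
proof -
  have "square_integrable (time_space T) (\<lambda>z. \<Sum>q<n. a q * (case z of (s, \<omega>) \<Rightarrow> X q s \<omega>))"
    using assms by (intro square_integrable_sum square_integrable_cmult) (auto simp: square_integrable_adapted_iff)
  then have "square_integrable (time_space T) (\<lambda>(s, \<omega>). \<Sum>q<n. a q * X q s \<omega>)"
    by (simp only: split_beta')
  then show ?thesis
    using assms by (auto simp: square_integrable_adapted_iff intro!: borel_measurable_sum borel_measurable_times)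
qed

lemma linear_sde_ito_process:
  assumes X: "linear_sde n a c x0 X" and r: "r < n"
  shows "ito_process (x0 r) (\<lambda>s \<omega>. \<Sum>q<n. a r q * X q s \<omega>) (\<lambda>s \<omega>. \<Sum>q<n. c r q * X q s \<omega>) (X r)"
proof -
  have b: "square_integrable_adapted M F T (\<lambda>s \<omega>. \<Sum>q<n. a r q * X q s \<omega>)" if "0 \<le> T" for T
    using X that by (intro square_integrable_adapted_linear) (auto simp: linear_sde_def)
  have bc: "continuous_on {0..} (\<lambda>s. \<Sum>q<n. a r q * X q s \<omega>)" if "\<omega> \<in> space M" for \<omega>
    using X that by (auto simp: linear_sde_def intro!: continuous_intros)
  have "ito_limit t (\<lambda>s \<omega>. \<Sum>q<n. c r q * X q s \<omega>)
      (\<lambda>\<omega>. X r t \<omega> - (x0 r + (LBINT s:{0..t}. \<Sum>q<n. a r q * X q s \<omega>)))" if t: "0 \<le> t" for t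
  proof -
    obtain Y where Y: "has_ito_integral M F w t (\<lambda>s \<omega>. \<Sum>q<n. c r q * X q s \<omega>) Y"
      and eq: "AE \<omega> in M. X r t \<omega> = x0 r + (LBINT s:{0..t}. \<Sum>q<n. a r q * X q s \<omega>) + Y \<omega>"
      using X r t unfolding linear_sde_def by blast
    have [measurable]: "(\<lambda>\<omega>. LBINT s:{0..t}. \<Sum>q<n. a r q * X q s \<omega>) \<in> borel_measurable M"
    proof (rule time_integral_measurable[OF t])
      show "(\<lambda>\<omega>. \<Sum>q<n. a r q * X q s \<omega>) \<in> borel_measurable M" if "0 \<le> s" for s
        using b[OF that] that by (intro measurable_F[OF that]) (auto simp: square_integrable_adapted_def)
      show "continuous_on {0..t} (\<lambda>s. \<Sum>q<n. a r q * X q s \<omega>)" if "\<omega> \<in> space M" for \<omega>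
        using bc[OF that] by (rule continuous_on_subset) auto
    qed
    have [measurable]: "X r t \<in> borel_measurable M"
      using X r t by (intro measurable_F[OF t]) (auto simp: linear_sde_def square_integrable_adapted_def)
    show ?thesis
    proof (rule ito_limit_cong_AE[OF has_ito_integral_imp_limit[OF Y t]])
      show "AE \<omega> in M. Y \<omega> = X r t \<omega> - (x0 r + (LBINT s:{0..t}. \<Sum>q<n. a r q * X q s \<omega>))"
        using eq by eventually_elim simp
    qed measurable
  qed
  then show ?thesis
    using X r b bc by (auto simp: ito_process_def linear_sde_def)
qed

end

section \<open>Approximation by simple processes\<close>

lemma simple_value_eq:
  assumes sp: "simple_process M F T m \<tau> \<xi>" and k: "k < m" "\<tau> k < t" "t \<le> \<tau> (Suc k)"
  shows "simple_value m \<tau> \<xi> t \<omega> = \<xi> k \<omega>"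
proof -
  have "simple_value m \<tau> \<xi> t \<omega> = (\<Sum>j<m. if j = k then \<xi> k \<omega> else 0)"
    unfolding simple_value_def
  proof (intro sum.cong refl)
    fix j assume j: "j \<in> {..<m}"
    consider "j < k" | "j = k" | "k < j" by linarith
    then show "\<xi> j \<omega> * indicator {\<tau> j<..\<tau> (Suc j)} t = (if j = k then \<xi> k \<omega> else 0)"
    proof cases
      case 1
      then have "\<tau> (Suc j) \<le> \<tau> k" using k by (intro simple_process_grid_mono[OF sp]) auto
      with 1 k show ?thesis by (simp add: indicator_def)
    next
      case 2
      with k show ?thesis by (simp add: indicator_def)
    next
      case 3
      then have "\<tau> (Suc k) \<le> \<tau> j" using j by (intro simple_process_grid_mono[OF sp]) auto
      with 3 k show ?thesis by (simp add: indicator_def)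
    qed
  qed
  also have "\<dots> = \<xi> k \<omega>" using k by simp
  finally show ?thesis .
qed

text \<open>\<open>k m\<close> numbers the cell of the uniform grid that contains \<open>t\<close>.
  Cells are open on the left, hence the ceiling minus 1. The limit runs over \<open>Suc m\<close> to
  stay clear of the empty grid.\<close>

lemma uniform_grid_left_point:
  assumes T: "0 < T" and t: "0 < t" "t \<le> T"
  defines "k \<equiv> \<lambda>m. nat (\<lceil>t * real m / T\<rceil> - 1)"
  shows "0 < m \<Longrightarrow> k m < m"
    and "0 < m \<Longrightarrow> T * real (k m) / real m < t"
    and "0 < m \<Longrightarrow> t \<le> T * real (Suc (k m)) / real m"
    and "(\<lambda>m. T * real (k (Suc m)) / real (Suc m)) \<longlonglongrightarrow> t"
proof -
  have k: "real (k m) < t * real m / T" "t * real m / T \<le> real (Suc (k m))" if "0 < m" for m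
  proof -
    have "0 < t * real m / T" using assms that by simp
    then have "1 \<le> \<lceil>t * real m / T\<rceil>" by linarith
    then have "real (k m) = real_of_int \<lceil>t * real m / T\<rceil> - 1" by (simp add: k_def)
    moreover have "real_of_int \<lceil>t * real m / T\<rceil> - 1 < t * real m / T"
      "t * real m / T \<le> real_of_int \<lceil>t * real m / T\<rceil>"
      by linarith+
    ultimately show "real (k m) < t * real m / T" "t * real m / T \<le> real (Suc (k m))" by simp_all
  qed
  show lt: "T * real (k m) / real m < t" if "0 < m" for m
    using k(1)[OF that] T that by (simp add: field_simps)
  show ge: "t \<le> T * real (Suc (k m)) / real m" if "0 < m" for m
    using k(2)[OF that] T that by (simp add: field_simps)
  show "k m < m" if "0 < m"
  proof -
    have "t * real m / T \<le> real m" using T t that by (simp add: field_simps)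
    then have "real (k m) < real m" using k(1)[OF that] by linarith
    then show ?thesis by simp
  qed
  show "(\<lambda>m. T * real (k (Suc m)) / real (Suc m)) \<longlonglongrightarrow> t"
  proof (rule tendsto_sandwich)
    show "(\<lambda>m. t - T * (1 / real (Suc m))) \<longlonglongrightarrow> t"
      using tendsto_diff[OF tendsto_const tendsto_mult_right_zero[OF LIMSEQ_Suc[OF lim_1_over_n]], of t T]
      by simp
    have "t - T * (1 / real (Suc m)) \<le> T * real (k (Suc m)) / real (Suc m)" for m
    proof -
      have "t \<le> T * real (k (Suc m)) / real (Suc m) + T * (1 / real (Suc m))"
        using ge[of "Suc m"] by (simp add: distrib_left add_divide_distrib add.commute)
      then show ?thesis by linarith
    qed
    then show "\<forall>\<^sub>F m in sequentially. t - T * (1 / real (Suc m)) \<le> T * real (k (Suc m)) / real (Suc m)"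
      by simp
    show "\<forall>\<^sub>F m in sequentially. T * real (k (Suc m)) / real (Suc m) \<le> t"
      by (rule always_eventually) (use lt[THEN less_imp_le] in blast)
  qed simp
qed

text \<open>Truncation to [- c, c]: coefficients of simple processes must be bounded, and unlike
  multiplication by an indicator this preserves path continuity.\<close>

definition clip :: "real \<Rightarrow> real \<Rightarrow> real" where
  "clip c x = max (- c) (min c x)"

lemma clip_bounds: "0 \<le> c \<Longrightarrow> \<bar>clip c x\<bar> \<le> c" "0 \<le> c \<Longrightarrow> \<bar>clip c x - x\<bar> \<le> \<bar>x\<bar>"
  by (auto simp: clip_def)

lemma clip_eq: "\<bar>x\<bar> \<le> c \<Longrightarrow> clip c x = x"
  by (auto simp: clip_def)

lemma clip_measurable: "f \<in> borel_measurable N \<Longrightarrow> (\<lambda>x. clip c (f x)) \<in> borel_measurable N"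
  unfolding clip_def by (intro borel_measurable_max borel_measurable_min borel_measurable_const)

section \<open>Density of simple processes and Doob's inequality\<close>

context wiener_setting
begin

text \<open>Simple processes vanish at time 0, their cells being open on the left, so the slice at
  time 0 is discarded before pointwise convergence is claimed.\<close>

lemma AE_time_space_pos: "AE z in time_space T. 0 < fst z"
proof (rule AE_I')
  have "{0} \<times> space M \<inter> space (time_space T) \<in> null_sets (time_space T)"
  proof (cases "0 \<le> T")
    case True
    have "emeasure (time_space T) ({0} \<times> space M) = emeasure (time_lebesgue T) {0} * emeasure M (space M)"
      using True by (intro emeasure_pair_measure_Times) (auto simp: sets_restrict_space_iff)
    moreover have "emeasure (time_lebesgue T) {0} = 0"
      using True by (subst emeasure_restrict_space) auto
    moreover have "{0} \<times> space M \<in> sets (time_space T)"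
      using True by (intro pair_measureI) (auto simp: sets_restrict_space_iff)
    ultimately have "{0} \<times> space M \<in> null_sets (time_space T)" by (simp add: null_sets_def)
    moreover have "{0} \<times> space M \<inter> space (time_space T) = {0} \<times> space M"
      using True by (auto simp: space_pair_measure space_restrict_space)
    ultimately show ?thesis by simp
  next
    case False
    then have "space (time_space T) = {}" by (auto simp: space_pair_measure space_restrict_space)
    then show ?thesis by simp
  qed
  then show "{0} \<times> space M \<inter> space (time_space T) \<in> null_sets (time_space T)" .
  show "{z \<in> space (time_space T). \<not> 0 < fst z} \<subseteq> {0} \<times> space M \<inter> space (time_space T)"
    by (auto simp: space_pair_measure space_restrict_space)
qed

lemma clip_approximation:
  assumes H: "square_integrable (time_space T) H" and e: "0 < e"
  shows "\<exists>N::nat. integral\<^sup>L (time_space T) (\<lambda>z. (clip (real N) (H z) - H z)\<^sup>2) < e"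
proof -
  have [measurable]: "H \<in> borel_measurable (time_space T)" by (rule square_integrable_measurable[OF H])
  have [measurable]: "(\<lambda>z. clip c (H z)) \<in> borel_measurable (time_space T)" for c
    by (rule clip_measurable) simp
  have "(\<lambda>N. integral\<^sup>L (time_space T) (\<lambda>z. (clip (real N) (H z) - H z)\<^sup>2))
      \<longlonglongrightarrow> integral\<^sup>L (time_space T) (\<lambda>z. 0)"
  proof (rule integral_dominated_convergence)
    show "integrable (time_space T) (\<lambda>z. (H z)\<^sup>2)" by (rule square_integrable_sq[OF H])
    show "AE z in time_space T. (\<lambda>N. (clip (real N) (H z) - H z)\<^sup>2) \<longlonglongrightarrow> 0"
    proof (rule AE_I2)
      fix z
      obtain N0 :: nat where N0: "\<bar>H z\<bar> \<le> real N0" using real_arch_simple by blast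
      have "\<forall>\<^sub>F N in sequentially. (clip (real N) (H z) - H z)\<^sup>2 = 0"
      proof (rule eventually_sequentiallyI)
        fix N assume "N0 \<le> N"
        then have "\<bar>H z\<bar> \<le> real N" using N0 by linarith
        then show "(clip (real N) (H z) - H z)\<^sup>2 = 0" by (simp add: clip_eq)
      qed
      then show "(\<lambda>N. (clip (real N) (H z) - H z)\<^sup>2) \<longlonglongrightarrow> 0"
        by (rule tendsto_eventually)
    qed
    show "AE z in time_space T. norm ((clip (real N) (H z) - H z)\<^sup>2) \<le> (H z)\<^sup>2" for N
    proof (rule AE_I2)
      fix z
      have "\<bar>clip (real N) (H z) - H z\<bar>\<^sup>2 \<le> \<bar>H z\<bar>\<^sup>2"
        by (intro power_mono clip_bounds) auto
      then show "norm ((clip (real N) (H z) - H z)\<^sup>2) \<le> (H z)\<^sup>2" by simp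
    qed
  qed measurable
  then have "(\<lambda>N. integral\<^sup>L (time_space T) (\<lambda>z. (clip (real N) (H z) - H z)\<^sup>2)) \<longlonglongrightarrow> 0" by simp
  from order_tendstoD(2)[OF this e] show ?thesis by (auto simp: eventually_sequentially)
qed

text \<open>Clip at a large level, then freeze at the left ends of a uniform grid. Left ends keep
  the coefficients adapted, continuity gives pointwise convergence, and the clipping level provides
  the constant for dominated convergence.\<close>

lemma simple_approximation:
  assumes T: "0 < T" and ad: "\<And>t. 0 \<le> t \<Longrightarrow> t \<le> T \<Longrightarrow> H t \<in> borel_measurable (F t)"
    and cont: "\<And>\<omega>. \<omega> \<in> space M \<Longrightarrow> continuous_on {0..T} (\<lambda>t. H t \<omega>)"
    and H: "square_integrable (time_space T) (\<lambda>(t, \<omega>). H t \<omega>)" and e: "0 < e"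
  shows "\<exists>m \<tau> \<xi>. simple_process M F T m \<tau> \<xi> \<and>
    integral\<^sup>L (time_space T) (\<lambda>(t, \<omega>). (simple_value m \<tau> \<xi> t \<omega> - H t \<omega>)\<^sup>2) < e"
proof -
  \<comment> \<open>Two errors below e / 4, each doubled by \<open>integral_square_add_le\<close>,
    add up to less than \<open>e\<close>.\<close>
  have "0 < e / 4" using e by simp
  from clip_approximation[OF H this] obtain N :: nat
    where N: "integral\<^sup>L (time_space T) (\<lambda>z. (clip (real N) (case z of (t, \<omega>) \<Rightarrow> H t \<omega>) - (case z of (t, \<omega>) \<Rightarrow> H t \<omega>))\<^sup>2) < e / 4"
    by blast
  define h where "h t \<omega> = clip (real N) (H t \<omega>)" for t \<omega>
  have hb: "\<bar>h t \<omega>\<bar> \<le> real N" for t \<omega> unfolding h_def by (rule clip_bounds) simp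
  have hF: "h t \<in> borel_measurable (F t)" if "0 \<le> t" "t \<le> T" for t
    unfolding h_def[abs_def] by (rule clip_measurable[OF ad[OF that]])
  have hc: "continuous_on {0..T} (\<lambda>t. h t \<omega>)" if "\<omega> \<in> space M" for \<omega>
    unfolding h_def clip_def using cont[OF that] by (intro continuous_intros)
  have hm: "(\<lambda>z. case z of (t, \<omega>) \<Rightarrow> h t \<omega>) \<in> borel_measurable (time_space T)"
    using clip_measurable[OF square_integrable_measurable[OF H], of "real N"]
    by (simp only: h_def split_beta')
  define \<tau> where "\<tau> m k = T * real k / real m" for m k :: nat
  define \<xi> where "\<xi> m k \<omega> = h (\<tau> m k) \<omega>" for m k \<omega>
  have sp: "simple_process M F T m (\<tau> m) (\<xi> m)" if m: "0 < m" for m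
    unfolding simple_process_def
  proof (intro conjI allI impI)
    fix k assume k: "k < m"
    show "\<tau> m k \<le> \<tau> m (Suc k)"
      unfolding \<tau>_def using T by (intro divide_right_mono mult_left_mono) auto
    have "T * real k \<le> T * real m" using T k by (intro mult_left_mono) auto
    then have "\<tau> m k \<le> T" using m by (simp add: \<tau>_def field_simps)
    then show "\<xi> m k \<in> borel_measurable (F (\<tau> m k))"
      unfolding \<xi>_def[abs_def] using T by (intro hF) (auto simp: \<tau>_def)
    show "bounded (\<xi> m k ` space M)" using hb by (auto simp: bounded_iff \<xi>_def)
  qed (use m in \<open>simp_all add: \<tau>_def\<close>)
  define S where "S m = simple_value m (\<tau> m) (\<xi> m)" for m
  have Sel: "elementary (S m) (running_integral w m (\<tau> m) (\<xi> m))" if "0 < m" for m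
    unfolding S_def by (rule simple_process_elementary[OF sp[OF that]])
  note Ssq = elementary_integrand_square_integrable[OF Sel]
  note [measurable] = square_integrable_measurable[OF Ssq, of _ T] hm
  have "(\<lambda>m. integral\<^sup>L (time_space T) (\<lambda>z. ((case z of (t, \<omega>) \<Rightarrow> S (Suc m) t \<omega>) - (case z of (t, \<omega>) \<Rightarrow> h t \<omega>))\<^sup>2))
      \<longlonglongrightarrow> integral\<^sup>L (time_space T) (\<lambda>z. 0)"
  proof (rule integral_dominated_convergence)
    show "integrable (time_space T) (\<lambda>z. (2 * real N)\<^sup>2)"
      using finite_measure.integrable_const[OF finite_measure_time_space] by blast
    show "(\<lambda>z. ((case z of (t, \<omega>) \<Rightarrow> S (Suc m) t \<omega>) - (case z of (t, \<omega>) \<Rightarrow> h t \<omega>))\<^sup>2) \<in> borel_measurable (time_space T)" for m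
      by measurable
    have val: "S m t \<omega> = h (\<tau> m (nat (\<lceil>t * real m / T\<rceil> - 1))) \<omega>"
      if "0 < t" "t \<le> T" "0 < m" for m t \<omega>
      unfolding S_def
      by (subst simple_value_eq[OF sp[OF that(3)] uniform_grid_left_point(1)[OF T that]])
        (use uniform_grid_left_point(2,3)[OF T that] in \<open>auto simp: \<tau>_def \<xi>_def\<close>)
    have pos: "AE z in time_space T. 0 < fst z \<and> fst z \<le> T \<and> snd z \<in> space M"
      using AE_time_space_pos[of T] AE_space
      by eventually_elim (auto simp: space_pair_measure space_restrict_space)
    show "AE z in time_space T. (\<lambda>m. ((case z of (t, \<omega>) \<Rightarrow> S (Suc m) t \<omega>) - (case z of (t, \<omega>) \<Rightarrow> h t \<omega>))\<^sup>2) \<longlonglongrightarrow> 0"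
      using pos
    proof eventually_elim
      case (elim z)
      obtain t \<omega> where z: "z = (t, \<omega>)" by (cases z)
      have t: "0 < t" "t \<le> T" "\<omega> \<in> space M" using elim z by auto
      have "(\<lambda>m. h (\<tau> (Suc m) (nat (\<lceil>t * real (Suc m) / T\<rceil> - 1))) \<omega>) \<longlonglongrightarrow> h t \<omega>"
      proof (rule continuous_on_tendsto_compose[OF hc[OF t(3)]])
        show "(\<lambda>m. \<tau> (Suc m) (nat (\<lceil>t * real (Suc m) / T\<rceil> - 1))) \<longlonglongrightarrow> t"
          unfolding \<tau>_def by (rule uniform_grid_left_point(4)[OF T t(1,2)])
        have "0 \<le> \<tau> (Suc m) (nat (\<lceil>t * real (Suc m) / T\<rceil> - 1))"
          "\<tau> (Suc m) (nat (\<lceil>t * real (Suc m) / T\<rceil> - 1)) \<le> T" for m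
          using uniform_grid_left_point(2)[OF T t(1,2), of "Suc m"] T t unfolding \<tau>_def by auto
        then show "\<forall>\<^sub>F m in sequentially. \<tau> (Suc m) (nat (\<lceil>t * real (Suc m) / T\<rceil> - 1)) \<in> {0..T}"
          by simp
      qed (use t in auto)
      then have "(\<lambda>m. S (Suc m) t \<omega>) \<longlonglongrightarrow> h t \<omega>"
        using val[OF t(1,2)] by simp
      from tendsto_power[OF tendsto_diff[OF this tendsto_const], of "h t \<omega>" 2]
      show ?case by (simp add: z)
    qed
    show "AE z in time_space T. norm (((case z of (t, \<omega>) \<Rightarrow> S (Suc m) t \<omega>) - (case z of (t, \<omega>) \<Rightarrow> h t \<omega>))\<^sup>2) \<le> (2 * real N)\<^sup>2" for m
      using pos
    proof eventually_elim
      case (elim z)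
      obtain t \<omega> where z: "z = (t, \<omega>)" by (cases z)
      have t: "0 < t" "t \<le> T" using elim z by auto
      have "\<bar>S (Suc m) t \<omega> - h t \<omega>\<bar> \<le> \<bar>S (Suc m) t \<omega>\<bar> + \<bar>h t \<omega>\<bar>" by (rule abs_triangle_ineq4)
      also have "\<dots> \<le> 2 * real N"
        unfolding val[OF t zero_less_Suc] using add_mono[OF hb hb] by (simp only: mult_2)
      finally have "\<bar>S (Suc m) t \<omega> - h t \<omega>\<bar>\<^sup>2 \<le> (2 * real N)\<^sup>2" by (intro power_mono) auto
      then show ?case by (simp add: z)
    qed
  qed simp
  then have "(\<lambda>m. integral\<^sup>L (time_space T) (\<lambda>z. ((case z of (t, \<omega>) \<Rightarrow> S (Suc m) t \<omega>) - (case z of (t, \<omega>) \<Rightarrow> h t \<omega>))\<^sup>2)) \<longlonglongrightarrow> 0"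
    by simp
  from order_tendstoD(2)[OF this \<open>0 < e / 4\<close>] obtain m
    where m: "integral\<^sup>L (time_space T) (\<lambda>z. ((case z of (t, \<omega>) \<Rightarrow> S (Suc m) t \<omega>) - (case z of (t, \<omega>) \<Rightarrow> h t \<omega>))\<^sup>2) < e / 4"
    by (auto simp: eventually_sequentially)
  have hsq: "square_integrable (time_space T) (\<lambda>z. case z of (t, \<omega>) \<Rightarrow> h t \<omega>)"
    by (rule square_integrable_bounded[OF finite_measure_time_space hm, of "real N"]) (auto simp: hb)
  have "integral\<^sup>L (time_space T) (\<lambda>(t, \<omega>). (S (Suc m) t \<omega> - H t \<omega>)\<^sup>2)
     = integral\<^sup>L (time_space T) (\<lambda>z. (((case z of (t, \<omega>) \<Rightarrow> S (Suc m) t \<omega>) - (case z of (t, \<omega>) \<Rightarrow> h t \<omega>))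
         + ((case z of (t, \<omega>) \<Rightarrow> h t \<omega>) - (case z of (t, \<omega>) \<Rightarrow> H t \<omega>)))\<^sup>2)"
    by (intro Bochner_Integration.integral_cong refl) auto
  also have "\<dots> \<le> 2 * integral\<^sup>L (time_space T) (\<lambda>z. ((case z of (t, \<omega>) \<Rightarrow> S (Suc m) t \<omega>) - (case z of (t, \<omega>) \<Rightarrow> h t \<omega>))\<^sup>2)
      + 2 * integral\<^sup>L (time_space T) (\<lambda>z. ((case z of (t, \<omega>) \<Rightarrow> h t \<omega>) - (case z of (t, \<omega>) \<Rightarrow> H t \<omega>))\<^sup>2)"
    by (intro integral_square_add_le square_integrable_diff Ssq[OF zero_less_Suc] hsq H)
  also have "\<dots> < e"
  proof -
    have "integral\<^sup>L (time_space T) (\<lambda>z. ((case z of (t, \<omega>) \<Rightarrow> h t \<omega>) - (case z of (t, \<omega>) \<Rightarrow> H t \<omega>))\<^sup>2) < e / 4"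
      using N by (simp only: h_def split_beta')
    then show ?thesis using m by linarith
  qed
  finally show ?thesis
    unfolding S_def using sp[OF zero_less_Suc] by blast
qed

text \<open>Doob's maximal inequality on a finite grid. Induction along the grid replaces the first
  exit time: at each step the event grows by the set \<open>A\<close> of paths that exceed
  \<open>l\<close> for the first time.\<close>

lemma elementary_maximal_grid:
  fixes \<theta> :: "nat \<Rightarrow> real"
  assumes el: "elementary S J" and th: "\<And>k. 0 \<le> \<theta> k" "mono \<theta>" and l: "0 < l"
  shows "{\<omega> \<in> space M. \<exists>k\<le>K. l < \<bar>J (\<theta> k) \<omega>\<bar>} \<in> sets (F (\<theta> K))"
    and "l\<^sup>2 * prob {\<omega> \<in> space M. \<exists>k\<le>K. l < \<bar>J (\<theta> k) \<omega>\<bar>}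
      \<le> expectation (\<lambda>\<omega>. (J (\<theta> K) \<omega>)\<^sup>2 * indicator {\<omega> \<in> space M. \<exists>k\<le>K. l < \<bar>J (\<theta> k) \<omega>\<bar>} \<omega>)"
proof -
  define U where "U K = {\<omega> \<in> space M. \<exists>k\<le>K. l < \<bar>J (\<theta> k) \<omega>\<bar>}" for K
  note Jm = elementary_integral_adapted[OF el th(1)]
  note Jsq = elementary_integral_square_integrable[OF el th(1)]
  have U_sets: "U K \<in> sets (F (\<theta> K))" for K
  proof -
    have "{\<omega> \<in> space (F (\<theta> K)). l < \<bar>J (\<theta> k) \<omega>\<bar>} \<in> sets (F (\<theta> K))" if k: "k \<le> K" for k
    proof -
      have J: "J (\<theta> k) \<in> borel_measurable (F (\<theta> K))"
        by (rule measurable_F_mono[OF th(1) monoD[OF th(2) k] Jm])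
      show ?thesis
        by (rule borel_measurable_less[OF borel_measurable_const borel_measurable_abs[OF J]])
    qed
    then have "(\<Union>k\<in>{..K}. {\<omega> \<in> space (F (\<theta> K)). l < \<bar>J (\<theta> k) \<omega>\<bar>}) \<in> sets (F (\<theta> K))"
      by (intro sets.finite_UN) simp_all
    moreover have "U K = (\<Union>k\<in>{..K}. {\<omega> \<in> space (F (\<theta> K)). l < \<bar>J (\<theta> k) \<omega>\<bar>})"
      unfolding U_def space_F[OF th(1)] by blast
    ultimately show ?thesis by (simp only:)
  qed
  have U_M: "U K \<in> sets M" for K
    using U_sets F_sub[OF th(1)] unfolding subalgebra_def by blast
  note [measurable] = U_M square_integrable_measurable[OF Jsq]
  have Ui: "integrable M (\<lambda>\<omega>. (J (\<theta> k) \<omega>)\<^sup>2 * indicator A \<omega>)" if "A \<in> sets M" for A k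
    by (rule integrable_real_mult_indicator[OF that square_integrable_sq[OF Jsq]])
  have "l\<^sup>2 * prob (U K) \<le> expectation (\<lambda>\<omega>. (J (\<theta> K) \<omega>)\<^sup>2 * indicator (U K) \<omega>)"
  proof (induction K)
    case 0
    have "l\<^sup>2 * prob (U 0) = expectation (\<lambda>\<omega>. l\<^sup>2 * indicator (U 0) \<omega>)" by simp
    also have "\<dots> \<le> expectation (\<lambda>\<omega>. (J (\<theta> 0) \<omega>)\<^sup>2 * indicator (U 0) \<omega>)"
    proof (rule integral_mono[OF _ Ui[OF U_M]])
      show "l\<^sup>2 * indicator (U 0) \<omega> \<le> (J (\<theta> 0) \<omega>)\<^sup>2 * indicator (U 0) \<omega>" for \<omega>
        using l power_mono[of l "\<bar>J (\<theta> 0) \<omega>\<bar>" 2] by (auto simp: U_def indicator_def)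
    qed (rule integrable_real_mult_indicator[OF U_M integrable_const])
    finally show ?case .
  next
    case (Suc K)
    define A where "A = U (Suc K) - U K"
    have AM: "A \<in> sets M" using U_M by (simp add: A_def)
    have UA: "U (Suc K) = U K \<union> A" "U K \<inter> A = {}"
    proof -
      have "U K \<subseteq> U (Suc K)" unfolding U_def using le_SucI by blast
      then show "U (Suc K) = U K \<union> A" "U K \<inter> A = {}" by (auto simp only: A_def)
    qed
    have big: "l\<^sup>2 \<le> (J (\<theta> (Suc K)) \<omega>)\<^sup>2" if "\<omega> \<in> A" for \<omega>
    proof -
      from that obtain k where k: "k \<le> Suc K" "l < \<bar>J (\<theta> k) \<omega>\<bar>" "\<not> k \<le> K"
        unfolding A_def U_def by blast
      then have "k = Suc K" by (simp only: le_Suc_eq simp_thms)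
      then have "l < \<bar>J (\<theta> (Suc K)) \<omega>\<bar>" using k(2) by simp
      then have "l\<^sup>2 \<le> \<bar>J (\<theta> (Suc K)) \<omega>\<bar>\<^sup>2" using l by (intro power_mono) auto
      then show ?thesis by simp
    qed
    \<comment> \<open>Known at time \<open>\<theta> K\<close> and square integrable, hence a test
      variable for the martingale property.\<close>
    define Z where "Z \<omega> = J (\<theta> K) \<omega> * indicator (U K) \<omega>" for \<omega>
    have ZF: "Z \<in> borel_measurable (F (\<theta> K))"
      unfolding Z_def[abs_def] using Jm[of K] U_sets[of K] by measurable
    have Zsq: "square_integrable M Z"
    proof -
      have "square_integrable M (\<lambda>\<omega>. indicator (U K) \<omega> * J (\<theta> K) \<omega>)"
        by (rule square_integrable_bounded_mult[OF Jsq, of _ 1]) (auto simp: indicator_def)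
      then show ?thesis by (simp only: Z_def[abs_def] mult.commute)
    qed
    have orth: "expectation (\<lambda>\<omega>. Z \<omega> * J (\<theta> (Suc K)) \<omega>) = expectation (\<lambda>\<omega>. Z \<omega> * J (\<theta> K) \<omega>)"
      by (rule elementary_martingale[OF el th(1) monoD[OF th(2)] ZF Zsq]) simp
    have "expectation (\<lambda>\<omega>. (J (\<theta> K) \<omega>)\<^sup>2 * indicator (U K) \<omega>) = expectation (\<lambda>\<omega>. Z \<omega> * J (\<theta> K) \<omega>)"
      by (intro Bochner_Integration.integral_cong refl) (simp add: Z_def power2_eq_square mult_ac)
    \<comment> \<open>The martingale property brings in the mixed term, and 2 a b - a^2 \<le> b^2
      then shows that the second moment on the fixed set \<open>U K\<close> does not decrease along
      the grid.\<close>
    also have "\<dots> = expectation (\<lambda>\<omega>. 2 * (Z \<omega> * J (\<theta> (Suc K)) \<omega>) - Z \<omega> * J (\<theta> K) \<omega>)"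
      using square_integrable_mult[OF Zsq Jsq] by (simp add: orth)
    also have "\<dots> \<le> expectation (\<lambda>\<omega>. (J (\<theta> (Suc K)) \<omega>)\<^sup>2 * indicator (U K) \<omega>)"
    proof (rule integral_mono[OF _ Ui[OF U_M]])
      show "2 * (Z \<omega> * J (\<theta> (Suc K)) \<omega>) - Z \<omega> * J (\<theta> K) \<omega> \<le> (J (\<theta> (Suc K)) \<omega>)\<^sup>2 * indicator (U K) \<omega>" for \<omega>
        using sum_squares_bound[of "J (\<theta> K) \<omega>" "J (\<theta> (Suc K)) \<omega>"]
        by (cases "\<omega> \<in> U K") (simp_all add: Z_def power2_eq_square)
      show "integrable M (\<lambda>\<omega>. 2 * (Z \<omega> * J (\<theta> (Suc K)) \<omega>) - Z \<omega> * J (\<theta> K) \<omega>)"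
        using square_integrable_mult[OF Zsq Jsq] by simp
    qed
    finally have "l\<^sup>2 * prob (U K) \<le> expectation (\<lambda>\<omega>. (J (\<theta> (Suc K)) \<omega>)\<^sup>2 * indicator (U K) \<omega>)"
      using Suc.IH by simp
    moreover have "l\<^sup>2 * prob A \<le> expectation (\<lambda>\<omega>. (J (\<theta> (Suc K)) \<omega>)\<^sup>2 * indicator A \<omega>)"
    proof -
      have "l\<^sup>2 * prob A = expectation (\<lambda>\<omega>. l\<^sup>2 * indicator A \<omega>)" using AM by simp
      also have "\<dots> \<le> expectation (\<lambda>\<omega>. (J (\<theta> (Suc K)) \<omega>)\<^sup>2 * indicator A \<omega>)"
        using big by (intro integral_mono Ui[OF AM] integrable_real_mult_indicator[OF AM integrable_const])
          (auto simp: indicator_def)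
      finally show ?thesis .
    qed
    moreover have "prob (U (Suc K)) = prob (U K) + prob A"
      unfolding UA(1) by (rule finite_measure_Union[OF U_M AM UA(2)])
    moreover have "expectation (\<lambda>\<omega>. (J (\<theta> (Suc K)) \<omega>)\<^sup>2 * indicator (U (Suc K)) \<omega>)
        = expectation (\<lambda>\<omega>. (J (\<theta> (Suc K)) \<omega>)\<^sup>2 * indicator (U K) \<omega>)
         + expectation (\<lambda>\<omega>. (J (\<theta> (Suc K)) \<omega>)\<^sup>2 * indicator A \<omega>)"
      unfolding Bochner_Integration.integral_add[OF Ui[OF U_M] Ui[OF AM], symmetric]
      using UA by (intro Bochner_Integration.integral_cong refl) (auto simp: indicator_def)
    ultimately show ?case by (simp add: distrib_left)
  qed
  then show "l\<^sup>2 * prob {\<omega> \<in> space M. \<exists>k\<le>K. l < \<bar>J (\<theta> k) \<omega>\<bar>}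
      \<le> expectation (\<lambda>\<omega>. (J (\<theta> K) \<omega>)\<^sup>2 * indicator {\<omega> \<in> space M. \<exists>k\<le>K. l < \<bar>J (\<theta> k) \<omega>\<bar>} \<omega>)"
    by (simp only: U_def)
  show "{\<omega> \<in> space M. \<exists>k\<le>K. l < \<bar>J (\<theta> k) \<omega>\<bar>} \<in> sets (F (\<theta> K))"
    using U_sets by (simp only: U_def)
qed

text \<open>The bound on a grid depends only on its end. The exceptional sets of the dyadic grids
  increase, so their union obeys the same bound, and along a path on which \<open>w\<close> is
  continuous the estimate passes from dyadic times to all times.\<close>

lemma elementary_maximal:
  assumes el: "elementary S J" and T: "0 < T" and l: "0 < l"
  obtains V where "V \<in> sets M"
    "prob V \<le> integral\<^sup>L (time_space T) (\<lambda>(s, \<omega>). (S s \<omega>)\<^sup>2) / l\<^sup>2"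
    "\<And>\<omega> t. \<omega> \<in> space M - V \<Longrightarrow> continuous_on {0..} (\<lambda>t. w t \<omega>) \<Longrightarrow> 0 \<le> t \<Longrightarrow> t \<le> T \<Longrightarrow> \<bar>J t \<omega>\<bar> \<le> l"
proof -
  define \<theta> where "\<theta> p k = T * real k / 2 ^ p" for p k :: nat
  define U where "U p = {\<omega> \<in> space M. \<exists>k\<le>2^p. l < \<bar>J (\<theta> p k) \<omega>\<bar>}" for p
  have th: "0 \<le> \<theta> p k" "mono (\<theta> p)" for p k
    using T by (auto simp: \<theta>_def mono_def intro!: divide_right_mono mult_left_mono)
  have end_T: "\<theta> p (2^p) = T" for p by (simp add: \<theta>_def)
  have U_M: "U p \<in> sets M" for p
    using elementary_maximal_grid(1)[where \<theta> = "\<theta> p" and K = "2^p", OF el th l] F_sub[OF th(1)[of p "2^p"]]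
    unfolding U_def subalgebra_def by blast
  define B where "B = integral\<^sup>L (time_space T) (\<lambda>(s, \<omega>). (S s \<omega>)\<^sup>2)"
  have PU: "prob (U p) \<le> B / l\<^sup>2" for p
  proof -
    note sq = square_integrable_sq[OF elementary_integral_square_integrable[OF el less_imp_le[OF T]]]
    have "l\<^sup>2 * prob (U p) \<le> expectation (\<lambda>\<omega>. (J T \<omega>)\<^sup>2 * indicator (U p) \<omega>)"
      using elementary_maximal_grid(2)[where \<theta> = "\<theta> p" and K = "2^p", OF el th l] by (simp only: U_def end_T)
    also have "\<dots> \<le> expectation (\<lambda>\<omega>. (J T \<omega>)\<^sup>2)"
      by (rule integral_mono[OF integrable_real_mult_indicator[OF U_M sq] sq]) (auto simp: indicator_def)
    also have "\<dots> = B"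
      using elementary_isometry[OF el el less_imp_le[OF T]] by (simp add: B_def power2_eq_square)
    finally show ?thesis using l by (simp add: field_simps)
  qed
  have inc: "incseq U"
  proof (rule incseq_SucI, rule subsetI)
    fix p \<omega> assume "\<omega> \<in> U p"
    then obtain k where k: "\<omega> \<in> space M" "k \<le> 2^p" "l < \<bar>J (\<theta> p k) \<omega>\<bar>" by (auto simp: U_def)
    have "\<theta> (Suc p) (2 * k) = \<theta> p k" by (simp add: \<theta>_def)
    with k show "\<omega> \<in> U (Suc p)"
      unfolding U_def by (intro CollectI conjI exI[of _ "2 * k"]) simp_all
  qed
  define V where "V = (\<Union>p. U p)"
  have "(\<lambda>p. prob (U p)) \<longlonglongrightarrow> prob V"
    unfolding V_def using U_M inc by (intro finite_Lim_measure_incseq) auto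
  then have "prob V \<le> B / l\<^sup>2"
    by (rule LIMSEQ_le_const2) (use PU in blast)
  moreover have "V \<in> sets M" using U_M by (auto simp: V_def)
  moreover have "\<bar>J t \<omega>\<bar> \<le> l" if w: "\<omega> \<in> space M - V" "continuous_on {0..} (\<lambda>t. w t \<omega>)" and t: "0 \<le> t" "t \<le> T" for \<omega> t
  proof -
    \<comment> \<open>The index of the last dyadic time of level \<open>p\<close> that is not after
      \<open>t\<close>.\<close>
    define k where "k p = nat \<lfloor>t * 2^p / T\<rfloor>" for p
    have kr: "real (k p) \<le> t * 2^p / T" "t * 2^p / T < real (k p) + 1" for p
    proof -
      have "0 \<le> t * 2^p / T" using t T by simp
      then have "real (k p) = real_of_int \<lfloor>t * 2^p / T\<rfloor>" by (simp add: k_def)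
      then show "real (k p) \<le> t * 2^p / T" "t * 2^p / T < real (k p) + 1" by linarith+
    qed
    have kle: "k p \<le> 2^p" for p
    proof -
      have "t * 2^p / T \<le> 2^p" using t T by (simp add: field_simps)
      then have "real (k p) \<le> real (2^p)"
        unfolding of_nat_power of_nat_numeral using kr(1)[of p] by linarith
      then show ?thesis by (rule of_nat_le_iff[THEN iffD1])
    qed
    have lim: "(\<lambda>p. \<theta> p (k p)) \<longlonglongrightarrow> t"
    proof (rule tendsto_sandwich)
      have "(\<lambda>p. (1/2::real)^p) \<longlonglongrightarrow> 0" by (rule LIMSEQ_power_zero) simp
      from tendsto_diff[OF tendsto_const tendsto_mult_right_zero[OF this], of t T]
      show "(\<lambda>p. t - T * (1/2)^p) \<longlonglongrightarrow> t" by simp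
      have "t - T * (1/2)^p \<le> \<theta> p (k p)" for p
      proof -
        have "t * 2^p < T * real (k p) + T"
          using kr(2)[of p] T by (simp add: field_simps)
        then have "t \<le> (T * real (k p) + T) / 2^p" by (simp add: pos_le_divide_eq)
        then show ?thesis by (simp add: \<theta>_def add_divide_distrib power_one_over)
      qed
      then show "\<forall>\<^sub>F p in sequentially. t - T * (1/2)^p \<le> \<theta> p (k p)" by simp
      have "\<theta> p (k p) \<le> t" for p
        using kr(1)[of p] T by (simp add: \<theta>_def field_simps)
      then show "\<forall>\<^sub>F p in sequentially. \<theta> p (k p) \<le> t" by simp
    qed simp
    have "(\<lambda>p. J (\<theta> p (k p)) \<omega>) \<longlonglongrightarrow> J t \<omega>"
      by (rule continuous_on_tendsto_compose[OF elementary_integral_continuous[OF el w(2)] lim])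
        (use t th in auto)
    then have "(\<lambda>p. \<bar>J (\<theta> p (k p)) \<omega>\<bar>) \<longlonglongrightarrow> \<bar>J t \<omega>\<bar>" by (rule tendsto_rabs)
    moreover have "\<bar>J (\<theta> p (k p)) \<omega>\<bar> \<le> l" for p
    proof (rule ccontr)
      assume "\<not> \<bar>J (\<theta> p (k p)) \<omega>\<bar> \<le> l"
      then have "\<omega> \<in> U p" using w(1) kle[of p] unfolding U_def not_le by blast
      then show False using w(1) unfolding V_def by blast
    qed
    ultimately show ?thesis by (intro LIMSEQ_le_const2) auto
  qed
  ultimately show thesis using that by (simp add: B_def)
qed

end

section \<open>Existence of solutions of linear equations\<close>

lemma linear_combination_square_le:
  fixes a v :: "nat \<Rightarrow> real"
  shows "(\<Sum>q<n. a q * v q)\<^sup>2 \<le> (\<Sum>q<n. (a q)\<^sup>2) * (\<Sum>q<n. (v q)\<^sup>2)"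
  using Cauchy_Schwarz_ineq_sum[of a v "{..<n}"] by simp

lemma square_integrable_linear_combination:
  assumes "\<And>q. q < n \<Longrightarrow> square_integrable N (f q)"
  shows "square_integrable N (\<lambda>z. \<Sum>q<n. a q * f q z)"
  using assms by (intro square_integrable_sum square_integrable_cmult) auto

lemma double_bound_chain:
  fixes u v p q s t :: real
  assumes "u \<le> 2 * v + 2 * p" "p \<le> q" "s \<le> t"
  shows "2 * u + 2 * s \<le> 2 * (2 * v + 2 * q) + 2 * t"
proof -
  have "u \<le> 2 * v + 2 * q" using assms(1,2) by linarith
  then show ?thesis using assms(3) by (intro add_mono mult_left_mono) simp_all
qed

lemma integral_linear_combination_square_le:
  fixes a :: "nat \<Rightarrow> real"
  assumes "\<And>q. q < n \<Longrightarrow> square_integrable N (f q)"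
  shows "(\<integral>z. (\<Sum>q<n. a q * f q z)\<^sup>2 \<partial>N) \<le> (\<Sum>q<n. (a q)\<^sup>2) * (\<Sum>q<n. \<integral>z. (f q z)\<^sup>2 \<partial>N)"
proof -
  have i: "integrable N (\<lambda>z. \<Sum>q<n. (f q z)\<^sup>2)"
    using assms by (intro Bochner_Integration.integrable_sum square_integrable_sq) auto
  have "(\<integral>z. (\<Sum>q<n. a q * f q z)\<^sup>2 \<partial>N) \<le> (\<integral>z. (\<Sum>q<n. (a q)\<^sup>2) * (\<Sum>q<n. (f q z)\<^sup>2) \<partial>N)"
  proof (rule integral_mono)
    show "integrable N (\<lambda>z. (\<Sum>q<n. a q * f q z)\<^sup>2)"
      by (rule square_integrable_sq[OF square_integrable_linear_combination[OF assms]])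
    show "integrable N (\<lambda>z. (\<Sum>q<n. (a q)\<^sup>2) * (\<Sum>q<n. (f q z)\<^sup>2))"
      by (rule integrable_mult_right[OF i])
    show "(\<Sum>q<n. a q * f q z)\<^sup>2 \<le> (\<Sum>q<n. (a q)\<^sup>2) * (\<Sum>q<n. (f q z)\<^sup>2)" for z
      using linear_combination_square_le[where a = a and v = "\<lambda>q. f q z"] .
  qed
  also have "\<dots> = (\<Sum>q<n. (a q)\<^sup>2) * (\<Sum>q<n. \<integral>z. (f q z)\<^sup>2 \<partial>N)"
    using assms by (simp add: square_integrable_sq)
  finally show ?thesis .
qed

text \<open>\<open>elementary\<close> forgets the grid, while \<open>has_ito_integral\<close> asks
  for simple processes. The pair keeps both views of an approximation.\<close>

definition simple_pair ::
  "'a measure \<Rightarrow> (real \<Rightarrow> 'a measure) \<Rightarrow> (real \<Rightarrow> 'a \<Rightarrow> real) \<Rightarrow> real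
    \<Rightarrow> (real \<Rightarrow> 'a \<Rightarrow> real) \<Rightarrow> (real \<Rightarrow> 'a \<Rightarrow> real) \<Rightarrow> bool" where
  "simple_pair M F w T S J \<longleftrightarrow> (\<exists>m \<tau> \<xi>. simple_process M F T m \<tau> \<xi> \<and>
     S = simple_value m \<tau> \<xi> \<and> J = running_integral w m \<tau> \<xi>)"

section \<open>The Picard iteration with simple diffusion terms\<close>

context wiener_setting
begin

lemma simple_pair_elementary: "simple_pair M F w T S J \<Longrightarrow> elementary S J"
  using simple_process_elementary by (auto simp: simple_pair_def)

lemma continuous_paths:
  obtains N0 where "N0 \<in> null_sets M"
    "\<And>\<omega>. \<omega> \<in> space M - N0 \<Longrightarrow> continuous_on {0..} (\<lambda>t. w t \<omega>)"
proof -
  obtain N where "{\<omega> \<in> space M. \<not> continuous_on {0..} (\<lambda>t. w t \<omega>)} \<subseteq> N" "N \<in> null_sets M"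
    using AE_E[OF w_continuous] by (metis null_setsI)
  then show thesis using that by blast
qed

text \<open>This is what allows a process to be altered on a null set without loss of
  adaptedness.\<close>

lemma null_set_F: "N \<in> null_sets M \<Longrightarrow> 0 \<le> t \<Longrightarrow> N \<in> sets (F t)"
  using F_null_sets F_mono[of 0 t] by (auto simp: subalgebra_def)

text \<open>The class in which the iteration runs. Continuity is demanded of every path, not of
  almost every one, because the adaptedness of drift integrals is deduced from it.\<close>

definition admissible :: "nat \<Rightarrow> (nat \<Rightarrow> real \<Rightarrow> 'a \<Rightarrow> real) \<Rightarrow> bool" where
  "admissible n X \<longleftrightarrow> (\<forall>r<n. (\<forall>t\<ge>0. X r t \<in> borel_measurable (F t) \<and> square_integrable M (X r t)) \<and>
     (\<forall>\<omega>\<in>space M. continuous_on {0..} (\<lambda>t. X r t \<omega>)) \<and>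
     (\<forall>T\<ge>0. square_integrable (time_space T) (\<lambda>(t, \<omega>). X r t \<omega>)))"

lemma admissibleD:
  assumes "admissible n X" "r < n"
  shows "0 \<le> t \<Longrightarrow> X r t \<in> borel_measurable (F t)" "0 \<le> t \<Longrightarrow> square_integrable M (X r t)"
    "\<omega> \<in> space M \<Longrightarrow> continuous_on {0..} (\<lambda>t. X r t \<omega>)"
    "0 \<le> t \<Longrightarrow> square_integrable (time_space t) (\<lambda>(t, \<omega>). X r t \<omega>)"
  using assms by (auto simp: admissible_def)

lemma admissible_linear:
  assumes "admissible n X"
  shows "0 \<le> t \<Longrightarrow> (\<lambda>\<omega>. \<Sum>q<n. a q * X q t \<omega>) \<in> borel_measurable (F t)"
    "\<omega> \<in> space M \<Longrightarrow> continuous_on {0..} (\<lambda>t. \<Sum>q<n. a q * X q t \<omega>)"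
    "0 \<le> t \<Longrightarrow> square_integrable (time_space t) (\<lambda>(t, \<omega>). \<Sum>q<n. a q * X q t \<omega>)"
proof -
  show "0 \<le> t \<Longrightarrow> (\<lambda>\<omega>. \<Sum>q<n. a q * X q t \<omega>) \<in> borel_measurable (F t)"
    using admissibleD(1)[OF assms] by (intro borel_measurable_sum borel_measurable_times) auto
  show "\<omega> \<in> space M \<Longrightarrow> continuous_on {0..} (\<lambda>t. \<Sum>q<n. a q * X q t \<omega>)"
    using admissibleD(3)[OF assms] by (intro continuous_intros) auto
  assume t: "0 \<le> t"
  have "square_integrable (time_space t) (\<lambda>z. \<Sum>q<n. a q * (case z of (t, \<omega>) \<Rightarrow> X q t \<omega>))"
    using admissibleD(4)[OF assms _ t] by (intro square_integrable_linear_combination) auto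
  then show "square_integrable (time_space t) (\<lambda>(t, \<omega>). \<Sum>q<n. a q * X q t \<omega>)"
    by (simp only: split_beta')
qed

lemma admissible_diff:
  assumes "admissible n X" "admissible n Y"
  shows "admissible n (\<lambda>r t \<omega>. X r t \<omega> - Y r t \<omega>)"
  unfolding admissible_def
proof (intro allI impI conjI ballI)
  fix r assume r: "r < n"
  note X = admissibleD[OF assms(1) r] and Y = admissibleD[OF assms(2) r]
  show "(\<lambda>\<omega>. X r t \<omega> - Y r t \<omega>) \<in> borel_measurable (F t)" if "0 \<le> t" for t
    using X(1)[OF that] Y(1)[OF that] by measurable
  show "square_integrable M (\<lambda>\<omega>. X r t \<omega> - Y r t \<omega>)" if "0 \<le> t" for t
    by (rule square_integrable_diff[OF X(2)[OF that] Y(2)[OF that]])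
  show "continuous_on {0..} (\<lambda>t. X r t \<omega> - Y r t \<omega>)" if "\<omega> \<in> space M" for \<omega>
    by (rule continuous_on_diff[OF X(3)[OF that] Y(3)[OF that]])
  show "square_integrable (time_space T) (\<lambda>(t, \<omega>). X r t \<omega> - Y r t \<omega>)" if "0 \<le> T" for T
    by (rule square_integrable_time_diff[OF X(4)[OF that] Y(4)[OF that]])
qed

lemma admissible_time_integral:
  assumes "admissible n X" "0 \<le> t"
  shows "(\<lambda>\<omega>. LBINT s:{0..t}. \<Sum>q<n. a q * X q s \<omega>) \<in> borel_measurable (F t)"
    and "square_integrable M (\<lambda>\<omega>. LBINT s:{0..t}. \<Sum>q<n. a q * X q s \<omega>)"
    and "expectation (\<lambda>\<omega>. (LBINT s:{0..t}. \<Sum>q<n. a q * X q s \<omega>)\<^sup>2)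
      \<le> t * integral\<^sup>L (time_space t) (\<lambda>(s, \<omega>). (\<Sum>q<n. a q * X q s \<omega>)\<^sup>2)"
proof -
  note b = admissible_linear[OF assms(1)]
  have c: "continuous_on {0..t} (\<lambda>t. \<Sum>q<n. a q * X q t \<omega>)" if "\<omega> \<in> space M" for \<omega>
    using b(2)[OF that] by (rule continuous_on_subset) auto
  have m: "(\<lambda>\<omega>. \<Sum>q<n. a q * X q s \<omega>) \<in> borel_measurable M" if "0 \<le> s" for s
    by (rule measurable_F[OF that b(1)[OF that]])
  show "(\<lambda>\<omega>. LBINT s:{0..t}. \<Sum>q<n. a q * X q s \<omega>) \<in> borel_measurable (F t)"
  proof (rule time_integral_measurable[OF assms(2)])
    show "(\<lambda>\<omega>. \<Sum>q<n. a q * X q s \<omega>) \<in> borel_measurable (F t)" if "0 \<le> s" "s \<le> t" for s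
      by (rule measurable_F_mono[OF that b(1)[OF that(1)]])
  qed (use c space_F[OF assms(2)] in simp)
  note props = time_integral_square_integrable[OF assms(2) b(3)[OF assms(2)] m c]
  show "square_integrable M (\<lambda>\<omega>. LBINT s:{0..t}. \<Sum>q<n. a q * X q s \<omega>)"
    by (rule props(1))
  show "expectation (\<lambda>\<omega>. (LBINT s:{0..t}. \<Sum>q<n. a q * X q s \<omega>)\<^sup>2)
      \<le> t * integral\<^sup>L (time_space t) (\<lambda>(s, \<omega>). (\<Sum>q<n. a q * X q s \<omega>)\<^sup>2)"
    by (rule props(2))
qed

text \<open>The indicator of the complement of \<open>N0\<close> removes the stochastic part on the
  paths where \<open>w\<close> may be discontinuous. So every path of the new iterate is continuous,
  and adaptedness survives because \<open>N0\<close> lies in every \<open>F t\<close>.\<close>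

lemma picard_admissible:
  assumes X: "admissible n X" and el: "\<And>r. r < n \<Longrightarrow> elementary (S r) (J r)"
    and N0: "N0 \<in> null_sets M" "\<And>\<omega>. \<omega> \<in> space M - N0 \<Longrightarrow> continuous_on {0..} (\<lambda>t. w t \<omega>)"
  shows "admissible n (\<lambda>r t \<omega>. x0 r + (LBINT s:{0..t}. \<Sum>q<n. a r q * X q s \<omega>) + indicator (space M - N0) \<omega> * J r t \<omega>)"
    (is "admissible n ?X'")
  unfolding admissible_def
proof (intro allI impI conjI ballI)
  fix r assume r: "r < n"
  define b where "b t \<omega> = (\<Sum>q<n. a r q * X q t \<omega>)" for t \<omega>
  note bI = admissible_time_integral[OF X, where a = "a r", folded b_def]
  note bp = admissible_linear[OF X, where a = "a r", folded b_def]
  have Gm: "indicat_real (space M - N0) \<in> borel_measurable (F t)" if "0 \<le> t" for t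
    using null_set_F[OF N0(1) that] sets.compl_sets[of N0 "F t"] space_F[OF that] by auto
  have Jm: "(\<lambda>\<omega>. indicator (space M - N0) \<omega> * J r t \<omega>) \<in> borel_measurable (F t)" if "0 \<le> t" for t
    using Gm[OF that] elementary_integral_adapted[OF el[OF r] that] by measurable
  have Jsq: "square_integrable M (\<lambda>\<omega>. indicator (space M - N0) \<omega> * J r t \<omega>)" if "0 \<le> t" for t
    by (rule square_integrable_bounded_mult[OF elementary_integral_square_integrable[OF el[OF r] that]
          measurable_F[OF that Gm[OF that]], of 1]) (simp add: indicator_def)
  have x0: "square_integrable M (\<lambda>_. x0 r)"
    by (auto intro!: square_integrable_bounded[OF finite_measure_axioms])
  show ad: "?X' r t \<in> borel_measurable (F t)" if "0 \<le> t" for t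
    unfolding b_def[symmetric] using bI(1)[OF that] Jm[OF that] by measurable
  show sq: "square_integrable M (?X' r t)" if "0 \<le> t" for t
    unfolding b_def[symmetric]
    by (rule square_integrable_add[OF square_integrable_add[OF x0 bI(2)[OF that]] Jsq[OF that]])
  show cont: "continuous_on {0..} (\<lambda>t. ?X' r t \<omega>)" if "\<omega> \<in> space M" for \<omega>
  proof -
    have "continuous_on {0..} (\<lambda>t. indicator (space M - N0) \<omega> * J r t \<omega>)"
    proof (cases "\<omega> \<in> N0")
      case False
      with that have "\<omega> \<in> space M - N0" by simp
      from elementary_integral_continuous[OF el[OF r] N0(2)[OF this]] show ?thesis
        by (rule continuous_on_mult_left)
    qed simp
    moreover have "continuous_on {0..} (\<lambda>t. LBINT s:{0..t}. b s \<omega>)"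
      by (rule continuous_time_integral[OF bp(2)[OF that]])
    ultimately show ?thesis
      unfolding b_def[symmetric] by (intro continuous_on_add continuous_on_const)
  qed
  show "square_integrable (time_space T) (\<lambda>(t, \<omega>). ?X' r t \<omega>)" if T: "0 \<le> T" for T
  proof (rule square_integrable_time_of_bounded)
    show "(\<lambda>(t, \<omega>). ?X' r t \<omega>) \<in> borel_measurable (time_space T)"
    proof (rule continuous_process_measurable_Icc[OF T])
      show "?X' r t \<in> borel_measurable M" if "0 \<le> t" for t
        by (rule measurable_F[OF that ad[OF that]])
      show "continuous_on {0..T} (\<lambda>t. ?X' r t \<omega>)" if "\<omega> \<in> space M" for \<omega>
        using cont[OF that] by (rule continuous_on_subset) auto
    qed
    fix t assume t: "0 \<le> t" "t \<le> T"
    show "square_integrable M (?X' r t)" by (rule sq[OF t(1)])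
    \<comment> \<open>\<open>B1\<close> and \<open>B2\<close> are taken over the whole horizon, so
      that the second moments are bounded uniformly in \<open>t\<close>.\<close>
    define B1 where "B1 = integral\<^sup>L (time_space T) (\<lambda>(s, \<omega>). (b s \<omega>)\<^sup>2)"
    define B2 where "B2 = integral\<^sup>L (time_space T) (\<lambda>(s, \<omega>). (S r s \<omega>)\<^sup>2)"
    have i1: "integrable (time_space T) (\<lambda>(s, \<omega>). (b s \<omega>)\<^sup>2)"
      using square_integrable_sq[OF bp(3)[OF T]] by (simp only: split_beta')
    have i2: "integrable (time_space T) (\<lambda>(s, \<omega>). (S r s \<omega>)\<^sup>2)"
      using square_integrable_sq[OF elementary_integrand_square_integrable[OF el[OF r], of T]]
      by (simp only: split_beta')
    have "expectation (\<lambda>\<omega>. (LBINT s:{0..t}. b s \<omega>)\<^sup>2) \<le> t * integral\<^sup>L (time_space t) (\<lambda>(s, \<omega>). (b s \<omega>)\<^sup>2)"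
      by (rule bI(3)[OF t(1)])
    also have "\<dots> \<le> T * B1"
      unfolding B1_def
      by (intro mult_mono time_space_integral_mono(2)[OF i1 _ t(2)]) (use t in \<open>auto intro!: Bochner_Integration.integral_nonneg\<close>)
    finally have e1: "expectation (\<lambda>\<omega>. (LBINT s:{0..t}. b s \<omega>)\<^sup>2) \<le> T * B1" .
    have "expectation (\<lambda>\<omega>. (indicator (space M - N0) \<omega> * J r t \<omega>)\<^sup>2) \<le> expectation (\<lambda>\<omega>. (J r t \<omega>)\<^sup>2)"
      by (intro integral_mono square_integrable_sq[OF Jsq[OF t(1)]]
          square_integrable_sq[OF elementary_integral_square_integrable[OF el[OF r] t(1)]]) (simp add: indicator_def)
    also have "\<dots> = integral\<^sup>L (time_space t) (\<lambda>(s, \<omega>). (S r s \<omega>)\<^sup>2)"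
      using elementary_isometry[OF el[OF r] el[OF r] t(1)] by (simp add: power2_eq_square)
    also have "\<dots> \<le> B2"
      unfolding B2_def by (rule time_space_integral_mono(2)[OF i2 _ t(2)]) simp
    finally have e2: "expectation (\<lambda>\<omega>. (indicator (space M - N0) \<omega> * J r t \<omega>)\<^sup>2) \<le> B2" .
    have "expectation (\<lambda>\<omega>. (x0 r + (LBINT s:{0..t}. b s \<omega>) + indicator (space M - N0) \<omega> * J r t \<omega>)\<^sup>2)
       \<le> 2 * expectation (\<lambda>\<omega>. (x0 r + (LBINT s:{0..t}. b s \<omega>))\<^sup>2)
        + 2 * expectation (\<lambda>\<omega>. (indicator (space M - N0) \<omega> * J r t \<omega>)\<^sup>2)"
      by (rule integral_square_add_le[OF square_integrable_add[OF x0 bI(2)[OF t(1)]] Jsq[OF t(1)]])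
    also have "\<dots> \<le> 2 * (2 * expectation (\<lambda>\<omega>. (x0 r)\<^sup>2) + 2 * (T * B1)) + 2 * B2"
      by (rule double_bound_chain[OF integral_square_add_le[OF x0 bI(2)[OF t(1)]] e1 e2])
    finally show "expectation (\<lambda>\<omega>. (?X' r t \<omega>)\<^sup>2) \<le> 2 * (2 * expectation (\<lambda>\<omega>. (x0 r)\<^sup>2) + 2 * (T * B1)) + 2 * B2"
      unfolding b_def .
  qed
qed

lemma admissible_simple_approximation:
  assumes X: "admissible n X" and T: "0 < T" and e: "0 < e"
  shows "\<exists>S J. simple_pair M F w T S J \<and>
    integral\<^sup>L (time_space T) (\<lambda>(t, \<omega>). (S t \<omega> - (\<Sum>q<n. c q * X q t \<omega>))\<^sup>2) \<le> e"
proof -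
  note b = admissible_linear[OF X, where a = c]
  have "continuous_on {0..T} (\<lambda>t. \<Sum>q<n. c q * X q t \<omega>)" if "\<omega> \<in> space M" for \<omega>
    using b(2)[OF that] by (rule continuous_on_subset) auto
  from simple_approximation[OF T b(1) this b(3)[OF less_imp_le[OF T]] e]
  obtain m \<tau> \<xi> where "simple_process M F T m \<tau> \<xi>"
    "integral\<^sup>L (time_space T) (\<lambda>(t, \<omega>). (simple_value m \<tau> \<xi> t \<omega> - (\<Sum>q<n. c q * X q t \<omega>))\<^sup>2) < e"
    by auto
  then show ?thesis
    unfolding simple_pair_def by (intro exI conjI) (rule refl | assumption | simp)+
qed

text \<open>Replacing the diffusion term of each Picard iterate by a simple process that is close to it keeps
  every iterate an elementary integral plus a time integral, so that no continuous version of a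
  general stochastic integral is needed before the limit.\<close>

lemma picard_sequence:
  fixes x0 :: "nat \<Rightarrow> real" and a c :: "nat \<Rightarrow> nat \<Rightarrow> real"
  assumes N0: "N0 \<in> null_sets M" "\<And>\<omega>. \<omega> \<in> space M - N0 \<Longrightarrow> continuous_on {0..} (\<lambda>t. w t \<omega>)"
  obtains X S J where "\<And>k. admissible n (X k)"
    "\<And>k r. r < n \<Longrightarrow> simple_pair M F w (real k + 1) (S k r) (J k r)"
    "\<And>k r. r < n \<Longrightarrow> integral\<^sup>L (time_space (real k + 1))
        (\<lambda>(t, \<omega>). (S k r t \<omega> - (\<Sum>q<n. c r q * X k q t \<omega>))\<^sup>2) \<le> (1/16)^k"
    "\<And>k r t \<omega>. X (Suc k) r t \<omega> = x0 r + (LBINT s:{0..t}. \<Sum>q<n. a r q * X k q s \<omega>)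
        + indicator (space M - N0) \<omega> * J k r t \<omega>"
proof -
  \<comment> \<open>One stage of the recursion: an iterate with simple approximations of its
    diffusion term. Both the horizon k + 1 and the accuracy (1/16)^k improve from stage to
    stage.\<close>
  define P where "P k Z \<longleftrightarrow> (case Z of (X, S, J) \<Rightarrow> admissible n X \<and> (\<forall>r<n. simple_pair M F w (real k + 1) (S r) (J r) \<and>
     integral\<^sup>L (time_space (real k + 1)) (\<lambda>(t, \<omega>). (S r t \<omega> - (\<Sum>q<n. c r q * X q t \<omega>))\<^sup>2) \<le> (1/16)^k))"
    for k :: nat and Z :: "(nat \<Rightarrow> real \<Rightarrow> 'a \<Rightarrow> real) \<times> (nat \<Rightarrow> real \<Rightarrow> 'a \<Rightarrow> real) \<times> (nat \<Rightarrow> real \<Rightarrow> 'a \<Rightarrow> real)"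
  define Q where "Q Z Z' \<longleftrightarrow> (case Z of (X, S, J) \<Rightarrow> fst Z' = (\<lambda>r t \<omega>. x0 r + (LBINT s:{0..t}. \<Sum>q<n. a r q * X q s \<omega>)
        + indicator (space M - N0) \<omega> * J r t \<omega>))"
    for Z Z' :: "(nat \<Rightarrow> real \<Rightarrow> 'a \<Rightarrow> real) \<times> (nat \<Rightarrow> real \<Rightarrow> 'a \<Rightarrow> real) \<times> (nat \<Rightarrow> real \<Rightarrow> 'a \<Rightarrow> real)"
  have complete: "\<exists>S J. P k (X, S, J)" if X: "admissible n X" for X k
  proof -
    define A where "A r S J \<longleftrightarrow> simple_pair M F w (real k + 1) S J \<and>
       integral\<^sup>L (time_space (real k + 1)) (\<lambda>(t, \<omega>). (S t \<omega> - (\<Sum>q<n. c r q * X q t \<omega>))\<^sup>2) \<le> (1/16)^k" for r S J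
    have "0 < real k + 1" "0 < (1/16::real)^k" by simp_all
    then have "\<exists>S J. A r S J" for r
      unfolding A_def by (rule admissible_simple_approximation[OF X])
    then have "\<forall>r. \<exists>Z. A r (fst Z) (snd Z)" by simp
    from choice[OF this] obtain Z where "\<forall>r. A r (fst (Z r)) (snd (Z r))" ..
    with X have "P k (X, \<lambda>r. fst (Z r), \<lambda>r. snd (Z r))"
      unfolding P_def prod.case A_def by simp
    then show ?thesis by blast
  qed
  \<comment> \<open>The iteration starts from the zero process; the initial value enters with the
    first step.\<close>
  have zero: "admissible n (\<lambda>r t \<omega>. 0)"
  proof -
    have "square_integrable (time_space T) (\<lambda>(t, \<omega>). 0)" for T
      using square_integrable_zero[of "time_space T"] by (simp only: split_beta')
    then show ?thesis unfolding admissible_def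
      using square_integrable_zero[of M] by (intro allI impI conjI ballI) (simp_all only: borel_measurable_const continuous_on_const)
  qed
  have "\<exists>f. \<forall>k. P k (f k) \<and> Q (f k) (f (Suc k))"
  proof (rule dependent_nat_choice)
    show "\<exists>Z. P 0 Z" using complete[OF zero] by blast
    fix Z k assume PZ: "P k Z"
    obtain X S J where Z: "Z = (X, S, J)" by (cases Z) auto
    note PZ' = PZ[unfolded P_def Z prod.case]
    have X: "admissible n X" using PZ' by (rule conjunct1)
    have el: "elementary (S r) (J r)" if "r < n" for r
      using conjunct2[OF PZ', rule_format, OF that, THEN conjunct1] by (rule simple_pair_elementary)
    have "admissible n (\<lambda>r t \<omega>. x0 r + (LBINT s:{0..t}. \<Sum>q<n. a r q * X q s \<omega>) + indicator (space M - N0) \<omega> * J r t \<omega>)"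
      using X el N0 by (rule picard_admissible)
    from complete[OF this, of "Suc k"] obtain S' J'
      where "P (Suc k) (\<lambda>r t \<omega>. x0 r + (LBINT s:{0..t}. \<Sum>q<n. a r q * X q s \<omega>)
        + indicator (space M - N0) \<omega> * J r t \<omega>, S', J')" (is "P _ ?Z")
      by blast
    moreover have "Q Z ?Z" by (simp only: Q_def Z prod.case fst_conv)
    ultimately show "\<exists>Z'. P (Suc k) Z' \<and> Q Z Z'" by blast
  qed
  then obtain f where f: "\<And>k. P k (f k)" "\<And>k. Q (f k) (f (Suc k))" by blast
  define X where "X k = fst (f k)" for k
  define S where "S k = fst (snd (f k))" for k
  define J where "J k = snd (snd (f k))" for k
  have fk: "f k = (X k, S k, J k)" for k by (simp add: X_def S_def J_def)
  note Pk = f(1)[unfolded fk P_def prod.case]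
  note Qk = f(2)[unfolded fk Q_def prod.case fst_conv]
  show thesis
  proof (rule that)
    show "admissible n (X k)" for k using Pk[of k] by (rule conjunct1)
    show "simple_pair M F w (real k + 1) (S k r) (J k r)" if "r < n" for k r
      using conjunct2[OF Pk[of k], rule_format, OF that] by (rule conjunct1)
    show "integral\<^sup>L (time_space (real k + 1))
        (\<lambda>(t, \<omega>). (S k r t \<omega> - (\<Sum>q<n. c r q * X k q t \<omega>))\<^sup>2) \<le> (1/16)^k" if "r < n" for k r
      using conjunct2[OF Pk[of k], rule_format, OF that] by (rule conjunct2)
    show "X (Suc k) r t \<omega> = x0 r + (LBINT s:{0..t}. \<Sum>q<n. a r q * X k q s \<omega>)
        + indicator (space M - N0) \<omega> * J k r t \<omega>" for k r t \<omega>
      unfolding Qk[of k] by (rule refl)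
  qed
qed

end

text \<open>Against the weight exp (l s) a time integration gains a factor 1 / l, which for large
  \<open>l\<close> turns the Picard step into a contraction.\<close>

lemma exp_time_integral_le:
  fixes l t :: real
  assumes "0 < l" "0 \<le> t"
  shows "(LBINT s:{0..t}. exp (l * s)) \<le> exp (l * t) / l"
proof -
  have "integral\<^sup>L lborel (\<lambda>s. indicator {0..t} s *\<^sub>R exp (l * s)) = exp (l * t) / l - exp (l * 0) / l"
  proof (rule integral_FTC_atLeastAtMost[OF assms(2)])
    fix s
    have "((\<lambda>s. exp (l * s) / l) has_real_derivative exp (l * s)) (at s within {0..t})"
      using assms(1) by (auto intro!: derivative_eq_intros)
    then show "((\<lambda>s. exp (l * s) / l) has_vector_derivative exp (l * s)) (at s within {0..t})"
      by (simp add: has_real_derivative_iff_has_vector_derivative)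
  qed (intro continuous_intros)
  moreover have "0 \<le> exp (l * 0) / l" using assms(1) by simp
  ultimately show ?thesis unfolding set_lebesgue_integral_def by linarith
qed

text \<open>Holds one sequence as produced by \<open>picard_sequence\<close>, to which all estimates
  below refer.\<close>

locale picard_scheme = wiener_setting M F w
  for M :: "'a measure" and F :: "real \<Rightarrow> 'a measure" and w :: "real \<Rightarrow> 'a \<Rightarrow> real" +
  fixes n :: nat and a c :: "nat \<Rightarrow> nat \<Rightarrow> real" and x0 :: "nat \<Rightarrow> real" and N0 :: "'a set"
    and X S J :: "nat \<Rightarrow> nat \<Rightarrow> real \<Rightarrow> 'a \<Rightarrow> real"
  assumes N0: "N0 \<in> null_sets M" "\<And>\<omega>. \<omega> \<in> space M - N0 \<Longrightarrow> continuous_on {0..} (\<lambda>t. w t \<omega>)"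
    and X: "\<And>k. admissible n (X k)"
    and S_pair: "\<And>k r. r < n \<Longrightarrow> simple_pair M F w (real k + 1) (S k r) (J k r)"
    and S_close: "\<And>k r. r < n \<Longrightarrow> integral\<^sup>L (time_space (real k + 1))
        (\<lambda>(t, \<omega>). (S k r t \<omega> - (\<Sum>q<n. c r q * X k q t \<omega>))\<^sup>2) \<le> (1/16)^k"
    and X_Suc: "\<And>k r t \<omega>. X (Suc k) r t \<omega> = x0 r + (LBINT s:{0..t}. \<Sum>q<n. a r q * X k q s \<omega>)
        + indicator (space M - N0) \<omega> * J k r t \<omega>"
begin

definition D :: "nat \<Rightarrow> nat \<Rightarrow> real \<Rightarrow> 'a \<Rightarrow> real" where
  "D k r t \<omega> = X (Suc k) r t \<omega> - X k r t \<omega>"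

definition err :: "nat \<Rightarrow> real \<Rightarrow> real" where
  "err k t = (\<Sum>r<n. integral\<^sup>L (time_space t) (\<lambda>(s, \<omega>). (D k r s \<omega>)\<^sup>2))"

text \<open>The squared Frobenius norm of a coefficient array.\<close>

definition sq_sum :: "(nat \<Rightarrow> nat \<Rightarrow> real) \<Rightarrow> real" where
  "sq_sum b = (\<Sum>r<n. \<Sum>q<n. (b r q)\<^sup>2)"

lemma sq_sum_nonneg: "0 \<le> sq_sum b"
  by (simp add: sq_sum_def sum_nonneg)

lemma sq_sum_ge: "r < n \<Longrightarrow> (\<Sum>q<n. (b r q)\<^sup>2) \<le> sq_sum b"
  unfolding sq_sum_def by (rule member_le_sum) (auto intro: sum_nonneg)

lemma D_admissible: "admissible n (D k)"
  unfolding D_def[abs_def] by (rule admissible_diff[OF X X])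

lemma el: "r < n \<Longrightarrow> elementary (S k r) (J k r)"
  by (rule simple_pair_elementary[OF S_pair])

lemma err_nonneg: "0 \<le> err k t"
  unfolding err_def by (intro sum_nonneg Bochner_Integration.integral_nonneg) auto

lemma D_sq_integrable:
  assumes "r < n" "0 \<le> t"
  shows "integrable (time_space t) (\<lambda>(s, \<omega>). (D k r s \<omega>)\<^sup>2)"
  using square_integrable_sq[OF admissibleD(4)[OF D_admissible assms]] by (simp only: split_beta')

lemma D_le_err:
  assumes "r < n"
  shows "integral\<^sup>L (time_space t) (\<lambda>(s, \<omega>). (D k r s \<omega>)\<^sup>2) \<le> err k t"
  unfolding err_def using assms
  by (intro member_le_sum Bochner_Integration.integral_nonneg) auto

lemma linear_D_le:
  assumes r: "r < n" and t: "0 \<le> t"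
  shows "integral\<^sup>L (time_space t) (\<lambda>(s, \<omega>). (\<Sum>q<n. b r q * D k q s \<omega>)\<^sup>2) \<le> sq_sum b * err k t"
proof -
  have "integral\<^sup>L (time_space t) (\<lambda>z. (\<Sum>q<n. b r q * (case z of (s, \<omega>) \<Rightarrow> D k q s \<omega>))\<^sup>2)
    \<le> (\<Sum>q<n. (b r q)\<^sup>2) * (\<Sum>q<n. integral\<^sup>L (time_space t) (\<lambda>z. (case z of (s, \<omega>) \<Rightarrow> D k q s \<omega>)\<^sup>2))"
    by (rule integral_linear_combination_square_le[OF admissibleD(4)[OF D_admissible _ t]])
  then have "integral\<^sup>L (time_space t) (\<lambda>(s, \<omega>). (\<Sum>q<n. b r q * D k q s \<omega>)\<^sup>2)
    \<le> (\<Sum>q<n. (b r q)\<^sup>2) * err k t"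
    by (simp only: err_def split_beta')
  also have "\<dots> \<le> sq_sum b * err k t"
    by (rule mult_right_mono[OF sq_sum_ge[OF r] err_nonneg])
  finally show ?thesis .
qed

lemma S_close_le:
  assumes r: "r < n" and t: "t \<le> real k + 1"
  shows "integral\<^sup>L (time_space t) (\<lambda>(t, \<omega>). (S k r t \<omega> - (\<Sum>q<n. c r q * X k q t \<omega>))\<^sup>2) \<le> (1/16)^k"
proof -
  have "0 \<le> real k + 1" by simp
  from square_integrable_time_diff[OF elementary_integrand_square_integrable[OF el[OF r]] admissible_linear(3)[OF X this]]
  have "square_integrable (time_space (real k + 1)) (\<lambda>(t, \<omega>). S k r t \<omega> - (\<Sum>q<n. c r q * X k q t \<omega>))" .
  from square_integrable_sq[OF this]
  have "integrable (time_space (real k + 1)) (\<lambda>(t, \<omega>). (S k r t \<omega> - (\<Sum>q<n. c r q * X k q t \<omega>))\<^sup>2)"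
    by (simp only: split_beta')
  from time_space_integral_mono(2)[OF this _ t] S_close[OF r, of k] show ?thesis by simp
qed

text \<open>The difference is U + (V - W): \<open>U\<close> and \<open>W\<close> are the
  approximation errors of the two stages, \<open>V\<close> is the diffusion coefficient applied to
  \<open>D j\<close>. Two uses of the doubled triangle inequality give the weights 2, 4 and 4 for
  the squares of U, V and W, and 2/16 + 4 \<le> 5.\<close>

lemma S_diff_le:
  assumes r: "r < n" and t: "0 \<le> t" "t \<le> real j + 1"
  shows "integral\<^sup>L (time_space t) (\<lambda>(s, \<omega>). (S (Suc j) r s \<omega> - S j r s \<omega>)\<^sup>2)
    \<le> 5 * (1/16)^j + 4 * sq_sum c * err j t"
proof -
  define U where "U z = (case z of (s, \<omega>) \<Rightarrow> S (Suc j) r s \<omega> - (\<Sum>q<n. c r q * X (Suc j) q s \<omega>))" for z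
  define V where "V z = (case z of (s, \<omega>) \<Rightarrow> \<Sum>q<n. c r q * D j q s \<omega>)" for z
  define W where "W z = (case z of (s, \<omega>) \<Rightarrow> S j r s \<omega> - (\<Sum>q<n. c r q * X j q s \<omega>))" for z
  have Usq: "square_integrable (time_space t) U" and Wsq: "square_integrable (time_space t) W"
    unfolding U_def[abs_def] W_def[abs_def]
    by (rule square_integrable_time_diff[OF elementary_integrand_square_integrable[OF el[OF r]] admissible_linear(3)[OF X t(1)]])+
  have Vsq: "square_integrable (time_space t) V"
    unfolding V_def[abs_def] by (rule admissible_linear(3)[OF D_admissible t(1)])
  have U: "integral\<^sup>L (time_space t) (\<lambda>z. (U z)\<^sup>2) \<le> (1/16)^(Suc j)"
  proof -
    have "t \<le> real (Suc j) + 1" using t by simp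
    from S_close_le[OF r this] show ?thesis by (simp only: U_def split_beta')
  qed
  have W: "integral\<^sup>L (time_space t) (\<lambda>z. (W z)\<^sup>2) \<le> (1/16)^j"
    using S_close_le[OF r t(2)] by (simp only: W_def split_beta')
  have V: "integral\<^sup>L (time_space t) (\<lambda>z. (V z)\<^sup>2) \<le> sq_sum c * err j t"
    using linear_D_le[OF r t(1), of c j] by (simp only: V_def split_beta')
  have "integral\<^sup>L (time_space t) (\<lambda>(s, \<omega>). (S (Suc j) r s \<omega> - S j r s \<omega>)\<^sup>2)
     = integral\<^sup>L (time_space t) (\<lambda>z. (U z + (V z - W z))\<^sup>2)"
    by (intro Bochner_Integration.integral_cong refl)
      (simp add: U_def V_def W_def D_def split_beta' sum_subtractf right_diff_distrib)
  also have "\<dots> \<le> 2 * integral\<^sup>L (time_space t) (\<lambda>z. (U z)\<^sup>2) + 2 * integral\<^sup>L (time_space t) (\<lambda>z. (V z - W z)\<^sup>2)"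
    by (rule integral_square_add_le[OF Usq square_integrable_diff[OF Vsq Wsq]])
  also have "integral\<^sup>L (time_space t) (\<lambda>z. (V z - W z)\<^sup>2)
      \<le> 2 * integral\<^sup>L (time_space t) (\<lambda>z. (V z)\<^sup>2) + 2 * integral\<^sup>L (time_space t) (\<lambda>z. (W z)\<^sup>2)"
    using integral_square_add_le[OF Vsq square_integrable_uminus[OF Wsq]] by simp
  finally have "integral\<^sup>L (time_space t) (\<lambda>(s, \<omega>). (S (Suc j) r s \<omega> - S j r s \<omega>)\<^sup>2)
     \<le> 2 * integral\<^sup>L (time_space t) (\<lambda>z. (U z)\<^sup>2) + 4 * integral\<^sup>L (time_space t) (\<lambda>z. (V z)\<^sup>2)
       + 4 * integral\<^sup>L (time_space t) (\<lambda>z. (W z)\<^sup>2)"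
    by (simp add: algebra_simps)
  also have "\<dots> \<le> 2 * (1/16)^(Suc j) + 4 * (sq_sum c * err j t) + 4 * (1/16)^j"
    by (intro add_mono mult_left_mono U V W) simp_all
  also have "\<dots> \<le> 5 * (1/16)^j + 4 * sq_sum c * err j t"
  proof -
    have "2 * (1/16::real)^(Suc j) \<le> (1/16)^j" by simp
    then show ?thesis by (simp add: algebra_simps)
  qed
  finally show ?thesis .
qed

lemma D_Suc:
  assumes "\<omega> \<in> space M"
  shows "D (Suc j) r t \<omega> = (LBINT s:{0..t}. \<Sum>q<n. a r q * D j q s \<omega>)
    + indicator (space M - N0) \<omega> * (J (Suc j) r t \<omega> - J j r t \<omega>)"
proof -
  have i: "set_integrable lborel {0..t} (\<lambda>s. \<Sum>q<n. a r q * X k q s \<omega>)" for k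
    by (rule borel_integrable_atLeastAtMost'[OF continuous_on_subset[OF admissible_linear(2)[OF X assms]]]) auto
  have "(LBINT s:{0..t}. \<Sum>q<n. a r q * D j q s \<omega>)
      = (LBINT s:{0..t}. (\<Sum>q<n. a r q * X (Suc j) q s \<omega>) - (\<Sum>q<n. a r q * X j q s \<omega>))"
    unfolding D_def by (simp only: sum_subtractf right_diff_distrib)
  also have "\<dots> = (LBINT s:{0..t}. \<Sum>q<n. a r q * X (Suc j) q s \<omega>) - (LBINT s:{0..t}. \<Sum>q<n. a r q * X j q s \<omega>)"
    by (rule set_integral_diff(2)[OF i i])
  finally show ?thesis
    unfolding D_def[of "Suc j"] X_Suc by (simp add: right_diff_distrib)
qed

text \<open>The drift is estimated by Cauchy-Schwarz in time, the stochastic part by the isometry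
  and \<open>S_diff_le\<close>. The condition \<open>T \<le> real j + 1\<close> ensures that stage
  \<open>j\<close> approximates on all of [0, T].\<close>

lemma D_Suc_le:
  assumes r: "r < n" and t: "0 \<le> t" "t \<le> T" and T: "T \<le> real j + 1"
  shows "expectation (\<lambda>\<omega>. (D (Suc j) r t \<omega>)\<^sup>2) \<le> (2 * T * sq_sum a + 8 * sq_sum c) * err j t + 10 * (1/16)^j"
proof -
  define I where "I \<omega> = (LBINT s:{0..t}. \<Sum>q<n. a r q * D j q s \<omega>)" for \<omega>
  define K where "K \<omega> = indicator (space M - N0) \<omega> * (J (Suc j) r t \<omega> - J j r t \<omega>)" for \<omega>
  note eld = elementary_diff[OF el[OF r, of "Suc j"] el[OF r, of j]]
  have Isq: "square_integrable M I"
    unfolding I_def[abs_def] by (rule admissible_time_integral(2)[OF D_admissible t(1)])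
  have Ksq: "square_integrable M K"
  proof -
    have "indicat_real (space M - N0) \<in> borel_measurable M" using N0(1) by auto
    from square_integrable_bounded_mult[OF elementary_integral_square_integrable[OF eld t(1)] this, of 1]
    show ?thesis by (simp add: K_def[abs_def] indicator_def)
  qed
  have Kle: "expectation (\<lambda>\<omega>. (K \<omega>)\<^sup>2) \<le> 5 * (1/16)^j + 4 * sq_sum c * err j t"
  proof -
    have "expectation (\<lambda>\<omega>. (K \<omega>)\<^sup>2) \<le> expectation (\<lambda>\<omega>. (J (Suc j) r t \<omega> - J j r t \<omega>)\<^sup>2)"
      by (intro integral_mono square_integrable_sq[OF Ksq]
          square_integrable_sq[OF elementary_integral_square_integrable[OF eld t(1)]])
        (simp add: K_def indicator_def)
    also have "\<dots> = integral\<^sup>L (time_space t) (\<lambda>(s, \<omega>). (S (Suc j) r s \<omega> - S j r s \<omega>)\<^sup>2)"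
      using elementary_isometry[OF eld eld t(1)] by (simp only: power2_eq_square)
    also have "\<dots> \<le> 5 * (1/16)^j + 4 * sq_sum c * err j t"
      using t T by (intro S_diff_le[OF r]) auto
    finally show ?thesis .
  qed
  have Ile: "expectation (\<lambda>\<omega>. (I \<omega>)\<^sup>2) \<le> T * (sq_sum a * err j t)"
  proof -
    have "expectation (\<lambda>\<omega>. (I \<omega>)\<^sup>2) \<le> t * integral\<^sup>L (time_space t) (\<lambda>(s, \<omega>). (\<Sum>q<n. a r q * D j q s \<omega>)\<^sup>2)"
      unfolding I_def by (rule admissible_time_integral(3)[OF D_admissible t(1)])
    also have "\<dots> \<le> T * (sq_sum a * err j t)"
      by (intro mult_mono linear_D_le[OF r t(1)]) (use t in \<open>auto intro!: Bochner_Integration.integral_nonneg\<close>)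
    finally show ?thesis .
  qed
  have "expectation (\<lambda>\<omega>. (D (Suc j) r t \<omega>)\<^sup>2) = expectation (\<lambda>\<omega>. (I \<omega> + K \<omega>)\<^sup>2)"
    by (intro Bochner_Integration.integral_cong refl) (simp only: D_Suc I_def K_def)
  also have "\<dots> \<le> 2 * expectation (\<lambda>\<omega>. (I \<omega>)\<^sup>2) + 2 * expectation (\<lambda>\<omega>. (K \<omega>)\<^sup>2)"
    by (rule integral_square_add_le[OF Isq Ksq])
  also have "\<dots> \<le> 2 * (T * (sq_sum a * err j t)) + 2 * (5 * (1/16)^j + 4 * sq_sum c * err j t)"
    by (intro add_mono mult_left_mono Ile Kle) simp_all
  also have "\<dots> = (2 * T * sq_sum a + 8 * sq_sum c) * err j t + 10 * (1/16)^j"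
    by (simp add: algebra_simps)
  finally show ?thesis .
qed

text \<open>Induction on \<open>k\<close> with the weighted bound B (1/16)^k exp (l t). The
  approximation errors already decay like (1/16)^k, and \<open>l\<close> is chosen so that a Picard
  step contracts at the same rate. The start is the ceiling of T, a stage whose horizon contains
  [0, T]; the error there is absorbed into \<open>B\<close>.\<close>

lemma err_geometric:
  assumes T: "0 < T"
  shows "\<exists>B\<ge>0. \<forall>k\<ge>nat \<lceil>T\<rceil>. \<forall>t. 0 \<le> t \<longrightarrow> t \<le> T \<longrightarrow> err k t \<le> B * (1/16)^k"
proof -
  define k0 where "k0 = nat \<lceil>T\<rceil>"
  have k0: "T \<le> real k0" unfolding k0_def by (rule real_nat_ceiling_ge)
  \<comment> \<open>The factor of \<open>err\<close> in \<open>D_Suc_le\<close>, plus the 10 of its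
    additive error.\<close>
  define C where "C = 2 * T * sq_sum a + 8 * sq_sum c + 10"
  have C: "10 \<le> C" unfolding C_def using T sq_sum_nonneg by simp
  \<comment> \<open>One step multiplies by (n + 1) C / l = 1/16; \<open>n + 1\<close> in place of
    \<open>n\<close> keeps \<open>l\<close> positive for n = 0.\<close>
  define l where "l = 16 * (real n + 1) * C"
  have l: "0 < l" unfolding l_def using C by simp
  \<comment> \<open>At least 1, so that it also dominates the pure error term (1/16)^j; the other
    entry covers the initial stage.\<close>
  define B where "B = max 1 (16^k0 * err k0 T)"
  have B: "1 \<le> B" "16^k0 * err k0 T \<le> B" by (simp_all add: B_def)
  have bound: "err k t \<le> B * (1/16)^k * exp (l * t)" if "k0 \<le> k" "0 \<le> t" "t \<le> T" for k t
    using that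
  proof (induction k arbitrary: t rule: dec_induct)
    case base
    have "err k0 t \<le> err k0 T"
      unfolding err_def using T base
      by (intro sum_mono time_space_integral_mono(2) D_sq_integrable) auto
    also have "\<dots> = (16^k0 * err k0 T) * (1/16)^k0" by (simp add: power_one_over)
    also have "\<dots> \<le> B * (1/16)^k0" by (rule mult_right_mono[OF B(2)]) simp
    also have "\<dots> \<le> B * (1/16)^k0 * exp (l * t)"
    proof -
      have "1 \<le> exp (l * t)" using l base by simp
      moreover have "0 \<le> B * (1/16)^k0" using B(1) by simp
      ultimately show ?thesis using mult_left_mono by fastforce
    qed
    finally show ?case .
  next
    case (step j)
    have Tj: "T \<le> real j + 1" using k0 step.hyps by simp
    define b where "b = C * B * (1/16)^j"
    have b0: "0 \<le> b" using C B(1) by (simp add: b_def)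
    \<comment> \<open>Pointwise in time first: here the weight exp (l s) is only carried along, and
      the time integration that follows gains the factor 1 / l.\<close>
    have pt: "expectation (\<lambda>\<omega>. (D (Suc j) r s \<omega>)\<^sup>2) \<le> b * exp (l * s)" if r: "r < n" and s: "0 \<le> s" "s \<le> T" for r s
    proof -
      have "expectation (\<lambda>\<omega>. (D (Suc j) r s \<omega>)\<^sup>2) \<le> (2 * T * sq_sum a + 8 * sq_sum c) * err j s + 10 * (1/16)^j"
        by (rule D_Suc_le[OF r s Tj])
      also have "\<dots> \<le> (2 * T * sq_sum a + 8 * sq_sum c) * (B * (1/16)^j * exp (l * s)) + 10 * (B * (1/16)^j * exp (l * s))"
      proof (intro add_mono mult_left_mono step.IH s)
        have "1 * (1/16::real)^j * 1 \<le> B * (1/16)^j * exp (l * s)"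
          using B(1) l s by (intro mult_mono) auto
        then show "(1/16::real)^j \<le> B * (1/16)^j * exp (l * s)" by simp
      qed (use T sq_sum_nonneg in auto)
      also have "\<dots> = b * exp (l * s)" by (simp add: b_def C_def algebra_simps)
      finally show ?thesis .
    qed
    have each: "integral\<^sup>L (time_space t) (\<lambda>(s, \<omega>). (D (Suc j) r s \<omega>)\<^sup>2) \<le> b * (exp (l * t) / l)" if r: "r < n" for r
    proof -
      note fub = time_space_Fubini[OF D_sq_integrable[OF r step.prems(1), of "Suc j"]]
      have "integral\<^sup>L (time_space t) (\<lambda>(s, \<omega>). (D (Suc j) r s \<omega>)\<^sup>2)
        = (LBINT s:{0..t}. expectation (\<lambda>\<omega>. (D (Suc j) r s \<omega>)\<^sup>2))"
        by (rule fub(1))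
      also have "\<dots> \<le> (LBINT s:{0..t}. b * exp (l * s))"
      proof (rule set_integral_mono[OF fub(2)])
        show "set_integrable lborel {0..t} (\<lambda>s. b * exp (l * s))"
          by (intro borel_integrable_atLeastAtMost' continuous_intros)
      qed (use pt[OF r] step.prems in auto)
      also have "\<dots> = b * (LBINT s:{0..t}. exp (l * s))" by simp
      also have "\<dots> \<le> b * (exp (l * t) / l)"
        by (rule mult_left_mono[OF exp_time_integral_le[OF l step.prems(1)] b0])
      finally show ?thesis .
    qed
    have "err (Suc j) t \<le> (\<Sum>r<n. b * (exp (l * t) / l))"
      unfolding err_def by (intro sum_mono each) simp
    also have "\<dots> = real n * (b * (exp (l * t) / l))" by simp
    also have "\<dots> \<le> (real n + 1) * (b * (exp (l * t) / l))"
      using b0 l by (intro mult_right_mono) auto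
    also have "\<dots> = ((real n + 1) * C / l) * (B * (1/16)^j * exp (l * t))"
      by (simp add: b_def)
    also have "(real n + 1) * C / l = 1/16"
    proof -
      have "(real n + 1) * C \<noteq> 0" using C by simp
      moreover have "l = 16 * ((real n + 1) * C)" by (simp only: l_def mult.assoc)
      moreover have "m / (16 * m) = 1 / 16" if "m \<noteq> 0" for m :: real using that by simp
      ultimately show ?thesis by metis
    qed
    also have "1/16 * (B * (1/16)^j * exp (l * t)) = B * (1/16)^(Suc j) * exp (l * t)"
      by simp
    finally show ?case .
  qed
  have "err k t \<le> (B * exp (l * T)) * (1/16)^k" if "k0 \<le> k" "0 \<le> t" "t \<le> T" for k t
  proof -
    have "exp (l * t) \<le> exp (l * T)" using that l by simp
    then have "B * (1/16)^k * exp (l * t) \<le> B * (1/16)^k * exp (l * T)"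
      using B(1) by (intro mult_left_mono) auto
    with bound[OF that] show ?thesis by (simp add: mult_ac)
  qed
  moreover have "0 \<le> B * exp (l * T)" using B(1) by simp
  ultimately show ?thesis unfolding k0_def by blast
qed

text \<open>Collects under one constant the four estimates on which convergence rests.
  \<open>k0\<close> is one above the ceiling of T because the pointwise bound on \<open>D k\<close>
  comes from \<open>err\<close> at the previous stage.\<close>

lemma geometric_bounds:
  assumes T: "0 < T"
  obtains C k0 where "0 \<le> C" "T \<le> real k0"
    "\<And>k r t. k0 \<le> k \<Longrightarrow> r < n \<Longrightarrow> 0 \<le> t \<Longrightarrow> t \<le> T \<Longrightarrow> expectation (\<lambda>\<omega>. (D k r t \<omega>)\<^sup>2) \<le> C * (1/16)^k"
    "\<And>k r. k0 \<le> k \<Longrightarrow> r < n \<Longrightarrow> integral\<^sup>L (time_space T) (\<lambda>(s, \<omega>). (D k r s \<omega>)\<^sup>2) \<le> C * (1/16)^k"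
    "\<And>k r. k0 \<le> k \<Longrightarrow> r < n \<Longrightarrow> integral\<^sup>L (time_space T) (\<lambda>(s, \<omega>). (\<Sum>q<n. a r q * D k q s \<omega>)\<^sup>2) \<le> C * (1/16)^k"
    "\<And>k r. k0 \<le> k \<Longrightarrow> r < n \<Longrightarrow> integral\<^sup>L (time_space T) (\<lambda>(s, \<omega>). (S (Suc k) r s \<omega> - S k r s \<omega>)\<^sup>2) \<le> C * (1/16)^k"
proof -
  obtain B where B: "0 \<le> B" "\<And>k t. nat \<lceil>T\<rceil> \<le> k \<Longrightarrow> 0 \<le> t \<Longrightarrow> t \<le> T \<Longrightarrow> err k t \<le> B * (1/16)^k"
    using err_geometric[OF T] by blast
  define k0 where "k0 = Suc (nat \<lceil>T\<rceil>)"
  have k0: "T \<le> real k0" unfolding k0_def using real_nat_ceiling_ge[of T] by simp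
  define P where "P = 2 * T * sq_sum a + 8 * sq_sum c"
  have P: "0 \<le> P" unfolding P_def using T sq_sum_nonneg by simp
  \<comment> \<open>The sum of the four constants, so as to dominate each; the 16 in the first one
    compensates the shift from stage \<open>j\<close> to \<open>k = Suc j\<close>.\<close>
  define C where "C = 16 * (P * B + 10) + B + sq_sum a * B + (5 + 4 * sq_sum c * B)"
  have parts: "0 \<le> 16 * (P * B + 10)" "0 \<le> sq_sum a * B" "0 \<le> 5 + 4 * sq_sum c * B"
    using P B(1) sq_sum_nonneg by simp_all
  have C: "0 \<le> C" "16 * (P * B + 10) \<le> C" "B \<le> C" "sq_sum a * B \<le> C" "5 + 4 * sq_sum c * B \<le> C"
    unfolding C_def using parts B(1) by linarith+
  have pos: "0 \<le> (1/16::real)^k" for k by simp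
  show thesis
  proof (rule that[OF C(1) k0])
    fix k r assume k: "k0 \<le> k" and r: "r < n"
    have k': "nat \<lceil>T\<rceil> \<le> k" using k unfolding k0_def by (rule Suc_leD)
    have Tk: "T \<le> real k + 1" using real_nat_ceiling_ge[of T] of_nat_mono[OF k', where 'a = real] by linarith
    note e = B(2)[OF k' less_imp_le[OF T] order_refl]
    show "integral\<^sup>L (time_space T) (\<lambda>(s, \<omega>). (D k r s \<omega>)\<^sup>2) \<le> C * (1/16)^k"
      using D_le_err[OF r, of T k] e mult_right_mono[OF C(3) pos[of k]] by linarith
    have "sq_sum a * err k T \<le> sq_sum a * (B * (1/16)^k)"
      by (rule mult_left_mono[OF e sq_sum_nonneg])
    moreover have "sq_sum a * (B * (1/16)^k) \<le> C * (1/16)^k"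
      using mult_right_mono[OF C(4) pos[of k]] by (simp only: mult.assoc)
    ultimately show "integral\<^sup>L (time_space T) (\<lambda>(s, \<omega>). (\<Sum>q<n. a r q * D k q s \<omega>)\<^sup>2) \<le> C * (1/16)^k"
      using linear_D_le[OF r less_imp_le[OF T], of a k] by linarith
    have "4 * sq_sum c * err k T \<le> 4 * sq_sum c * (B * (1/16)^k)"
      using e sq_sum_nonneg by (intro mult_left_mono) auto
    then have "5 * (1/16)^k + 4 * sq_sum c * err k T \<le> (5 + 4 * sq_sum c * B) * (1/16)^k"
      by (simp add: distrib_right mult.assoc)
    then show "integral\<^sup>L (time_space T) (\<lambda>(s, \<omega>). (S (Suc k) r s \<omega> - S k r s \<omega>)\<^sup>2) \<le> C * (1/16)^k"
      using S_diff_le[OF r less_imp_le[OF T] Tk] mult_right_mono[OF C(5) pos[of k]] by linarith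
    fix t assume t: "0 \<le> t" "t \<le> T"
    obtain j where j: "k = Suc j" using k by (cases k) (auto simp: k0_def)
    have j': "nat \<lceil>T\<rceil> \<le> j" using k unfolding j k0_def by (rule Suc_le_mono[THEN iffD1])
    have Tj: "T \<le> real j + 1" using real_nat_ceiling_ge[of T] of_nat_mono[OF j', where 'a = real] by linarith
    have "expectation (\<lambda>\<omega>. (D k r t \<omega>)\<^sup>2) \<le> P * err j t + 10 * (1/16)^j"
      unfolding P_def j by (rule D_Suc_le[OF r t Tj])
    also have "\<dots> \<le> P * (B * (1/16)^j) + 10 * (1/16)^j"
      by (intro add_mono mult_left_mono B(2)[OF j' t] P order_refl)
    also have "\<dots> = 16 * (P * B + 10) * (1/16)^k"
      by (simp add: j algebra_simps)
    also have "\<dots> \<le> C * (1/16)^k" by (rule mult_right_mono[OF C(2) pos])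
    finally show "expectation (\<lambda>\<omega>. (D k r t \<omega>)\<^sup>2) \<le> C * (1/16)^k" .
  qed
qed

end

section \<open>Passage to the limit: L2, locally uniform, almost sure\<close>

lemma l2_tendsto_linear:
  fixes b :: "nat \<Rightarrow> real"
  assumes "\<And>q. q < n \<Longrightarrow> l2_tendsto N (\<lambda>l. f l q) (g q)"
  shows "l2_tendsto N (\<lambda>l z. \<Sum>q<n. b q * f l q z) (\<lambda>z. \<Sum>q<n. b q * g q z)"
  unfolding l2_tendsto_def
proof (intro conjI allI)
  have fs: "square_integrable N (f l q)" and gs: "square_integrable N (g q)" if "q < n" for l q
    using assms[OF that] by (auto simp: l2_tendsto_def)
  show "square_integrable N (\<lambda>z. \<Sum>q<n. b q * f l q z)" for l
    using fs by (rule square_integrable_linear_combination)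
  show "square_integrable N (\<lambda>z. \<Sum>q<n. b q * g q z)"
    using gs by (rule square_integrable_linear_combination)
  have lim: "(\<lambda>l. (\<Sum>q<n. (b q)\<^sup>2) * (\<Sum>q<n. \<integral>z. (f l q z - g q z)\<^sup>2 \<partial>N)) \<longlonglongrightarrow> 0"
    using assms by (intro tendsto_mult_right_zero tendsto_null_sum) (auto simp: l2_tendsto_def)
  show "(\<lambda>l. \<integral>z. ((\<Sum>q<n. b q * f l q z) - (\<Sum>q<n. b q * g q z))\<^sup>2 \<partial>N) \<longlonglongrightarrow> 0"
  proof (rule tendsto_sandwich[OF _ _ tendsto_const lim])
    have "(\<integral>z. ((\<Sum>q<n. b q * f l q z) - (\<Sum>q<n. b q * g q z))\<^sup>2 \<partial>N)
      \<le> (\<Sum>q<n. (b q)\<^sup>2) * (\<Sum>q<n. \<integral>z. (f l q z - g q z)\<^sup>2 \<partial>N)" for l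
    proof -
      have "(\<integral>z. (\<Sum>q<n. b q * (f l q z - g q z))\<^sup>2 \<partial>N)
        \<le> (\<Sum>q<n. (b q)\<^sup>2) * (\<Sum>q<n. \<integral>z. (f l q z - g q z)\<^sup>2 \<partial>N)"
        by (rule integral_linear_combination_square_le[OF square_integrable_diff[OF fs gs]])
      then show ?thesis by (simp only: right_diff_distrib sum_subtractf)
    qed
    then show "\<forall>\<^sub>F l in sequentially. (\<integral>z. ((\<Sum>q<n. b q * f l q z) - (\<Sum>q<n. b q * g q z))\<^sup>2 \<partial>N)
      \<le> (\<Sum>q<n. (b q)\<^sup>2) * (\<Sum>q<n. \<integral>z. (f l q z - g q z)\<^sup>2 \<partial>N)"
      by (intro always_eventually allI)
  qed (intro always_eventually allI Bochner_Integration.integral_nonneg zero_le_power2)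
qed

lemma l2_tendsto_perturb:
  assumes fg: "l2_tendsto N f g" and h: "\<And>l. square_integrable N (h l)"
    and d: "(\<lambda>l. \<integral>z. (h l z - f l z)\<^sup>2 \<partial>N) \<longlonglongrightarrow> 0"
  shows "l2_tendsto N h g"
proof -
  have fs: "square_integrable N (f l)" and gs: "square_integrable N g"
    and lim: "(\<lambda>l. \<integral>z. (f l z - g z)\<^sup>2 \<partial>N) \<longlonglongrightarrow> 0" for l
    using fg by (auto simp: l2_tendsto_def)
  have lim0: "(\<lambda>l. 2 * (\<integral>z. (h l z - f l z)\<^sup>2 \<partial>N) + 2 * (\<integral>z. (f l z - g z)\<^sup>2 \<partial>N)) \<longlonglongrightarrow> 0"
    by (intro tendsto_add_zero tendsto_mult_right_zero d lim)
  have "(\<lambda>l. \<integral>z. (h l z - g z)\<^sup>2 \<partial>N) \<longlonglongrightarrow> 0"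
  proof (rule tendsto_sandwich[OF _ _ tendsto_const lim0])
    have "(\<integral>z. (h l z - g z)\<^sup>2 \<partial>N) \<le> 2 * (\<integral>z. (h l z - f l z)\<^sup>2 \<partial>N) + 2 * (\<integral>z. (f l z - g z)\<^sup>2 \<partial>N)" for l
      using integral_square_add_le[OF square_integrable_diff[OF h[of l] fs[of l]] square_integrable_diff[OF fs[of l] gs]]
      by simp
    then show "\<forall>\<^sub>F l in sequentially. (\<integral>z. (h l z - g z)\<^sup>2 \<partial>N) \<le> 2 * (\<integral>z. (h l z - f l z)\<^sup>2 \<partial>N) + 2 * (\<integral>z. (f l z - g z)\<^sup>2 \<partial>N)"
      by (intro always_eventually allI)
  qed (intro always_eventually allI Bochner_Integration.integral_nonneg zero_le_power2)
  then show ?thesis using h gs by (simp add: l2_tendsto_def)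
qed

lemma l2_tendsto_diff:
  assumes f: "l2_tendsto N f g" and f': "l2_tendsto N f' g'"
  shows "l2_tendsto N (\<lambda>l z. f l z - f' l z) (\<lambda>z. g z - g' z)"
proof (rule l2_tendsto_perturb)
  have sq: "square_integrable N (f l)" "square_integrable N g" "square_integrable N (f' l)" "square_integrable N g'" for l
    using f f' by (auto simp: l2_tendsto_def)
  have "(\<lambda>l. \<integral>z. ((f l z - g' z) - (g z - g' z))\<^sup>2 \<partial>N) \<longlonglongrightarrow> 0"
    using f by (simp add: l2_tendsto_def)
  then show "l2_tendsto N (\<lambda>l z. f l z - g' z) (\<lambda>z. g z - g' z)"
    using sq by (simp add: l2_tendsto_def square_integrable_diff)
  show "square_integrable N (\<lambda>z. f l z - f' l z)" for l using sq by (simp add: square_integrable_diff)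
  have "(\<integral>z. ((f l z - f' l z) - (f l z - g' z))\<^sup>2 \<partial>N) = (\<integral>z. (f' l z - g' z)\<^sup>2 \<partial>N)" for l
    by (intro Bochner_Integration.integral_cong refl) (simp add: power2_commute)
  then show "(\<lambda>l. \<integral>z. ((f l z - f' l z) - (f l z - g' z))\<^sup>2 \<partial>N) \<longlonglongrightarrow> 0"
    using f' by (simp add: l2_tendsto_def)
qed

text \<open>The Weierstrass test on each [0, p]. The index from which the bound holds may depend on
  \<open>p\<close>, and Borel-Cantelli delivers exactly this. Continuity at \<open>s\<close> is
  local, so a \<open>p\<close> above s + 1 suffices.\<close>

lemma locally_uniform_limit:
  fixes f :: "nat \<Rightarrow> real \<Rightarrow> real"
  assumes cont: "\<And>k. continuous_on {0..} (f k)"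
    and ev: "\<And>p::nat. \<forall>\<^sub>F k in sequentially. \<forall>t. 0 \<le> t \<longrightarrow> t \<le> real p \<longrightarrow> \<bar>f (Suc k) t - f k t\<bar> \<le> C * (1/2)^k"
  shows "continuous_on {0..} (\<lambda>t. lim (\<lambda>k. f k t))"
    and "0 \<le> t \<Longrightarrow> (\<lambda>k. f k t) \<longlonglongrightarrow> lim (\<lambda>k. f k t)"
proof -
  define g where "g t = f 0 t + (\<Sum>i. f (Suc i) t - f i t)" for t
  have ul: "uniform_limit {0..real p} f g sequentially" for p
  proof -
    have "summable (\<lambda>k. C * (1/2)^k)" by (intro summable_mult summable_geometric) simp
    then have "uniform_limit {0..real p} (\<lambda>m t. \<Sum>i<m. f (Suc i) t - f i t) (\<lambda>t. \<Sum>i. f (Suc i) t - f i t) sequentially"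
    proof (rule Weierstrass_m_test_ev[rotated])
      show "\<forall>\<^sub>F k in sequentially. \<forall>t\<in>{0..real p}. norm (f (Suc k) t - f k t) \<le> C * (1/2)^k"
        using ev[of p] by eventually_elim simp
    qed
    then have "uniform_limit {0..real p} (\<lambda>m t. f 0 t + (\<Sum>i<m. f (Suc i) t - f i t)) g sequentially"
      unfolding g_def by (intro uniform_limit_add uniform_limit_const)
    moreover have "f 0 t + (\<Sum>i<m. f (Suc i) t - f i t) = f m t" for m t
      using sum_lessThan_telescope[of "\<lambda>i. f i t" m] by simp
    ultimately show ?thesis by simp
  qed
  have lim: "(\<lambda>k. f k t) \<longlonglongrightarrow> g t" if "0 \<le> t" for t
  proof -
    obtain p :: nat where "t \<le> real p" using real_arch_simple by blast
    with that show ?thesis by (intro tendsto_uniform_limitI[OF ul[of p]]) simp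
  qed
  then have lim_g: "lim (\<lambda>k. f k t) = g t" if "0 \<le> t" for t
    using that by (intro limI) blast
  show "0 \<le> t \<Longrightarrow> (\<lambda>k. f k t) \<longlonglongrightarrow> lim (\<lambda>k. f k t)"
    using lim lim_g by simp
  have "continuous (at s within {0..}) g" if "0 \<le> s" for s
  proof -
    obtain p :: nat where p: "s + 1 \<le> real p" using real_arch_simple by blast
    have "continuous_on {0..real p} g"
    proof (rule uniform_limit_theorem[OF _ ul])
      show "\<forall>\<^sub>F k in sequentially. continuous_on {0..real p} (f k)"
        by (intro always_eventually allI continuous_on_subset[OF cont]) auto
    qed simp
    then have "continuous (at s within {0..real p}) g"
      using that p by (auto simp: continuous_on_eq_continuous_within)
    moreover have "at s within {0..real p} = at s within {0..}"
      by (rule at_within_nhd[of s "{..<real p}"]) (use p in auto)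
    ultimately show ?thesis by simp
  qed
  then have "continuous_on {0..} g" by (auto simp: continuous_on_eq_continuous_within)
  then show "continuous_on {0..} (\<lambda>t. lim (\<lambda>k. f k t))"
    by (rule continuous_on_cong[THEN iffD1, rotated -1]) (auto simp: lim_g)
qed

context wiener_setting
begin

lemma AE_time_space_null:
  assumes "N \<in> null_sets M"
  shows "AE z in time_space T. snd z \<notin> N"
proof (rule AE_I')
  show "space (time_lebesgue T) \<times> N \<in> null_sets (time_space T)"
    using assms by (intro times_in_null_sets2 sets.top)
  show "{z \<in> space (time_space T). \<not> snd z \<notin> N} \<subseteq> space (time_lebesgue T) \<times> N"
    by (auto simp: space_pair_measure)
qed

text \<open>Borel-Cantelli for a tail dominated by a geometric series.\<close>

lemma AE_eventually_notin:
  assumes A: "\<And>k::nat. A k \<in> sets M" and P: "\<And>k. k0 \<le> k \<Longrightarrow> prob (A k) \<le> C * (1/4)^k"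
  shows "AE \<omega> in M. \<forall>\<^sub>F k in sequentially. \<omega> \<notin> A k"
proof -
  have "summable (\<lambda>k. prob (A k))"
    by (rule summable_comparison_test'[of "\<lambda>k. C * (1/4)^k" k0])
      (use P in \<open>auto intro!: summable_mult summable_geometric\<close>)
  then have "AE \<omega> in M. \<forall>\<^sub>F k in sequentially. \<omega> \<in> space M - A k"
    by (intro borel_cantelli_AE1 A) (simp_all add: emeasure_eq_measure)
  then show ?thesis by eventually_elim (auto elim: eventually_mono)
qed

text \<open>Chebyshev at level (1/2)^k: the probabilities are at most C (1/16)^k / (1/4)^k = C
  (1/4)^k.\<close>

lemma AE_eventually_small:
  assumes f: "\<And>k. square_integrable M (f k)" and E: "\<And>k. k0 \<le> k \<Longrightarrow> expectation (\<lambda>\<omega>. (f k \<omega>)\<^sup>2) \<le> C * (1/16)^k"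
  shows "AE \<omega> in M. \<forall>\<^sub>F k in sequentially. \<bar>f k \<omega>\<bar> \<le> (1/2)^k"
proof -
  define A where "A k = {\<omega> \<in> space M. (1/2)^k < \<bar>f k \<omega>\<bar>}" for k
  have A: "A k \<in> sets M" for k
    unfolding A_def using square_integrable_measurable[OF f[of k]] by measurable
  have P: "prob (A k) \<le> C * (1/4)^k" if k: "k0 \<le> k" for k
  proof -
    have sq: "((1/2)^k)\<^sup>2 = (1/4::real)^k" by (simp add: power_mult_distrib[symmetric] power2_eq_square)
    have "(1/4)^k * prob (A k) = expectation (\<lambda>\<omega>. (1/4)^k * indicator (A k) \<omega>)" using A by simp
    also have "\<dots> \<le> expectation (\<lambda>\<omega>. (f k \<omega>)\<^sup>2)"
    proof (rule integral_mono[OF integrable_real_mult_indicator[OF A integrable_const] square_integrable_sq[OF f]])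
      fix \<omega>
      show "(1/4)^k * indicator (A k) \<omega> \<le> (f k \<omega>)\<^sup>2"
      proof (cases "\<omega> \<in> A k")
        case True
        then have "((1/2)^k)\<^sup>2 \<le> \<bar>f k \<omega>\<bar>\<^sup>2" unfolding A_def by (intro power_mono) auto
        then show ?thesis using True by (simp add: sq)
      qed simp
    qed
    also have "\<dots> \<le> (1/4)^k * (C * (1/4)^k)"
      using E[OF k] by (simp add: mult.left_commute power_mult_distrib[symmetric])
    finally show ?thesis by simp
  qed
  from AE_eventually_notin[OF A P] have "AE \<omega> in M. \<forall>\<^sub>F k in sequentially. \<omega> \<notin> A k" .
  with AE_space show ?thesis
  proof eventually_elim
    case (elim \<omega>)
    show ?case using elim(2) by eventually_elim (use elim(1) in \<open>auto simp: A_def\<close>)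
  qed
qed

text \<open>The approximations may live on any horizons \<open>T k\<close>. Stopping their grids at
  \<open>t\<close> gives simple processes on [0, t] that agree with them up to \<open>t\<close> and
  have the running integrals at \<open>t\<close> as their integrals.\<close>

lemma has_ito_integral_of_simple_pairs:
  assumes t: "0 \<le> t" and H: "square_integrable_adapted M F t H"
    and sp: "\<And>k. simple_pair M F w (T k) (S k) (J k)"
    and lS: "l2_tendsto (time_space t) (\<lambda>k (s, \<omega>). S k s \<omega>) (\<lambda>(s, \<omega>). H s \<omega>)"
    and lJ: "l2_tendsto M (\<lambda>k. J k t) Y"
  shows "has_ito_integral M F w t H Y"
proof -
  have "\<forall>k. \<exists>Z. simple_process M F (T k) (fst Z) (fst (snd Z)) (snd (snd Z)) \<and>
      S k = simple_value (fst Z) (fst (snd Z)) (snd (snd Z)) \<and> J k = running_integral w (fst Z) (fst (snd Z)) (snd (snd Z))"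
    using sp unfolding simple_pair_def by simp
  from choice[OF this] obtain Z where Z: "\<forall>k. simple_process M F (T k) (fst (Z k)) (fst (snd (Z k))) (snd (snd (Z k))) \<and>
      S k = simple_value (fst (Z k)) (fst (snd (Z k))) (snd (snd (Z k))) \<and>
      J k = running_integral w (fst (Z k)) (fst (snd (Z k))) (snd (snd (Z k)))" ..
  define m where "m k = fst (Z k)" for k
  define \<tau> where "\<tau> k = fst (snd (Z k))" for k
  define \<xi> where "\<xi> k = snd (snd (Z k))" for k
  have Z': "simple_process M F (T k) (m k) (\<tau> k) (\<xi> k)" "S k = simple_value (m k) (\<tau> k) (\<xi> k)"
    "J k = running_integral w (m k) (\<tau> k) (\<xi> k)" for k
    using Z by (simp_all add: m_def \<tau>_def \<xi>_def)
  define \<tau>' where "\<tau>' k = (\<lambda>i. min (\<tau> k i) t)" for k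
  define \<xi>' where "\<xi>' k = (\<lambda>i \<omega>. if \<tau> k i < t then \<xi> k i \<omega> else 0)" for k
  note trunc = simple_process_truncate[OF Z'(1) t, folded \<tau>'_def \<xi>'_def]
  have "(\<integral>\<^sup>+\<omega>. (\<integral>\<^sup>+s\<in>{0..t}. ennreal ((H s \<omega> - simple_value (m k) (\<tau>' k) (\<xi>' k) s \<omega>)\<^sup>2) \<partial>lborel) \<partial>M)
     = (\<integral>\<^sup>+z. ennreal (((case z of (s, \<omega>) \<Rightarrow> H s \<omega>) - (case z of (s, \<omega>) \<Rightarrow> S k s \<omega>))\<^sup>2) \<partial>time_space t)" for k
  proof -
    have "(\<integral>\<^sup>+\<omega>. (\<integral>\<^sup>+s\<in>{0..t}. ennreal ((H s \<omega> - simple_value (m k) (\<tau>' k) (\<xi>' k) s \<omega>)\<^sup>2) \<partial>lborel) \<partial>M)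
      = (\<integral>\<^sup>+\<omega>. (\<integral>\<^sup>+s\<in>{0..t}. ennreal ((H s \<omega> - S k s \<omega>)\<^sup>2) \<partial>lborel) \<partial>M)"
      by (intro nn_integral_cong) (auto simp: trunc(2) Z'(2) indicator_def)
    also have "\<dots> = (\<integral>\<^sup>+z. ennreal (case z of (s, \<omega>) \<Rightarrow> (H s \<omega> - S k s \<omega>)\<^sup>2) \<partial>time_space t)"
    proof (rule nn_integral_time_space)
      have "(\<lambda>z. ((case z of (s, \<omega>) \<Rightarrow> H s \<omega>) - (case z of (s, \<omega>) \<Rightarrow> S k s \<omega>))\<^sup>2) \<in> borel_measurable (time_space t)"
        using lS unfolding l2_tendsto_def square_integrable_def by (intro borel_measurable_power borel_measurable_diff) blast+
      then show "(\<lambda>(s, \<omega>). (H s \<omega> - S k s \<omega>)\<^sup>2) \<in> borel_measurable (time_space t)" by (simp only: split_beta')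
    qed
    finally show ?thesis by (simp only: split_beta')
  qed
  then have 1: "(\<lambda>k. \<integral>\<^sup>+\<omega>. (\<integral>\<^sup>+s\<in>{0..t}. ennreal ((H s \<omega> - simple_value (m k) (\<tau>' k) (\<xi>' k) s \<omega>)\<^sup>2) \<partial>lborel) \<partial>M) \<longlonglongrightarrow> 0"
    using nn_integral_of_l2_tendsto[OF lS] by simp
  have 2: "(\<lambda>k. \<integral>\<^sup>+\<omega>. ennreal ((Y \<omega> - simple_integral w (m k) (\<tau>' k) (\<xi>' k) \<omega>)\<^sup>2) \<partial>M) \<longlonglongrightarrow> 0"
    using nn_integral_of_l2_tendsto[OF lJ] by (simp only: trunc(3) Z'(3))
  have Y: "Y \<in> borel_measurable M" using lJ by (simp add: l2_tendsto_def square_integrable_def)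
  show ?thesis
    unfolding has_ito_integral_def using H Y trunc(1) 1 2 by blast
qed

end

section \<open>Convergence of the iterates to a solution\<close>

context picard_scheme
begin

text \<open>This lemma and the next three restate the bounds of \<open>geometric_bounds\<close> one
  at a time, in existential form, so that each can be obtained separately.\<close>

lemma iterates_geometric:
  assumes T: "0 < T"
  shows "\<exists>C k0. \<forall>k r t. k0 \<le> k \<longrightarrow> r < n \<longrightarrow> 0 \<le> t \<longrightarrow> t \<le> T \<longrightarrow> expectation (\<lambda>\<omega>. (D k r t \<omega>)\<^sup>2) \<le> C * (1/16)^k"
proof (rule geometric_bounds[OF T])
  fix C k0
  assume bound: "\<And>k r t. k0 \<le> k \<Longrightarrow> r < n \<Longrightarrow> 0 \<le> t \<Longrightarrow> t \<le> T \<Longrightarrow> expectation (\<lambda>\<omega>. (D k r t \<omega>)\<^sup>2) \<le> C * (1/16)^k"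
  show ?thesis
    by (rule exI[of _ C], rule exI[of _ k0], intro allI impI, rule bound)
qed

lemma iterates_geometric_time:
  assumes T: "0 < T"
  shows "\<exists>C k0. \<forall>k r. k0 \<le> k \<longrightarrow> r < n \<longrightarrow> integral\<^sup>L (time_space T) (\<lambda>(s, \<omega>). (D k r s \<omega>)\<^sup>2) \<le> C * (1/16)^k"
proof (rule geometric_bounds[OF T])
  fix C k0
  assume bound: "\<And>k r. k0 \<le> k \<Longrightarrow> r < n \<Longrightarrow> integral\<^sup>L (time_space T) (\<lambda>(s, \<omega>). (D k r s \<omega>)\<^sup>2) \<le> C * (1/16)^k"
  show ?thesis
    by (rule exI[of _ C], rule exI[of _ k0], intro allI impI, rule bound)
qed

lemma drift_geometric:
  assumes T: "0 < T"
  shows "\<exists>C k0. \<forall>k r. k0 \<le> k \<longrightarrow> r < n \<longrightarrow> integral\<^sup>L (time_space T) (\<lambda>(s, \<omega>). (\<Sum>q<n. a r q * D k q s \<omega>)\<^sup>2) \<le> C * (1/16)^k"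
proof (rule geometric_bounds[OF T])
  fix C k0
  assume bound: "\<And>k r. k0 \<le> k \<Longrightarrow> r < n \<Longrightarrow> integral\<^sup>L (time_space T) (\<lambda>(s, \<omega>). (\<Sum>q<n. a r q * D k q s \<omega>)\<^sup>2) \<le> C * (1/16)^k"
  show ?thesis
    by (rule exI[of _ C], rule exI[of _ k0], intro allI impI, rule bound)
qed

lemma diffusion_geometric:
  assumes T: "0 < T"
  shows "\<exists>C k0. \<forall>k r. k0 \<le> k \<longrightarrow> r < n \<longrightarrow> integral\<^sup>L (time_space T) (\<lambda>(s, \<omega>). (S (Suc k) r s \<omega> - S k r s \<omega>)\<^sup>2) \<le> C * (1/16)^k"
proof (rule geometric_bounds[OF T])
  fix C k0
  assume bound: "\<And>k r. k0 \<le> k \<Longrightarrow> r < n \<Longrightarrow> integral\<^sup>L (time_space T) (\<lambda>(s, \<omega>). (S (Suc k) r s \<omega> - S k r s \<omega>)\<^sup>2) \<le> C * (1/16)^k"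
  show ?thesis
    by (rule exI[of _ C], rule exI[of _ k0], intro allI impI, rule bound)
qed

text \<open>Doob's inequality at level (1/2)^k bounds the exceptional probability by C (1/4)^k, and
  Borel-Cantelli applies.\<close>

lemma martingale_increment_small:
  assumes T: "0 < T" and r: "r < n"
  shows "AE \<omega> in M. \<forall>\<^sub>F k in sequentially. \<forall>t. 0 \<le> t \<longrightarrow> t \<le> T \<longrightarrow> \<bar>J (Suc k) r t \<omega> - J k r t \<omega>\<bar> \<le> (1/2)^k"
proof -
  obtain C k0 where C: "\<And>k r. k0 \<le> k \<Longrightarrow> r < n \<Longrightarrow>
      integral\<^sup>L (time_space T) (\<lambda>(s, \<omega>). (S (Suc k) r s \<omega> - S k r s \<omega>)\<^sup>2) \<le> C * (1/16)^k"
    using diffusion_geometric[OF T] by blast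
  have sq: "((1/2)^k)\<^sup>2 = (1/4::real)^k" for k by (simp add: power_mult_distrib[symmetric] power2_eq_square)
  \<comment> \<open>The probability bound is conditional on \<open>k0 \<le> k\<close>, so that a set
    with this property exists for every \<open>k\<close> and a sequence of sets can be
    chosen.\<close>
  define A where "A k V \<longleftrightarrow> V \<in> sets M \<and> (k0 \<le> k \<longrightarrow> prob V \<le> C * (1/4)^k) \<and>
      (\<forall>\<omega> t. \<omega> \<in> space M - V \<longrightarrow> continuous_on {0..} (\<lambda>t. w t \<omega>) \<longrightarrow> 0 \<le> t \<longrightarrow> t \<le> T
        \<longrightarrow> \<bar>J (Suc k) r t \<omega> - J k r t \<omega>\<bar> \<le> (1/2)^k)" for k V
  have "\<exists>V. A k V" for k
  proof -
    have "0 < (1/2::real)^k" by simp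
    from elementary_maximal[OF elementary_diff[OF el[OF r, of "Suc k"] el[OF r, of k]] T this]
    obtain V where V: "V \<in> sets M"
      "prob V \<le> integral\<^sup>L (time_space T) (\<lambda>(s, \<omega>). (S (Suc k) r s \<omega> - S k r s \<omega>)\<^sup>2) / ((1/2)^k)\<^sup>2"
      "\<And>\<omega> t. \<omega> \<in> space M - V \<Longrightarrow> continuous_on {0..} (\<lambda>t. w t \<omega>) \<Longrightarrow> 0 \<le> t \<Longrightarrow> t \<le> T
        \<Longrightarrow> \<bar>J (Suc k) r t \<omega> - J k r t \<omega>\<bar> \<le> (1/2)^k"
      by blast
    have "prob V \<le> C * (1/4)^k" if k: "k0 \<le> k"
    proof -
      have "prob V \<le> (C * (1/16)^k) / (1/4)^k"
        using V(2) divide_right_mono[OF C[OF k r], of "(1/4)^k"] unfolding sq by simp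
      also have "(C * (1/16)^k) / (1/4)^k = C * (1/4)^k"
        by (simp add: power_divide power_mult_distrib[symmetric] field_simps)
      finally show ?thesis .
    qed
    with V show ?thesis unfolding A_def by blast
  qed
  then obtain V where V: "\<And>k. A k (V k)" by metis
  have "AE \<omega> in M. \<forall>\<^sub>F k in sequentially. \<omega> \<notin> V k"
    by (rule AE_eventually_notin[of V k0 C]) (use V in \<open>auto simp: A_def\<close>)
  moreover have "AE \<omega> in M. \<omega> \<notin> N0" by (rule AE_not_in[OF N0(1)])
  ultimately show ?thesis using AE_space
  proof eventually_elim
    case (elim \<omega>)
    have w: "continuous_on {0..} (\<lambda>t. w t \<omega>)" using N0(2) elim by blast
    show ?case using elim(1)
    proof eventually_elim
      case (elim k)
      then show ?case using V[of k] w \<open>\<omega> \<in> space M\<close> unfolding A_def by blast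
    qed
  qed
qed

text \<open>The absolute value stands inside the integral, so that one bound at the end
  \<open>T\<close> controls the drift increments at all earlier times.\<close>

lemma drift_increment_small:
  assumes T: "0 < T" and r: "r < n"
  shows "AE \<omega> in M. \<forall>\<^sub>F k in sequentially. (LBINT s:{0..T}. \<bar>\<Sum>q<n. a r q * D k q s \<omega>\<bar>) \<le> (1/2)^k"
proof -
  obtain C k0 where C: "\<And>k r. k0 \<le> k \<Longrightarrow> r < n \<Longrightarrow>
      integral\<^sup>L (time_space T) (\<lambda>(s, \<omega>). (\<Sum>q<n. a r q * D k q s \<omega>)\<^sup>2) \<le> C * (1/16)^k"
    using drift_geometric[OF T] by blast
  define b where "b k s \<omega> = \<bar>\<Sum>q<n. a r q * D k q s \<omega>\<bar>" for k s \<omega>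
  note lin = admissible_linear[OF D_admissible, where a = "a r"]
  have bm: "b k s \<in> borel_measurable M" if "0 \<le> s" for k s
    unfolding b_def[abs_def] by (intro borel_measurable_abs measurable_F[OF that lin(1)[OF that]])
  have bc: "continuous_on {0..T} (\<lambda>s. b k s \<omega>)" if "\<omega> \<in> space M" for k \<omega>
    unfolding b_def by (rule continuous_on_subset[OF continuous_on_rabs[OF lin(2)[OF that]]]) auto
  have bs: "square_integrable (time_space T) (\<lambda>(s, \<omega>). b k s \<omega>)" for k
  proof -
    note sq = lin(3)[OF less_imp_le[OF T], of k]
    have "integrable (time_space T) (\<lambda>(s, \<omega>). (b k s \<omega>)\<^sup>2)"
      using square_integrable_sq[OF sq] by (simp only: b_def split_beta' power2_abs)
    moreover have "(\<lambda>(s, \<omega>). b k s \<omega>) \<in> borel_measurable (time_space T)"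
      using borel_measurable_abs[OF square_integrable_measurable[OF sq]] by (simp only: b_def split_beta')
    ultimately show ?thesis by (simp only: square_integrable_def split_beta' simp_thms)
  qed
  have "AE \<omega> in M. \<forall>\<^sub>F k in sequentially. \<bar>LBINT s:{0..T}. b k s \<omega>\<bar> \<le> (1/2)^k"
  proof (rule AE_eventually_small)
    show "square_integrable M (\<lambda>\<omega>. LBINT s:{0..T}. b k s \<omega>)" for k
      by (rule time_integral_square_integrable(1)[OF less_imp_le[OF T] bs bm bc])
    fix k assume k: "k0 \<le> k"
    have "expectation (\<lambda>\<omega>. (LBINT s:{0..T}. b k s \<omega>)\<^sup>2) \<le> T * integral\<^sup>L (time_space T) (\<lambda>(s, \<omega>). (b k s \<omega>)\<^sup>2)"
      by (rule time_integral_square_integrable(2)[OF less_imp_le[OF T] bs bm bc])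
    also have "integral\<^sup>L (time_space T) (\<lambda>(s, \<omega>). (b k s \<omega>)\<^sup>2) \<le> C * (1/16)^k"
      using C[OF k r] by (simp only: b_def power2_abs)
    finally show "expectation (\<lambda>\<omega>. (LBINT s:{0..T}. b k s \<omega>)\<^sup>2) \<le> (T * C) * (1/16)^k"
      using T by (simp add: mult.assoc)
  qed
  then show ?thesis
    by eventually_elim (auto simp: b_def elim: eventually_mono)
qed

text \<open>The two parts of \<open>D (Suc k)\<close> are each at most (1/2)^k, and 2 (1/2)^k = 4
  (1/2)^(k+1) is the bound at the shifted index. Horizons and coordinates are countable, so a single
  null set serves all of them.\<close>

lemma iterates_locally_uniformly_Cauchy:
  "AE \<omega> in M. \<forall>p::nat. \<forall>r<n. \<forall>\<^sub>F k in sequentially.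
     \<forall>t. 0 \<le> t \<longrightarrow> t \<le> real p \<longrightarrow> \<bar>X (Suc k) r t \<omega> - X k r t \<omega>\<bar> \<le> 4 * (1/2)^k"
proof -
  have "AE \<omega> in M. r < n \<longrightarrow> (\<forall>\<^sub>F k in sequentially.
     \<forall>t. 0 \<le> t \<longrightarrow> t \<le> real p \<longrightarrow> \<bar>X (Suc k) r t \<omega> - X k r t \<omega>\<bar> \<le> 4 * (1/2)^k)" for p r :: nat
  proof (cases "r < n")
    case r: True
    \<comment> \<open>\<open>Suc p\<close>, since the estimates ask for a positive horizon and
      \<open>p\<close> may be 0.\<close>
    define T where "T = real (Suc p)"
    have T: "0 < T" by (simp add: T_def)
    show ?thesis
      using martingale_increment_small[OF T r] drift_increment_small[OF T r] AE_space
    proof eventually_elim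
      case (elim \<omega>)
      have "\<forall>\<^sub>F k in sequentially. \<forall>t. 0 \<le> t \<longrightarrow> t \<le> real p \<longrightarrow> \<bar>X (Suc (Suc k)) r t \<omega> - X (Suc k) r t \<omega>\<bar> \<le> 4 * (1/2)^(Suc k)"
        using elim(1,2)
      proof eventually_elim
        case (elim k)
        show ?case
        proof (intro allI impI)
          fix t assume t: "0 \<le> t" "t \<le> real p"
          have cont: "continuous_on {0..} (\<lambda>s. \<Sum>q<n. a r q * D k q s \<omega>)"
            by (rule admissible_linear(2)[OF D_admissible \<open>\<omega> \<in> space M\<close>])
          have i: "set_integrable lborel {0..u} (\<lambda>s. \<bar>\<Sum>q<n. a r q * D k q s \<omega>\<bar>)" for u
            by (rule borel_integrable_atLeastAtMost'[OF continuous_on_subset[OF continuous_on_rabs[OF cont]]]) auto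
          have "\<bar>LBINT s:{0..t}. \<Sum>q<n. a r q * D k q s \<omega>\<bar> \<le> (LBINT s:{0..t}. \<bar>\<Sum>q<n. a r q * D k q s \<omega>\<bar>)"
            unfolding time_lebesgue_integral[symmetric] by (rule integral_abs_bound)
          also have "\<dots> \<le> (LBINT s:{0..T}. \<bar>\<Sum>q<n. a r q * D k q s \<omega>\<bar>)"
            using i[unfolded set_integrable_def] t unfolding set_lebesgue_integral_def T_def
            by (intro integral_mono) (auto simp: indicator_def)
          finally have d: "\<bar>LBINT s:{0..t}. \<Sum>q<n. a r q * D k q s \<omega>\<bar> \<le> (1/2)^k"
            using elim(2) by linarith
          have j: "\<bar>J (Suc k) r t \<omega> - J k r t \<omega>\<bar> \<le> (1/2)^k"
            using elim(1) t by (simp add: T_def)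
          have "\<bar>X (Suc (Suc k)) r t \<omega> - X (Suc k) r t \<omega>\<bar> = \<bar>D (Suc k) r t \<omega>\<bar>" by (simp only: D_def)
          also have "\<dots> \<le> \<bar>LBINT s:{0..t}. \<Sum>q<n. a r q * D k q s \<omega>\<bar>
             + \<bar>indicator (space M - N0) \<omega> * (J (Suc k) r t \<omega> - J k r t \<omega>)\<bar>"
            unfolding D_Suc[OF \<open>\<omega> \<in> space M\<close>] by (rule abs_triangle_ineq)
          also have "\<bar>indicator (space M - N0) \<omega> * (J (Suc k) r t \<omega> - J k r t \<omega>)\<bar> \<le> (1/2)^k"
            using j by (cases "\<omega> \<in> space M - N0") (simp_all add: indicator_def)
          also have "\<bar>LBINT s:{0..t}. \<Sum>q<n. a r q * D k q s \<omega>\<bar> + (1/2)^k \<le> 4 * (1/2)^(Suc k)"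
            using d by simp
          finally show "\<bar>X (Suc (Suc k)) r t \<omega> - X (Suc k) r t \<omega>\<bar> \<le> 4 * (1/2)^(Suc k)" by simp
        qed
      qed
      then have "\<forall>\<^sub>F k in sequentially. \<forall>t. 0 \<le> t \<longrightarrow> t \<le> real p \<longrightarrow> \<bar>X (Suc k) r t \<omega> - X k r t \<omega>\<bar> \<le> 4 * (1/2)^k"
        by (subst (asm) eventually_sequentially_Suc)
      then show ?case by blast
    qed
  qed simp
  then show ?thesis by (simp add: AE_all_countable)
qed

text \<open>The pathwise limit \<open>Z\<close> is also the L2 limit at each time and on each
  [0, T]. Almost surely the integral \<open>J k\<close> is the next iterate minus initial value and
  drift, so its L2 limit is the required expression in \<open>Z\<close>, while the simple integrands
  tend to the diffusion term of \<open>Z\<close>.\<close>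

lemma limit_solves_linear_sde: "\<exists>Z. linear_sde n a c x0 Z"
proof -
  define good where "good \<omega> \<longleftrightarrow> (\<forall>p::nat. \<forall>r<n. \<forall>\<^sub>F k in sequentially.
     \<forall>t. 0 \<le> t \<longrightarrow> t \<le> real p \<longrightarrow> \<bar>X (Suc k) r t \<omega> - X k r t \<omega>\<bar> \<le> 4 * (1/2)^k)" for \<omega>
  have "AE \<omega> in M. good \<omega>" unfolding good_def by (rule iterates_locally_uniformly_Cauchy)
  then obtain N1 where "{\<omega> \<in> space M. \<not> good \<omega>} \<subseteq> N1" "emeasure M N1 = 0" "N1 \<in> sets M"
    by (rule AE_E)
  then have N1: "N1 \<in> null_sets M" "\<And>\<omega>. \<omega> \<in> space M - N1 \<Longrightarrow> good \<omega>"
    by auto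
  \<comment> \<open>Sets all iterates to 0 on a null set containing the paths without locally
    uniform convergence. Then \<open>Z\<close> is continuous on every path and, \<open>N1\<close>
    being in every \<open>F t\<close>, adapted.\<close>
  define G where "G \<omega> = indicat_real (space M - N1) \<omega>" for \<omega>
  define Z where "Z r t \<omega> = lim (\<lambda>k. G \<omega> * X k r t \<omega>)" for r t \<omega>
  have ev: "\<forall>\<^sub>F k in sequentially. \<forall>t. 0 \<le> t \<longrightarrow> t \<le> real p \<longrightarrow>
      \<bar>G \<omega> * X (Suc k) r t \<omega> - G \<omega> * X k r t \<omega>\<bar> \<le> 4 * (1/2)^k"
    if w: "\<omega> \<in> space M" and r: "r < n" for \<omega> r and p :: nat
  proof (cases "\<omega> \<in> N1")
    case True
    then show ?thesis by (simp add: G_def)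
  next
    case False
    with w have "good \<omega>" "G \<omega> = 1" using N1(2) by (auto simp: G_def)
    then show ?thesis using r by (simp add: good_def)
  qed
  have cont: "continuous_on {0..} (\<lambda>t. G \<omega> * X k r t \<omega>)" if "\<omega> \<in> space M" "r < n" for \<omega> r k
    by (intro continuous_on_mult_left admissibleD(3)[OF X that(2,1)])
  have Zc: "continuous_on {0..} (\<lambda>t. Z r t \<omega>)" if "\<omega> \<in> space M" "r < n" for \<omega> r
    unfolding Z_def by (rule locally_uniform_limit(1)[OF cont[OF that] ev[OF that]])
  have Zlim: "(\<lambda>k. G \<omega> * X k r t \<omega>) \<longlonglongrightarrow> Z r t \<omega>" if "\<omega> \<in> space M" "r < n" "0 \<le> t" for \<omega> r t
    unfolding Z_def by (rule locally_uniform_limit(2)[OF cont[OF that(1,2)] ev[OF that(1,2)] that(3)])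
  have Zlim': "(\<lambda>k. X k r t \<omega>) \<longlonglongrightarrow> Z r t \<omega>" if "\<omega> \<in> space M" "\<omega> \<notin> N1" "r < n" "0 \<le> t" for \<omega> r t
    using Zlim[OF that(1,3,4)] that(1,2) by (simp add: G_def)
  have ZF: "Z r t \<in> borel_measurable (F t)" if r: "r < n" and t: "0 \<le> t" for r t
  proof (rule borel_measurable_LIMSEQ_real)
    show "(\<lambda>k. G \<omega> * X k r t \<omega>) \<longlonglongrightarrow> Z r t \<omega>" if "\<omega> \<in> space (F t)" for \<omega>
      using Zlim r t that space_F[OF t] by simp
    have "space M - N1 \<in> sets (F t)"
      using null_set_F[OF N1(1) t] sets.compl_sets[of N1 "F t"] space_F[OF t] by simp
    then have "G \<in> borel_measurable (F t)" unfolding G_def[abs_def] by (rule borel_measurable_indicator)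
    then show "(\<lambda>\<omega>. G \<omega> * X k r t \<omega>) \<in> borel_measurable (F t)" for k
      by (rule borel_measurable_times[OF _ admissibleD(1)[OF X r t]])
  qed
  have l2M: "l2_tendsto M (\<lambda>k. X k r t) (Z r t)" if r: "r < n" and t: "0 \<le> t" for r t
  proof -
    \<comment> \<open>The geometric bounds ask for a positive horizon, while \<open>t\<close> may be
      0.\<close>
    have "0 < t + 1" using t by simp
    from iterates_geometric[OF this] obtain C k0 where
      C: "\<And>k r s. k0 \<le> k \<Longrightarrow> r < n \<Longrightarrow> 0 \<le> s \<Longrightarrow> s \<le> t + 1 \<Longrightarrow> expectation (\<lambda>\<omega>. (D k r s \<omega>)\<^sup>2) \<le> C * (1/16)^k"
      by blast
    show ?thesis
    proof (rule l2_tendsto_geometric)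
      show "square_integrable M (X k r t)" for k by (rule admissibleD(2)[OF X r t])
      show "Z r t \<in> borel_measurable M" by (rule measurable_F[OF t ZF[OF r t]])
      show "AE \<omega> in M. (\<lambda>k. X k r t \<omega>) \<longlonglongrightarrow> Z r t \<omega>"
        using AE_not_in[OF N1(1)] AE_space by eventually_elim (rule Zlim'[OF _ _ r t])
      show "expectation (\<lambda>\<omega>. (X (Suc k) r t \<omega> - X k r t \<omega>)\<^sup>2) \<le> C * (1/16)^k" if "k0 \<le> k" for k
        using C[OF that r t] by (simp add: D_def)
    qed
  qed
  have l2T: "l2_tendsto (time_space T) (\<lambda>k (s, \<omega>). X k r s \<omega>) (\<lambda>(s, \<omega>). Z r s \<omega>)"
    if r: "r < n" and T: "0 \<le> T" for r T
  proof -
    have "0 < T + 1" using T by simp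
    from iterates_geometric_time[OF this] obtain C k0 where
      C: "\<And>k r. k0 \<le> k \<Longrightarrow> r < n \<Longrightarrow> integral\<^sup>L (time_space (T + 1)) (\<lambda>(s, \<omega>). (D k r s \<omega>)\<^sup>2) \<le> C * (1/16)^k"
      by blast
    show ?thesis
    proof (rule l2_tendsto_geometric)
      show "square_integrable (time_space T) (\<lambda>(s, \<omega>). X k r s \<omega>)" for k
        by (rule admissibleD(4)[OF X r T])
      show "(\<lambda>(s, \<omega>). Z r s \<omega>) \<in> borel_measurable (time_space T)"
      proof (rule continuous_process_measurable_Icc[OF T])
        show "continuous_on {0..T} (\<lambda>t. Z r t \<omega>)" if "\<omega> \<in> space M" for \<omega>
          by (rule continuous_on_subset[OF Zc[OF that r]]) auto
      qed (rule measurable_F[OF _ ZF[OF r]])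
      show "AE z in time_space T. (\<lambda>k. case z of (s, \<omega>) \<Rightarrow> X k r s \<omega>) \<longlonglongrightarrow> (case z of (s, \<omega>) \<Rightarrow> Z r s \<omega>)"
        using AE_time_space_null[OF N1(1), of T] AE_space
      proof eventually_elim
        case (elim z)
        then have "snd z \<in> space M" "0 \<le> fst z" by (auto simp: space_pair_measure space_restrict_space)
        then show ?case using Zlim'[OF _ elim(1) r] by (simp add: split_beta)
      qed
      show "integral\<^sup>L (time_space T) (\<lambda>z. ((case z of (s, \<omega>) \<Rightarrow> X (Suc k) r s \<omega>) - (case z of (s, \<omega>) \<Rightarrow> X k r s \<omega>))\<^sup>2)
        \<le> C * (1/16)^k" if "k0 \<le> k" for k
      proof -
        have "integral\<^sup>L (time_space T) (\<lambda>(s, \<omega>). (D k r s \<omega>)\<^sup>2) \<le> integral\<^sup>L (time_space (T + 1)) (\<lambda>(s, \<omega>). (D k r s \<omega>)\<^sup>2)"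
          using T by (intro time_space_integral_mono(2) D_sq_integrable r) auto
        also have "\<dots> \<le> C * (1/16)^k" by (rule C[OF that r])
        finally show ?thesis by (simp only: D_def split_beta')
      qed
    qed
  qed
  have Zad: "admissible n Z"
    unfolding admissible_def
  proof (intro allI impI conjI ballI)
    fix r assume r: "r < n"
    show "Z r t \<in> borel_measurable (F t)" "square_integrable M (Z r t)" if "0 \<le> t" for t
      using ZF[OF r that] l2M[OF r that] by (auto simp: l2_tendsto_def)
    show "continuous_on {0..} (\<lambda>t. Z r t \<omega>)" if "\<omega> \<in> space M" for \<omega> by (rule Zc[OF that r])
    show "square_integrable (time_space T) (\<lambda>(t, \<omega>). Z r t \<omega>)" if "0 \<le> T" for T
      using l2T[OF r that] by (simp add: l2_tendsto_def)
  qed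
  have l2lin: "l2_tendsto (time_space t) (\<lambda>k (s, \<omega>). \<Sum>q<n. b q * X k q s \<omega>) (\<lambda>(s, \<omega>). \<Sum>q<n. b q * Z q s \<omega>)"
    if t: "0 \<le> t" for t and b :: "nat \<Rightarrow> real"
    using l2_tendsto_linear[of n "time_space t" "\<lambda>k q z. case z of (s, \<omega>) \<Rightarrow> X k q s \<omega>"
        "\<lambda>q z. case z of (s, \<omega>) \<Rightarrow> Z q s \<omega>" b] l2T[OF _ t]
    by (simp only: split_beta')
  have sde: "has_ito_integral M F w t (\<lambda>s \<omega>. \<Sum>q<n. c r q * Z q s \<omega>)
      (\<lambda>\<omega>. Z r t \<omega> - (x0 r + (LBINT s:{0..t}. \<Sum>q<n. a r q * Z q s \<omega>)))"
    if r: "r < n" and t: "0 \<le> t" for r t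
  proof (rule has_ito_integral_of_simple_pairs[OF t])
    show "square_integrable_adapted M F t (\<lambda>s \<omega>. \<Sum>q<n. c r q * Z q s \<omega>)"
      unfolding square_integrable_adapted_iff using admissible_linear(1,3)[OF Zad] t by simp
    show "simple_pair M F w (real k + 1) (S k r) (J k r)" for k by (rule S_pair[OF r])
    have pw: "(\<lambda>k. (1/16::real)^k) \<longlonglongrightarrow> 0" by (rule LIMSEQ_power_zero) simp
    show "l2_tendsto (time_space t) (\<lambda>k (s, \<omega>). S k r s \<omega>) (\<lambda>(s, \<omega>). \<Sum>q<n. c r q * Z q s \<omega>)"
    proof (rule l2_tendsto_perturb[OF l2lin[OF t]])
      show "square_integrable (time_space t) (\<lambda>(s, \<omega>). S k r s \<omega>)" for k
        by (rule elementary_integrand_square_integrable[OF el[OF r]])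
      show "(\<lambda>k. integral\<^sup>L (time_space t) (\<lambda>z. ((case z of (s, \<omega>) \<Rightarrow> S k r s \<omega>)
          - (case z of (s, \<omega>) \<Rightarrow> \<Sum>q<n. c r q * X k q s \<omega>))\<^sup>2)) \<longlonglongrightarrow> 0"
      proof (rule tendsto_sandwich[OF _ _ tendsto_const pw])
        show "\<forall>\<^sub>F k in sequentially. integral\<^sup>L (time_space t) (\<lambda>z. ((case z of (s, \<omega>) \<Rightarrow> S k r s \<omega>)
          - (case z of (s, \<omega>) \<Rightarrow> \<Sum>q<n. c r q * X k q s \<omega>))\<^sup>2) \<le> (1/16)^k"
        proof (rule eventually_sequentiallyI[of "nat \<lceil>t\<rceil>"])
          fix k assume "nat \<lceil>t\<rceil> \<le> k"
          then have "t \<le> real k + 1" by linarith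
          from S_close_le[OF r this]
          show "integral\<^sup>L (time_space t) (\<lambda>z. ((case z of (s, \<omega>) \<Rightarrow> S k r s \<omega>)
            - (case z of (s, \<omega>) \<Rightarrow> \<Sum>q<n. c r q * X k q s \<omega>))\<^sup>2) \<le> (1/16)^k"
            by (simp only: split_beta')
        qed
      qed (intro always_eventually allI Bochner_Integration.integral_nonneg zero_le_power2)
    qed
    define I where "I Y \<omega> = (LBINT s:{0..t}. \<Sum>q<n. a r q * Y q s \<omega>)" for Y :: "nat \<Rightarrow> real \<Rightarrow> 'a \<Rightarrow> real" and \<omega>
    have Isq: "square_integrable M (I Y)" if "admissible n Y" for Y
      unfolding I_def[abs_def] by (rule admissible_time_integral(2)[OF that t])
    have Idiff: "I Y \<omega> - I Y' \<omega> = I (\<lambda>q s \<omega>. Y q s \<omega> - Y' q s \<omega>) \<omega>"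
      if Y: "admissible n Y" and Y': "admissible n Y'" and w: "\<omega> \<in> space M" for Y Y' \<omega>
    proof -
      have i: "set_integrable lborel {0..t} (\<lambda>s. \<Sum>q<n. a r q * Y q s \<omega>)" if "admissible n Y" for Y
        by (rule borel_integrable_atLeastAtMost'[OF continuous_on_subset[OF admissible_linear(2)[OF that w]]]) auto
      show ?thesis
        unfolding I_def set_integral_diff(2)[OF i[OF Y] i[OF Y'], symmetric]
        by (simp only: sum_subtractf right_diff_distrib)
    qed
    \<comment> \<open>Cauchy-Schwarz in time transfers L2 convergence on the product space to the
      drift integrals at the fixed time \<open>t\<close>.\<close>
    have Ilim: "l2_tendsto M (\<lambda>k. I (X k)) (I Z)"
      unfolding l2_tendsto_def
    proof (intro conjI allI Isq X Zad)
      have lim0: "(\<lambda>k. t * integral\<^sup>L (time_space t) (\<lambda>(s, \<omega>). (\<Sum>q<n. a r q * (X k q s \<omega> - Z q s \<omega>))\<^sup>2)) \<longlonglongrightarrow> 0"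
      proof (rule tendsto_mult_right_zero)
        have "(\<lambda>k. integral\<^sup>L (time_space t) (\<lambda>z. ((case z of (s, \<omega>) \<Rightarrow> \<Sum>q<n. a r q * X k q s \<omega>)
            - (case z of (s, \<omega>) \<Rightarrow> \<Sum>q<n. a r q * Z q s \<omega>))\<^sup>2)) \<longlonglongrightarrow> 0"
          using l2lin[OF t] unfolding l2_tendsto_def by blast
        then show "(\<lambda>k. integral\<^sup>L (time_space t) (\<lambda>(s, \<omega>). (\<Sum>q<n. a r q * (X k q s \<omega> - Z q s \<omega>))\<^sup>2)) \<longlonglongrightarrow> 0"
          by (simp only: split_beta' right_diff_distrib sum_subtractf)
      qed
      show "(\<lambda>k. expectation (\<lambda>\<omega>. (I (X k) \<omega> - I Z \<omega>)\<^sup>2)) \<longlonglongrightarrow> 0"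
      proof (rule tendsto_sandwich[OF _ _ tendsto_const lim0])
        have "expectation (\<lambda>\<omega>. (I (X k) \<omega> - I Z \<omega>)\<^sup>2)
           \<le> t * integral\<^sup>L (time_space t) (\<lambda>(s, \<omega>). (\<Sum>q<n. a r q * (X k q s \<omega> - Z q s \<omega>))\<^sup>2)" for k
        proof -
          have "expectation (\<lambda>\<omega>. (I (X k) \<omega> - I Z \<omega>)\<^sup>2) = expectation (\<lambda>\<omega>. (I (\<lambda>q s \<omega>. X k q s \<omega> - Z q s \<omega>) \<omega>)\<^sup>2)"
            by (intro Bochner_Integration.integral_cong refl) (simp only: Idiff[OF X Zad])
          also have "\<dots> \<le> t * integral\<^sup>L (time_space t) (\<lambda>(s, \<omega>). (\<Sum>q<n. a r q * (X k q s \<omega> - Z q s \<omega>))\<^sup>2)"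
            unfolding I_def by (rule admissible_time_integral(3)[OF admissible_diff[OF X Zad] t])
          finally show ?thesis .
        qed
        then show "\<forall>\<^sub>F k in sequentially. expectation (\<lambda>\<omega>. (I (X k) \<omega> - I Z \<omega>)\<^sup>2)
           \<le> t * integral\<^sup>L (time_space t) (\<lambda>(s, \<omega>). (\<Sum>q<n. a r q * (X k q s \<omega> - Z q s \<omega>))\<^sup>2)"
          by (intro always_eventually allI)
      qed (intro always_eventually allI Bochner_Integration.integral_nonneg zero_le_power2)
    qed
    have x0sq: "square_integrable M (\<lambda>_. x0 r)"
      by (auto intro!: square_integrable_bounded[OF finite_measure_axioms])
    have Xs: "l2_tendsto M (\<lambda>k. X (Suc k) r t) (Z r t)"
      using l2M[OF r t] LIMSEQ_Suc[of "\<lambda>k. expectation (\<lambda>\<omega>. (X k r t \<omega> - Z r t \<omega>)\<^sup>2)"]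
      by (simp add: l2_tendsto_def)
    have lim: "l2_tendsto M (\<lambda>k \<omega>. (X (Suc k) r t \<omega> - x0 r) - I (X k) \<omega>) (\<lambda>\<omega>. (Z r t \<omega> - x0 r) - I Z \<omega>)"
      by (rule l2_tendsto_diff[OF l2_tendsto_diff[OF Xs l2_tendsto_const[OF x0sq]] Ilim])
    have "l2_tendsto M (\<lambda>k. J k r t) (\<lambda>\<omega>. (Z r t \<omega> - x0 r) - I Z \<omega>)"
    proof (rule l2_tendsto_perturb[OF lim])
      show "square_integrable M (J k r t)" for k
        by (rule elementary_integral_square_integrable[OF el[OF r] t])
      \<comment> \<open>Off \<open>N0\<close> this is the recursion \<open>X_Suc\<close> solved for
        \<open>J\<close>.\<close>
      have "expectation (\<lambda>\<omega>. (J k r t \<omega> - ((X (Suc k) r t \<omega> - x0 r) - I (X k) \<omega>))\<^sup>2) = 0" for k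
      proof (rule integral_eq_zero_AE)
        show "AE \<omega> in M. (J k r t \<omega> - ((X (Suc k) r t \<omega> - x0 r) - I (X k) \<omega>))\<^sup>2 = 0"
          using AE_not_in[OF N0(1)] AE_space by eventually_elim (simp add: X_Suc I_def)
      qed
      then show "(\<lambda>k. expectation (\<lambda>\<omega>. (J k r t \<omega> - ((X (Suc k) r t \<omega> - x0 r) - I (X k) \<omega>))\<^sup>2)) \<longlonglongrightarrow> 0" by simp
    qed
    then show "l2_tendsto M (\<lambda>k. J k r t) (\<lambda>\<omega>. Z r t \<omega> - (x0 r + (LBINT s:{0..t}. \<Sum>q<n. a r q * Z q s \<omega>)))"
      by (simp only: I_def diff_diff_eq)
  qed
  have "linear_sde n a c x0 Z"
    unfolding linear_sde_def
  proof (intro conjI allI impI ballI)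
    show "square_integrable_adapted M F T (Z r)" if "0 \<le> T" "r < n" for T r
      unfolding square_integrable_adapted_iff using admissibleD(1,4)[OF Zad that(2)] that(1) by simp
    show "continuous_on {0..} (\<lambda>t. Z r t \<omega>)" if "\<omega> \<in> space M" "r < n" for \<omega> r
      by (rule Zc[OF that])
    show "\<exists>Y. has_ito_integral M F w t (\<lambda>s \<omega>. \<Sum>q<n. c r q * Z q s \<omega>) Y \<and>
      (AE \<omega> in M. Z r t \<omega> = x0 r + (LBINT s:{0..t}. \<Sum>q<n. a r q * Z q s \<omega>) + Y \<omega>)" if "0 \<le> t" "r < n" for t r
      by (rule exI, rule conjI, rule sde[OF that(2,1)]) simp
  qed
  then show ?thesis by (rule exI[of _ Z])
qed

end

lemma (in wiener_setting) linear_sde_exists: "\<exists>Z. linear_sde n a c x0 Z"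
proof -
  obtain N0 where N0: "N0 \<in> null_sets M"
    "\<And>\<omega>. \<omega> \<in> space M - N0 \<Longrightarrow> continuous_on {0..} (\<lambda>t. w t \<omega>)"
    using continuous_paths by blast
  obtain X S J where "\<And>k. admissible n (X k)"
    "\<And>k r. r < n \<Longrightarrow> simple_pair M F w (real k + 1) (S k r) (J k r)"
    "\<And>k r. r < n \<Longrightarrow> integral\<^sup>L (time_space (real k + 1))
        (\<lambda>(t, \<omega>). (S k r t \<omega> - (\<Sum>q<n. c r q * X k q t \<omega>))\<^sup>2) \<le> (1/16)^k"
    "\<And>k r t \<omega>. X (Suc k) r t \<omega> = x0 r + (LBINT s:{0..t}. \<Sum>q<n. a r q * X k q s \<omega>)
        + indicator (space M - N0) \<omega> * J k r t \<omega>"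
    using picard_sequence[OF N0, of n c x0 a] by blast
  then interpret picard_scheme M F w n a c x0 N0 X S J
    using N0 by unfold_locales blast+
  show ?thesis by (rule limit_solves_linear_sde)
qed

section \<open>Second moments and the Lyapunov operator\<close>

lemma set_integral_sum:
  fixes f :: "'i \<Rightarrow> 'b \<Rightarrow> real"
  assumes "\<And>i. i \<in> I \<Longrightarrow> set_integrable N A (f i)"
  shows "set_integrable N A (\<lambda>x. \<Sum>i\<in>I. f i x)"
    and "(LINT x:A|N. \<Sum>i\<in>I. f i x) = (\<Sum>i\<in>I. LINT x:A|N. f i x)"
  using assms unfolding set_integrable_def set_lebesgue_integral_def scaleR_sum_right
  by (auto intro!: Bochner_Integration.integrable_sum Bochner_Integration.integral_sum)

definition lyapunov :: "real mat \<Rightarrow> real mat \<Rightarrow> real mat \<Rightarrow> real mat" where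
  "lyapunov A C P = P * A + A\<^sup>T * P + C\<^sup>T * P * C"

lemma lyapunov_carrier:
  "A \<in> carrier_mat n n \<Longrightarrow> C \<in> carrier_mat n n \<Longrightarrow> P \<in> carrier_mat n n \<Longrightarrow> lyapunov A C P \<in> carrier_mat n n"
  by (auto simp: lyapunov_def)

lemma bilinear_expand:
  fixes P :: "real mat"
  assumes "P \<in> carrier_mat n n" "u \<in> carrier_vec n" "v \<in> carrier_vec n"
  shows "u \<bullet> (P *\<^sub>v v) = (\<Sum>i<n. \<Sum>j<n. P $$ (i, j) * (u $ i * v $ j))"
  using assms
  by (auto simp: scalar_prod_def mult_mat_vec_def row_def atLeast0LessThan sum_distrib_left intro!: sum.cong)

lemma mult_mat_vec_expand:
  assumes "P \<in> carrier_mat m n" "v \<in> carrier_vec n" "i < m"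
  shows "(P *\<^sub>v v) $ i = (\<Sum>j<n. P $$ (i, j) * v $ j)"
  using assms by (auto simp: scalar_prod_def mult_mat_vec_def row_def atLeast0LessThan intro!: sum.cong)

lemma quad_form_expand:
  assumes "P \<in> carrier_mat n n" "v \<in> carrier_vec n"
  shows "quad_form P v = (\<Sum>i<n. \<Sum>j<n. P $$ (i, j) * (v $ i * v $ j))"
  unfolding quad_form_def by (rule bilinear_expand[OF assms(1,2,2)])

lemma scalar_prod_transpose:
  assumes "A \<in> carrier_mat m n" "u \<in> carrier_vec m" "v \<in> carrier_vec n"
  shows "v \<bullet> (A\<^sup>T *\<^sub>v u) = (A *\<^sub>v v) \<bullet> (u :: real vec)"
proof -
  have "v \<bullet> (A\<^sup>T *\<^sub>v u) = (A\<^sup>T *\<^sub>v u) \<bullet> v"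
    using assms by (intro comm_scalar_prod[of _ n]) auto
  also have "\<dots> = u \<bullet> (A *\<^sub>v v)"
    by (rule transpose_vec_mult_scalar[OF assms(1,3,2)])
  also have "\<dots> = (A *\<^sub>v v) \<bullet> u"
    using assms by (intro comm_scalar_prod[of _ m]) auto
  finally show ?thesis .
qed

lemma quad_form_lyapunov:
  assumes "A \<in> carrier_mat n n" "C \<in> carrier_mat n n" "P \<in> carrier_mat n n" "v \<in> carrier_vec n"
  shows "quad_form (lyapunov A C P) v
    = v \<bullet> (P *\<^sub>v (A *\<^sub>v v)) + (A *\<^sub>v v) \<bullet> (P *\<^sub>v v) + (C *\<^sub>v v) \<bullet> (P *\<^sub>v (C *\<^sub>v v))"
proof -
  have m: "P * A \<in> carrier_mat n n" "A\<^sup>T * P \<in> carrier_mat n n" "C\<^sup>T * P * C \<in> carrier_mat n n"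
    using assms by auto
  have "lyapunov A C P *\<^sub>v v = P *\<^sub>v (A *\<^sub>v v) + A\<^sup>T *\<^sub>v (P *\<^sub>v v) + C\<^sup>T *\<^sub>v (P *\<^sub>v (C *\<^sub>v v))"
  proof -
    have "lyapunov A C P *\<^sub>v v = (P * A) *\<^sub>v v + (A\<^sup>T * P) *\<^sub>v v + (C\<^sup>T * P * C) *\<^sub>v v"
      unfolding lyapunov_def using m assms(4)
      by (subst add_mult_distrib_mat_vec[of _ n n], simp, simp, simp)+ simp
    also have "(P * A) *\<^sub>v v = P *\<^sub>v (A *\<^sub>v v)" using assms by (intro assoc_mult_mat_vec)
    also have "(A\<^sup>T * P) *\<^sub>v v = A\<^sup>T *\<^sub>v (P *\<^sub>v v)" using assms by (intro assoc_mult_mat_vec[of _ n n]) auto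
    also have "(C\<^sup>T * P * C) *\<^sub>v v = C\<^sup>T *\<^sub>v (P *\<^sub>v (C *\<^sub>v v))"
    proof -
      have "(C\<^sup>T * P * C) *\<^sub>v v = (C\<^sup>T * P) *\<^sub>v (C *\<^sub>v v)"
        using assms by (intro assoc_mult_mat_vec[of _ n n]) auto
      also have "\<dots> = C\<^sup>T *\<^sub>v (P *\<^sub>v (C *\<^sub>v v))"
        using assms by (intro assoc_mult_mat_vec[of _ n n]) auto
      finally show ?thesis .
    qed
    finally show ?thesis .
  qed
  moreover have "v \<bullet> (P *\<^sub>v (A *\<^sub>v v) + A\<^sup>T *\<^sub>v (P *\<^sub>v v) + C\<^sup>T *\<^sub>v (P *\<^sub>v (C *\<^sub>v v)))
      = v \<bullet> (P *\<^sub>v (A *\<^sub>v v)) + v \<bullet> (A\<^sup>T *\<^sub>v (P *\<^sub>v v)) + v \<bullet> (C\<^sup>T *\<^sub>v (P *\<^sub>v (C *\<^sub>v v)))"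
    using assms by (subst scalar_prod_add_distrib[of _ n], auto)+
  ultimately show ?thesis
    unfolding quad_form_def
    using scalar_prod_transpose[of A n n "P *\<^sub>v v" v] scalar_prod_transpose[of C n n "P *\<^sub>v (C *\<^sub>v v)" v] assms
    by simp
qed

section \<open>Evolution of second moments\<close>

context wiener_setting
begin

definition moment :: "nat \<Rightarrow> (nat \<Rightarrow> real \<Rightarrow> 'a \<Rightarrow> real) \<Rightarrow> real mat \<Rightarrow> real \<Rightarrow> real" where
  "moment n X P t = expectation (\<lambda>\<omega>. quad_form P (vec n (\<lambda>r. X r t \<omega>)))"

lemma moment_expand:
  assumes P: "P \<in> carrier_mat n n" and X: "\<And>r. r < n \<Longrightarrow> square_integrable M (X r t)"
  shows "integrable M (\<lambda>\<omega>. quad_form P (vec n (\<lambda>r. X r t \<omega>)))"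
    and "moment n X P t = (\<Sum>i<n. \<Sum>j<n. P $$ (i, j) * expectation (\<lambda>\<omega>. X i t \<omega> * X j t \<omega>))"
proof -
  have q: "quad_form P (vec n (\<lambda>r. X r t \<omega>)) = (\<Sum>i<n. \<Sum>j<n. P $$ (i, j) * (X i t \<omega> * X j t \<omega>))" for \<omega>
    using quad_form_expand[OF P, of "vec n (\<lambda>r. X r t \<omega>)"] by simp
  have i: "integrable M (\<lambda>\<omega>. P $$ (i, j) * (X i t \<omega> * X j t \<omega>))" if "i < n" "j < n" for i j
    using square_integrable_mult[OF X[OF that(1)] X[OF that(2)]] by simp
  show "integrable M (\<lambda>\<omega>. quad_form P (vec n (\<lambda>r. X r t \<omega>)))"
    unfolding q by (intro Bochner_Integration.integrable_sum i) auto
  have "moment n X P t = (\<Sum>i<n. expectation (\<lambda>\<omega>. \<Sum>j<n. P $$ (i, j) * (X i t \<omega> * X j t \<omega>)))"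
    unfolding moment_def q
    by (intro Bochner_Integration.integral_sum Bochner_Integration.integrable_sum i) auto
  also have "\<dots> = (\<Sum>i<n. \<Sum>j<n. expectation (\<lambda>\<omega>. P $$ (i, j) * (X i t \<omega> * X j t \<omega>)))"
    by (intro sum.cong refl Bochner_Integration.integral_sum i) auto
  finally show "moment n X P t = (\<Sum>i<n. \<Sum>j<n. P $$ (i, j) * expectation (\<lambda>\<omega>. X i t \<omega> * X j t \<omega>))"
    by simp
qed

context
  fixes n :: nat and A C :: "real mat" and x0 :: "real vec" and X :: "nat \<Rightarrow> real \<Rightarrow> 'a \<Rightarrow> real"
  assumes A: "A \<in> carrier_mat n n" and C: "C \<in> carrier_mat n n" and x0: "x0 \<in> carrier_vec n"
    and X: "linear_sde n (\<lambda>r q. A $$ (r, q)) (\<lambda>r q. C $$ (r, q)) (\<lambda>r. x0 $ r) X"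
begin

lemma linear_sde_square_integrable: "r < n \<Longrightarrow> 0 \<le> t \<Longrightarrow> square_integrable M (X r t)"
  by (rule ito_process_square_integrable(1)[OF linear_sde_ito_process[OF X]])

lemma moment_integrable:
  "P \<in> carrier_mat n n \<Longrightarrow> 0 \<le> t \<Longrightarrow> integrable M (\<lambda>\<omega>. quad_form P (vec n (\<lambda>r. X r t \<omega>)))"
  by (rule moment_expand(1)) (auto intro: linear_sde_square_integrable)

text \<open>Dynkin's formula for a quadratic form: the product formula for each pair of coordinates,
  weighted by the entries of \<open>P\<close> and summed. The integrand \<open>e i j\<close>
  collects the three terms of the product formula, and their weighted sum is the Lyapunov form by
  \<open>quad_form_lyapunov\<close>.\<close>

lemma moment_evolution:
  assumes P: "P \<in> carrier_mat n n" and t: "0 \<le> t"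
  shows "set_integrable lborel {0..t} (moment n X (lyapunov A C P))"
    and "moment n X P t = quad_form P x0 + (LBINT s:{0..t}. moment n X (lyapunov A C P) s)"
proof -
  define b where "b i s \<omega> = (\<Sum>q<n. A $$ (i, q) * X q s \<omega>)" for i s \<omega>
  define \<sigma> where "\<sigma> i s \<omega> = (\<Sum>q<n. C $$ (i, q) * X q s \<omega>)" for i s \<omega>
  have ito: "ito_process (x0 $ i) (b i) (\<sigma> i) (X i)" if "i < n" for i
    unfolding b_def[abs_def] \<sigma>_def[abs_def] by (rule linear_sde_ito_process[OF X that])
  define e where "e i j s = expectation (\<lambda>\<omega>. b i s \<omega> * X j s \<omega>) + expectation (\<lambda>\<omega>. X i s \<omega> * b j s \<omega>)
      + expectation (\<lambda>\<omega>. \<sigma> i s \<omega> * \<sigma> j s \<omega>)" for i j s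
  have e_int: "set_integrable lborel {0..t} (e i j)" if ij: "i < n" "j < n" for i j
  proof -
    note pi = ito_process_drift[OF ito[OF ij(1)] t] and pj = ito_process_drift[OF ito[OF ij(2)] t]
    show ?thesis
      unfolding e_def[abs_def]
      by (intro set_integral_add(1) time_space_Fubini(2) square_integrable_time_mult pi(1,6,8) pj(1,6,8))
  qed
  have e_moment: "(\<Sum>i<n. \<Sum>j<n. P $$ (i, j) * e i j s) = moment n X (lyapunov A C P) s" if s: "0 \<le> s" for s
  proof -
    have Xs: "square_integrable M (X i s)" if "i < n" for i by (rule linear_sde_square_integrable[OF that s])
    have bs: "square_integrable M (b i s)" and \<sigma>s: "square_integrable M (\<sigma> i s)" for i
      unfolding b_def[abs_def] \<sigma>_def[abs_def] by (intro square_integrable_linear_combination Xs; assumption)+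
    have eq: "e i j s = expectation (\<lambda>\<omega>. b i s \<omega> * X j s \<omega> + X i s \<omega> * b j s \<omega> + \<sigma> i s \<omega> * \<sigma> j s \<omega>)"
      and int: "integrable M (\<lambda>\<omega>. b i s \<omega> * X j s \<omega> + X i s \<omega> * b j s \<omega> + \<sigma> i s \<omega> * \<sigma> j s \<omega>)"
      if ij: "i < n" "j < n" for i j
      using square_integrable_mult[OF bs Xs[OF ij(2)]] square_integrable_mult[OF Xs[OF ij(1)] bs]
        square_integrable_mult[OF \<sigma>s \<sigma>s] by (simp_all add: e_def)
    have pt: "(\<Sum>i<n. \<Sum>j<n. P $$ (i, j) * (b i s \<omega> * X j s \<omega> + X i s \<omega> * b j s \<omega> + \<sigma> i s \<omega> * \<sigma> j s \<omega>))
       = quad_form (lyapunov A C P) (vec n (\<lambda>r. X r s \<omega>))" for \<omega>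
    proof -
      define v where "v = vec n (\<lambda>r. X r s \<omega>)"
      have v: "v \<in> carrier_vec n" "\<And>i. i < n \<Longrightarrow> v $ i = X i s \<omega>" by (simp_all add: v_def)
      have Av: "A *\<^sub>v v \<in> carrier_vec n" "\<And>i. i < n \<Longrightarrow> (A *\<^sub>v v) $ i = b i s \<omega>"
        using A v mult_mat_vec_expand[OF A v(1)] by (auto simp: b_def)
      have Cv: "C *\<^sub>v v \<in> carrier_vec n" "\<And>i. i < n \<Longrightarrow> (C *\<^sub>v v) $ i = \<sigma> i s \<omega>"
        using C v mult_mat_vec_expand[OF C v(1)] by (auto simp: \<sigma>_def)
      have "quad_form (lyapunov A C P) v
        = (\<Sum>i<n. \<Sum>j<n. P $$ (i, j) * (X i s \<omega> * b j s \<omega>)) + (\<Sum>i<n. \<Sum>j<n. P $$ (i, j) * (b i s \<omega> * X j s \<omega>))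
          + (\<Sum>i<n. \<Sum>j<n. P $$ (i, j) * (\<sigma> i s \<omega> * \<sigma> j s \<omega>))"
        unfolding quad_form_lyapunov[OF A C P v(1)] bilinear_expand[OF P v(1) Av(1)]
          bilinear_expand[OF P Av(1) v(1)] bilinear_expand[OF P Cv(1) Cv(1)]
        by (intro arg_cong2[of _ _ _ _ "(+)"] sum.cong refl) (simp_all add: v(2) Av(2) Cv(2))
      then show ?thesis
        by (simp add: v_def[symmetric] sum.distrib[symmetric] algebra_simps)
    qed
    have "(\<Sum>i<n. \<Sum>j<n. P $$ (i, j) * e i j s)
      = (\<Sum>i<n. \<Sum>j<n. expectation (\<lambda>\<omega>. P $$ (i, j) * (b i s \<omega> * X j s \<omega> + X i s \<omega> * b j s \<omega> + \<sigma> i s \<omega> * \<sigma> j s \<omega>)))"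
      by (intro sum.cong refl) (simp add: eq)
    also have "\<dots> = (\<Sum>i<n. expectation (\<lambda>\<omega>. \<Sum>j<n. P $$ (i, j) * (b i s \<omega> * X j s \<omega> + X i s \<omega> * b j s \<omega> + \<sigma> i s \<omega> * \<sigma> j s \<omega>)))"
      by (intro sum.cong refl Bochner_Integration.integral_sum[symmetric] integrable_mult_right int) auto
    also have "\<dots> = expectation (\<lambda>\<omega>. \<Sum>i<n. \<Sum>j<n. P $$ (i, j) * (b i s \<omega> * X j s \<omega> + X i s \<omega> * b j s \<omega> + \<sigma> i s \<omega> * \<sigma> j s \<omega>))"
      by (intro Bochner_Integration.integral_sum[symmetric] Bochner_Integration.integrable_sum integrable_mult_right int) auto
    also have "\<dots> = moment n X (lyapunov A C P) s"
      unfolding pt moment_def ..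
    finally show ?thesis .
  qed
  have sum_int: "set_integrable lborel {0..t} (\<lambda>s. P $$ (i, j) * e i j s)" if "i < n" "j < n" for i j
    using e_int[OF that] by simp
  have row_int: "set_integrable lborel {0..t} (\<lambda>s. \<Sum>j<n. P $$ (i, j) * e i j s)" if "i < n" for i
    by (intro set_integral_sum(1) sum_int that) auto
  have tot: "set_integrable lborel {0..t} (\<lambda>s. \<Sum>i<n. \<Sum>j<n. P $$ (i, j) * e i j s)"
    by (intro set_integral_sum(1) row_int) auto
  show "set_integrable lborel {0..t} (moment n X (lyapunov A C P))"
    by (rule set_integrable_cong[THEN iffD1, OF refl refl _ tot]) (simp add: e_moment)
  have "moment n X P t = (\<Sum>i<n. \<Sum>j<n. P $$ (i, j) * (x0 $ i * x0 $ j + (LBINT s:{0..t}. e i j s)))"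
  proof -
    have "expectation (\<lambda>\<omega>. X i t \<omega> * X j t \<omega>) = x0 $ i * x0 $ j + (LBINT s:{0..t}. e i j s)" if "i < n" "j < n" for i j
      unfolding e_def by (rule ito_process_product[OF ito[OF that(1)] ito[OF that(2)] t])
    moreover have "moment n X P t = (\<Sum>i<n. \<Sum>j<n. P $$ (i, j) * expectation (\<lambda>\<omega>. X i t \<omega> * X j t \<omega>))"
      by (rule moment_expand(2)[OF P]) (rule linear_sde_square_integrable[OF _ t])
    ultimately show ?thesis by simp
  qed
  also have "\<dots> = quad_form P x0 + (\<Sum>i<n. \<Sum>j<n. LBINT s:{0..t}. P $$ (i, j) * e i j s)"
    unfolding quad_form_expand[OF P x0] by (simp add: distrib_left sum.distrib)
  also have "(\<Sum>i<n. \<Sum>j<n. LBINT s:{0..t}. P $$ (i, j) * e i j s) = (LBINT s:{0..t}. \<Sum>i<n. \<Sum>j<n. P $$ (i, j) * e i j s)"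
  proof -
    have "(\<Sum>i<n. \<Sum>j<n. LBINT s:{0..t}. P $$ (i, j) * e i j s) = (\<Sum>i<n. LBINT s:{0..t}. \<Sum>j<n. P $$ (i, j) * e i j s)"
      by (intro sum.cong refl set_integral_sum(2)[symmetric] sum_int) auto
    also have "\<dots> = (LBINT s:{0..t}. \<Sum>i<n. \<Sum>j<n. P $$ (i, j) * e i j s)"
      by (intro set_integral_sum(2)[symmetric] row_int) auto
    finally show ?thesis .
  qed
  also have "\<dots> = (LBINT s:{0..t}. moment n X (lyapunov A C P) s)"
    by (rule set_lebesgue_integral_cong) (auto simp: e_moment)
  finally show "moment n X P t = quad_form P x0 + (LBINT s:{0..t}. moment n X (lyapunov A C P) s)" .
qed

text \<open>By \<open>moment_evolution\<close> the moment is a constant plus an indefinite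
  integral.\<close>

lemma moment_continuous:
  assumes P: "P \<in> carrier_mat n n" and T: "0 \<le> T"
  shows "continuous_on {0..T} (moment n X P)"
proof -
  have "continuous_on {0..T} (\<lambda>t. quad_form P x0 + integral {0..t} (moment n X (lyapunov A C P)))"
    by (intro continuous_intros indefinite_integral_continuous_1
        set_borel_integral_eq_integral(1)[OF moment_evolution(1)[OF P T]])
  then show ?thesis
    by (rule continuous_on_cong[THEN iffD1, OF refl, rotated])
      (simp add: moment_evolution(2)[OF P] set_borel_integral_eq_integral(2)[OF moment_evolution(1)[OF P]])
qed

end

end

section \<open>Positive definite matrices and the Lyapunov equation\<close>

text \<open>Delivers the value of \<open>mat_inverse\<close> itself, because
  \<open>riccati_gain\<close> is stated through it.\<close>

lemma invertible_of_trivial_kernel: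
  fixes A :: "real mat"
  assumes A: "A \<in> carrier_mat n n" and ker: "\<And>v. v \<in> carrier_vec n \<Longrightarrow> A *\<^sub>v v = 0\<^sub>v n \<Longrightarrow> v = 0\<^sub>v n"
  obtains B where "mat_inverse A = Some B" "B \<in> carrier_mat n n" "A * B = 1\<^sub>m n" "B * A = 1\<^sub>m n"
proof -
  have "det A \<noteq> 0" using ker unfolding det_0_iff_vec_prod_zero[OF A] by blast
  from det_non_zero_imp_unit[OF A this, of undefined] mat_inverse(1)[OF A, of undefined]
  obtain B where B: "mat_inverse A = Some B" by (cases "mat_inverse A") auto
  with mat_inverse(2)[OF A B] show thesis using that by blast
qed

section \<open>Quadratic forms of symmetric and positive definite matrices\<close>

lemma quad_form_zero: "S \<in> carrier_mat n n \<Longrightarrow> quad_form S (0\<^sub>v n) = 0"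
  by (simp add: quad_form_expand)

lemma pos_defD:
  assumes "S \<in> pos_def_mats n"
  shows "S \<in> carrier_mat n n" "S\<^sup>T = S" "v \<in> carrier_vec n \<Longrightarrow> v \<noteq> 0\<^sub>v n \<Longrightarrow> 0 < quad_form S v"
    "v \<in> carrier_vec n \<Longrightarrow> 0 \<le> quad_form S v"
proof -
  show S: "S \<in> carrier_mat n n" and "S\<^sup>T = S"
    and pos: "v \<in> carrier_vec n \<Longrightarrow> v \<noteq> 0\<^sub>v n \<Longrightarrow> 0 < quad_form S v"
    using assms by (auto simp: pos_def_mats_def)
  show "v \<in> carrier_vec n \<Longrightarrow> 0 \<le> quad_form S v"
    using pos quad_form_zero[OF S] by (cases "v = 0\<^sub>v n") auto
qed

lemma pos_semidefD:
  assumes "S \<in> pos_semidef_mats n"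
  shows "S \<in> carrier_mat n n" "S\<^sup>T = S" "v \<in> carrier_vec n \<Longrightarrow> 0 \<le> quad_form S v"
  using assms by (auto simp: pos_semidef_mats_def)

lemma pos_def_imp_semidef: "S \<in> pos_def_mats n \<Longrightarrow> S \<in> pos_semidef_mats n"
  using pos_defD[of S n] by (auto simp: pos_semidef_mats_def)

lemma pos_def_inverse:
  assumes S: "S \<in> pos_def_mats n"
  obtains B where "mat_inverse S = Some B" "B \<in> carrier_mat n n" "S * B = 1\<^sub>m n" "B * S = 1\<^sub>m n"
proof (rule invertible_of_trivial_kernel[OF pos_defD(1)[OF S]])
  fix v assume v: "v \<in> carrier_vec n" "S *\<^sub>v v = 0\<^sub>v n"
  then have "quad_form S v = 0" by (simp add: quad_form_def)
  then show "v = 0\<^sub>v n" using pos_defD(3)[OF S v(1)] by fastforce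
qed (rule that)

lemma symmetric_scalar_prod:
  fixes S :: "real mat"
  assumes "S \<in> carrier_mat n n" "S\<^sup>T = S" "u \<in> carrier_vec n" "v \<in> carrier_vec n"
  shows "u \<bullet> (S *\<^sub>v v) = v \<bullet> (S *\<^sub>v u)"
  using scalar_prod_transpose[of S n n u v] comm_scalar_prod[of "S *\<^sub>v v" n u] assms by simp

lemma quad_form_add:
  assumes S: "S \<in> carrier_mat n n" "S\<^sup>T = S" and u: "u \<in> carrier_vec n" and v: "v \<in> carrier_vec n"
  shows "quad_form S (u + v) = quad_form S u + 2 * (u \<bullet> (S *\<^sub>v v)) + quad_form S v"
proof -
  have c: "S *\<^sub>v u \<in> carrier_vec n" "S *\<^sub>v v \<in> carrier_vec n" using S u v by auto
  have "quad_form S (u + v) = u \<bullet> (S *\<^sub>v u) + v \<bullet> (S *\<^sub>v u) + (u \<bullet> (S *\<^sub>v v) + v \<bullet> (S *\<^sub>v v))"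
    unfolding quad_form_def mult_add_distrib_mat_vec[OF S(1) u v]
      scalar_prod_add_distrib[OF add_carrier_vec[OF u v] c]
      add_scalar_prod_distrib[OF u v c(1)] add_scalar_prod_distrib[OF u v c(2)] by simp
  then show ?thesis
    using symmetric_scalar_prod[OF S u v] by (simp add: quad_form_def)
qed

lemma quad_form_smult:
  assumes S: "S \<in> carrier_mat n n" and v: "v \<in> carrier_vec n"
  shows "quad_form S (k \<cdot>\<^sub>v v) = k\<^sup>2 * quad_form S v"
proof -
  have "S *\<^sub>v v \<in> carrier_vec n" using S v by auto
  then show ?thesis
    unfolding quad_form_def mult_mat_vec[OF S v] using v by (simp add: power2_eq_square)
qed

lemma quad_form_one: "v \<in> carrier_vec n \<Longrightarrow> quad_form (1\<^sub>m n) v = v \<bullet> v"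
  by (simp add: quad_form_def)

lemma scalar_prod_self_eq: "v \<in> carrier_vec n \<Longrightarrow> v \<bullet> v = (\<Sum>i<n. (v $ i)\<^sup>2)" for v :: "real vec"
  by (auto simp: scalar_prod_def atLeast0LessThan power2_eq_square)

lemma scalar_prod_self_nonneg: "v \<in> carrier_vec n \<Longrightarrow> 0 \<le> v \<bullet> v" for v :: "real vec"
  by (simp add: scalar_prod_self_eq sum_nonneg)

lemma scalar_prod_self_zero:
  fixes v :: "real vec"
  assumes v: "v \<in> carrier_vec n" and z: "v \<bullet> v = 0"
  shows "v = 0\<^sub>v n"
proof (rule eq_vecI)
  fix i assume "i < dim_vec (0\<^sub>v n :: real vec)"
  then have i: "i < n" by simp
  have "(v $ i)\<^sup>2 \<le> (\<Sum>i<n. (v $ i)\<^sup>2)"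
    using i by (intro member_le_sum) auto
  then have "(v $ i)\<^sup>2 \<le> 0" using z scalar_prod_self_eq[OF v] by simp
  then show "v $ i = 0\<^sub>v n $ i" using i by simp
qed (use v in simp)

text \<open>Each product of two coordinates is at most the squared norm, so the sum of the absolute
  entries is a bound; the added 1 makes it positive.\<close>

lemma quad_form_bound:
  assumes S: "S \<in> carrier_mat n n"
  obtains c where "0 < c" "\<And>v. v \<in> carrier_vec n \<Longrightarrow> \<bar>quad_form S v\<bar> \<le> c * (v \<bullet> v)"
proof -
  define c where "c = 1 + (\<Sum>i<n. \<Sum>j<n. \<bar>S $$ (i, j)\<bar>)"
  have "0 < c" unfolding c_def by (intro add_pos_nonneg sum_nonneg) auto
  moreover have "\<bar>quad_form S v\<bar> \<le> c * (v \<bullet> v)" if v: "v \<in> carrier_vec n" for v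
  proof -
    note nonneg = scalar_prod_self_nonneg[OF v]
    have le: "\<bar>v $ i * v $ j\<bar> \<le> v \<bullet> v" if "i < n" "j < n" for i j
    proof -
      have "(v $ i)\<^sup>2 \<le> v \<bullet> v" "(v $ j)\<^sup>2 \<le> v \<bullet> v"
        unfolding scalar_prod_self_eq[OF v] using that by (auto intro!: member_le_sum)
      moreover have "2 * \<bar>v $ i * v $ j\<bar> \<le> (v $ i)\<^sup>2 + (v $ j)\<^sup>2"
        using sum_squares_bound[of "\<bar>v $ i\<bar>" "\<bar>v $ j\<bar>"] by (simp add: abs_mult)
      ultimately show ?thesis by linarith
    qed
    have "\<bar>quad_form S v\<bar> \<le> (\<Sum>i<n. \<bar>\<Sum>j<n. S $$ (i, j) * (v $ i * v $ j)\<bar>)"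
      unfolding quad_form_expand[OF S v] by (rule sum_abs)
    also have "\<dots> \<le> (\<Sum>i<n. \<Sum>j<n. \<bar>S $$ (i, j) * (v $ i * v $ j)\<bar>)"
      by (intro sum_mono sum_abs)
    also have "\<dots> \<le> (\<Sum>i<n. \<Sum>j<n. \<bar>S $$ (i, j)\<bar> * (v \<bullet> v))"
      unfolding abs_mult[of "S $$ _"] by (intro sum_mono mult_left_mono le) auto
    also have "\<dots> = (\<Sum>i<n. \<Sum>j<n. \<bar>S $$ (i, j)\<bar>) * (v \<bullet> v)"
      by (simp add: sum_distrib_right)
    also have "\<dots> \<le> c * (v \<bullet> v)"
      unfolding c_def by (intro mult_right_mono nonneg) simp
    finally show ?thesis .
  qed
  ultimately show thesis by (rule that)
qed

lemma quad_form_Cauchy_Schwarz: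
  assumes S: "S \<in> pos_def_mats n" and u: "u \<in> carrier_vec n" and v: "v \<in> carrier_vec n"
  shows "(u \<bullet> (S *\<^sub>v v))\<^sup>2 \<le> quad_form S u * quad_form S v"
proof (cases "u = 0\<^sub>v n")
  case True
  have "S *\<^sub>v v \<in> carrier_vec n" using pos_defD(1)[OF S] v by auto
  then show ?thesis using True quad_form_zero[OF pos_defD(1)[OF S]] by simp
next
  case False
  define a b c where "a = quad_form S u" and "b = quad_form S v" and "c = u \<bullet> (S *\<^sub>v v)"
  note Sc = pos_defD(1,2)[OF S]
  have a: "0 < a" unfolding a_def by (rule pos_defD(3)[OF S u False])
  have Sv: "S *\<^sub>v v \<in> carrier_vec n" using Sc v by auto
  \<comment> \<open>The combination that minimizes the form on the line through \<open>v\<close> in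
    direction \<open>u\<close>, scaled by \<open>a\<close> to avoid a division.\<close>
  have "0 \<le> quad_form S ((- c) \<cdot>\<^sub>v u + a \<cdot>\<^sub>v v)"
    by (rule pos_defD(4)[OF S]) (use u v in simp)
  also have "\<dots> = c\<^sup>2 * a + 2 * ((- c) * (a * c)) + a\<^sup>2 * b"
  proof -
    have au: "(- c) \<cdot>\<^sub>v u \<in> carrier_vec n" and bv: "a \<cdot>\<^sub>v v \<in> carrier_vec n" using u v by auto
    have "((- c) \<cdot>\<^sub>v u) \<bullet> (S *\<^sub>v (a \<cdot>\<^sub>v v)) = (- c) * (a * c)"
      unfolding mult_mat_vec[OF Sc(1) v] using u Sv by (simp add: c_def)
    then show ?thesis
      unfolding quad_form_add[OF Sc au bv] quad_form_smult[OF Sc(1) u] quad_form_smult[OF Sc(1) v]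
      by (simp add: a_def b_def)
  qed
  finally have "0 \<le> a * (a * b - c\<^sup>2)" by (simp add: power2_eq_square algebra_simps)
  then have "c\<^sup>2 \<le> a * b" using a by (simp add: zero_le_mult_iff)
  then show ?thesis by (simp add: a_def b_def c_def)
qed

text \<open>Writing v = S w, the Cauchy-Schwarz inequality for the form S gives (v . v)^2 = (v . S w)^2 at most the
  product of the values of S at v and of its inverse at v; this avoids compactness of the unit sphere.\<close>

lemma pos_def_coercive:
  assumes S: "S \<in> pos_def_mats n"
  obtains c where "0 < c" "\<And>v. v \<in> carrier_vec n \<Longrightarrow> v \<bullet> v \<le> c * quad_form S v"
proof -
  obtain B where B: "B \<in> carrier_mat n n" "S * B = 1\<^sub>m n" by (rule pos_def_inverse[OF S])
  obtain c where c: "0 < c" "\<And>v. v \<in> carrier_vec n \<Longrightarrow> \<bar>quad_form B v\<bar> \<le> c * (v \<bullet> v)"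
    using quad_form_bound[OF B(1)] by blast
  have "v \<bullet> v \<le> c * quad_form S v" if v: "v \<in> carrier_vec n" for v
  proof (cases "v = 0\<^sub>v n")
    case True
    then show ?thesis using quad_form_zero[OF pos_defD(1)[OF S]] by simp
  next
    case False
    have vv: "0 < v \<bullet> v" using scalar_prod_self_nonneg[OF v] scalar_prod_self_zero[OF v] False by fastforce
    have Bv: "B *\<^sub>v v \<in> carrier_vec n" using B v by auto
    have SBv: "S *\<^sub>v (B *\<^sub>v v) = v"
      using assoc_mult_mat_vec[OF pos_defD(1)[OF S] B(1) v] B(2) v by simp
    have "quad_form S (B *\<^sub>v v) = quad_form B v"
      unfolding quad_form_def SBv by (rule comm_scalar_prod[OF Bv v])
    with quad_form_Cauchy_Schwarz[OF S v Bv]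
    have "(v \<bullet> v)\<^sup>2 \<le> quad_form S v * quad_form B v" by (simp add: SBv)
    also have "\<dots> \<le> quad_form S v * (c * (v \<bullet> v))"
      using c(2)[OF v] by (intro mult_left_mono pos_defD(4)[OF S v]) linarith
    finally have "(v \<bullet> v) * (v \<bullet> v) \<le> (c * quad_form S v) * (v \<bullet> v)"
      by (simp add: power2_eq_square mult_ac)
    then show ?thesis using vv by simp
  qed
  with c(1) show thesis by (rule that)
qed

section \<open>Injective linear maps in equal finite dimensions are onto\<close>

lemma linear_system_solvable:
  fixes t :: "'i \<Rightarrow> 'i \<Rightarrow> real"
  assumes I: "finite I"
    and inj: "\<And>f. (\<And>p. p \<in> I \<Longrightarrow> (\<Sum>q\<in>I. t p q * f q) = 0) \<Longrightarrow> (\<And>q. q \<in> I \<Longrightarrow> f q = 0)"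
  shows "\<exists>f. \<forall>p\<in>I. (\<Sum>q\<in>I. t p q * f q) = g p"
proof -
  define N where "N = card I"
  obtain h where h: "bij_betw h {0..<N} I"
    using ex_bij_betw_nat_finite[OF I] by (auto simp: N_def)
  define h' where "h' = the_inv_into {0..<N} h"
  have h': "h' (h k) = k" if "k < N" for k
    unfolding h'_def using h that by (intro the_inv_into_f_f) (auto simp: bij_betw_def)
  have onto: "\<exists>k<N. p = h k" if "p \<in> I" for p
    using h that by (force simp: bij_betw_def)
  \<comment> \<open>The numbering \<open>h\<close> of \<open>I\<close> turns the system into a
    square matrix; \<open>inj\<close> says that its kernel is trivial, so it is invertible.\<close>
  define A where "A = mat N N (\<lambda>(i, j). t (h i) (h j))"
  have A: "A \<in> carrier_mat N N" by (simp add: A_def)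
  have Av: "(A *\<^sub>v v) $ i = (\<Sum>q\<in>I. t (h i) q * v $ h' q)" if v: "v \<in> carrier_vec N" and i: "i < N" for v i
  proof -
    have "(A *\<^sub>v v) $ i = (\<Sum>j\<in>{0..<N}. t (h i) (h j) * v $ h' (h j))"
      unfolding mult_mat_vec_expand[OF A v i] using i by (auto simp: A_def h' atLeast0LessThan)
    also have "\<dots> = (\<Sum>q\<in>I. t (h i) q * v $ h' q)"
      by (rule sum.reindex_bij_betw[OF h])
    finally show ?thesis .
  qed
  have ker: "v = 0\<^sub>v N" if v: "v \<in> carrier_vec N" "A *\<^sub>v v = 0\<^sub>v N" for v
  proof (rule eq_vecI)
    fix k assume "k < dim_vec (0\<^sub>v N :: real vec)"
    then have k: "k < N" by simp
    have "(\<Sum>q\<in>I. t p q * v $ h' q) = 0" if "p \<in> I" for p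
      using onto[OF that] Av[OF v(1)] v(2) by auto
    from inj[of "\<lambda>q. v $ h' q", OF this] have "v $ h' (h k) = 0"
      using h k by (auto simp: bij_betw_def)
    then show "v $ k = 0\<^sub>v N $ k" using k h' by simp
  qed (use v in simp)
  obtain B where B: "B \<in> carrier_mat N N" "A * B = 1\<^sub>m N"
    by (rule invertible_of_trivial_kernel[OF A ker])
  define b where "b = vec N (\<lambda>k. g (h k))"
  have b: "b \<in> carrier_vec N" by (simp add: b_def)
  have ABb: "A *\<^sub>v (B *\<^sub>v b) = b" using assoc_mult_mat_vec[OF A B(1) b] B(2) b by simp
  have Bb: "B *\<^sub>v b \<in> carrier_vec N" using B(1) b by auto
  have solves: "(\<Sum>q\<in>I. t (h k) q * (B *\<^sub>v b) $ h' q) = g (h k)" if k: "k < N" for k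
  proof -
    have "b $ k = (\<Sum>q\<in>I. t (h k) q * (B *\<^sub>v b) $ h' q)"
      using Av[OF Bb k] unfolding ABb .
    moreover have "b $ k = g (h k)" using k by (simp add: b_def)
    ultimately show ?thesis by (rule trans[OF sym])
  qed
  have "(\<Sum>q\<in>I. t p q * (B *\<^sub>v b) $ h' q) = g p" if "p \<in> I" for p
    using onto[OF that] solves by (elim exE conjE) (simp only:)
  then show ?thesis by (intro exI[of _ "\<lambda>q. (B *\<^sub>v b) $ h' q"] ballI)
qed

text \<open>Vectors are functions of which only the values on \<open>I\<close> count, which is what
  \<open>cong\<close> expresses. Expansion in the indicator functions of single points produces the
  matrix of \<open>L\<close>.\<close>

lemma linear_operator_surjective:
  fixes L :: "('i \<Rightarrow> real) \<Rightarrow> 'i \<Rightarrow> real"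
  assumes I: "finite I"
    and add: "\<And>f g p. p \<in> I \<Longrightarrow> L (\<lambda>q. f q + g q) p = L f p + L g p"
    and scale: "\<And>c f p. p \<in> I \<Longrightarrow> L (\<lambda>q. c * f q) p = c * L f p"
    and cong: "\<And>f g p. p \<in> I \<Longrightarrow> (\<And>q. q \<in> I \<Longrightarrow> f q = g q) \<Longrightarrow> L f p = L g p"
    and inj: "\<And>f q. (\<And>p. p \<in> I \<Longrightarrow> L f p = 0) \<Longrightarrow> q \<in> I \<Longrightarrow> f q = 0"
  shows "\<exists>f. \<forall>p\<in>I. L f p = g p"
proof -
  define t where "t p q = L (\<lambda>r. if r = q then 1 else 0) p" for p q
  have sum: "L (\<lambda>r. \<Sum>q\<in>K. f q * (if r = q then 1 else 0)) p = (\<Sum>q\<in>K. t p q * f q)"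
    if "finite K" "p \<in> I" for K f p
    using that(1)
  proof (induction K rule: finite_induct)
    case empty
    show ?case using scale[OF that(2), of 0 "\<lambda>_. 0"] by simp
  next
    case (insert x K)
    then show ?case using that(2) by (simp add: add scale t_def mult.commute)
  qed
  have Lf: "L f p = (\<Sum>q\<in>I. t p q * f q)" if p: "p \<in> I" for f p
  proof -
    have "L f p = L (\<lambda>r. \<Sum>q\<in>I. f q * (if r = q then 1 else 0)) p"
    proof (rule cong[OF p])
      fix r assume "r \<in> I"
      then have "f r = (\<Sum>q\<in>I. if r = q then f q else 0)" using I by simp
      also have "\<dots> = (\<Sum>q\<in>I. f q * (if r = q then 1 else 0))" by (intro sum.cong) auto
      finally show "f r = (\<Sum>q\<in>I. f q * (if r = q then 1 else 0))" .
    qed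
    then show ?thesis using sum[OF I p] by simp
  qed
  have "\<exists>f. \<forall>p\<in>I. (\<Sum>q\<in>I. t p q * f q) = g p"
  proof (rule linear_system_solvable[OF I])
    fix f q assume z: "\<And>p. p \<in> I \<Longrightarrow> (\<Sum>q\<in>I. t p q * f q) = 0" and q: "q \<in> I"
    show "f q = 0" by (rule inj[OF _ q]) (simp add: Lf z)
  qed
  then show ?thesis by (simp add: Lf)
qed

section \<open>Solvability of the Lyapunov equation\<close>

lemma lyapunov_transpose:
  assumes A: "A \<in> carrier_mat n n" and C: "C \<in> carrier_mat n n" and P: "P \<in> carrier_mat n n" "P\<^sup>T = P"
  shows "(lyapunov A C P)\<^sup>T = lyapunov A C P"
proof -
  have c: "P * A \<in> carrier_mat n n" "A\<^sup>T * P \<in> carrier_mat n n" "C\<^sup>T * P * C \<in> carrier_mat n n" "C\<^sup>T * P \<in> carrier_mat n n"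
    "A\<^sup>T \<in> carrier_mat n n" "C\<^sup>T \<in> carrier_mat n n"
    using A C P by auto
  have "(C\<^sup>T * P * C)\<^sup>T = C\<^sup>T * (P * C)"
    unfolding transpose_mult[OF c(4) C] transpose_mult[OF c(6) P(1)] by (simp add: P(2))
  also have "\<dots> = C\<^sup>T * P * C" using assoc_mult_mat[OF c(6) P(1) C] by simp
  finally have 3: "(C\<^sup>T * P * C)\<^sup>T = C\<^sup>T * P * C" .
  have "(lyapunov A C P)\<^sup>T = (P * A)\<^sup>T + (A\<^sup>T * P)\<^sup>T + (C\<^sup>T * P * C)\<^sup>T"
    unfolding lyapunov_def
    using transpose_add[OF add_carrier_mat[OF c(2)] c(3), of "P * A"] transpose_add[OF c(1,2)] by simp
  also have "\<dots> = A\<^sup>T * P + P * A + C\<^sup>T * P * C"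
    unfolding 3 transpose_mult[OF P(1) A] transpose_mult[OF c(5) P(1)] by (simp add: P(2))
  also have "\<dots> = lyapunov A C P"
    unfolding lyapunov_def using comm_add_mat[OF c(2,1)] by simp
  finally show ?thesis .
qed

text \<open>Written in entries the operator is visibly linear in \<open>P\<close>, which is what the
  solvability proof rewrites with.\<close>

lemma lyapunov_index:
  assumes A: "A \<in> carrier_mat n n" and C: "C \<in> carrier_mat n n" and P: "P \<in> carrier_mat n n" and rs: "r < n" "s < n"
  shows "lyapunov A C P $$ (r, s) = (\<Sum>b<n. P $$ (r, b) * A $$ (b, s)) + (\<Sum>a<n. A $$ (a, r) * P $$ (a, s))
     + (\<Sum>b<n. (\<Sum>a<n. C $$ (a, r) * P $$ (a, b)) * C $$ (b, s))"
proof -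
  have m: "(U * V) $$ (i, j) = (\<Sum>k<n. U $$ (i, k) * V $$ (k, j))"
    if "U \<in> carrier_mat n n" "V \<in> carrier_mat n n" "i < n" "j < n" for U V :: "real mat" and i j
    using that by (auto simp: scalar_prod_def atLeast0LessThan)
  have c: "A\<^sup>T \<in> carrier_mat n n" "C\<^sup>T \<in> carrier_mat n n" "C\<^sup>T * P \<in> carrier_mat n n"
    using A C P by auto
  have "lyapunov A C P $$ (r, s) = (P * A) $$ (r, s) + (A\<^sup>T * P) $$ (r, s) + (C\<^sup>T * P * C) $$ (r, s)"
    unfolding lyapunov_def using A C P rs by simp
  also have "(P * A) $$ (r, s) = (\<Sum>b<n. P $$ (r, b) * A $$ (b, s))" by (rule m[OF P A rs])
  also have "(A\<^sup>T * P) $$ (r, s) = (\<Sum>a<n. A $$ (a, r) * P $$ (a, s))"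
    unfolding m[OF c(1) P rs] using A rs by (intro sum.cong) auto
  also have "(C\<^sup>T * P * C) $$ (r, s) = (\<Sum>b<n. (\<Sum>a<n. C $$ (a, r) * P $$ (a, b)) * C $$ (b, s))"
    unfolding m[OF c(3) C rs] using C rs by (intro sum.cong refl) (simp add: m[OF c(2) P rs(1)])
  finally show ?thesis .
qed

text \<open>A symmetric matrix is parametrized by its upper triangle, on which the Lyapunov operator is a
  linear map between spaces of equal finite dimension.\<close>

lemma lyapunov_solvable:
  assumes A: "A \<in> carrier_mat n n" and C: "C \<in> carrier_mat n n"
    and inj: "\<And>P. P \<in> carrier_mat n n \<Longrightarrow> P\<^sup>T = P \<Longrightarrow> lyapunov A C P = 0\<^sub>m n n \<Longrightarrow> P = 0\<^sub>m n n"
    and W: "W \<in> carrier_mat n n" "W\<^sup>T = W"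
  obtains P where "P \<in> carrier_mat n n" "P\<^sup>T = P" "lyapunov A C P = - W"
proof -
  \<comment> \<open>Indices of the upper triangle; \<open>S f\<close> is the symmetric matrix with
    that triangle. Injectivity is assumed for symmetric matrices only, and symmetric values are
    determined by the same triangle, so the restricted operator is injective.\<close>
  define I where "I = {p :: nat \<times> nat. fst p \<le> snd p \<and> snd p < n}"
  define S where "S f = mat n n (\<lambda>(a, b). f (min a b, max a b))" for f :: "nat \<times> nat \<Rightarrow> real"
  have "I \<subseteq> {..<n} \<times> {..<n}" by (auto simp: I_def)
  then have fin: "finite I" by (rule finite_subset) simp
  have S: "S f \<in> carrier_mat n n" "(S f)\<^sup>T = S f" for f
    by (auto simp: S_def min.commute max.commute intro!: eq_matI)
  have Sidx: "S f $$ (a, b) = f (min a b, max a b)" if "a < n" "b < n" for f a b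
    using that by (simp add: S_def)
  have sym_eq: "U = V" if U: "U \<in> carrier_mat n n" "U\<^sup>T = U" and V: "V \<in> carrier_mat n n" "V\<^sup>T = V"
    and eq: "\<And>p. p \<in> I \<Longrightarrow> U $$ p = V $$ p" for U V :: "real mat"
  proof (rule eq_matI)
    fix i j assume "i < dim_row V" "j < dim_col V"
    then have ij: "i < n" "j < n" using V by auto
    show "U $$ (i, j) = V $$ (i, j)"
    proof (cases "i \<le> j")
      case True
      then show ?thesis using ij by (intro eq) (simp add: I_def)
    next
      case False
      then have "U $$ (j, i) = V $$ (j, i)" using ij by (intro eq) (simp add: I_def)
      moreover have "U $$ (i, j) = U $$ (j, i)" using U ij by (metis carrier_matD index_transpose_mat(1))
      moreover have "V $$ (i, j) = V $$ (j, i)" using V ij by (metis carrier_matD index_transpose_mat(1))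
      ultimately show ?thesis by simp
    qed
  qed (use U V in auto)
  define L where "L f p = lyapunov A C (S f) $$ p" for f p
  have idx: "L f (r, s) = (\<Sum>b<n. S f $$ (r, b) * A $$ (b, s)) + (\<Sum>a<n. A $$ (a, r) * S f $$ (a, s))
     + (\<Sum>b<n. (\<Sum>a<n. C $$ (a, r) * S f $$ (a, b)) * C $$ (b, s))" if "r < n" "s < n" for f r s
    unfolding L_def by (rule lyapunov_index[OF A C S(1) that])
  have "\<exists>f. \<forall>p\<in>I. L f p = - W $$ p"
  proof (rule linear_operator_surjective[OF fin])
    fix f g :: "nat \<times> nat \<Rightarrow> real" and k :: real and p assume "p \<in> I"
    then obtain r s where p: "p = (r, s)" and rs: "r < n" "s < n" by (cases p) (auto simp: I_def)
    have a: "S (\<lambda>q. f q + g q) $$ (i, j) = S f $$ (i, j) + S g $$ (i, j)" if "i < n" "j < n" for i j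
      using that by (simp add: Sidx)
    show "L (\<lambda>q. f q + g q) p = L f p + L g p"
      unfolding p idx[OF rs] using rs by (simp add: a distrib_left distrib_right sum.distrib)
    have m: "S (\<lambda>q. k * f q) $$ (i, j) = k * S f $$ (i, j)" if "i < n" "j < n" for i j
      using that by (simp add: Sidx)
    show "L (\<lambda>q. k * f q) p = k * L f p"
      unfolding p idx[OF rs] using rs by (simp add: m distrib_left sum_distrib_left sum_distrib_right mult_ac)
    assume eq: "\<And>q. q \<in> I \<Longrightarrow> f q = g q"
    have "S f = S g"
      unfolding S_def by (rule cong_mat) (auto simp: I_def intro!: eq)
    then show "L f p = L g p" by (simp add: L_def)
  next
    fix f q assume z: "\<And>p. p \<in> I \<Longrightarrow> L f p = 0" and q: "q \<in> I"
    have "lyapunov A C (S f) = 0\<^sub>m n n"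
    proof (rule sym_eq)
      fix p assume p: "p \<in> I"
      then have "fst p < n" "snd p < n" by (auto simp: I_def)
      then have "(0\<^sub>m n n :: real mat) $$ p = 0" by (cases p) simp
      with z[OF p] show "lyapunov A C (S f) $$ p = 0\<^sub>m n n $$ p" by (simp add: L_def)
    qed (simp_all add: lyapunov_carrier[OF A C S(1)] lyapunov_transpose[OF A C S])
    from inj[OF S this] have "S f = 0\<^sub>m n n" .
    then have "S f $$ q = 0" using q by (cases q) (auto simp: I_def)
    moreover have "S f $$ q = f q" using q by (cases q) (auto simp: I_def Sidx min_def max_def)
    ultimately show "f q = 0" by simp
  qed
  then obtain f where f: "\<And>p. p \<in> I \<Longrightarrow> L f p = - W $$ p" by blast
  have "lyapunov A C (S f) = - W"
  proof (rule sym_eq)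
    fix p assume p: "p \<in> I"
    then have "(- W) $$ p = - (W $$ p)" using W by (cases p) (auto simp: I_def)
    with f[OF p] show "lyapunov A C (S f) $$ p = (- W) $$ p" by (simp add: L_def)
  next
    show "(- W)\<^sup>T = - W" using W by (simp add: transpose_uminus)
  qed (simp_all add: lyapunov_carrier[OF A C S(1)] lyapunov_transpose[OF A C S] W)
  with S show thesis by (rule that)
qed

section \<open>Gains and Riccati equations\<close>

lemma index_minus_carrier: "w \<in> carrier_vec r \<Longrightarrow> a < r \<Longrightarrow> (u - w) $ a = u $ a - (w $ a :: real)"
  by (rule index_minus_vec(1)) (simp only: carrier_vecD)

lemma index_mat_carrier:
  fixes U V :: "real mat"
  assumes V: "V \<in> carrier_mat r c" and ab: "a < r" "b < c"
  shows "(U + V) $$ (a, b) = U $$ (a, b) + V $$ (a, b)" "(U - V) $$ (a, b) = U $$ (a, b) - V $$ (a, b)"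
proof -
  have d: "a < dim_row V" "b < dim_col V" using ab by (simp_all only: carrier_matD[OF V])
  show "(U + V) $$ (a, b) = U $$ (a, b) + V $$ (a, b)" by (rule index_add_mat(1)[OF d])
  show "(U - V) $$ (a, b) = U $$ (a, b) - V $$ (a, b)" by (rule index_minus_mat(1)[OF d])
qed

lemma mat_sum_carrier: "mat_sum r c S I \<in> carrier_mat r c"
  by (simp add: mat_sum_def)

lemma mat_sum_mult_vec:
  assumes S: "\<And>i. i \<in> I \<Longrightarrow> S i \<in> carrier_mat r c" and v: "v \<in> carrier_vec c" and a: "a < r"
  shows "(mat_sum r c S I *\<^sub>v v) $ a = (\<Sum>i\<in>I. (S i *\<^sub>v v) $ a)"
proof -
  have "(mat_sum r c S I *\<^sub>v v) $ a = (\<Sum>b<c. (\<Sum>i\<in>I. S i $$ (a, b)) * v $ b)"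
    unfolding mult_mat_vec_expand[OF mat_sum_carrier v a] using a by (intro sum.cong) (auto simp: mat_sum_def)
  also have "\<dots> = (\<Sum>i\<in>I. \<Sum>b<c. S i $$ (a, b) * v $ b)"
    by (simp add: sum_distrib_right sum.swap[of _ _ I])
  also have "\<dots> = (\<Sum>i\<in>I. (S i *\<^sub>v v) $ a)"
    by (intro sum.cong refl) (simp add: mult_mat_vec_expand[OF S v a])
  finally show ?thesis .
qed

lemma quad_form_mat_sum:
  assumes S: "\<And>i. i \<in> I \<Longrightarrow> S i \<in> carrier_mat n n" and v: "v \<in> carrier_vec n"
  shows "quad_form (mat_sum n n S I) v = (\<Sum>i\<in>I. quad_form (S i) v)"
proof -
  have "quad_form (mat_sum n n S I) v = (\<Sum>a<n. v $ a * (\<Sum>i\<in>I. (S i *\<^sub>v v) $ a))"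
    unfolding quad_form_def scalar_prod_def using mat_sum_carrier[of n n S I]
    by (intro sum.cong) (auto simp: atLeast0LessThan mat_sum_mult_vec[OF S v] simp del: index_mult_mat_vec)
  also have "\<dots> = (\<Sum>i\<in>I. \<Sum>a<n. v $ a * (S i *\<^sub>v v) $ a)"
    by (simp add: sum_distrib_left sum.swap[of _ _ I] del: index_mult_mat_vec)
  also have "\<dots> = (\<Sum>i\<in>I. quad_form (S i) v)"
  proof (intro sum.cong refl)
    fix i assume "i \<in> I"
    then have "dim_vec (S i *\<^sub>v v) = n" using S by auto
    then show "(\<Sum>a<n. v $ a * (S i *\<^sub>v v) $ a) = quad_form (S i) v"
      unfolding quad_form_def scalar_prod_def by (simp add: atLeast0LessThan del: index_mult_mat_vec)
  qed
  finally show ?thesis .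
qed

lemma mult_mat_sum:
  assumes X: "X \<in> carrier_mat r c" and S: "\<And>i. i \<in> I \<Longrightarrow> S i \<in> carrier_mat c d"
  shows "X * mat_sum c d S I = mat_sum r d (\<lambda>i. X * S i) I"
proof (rule eq_matI)
  fix a b assume "a < dim_row (mat_sum r d (\<lambda>i. X * S i) I)" "b < dim_col (mat_sum r d (\<lambda>i. X * S i) I)"
  then have ab: "a < r" "b < d" using mat_sum_carrier[of r d "\<lambda>i. X * S i" I] by auto
  have "(X * mat_sum c d S I) $$ (a, b) = (\<Sum>k<c. X $$ (a, k) * (\<Sum>i\<in>I. S i $$ (k, b)))"
    using X ab by (auto simp: scalar_prod_def mat_sum_def atLeast0LessThan)
  also have "\<dots> = (\<Sum>i\<in>I. \<Sum>k<c. X $$ (a, k) * S i $$ (k, b))"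
    by (simp add: sum_distrib_left sum.swap[of _ _ I])
  also have "\<dots> = (\<Sum>i\<in>I. (X * S i) $$ (a, b))"
  proof (intro sum.cong refl)
    fix i assume "i \<in> I"
    from S[OF this] show "(\<Sum>k<c. X $$ (a, k) * S i $$ (k, b)) = (X * S i) $$ (a, b)"
      using X ab by (auto simp: scalar_prod_def atLeast0LessThan)
  qed
  finally show "(X * mat_sum c d S I) $$ (a, b) = mat_sum r d (\<lambda>i. X * S i) I $$ (a, b)"
    using ab by (simp add: mat_sum_def)
qed (use X mat_sum_carrier[of r d "\<lambda>i. X * S i" I] mat_sum_carrier[of c d S I] in auto)

lemma quad_form_congruence:
  fixes R :: "real mat"
  assumes "R \<in> carrier_mat m m" "K \<in> carrier_mat m n" "v \<in> carrier_vec n"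
  shows "quad_form (K\<^sup>T * R * K) v = quad_form R (K *\<^sub>v v)"
proof -
  have "(K\<^sup>T * R * K) *\<^sub>v v = K\<^sup>T *\<^sub>v (R *\<^sub>v (K *\<^sub>v v))"
    using assms assoc_mult_mat_vec[of "K\<^sup>T * R" n m K n v] assoc_mult_mat_vec[of "K\<^sup>T" n m R m "K *\<^sub>v v"] by simp
  then show ?thesis
    unfolding quad_form_def using scalar_prod_transpose[of K m n "R *\<^sub>v (K *\<^sub>v v)" v] assms by simp
qed

lemma congruence_carrier:
  "R \<in> carrier_mat m m \<Longrightarrow> K \<in> carrier_mat m n \<Longrightarrow> K\<^sup>T * R * K \<in> carrier_mat n n"
  by (rule mult_carrier_mat[OF mult_carrier_mat[OF transpose_carrier_mat[THEN iffD2]]])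

text \<open>With u_j = - K_j x the running cost of player i is the quadratic form of this matrix at
  the state.\<close>

definition running_weight :: "lq_game \<Rightarrow> (nat \<Rightarrow> real mat) \<Rightarrow> nat \<Rightarrow> real mat" where
  "running_weight G K i = Qmat G i + mat_sum (xdim G) (xdim G) (\<lambda>j. (K j)\<^sup>T * Rmat G i j * K j) (players G)"

section \<open>Closed-loop matrices and running weights\<close>

locale lq_setting =
  fixes G :: lq_game
  assumes dims: "game_dims G"
    and Q_pos: "\<forall>i\<in>players G. Qmat G i \<in> pos_def_mats (xdim G)"
    and R_pos: "\<forall>i\<in>players G. Rmat G i i \<in> pos_def_mats (udim G i)"
    and R_nonneg: "\<forall>i\<in>players G. \<forall>j\<in>players G - {i}. Rmat G i j \<in> pos_semidef_mats (udim G j)"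
begin

abbreviation "n \<equiv> xdim G"

definition gains :: "(nat \<Rightarrow> real mat) set" where
  "gains = {K. \<forall>i\<in>players G. K i \<in> carrier_mat (udim G i) n}"

lemma finite_players: "finite (players G)"
  by (simp add: players_def)

lemma game_carriers:
  "Amat G \<in> carrier_mat n n" "Cmat G \<in> carrier_mat n n"
  "i \<in> players G \<Longrightarrow> Bmat G i \<in> carrier_mat n (udim G i)"
  "i \<in> players G \<Longrightarrow> Dmat G i \<in> carrier_mat n (udim G i)"
  "i \<in> players G \<Longrightarrow> Qmat G i \<in> carrier_mat n n"
  "i \<in> players G \<Longrightarrow> j \<in> players G \<Longrightarrow> Rmat G i j \<in> carrier_mat (udim G j) (udim G j)"
  using dims by (auto simp: game_dims_def)

lemma R_semidef: "i \<in> players G \<Longrightarrow> j \<in> players G \<Longrightarrow> Rmat G i j \<in> pos_semidef_mats (udim G j)"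
  using R_pos R_nonneg pos_def_imp_semidef by (cases "i = j") auto

lemma gainsD: "K \<in> gains \<Longrightarrow> i \<in> players G \<Longrightarrow> K i \<in> carrier_mat (udim G i) n"
  by (simp add: gains_def)

lemma gains_update: "K \<in> gains \<Longrightarrow> Ki \<in> carrier_mat (udim G i) n \<Longrightarrow> K(i := Ki) \<in> gains"
  by (simp add: gains_def)

lemma cl_carrier: "A_cl G K \<in> carrier_mat n n" "C_cl G K \<in> carrier_mat n n"
  unfolding A_cl_def C_cl_def by (intro minus_carrier_mat mat_sum_carrier)+

lemma cl_apply:
  assumes K: "K \<in> gains" and v: "v \<in> carrier_vec n" and a: "a < n"
  shows "(A_cl G K *\<^sub>v v) $ a = (Amat G *\<^sub>v v) $ a - (\<Sum>j\<in>players G. (Bmat G j *\<^sub>v (K j *\<^sub>v v)) $ a)"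
    and "(C_cl G K *\<^sub>v v) $ a = (Cmat G *\<^sub>v v) $ a - (\<Sum>j\<in>players G. (Dmat G j *\<^sub>v (K j *\<^sub>v v)) $ a)"
proof -
  have *: "((Y - mat_sum n n (\<lambda>j. B j * K j) (players G)) *\<^sub>v v) $ a
     = (Y *\<^sub>v v) $ a - (\<Sum>j\<in>players G. (B j *\<^sub>v (K j *\<^sub>v v)) $ a)"
    if Y: "Y \<in> carrier_mat n n" and B: "\<And>j. j \<in> players G \<Longrightarrow> B j \<in> carrier_mat n (udim G j)" for Y and B :: "nat \<Rightarrow> real mat"
  proof -
    have BK: "B j * K j \<in> carrier_mat n n" if "j \<in> players G" for j
      using B[OF that] gainsD[OF K that] by (rule mult_carrier_mat)
    have sv: "mat_sum n n (\<lambda>j. B j * K j) (players G) *\<^sub>v v \<in> carrier_vec n"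
      using mat_sum_carrier v by (rule mult_mat_vec_carrier)
    have "((Y - mat_sum n n (\<lambda>j. B j * K j) (players G)) *\<^sub>v v) $ a
      = (Y *\<^sub>v v) $ a - (mat_sum n n (\<lambda>j. B j * K j) (players G) *\<^sub>v v) $ a"
      unfolding minus_mult_distrib_mat_vec[OF Y mat_sum_carrier v] by (rule index_minus_carrier[OF sv a])
    also have "(mat_sum n n (\<lambda>j. B j * K j) (players G) *\<^sub>v v) $ a = (\<Sum>j\<in>players G. ((B j * K j) *\<^sub>v v) $ a)"
      by (rule mat_sum_mult_vec[OF BK v a])
    also have "\<dots> = (\<Sum>j\<in>players G. (B j *\<^sub>v (K j *\<^sub>v v)) $ a)"
      by (intro sum.cong refl) (simp only: assoc_mult_mat_vec[OF B gainsD[OF K] v])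
    finally show ?thesis .
  qed
  show "(A_cl G K *\<^sub>v v) $ a = (Amat G *\<^sub>v v) $ a - (\<Sum>j\<in>players G. (Bmat G j *\<^sub>v (K j *\<^sub>v v)) $ a)"
    unfolding A_cl_def by (rule *[OF game_carriers(1,3)])
  show "(C_cl G K *\<^sub>v v) $ a = (Cmat G *\<^sub>v v) $ a - (\<Sum>j\<in>players G. (Dmat G j *\<^sub>v (K j *\<^sub>v v)) $ a)"
    unfolding C_cl_def by (rule *[OF game_carriers(2,4)])
qed

text \<open>Only the summand of player i changes. The statement is about vectors because the square
  is later completed at a fixed state \<open>v\<close>.\<close>

lemma cl_update:
  assumes K: "K \<in> gains" and i: "i \<in> players G" and Ki: "Ki \<in> carrier_mat (udim G i) n" and v: "v \<in> carrier_vec n"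
  shows "A_cl G (K(i := Ki)) *\<^sub>v v = A_cl G K *\<^sub>v v - Bmat G i *\<^sub>v (Ki *\<^sub>v v - K i *\<^sub>v v)"
    and "C_cl G (K(i := Ki)) *\<^sub>v v = C_cl G K *\<^sub>v v - Dmat G i *\<^sub>v (Ki *\<^sub>v v - K i *\<^sub>v v)"
proof -
  have Kv: "K i *\<^sub>v v \<in> carrier_vec (udim G i)" "Ki *\<^sub>v v \<in> carrier_vec (udim G i)"
    using gainsD[OF K i] Ki v by (auto intro: mult_mat_vec_carrier)
  have diff: "(\<Sum>j\<in>players G. (B j *\<^sub>v ((K(i := Ki)) j *\<^sub>v v)) $ a) - (\<Sum>j\<in>players G. (B j *\<^sub>v (K j *\<^sub>v v)) $ a)
      = (B i *\<^sub>v (Ki *\<^sub>v v - K i *\<^sub>v v)) $ a"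
    if B: "B i \<in> carrier_mat n (udim G i)" and a: "a < n" for B :: "nat \<Rightarrow> real mat" and a
  proof -
    have c: "B i *\<^sub>v (K i *\<^sub>v v) \<in> carrier_vec n" using B Kv(1) by (rule mult_mat_vec_carrier)
    have "(\<Sum>j\<in>players G. (B j *\<^sub>v ((K(i := Ki)) j *\<^sub>v v)) $ a) - (\<Sum>j\<in>players G. (B j *\<^sub>v (K j *\<^sub>v v)) $ a)
      = (B i *\<^sub>v (Ki *\<^sub>v v)) $ a - (B i *\<^sub>v (K i *\<^sub>v v)) $ a"
      unfolding sum.remove[OF finite_players i, of "\<lambda>j. (B j *\<^sub>v ((K(i := Ki)) j *\<^sub>v v)) $ a"]
        sum.remove[OF finite_players i, of "\<lambda>j. (B j *\<^sub>v (K j *\<^sub>v v)) $ a"]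
      by (simp del: index_mult_mat_vec)
    also have "\<dots> = (B i *\<^sub>v (Ki *\<^sub>v v - K i *\<^sub>v v)) $ a"
      unfolding mult_minus_distrib_mat_vec[OF B Kv(2,1)] by (rule index_minus_carrier[OF c a, symmetric])
    finally show ?thesis .
  qed
  note K' = gains_update[OF K Ki]
  show "A_cl G (K(i := Ki)) *\<^sub>v v = A_cl G K *\<^sub>v v - Bmat G i *\<^sub>v (Ki *\<^sub>v v - K i *\<^sub>v v)"
  proof (rule eq_vecI)
    have c: "Bmat G i *\<^sub>v (Ki *\<^sub>v v - K i *\<^sub>v v) \<in> carrier_vec n"
      by (rule mult_mat_vec_carrier[OF game_carriers(3)[OF i] minus_carrier_vec[OF Kv(2,1)]])
    fix a assume "a < dim_vec (A_cl G K *\<^sub>v v - Bmat G i *\<^sub>v (Ki *\<^sub>v v - K i *\<^sub>v v))"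
    then have a: "a < n" by (simp only: index_minus_vec(2) carrier_vecD[OF c])
    show "(A_cl G (K(i := Ki)) *\<^sub>v v) $ a = (A_cl G K *\<^sub>v v - Bmat G i *\<^sub>v (Ki *\<^sub>v v - K i *\<^sub>v v)) $ a"
      using diff[of "Bmat G", OF game_carriers(3)[OF i] a] cl_apply(1)[OF K' v a] cl_apply(1)[OF K v a]
        index_minus_carrier[OF c a, of "A_cl G K *\<^sub>v v"] by linarith
  qed (use cl_carrier(1)[of "K(i := Ki)"] game_carriers(3)[OF i] in auto)
  show "C_cl G (K(i := Ki)) *\<^sub>v v = C_cl G K *\<^sub>v v - Dmat G i *\<^sub>v (Ki *\<^sub>v v - K i *\<^sub>v v)"
  proof (rule eq_vecI)
    have c: "Dmat G i *\<^sub>v (Ki *\<^sub>v v - K i *\<^sub>v v) \<in> carrier_vec n"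
      by (rule mult_mat_vec_carrier[OF game_carriers(4)[OF i] minus_carrier_vec[OF Kv(2,1)]])
    fix a assume "a < dim_vec (C_cl G K *\<^sub>v v - Dmat G i *\<^sub>v (Ki *\<^sub>v v - K i *\<^sub>v v))"
    then have a: "a < n" by (simp only: index_minus_vec(2) carrier_vecD[OF c])
    show "(C_cl G (K(i := Ki)) *\<^sub>v v) $ a = (C_cl G K *\<^sub>v v - Dmat G i *\<^sub>v (Ki *\<^sub>v v - K i *\<^sub>v v)) $ a"
      using diff[of "Dmat G", OF game_carriers(4)[OF i] a] cl_apply(2)[OF K' v a] cl_apply(2)[OF K v a]
        index_minus_carrier[OF c a, of "C_cl G K *\<^sub>v v"] by linarith
  qed (use cl_carrier(2)[of "K(i := Ki)"] game_carriers(4)[OF i] in auto)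
qed

lemma running_weight_carrier: "i \<in> players G \<Longrightarrow> running_weight G K i \<in> carrier_mat n n"
  unfolding running_weight_def by (intro add_carrier_mat mat_sum_carrier)

lemma quad_form_running_weight:
  assumes K: "K \<in> gains" and i: "i \<in> players G" and v: "v \<in> carrier_vec n"
  shows "quad_form (running_weight G K i) v
    = quad_form (Qmat G i) v + (\<Sum>j\<in>players G. quad_form (Rmat G i j) (K j *\<^sub>v v))"
proof -
  have KRK: "(K j)\<^sup>T * Rmat G i j * K j \<in> carrier_mat n n" if "j \<in> players G" for j
    by (rule congruence_carrier[OF game_carriers(6)[OF i that] gainsD[OF K that]])
  define N where "N = mat_sum n n (\<lambda>j. (K j)\<^sup>T * Rmat G i j * K j) (players G)"
  have N: "N \<in> carrier_mat n n" unfolding N_def by (rule mat_sum_carrier)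
  have c: "Qmat G i *\<^sub>v v \<in> carrier_vec n" "N *\<^sub>v v \<in> carrier_vec n"
    using game_carriers(5)[OF i] N v by (auto intro: mult_mat_vec_carrier)
  have "quad_form (running_weight G K i) v = quad_form (Qmat G i) v + quad_form N v"
    unfolding quad_form_def running_weight_def N_def[symmetric]
      add_mult_distrib_mat_vec[OF game_carriers(5)[OF i] N v] by (rule scalar_prod_add_distrib[OF v c])
  also have "quad_form N v = (\<Sum>j\<in>players G. quad_form ((K j)\<^sup>T * Rmat G i j * K j) v)"
    unfolding N_def by (rule quad_form_mat_sum[OF KRK v])
  also have "\<dots> = (\<Sum>j\<in>players G. quad_form (Rmat G i j) (K j *\<^sub>v v))"
    by (intro sum.cong refl) (rule quad_form_congruence[OF game_carriers(6)[OF i] gainsD[OF K] v])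
  finally show ?thesis .
qed

lemma running_weight_ge:
  assumes K: "K \<in> gains" and i: "i \<in> players G" and v: "v \<in> carrier_vec n"
  shows "quad_form (Qmat G i) v \<le> quad_form (running_weight G K i) v"
  unfolding quad_form_running_weight[OF assms]
  using pos_semidefD(3)[OF R_semidef[OF i]] gainsD[OF K] v
  by (auto intro!: sum_nonneg intro: mult_mat_vec_carrier)

lemma running_weight_symmetric:
  assumes K: "K \<in> gains" and i: "i \<in> players G"
  shows "(running_weight G K i)\<^sup>T = running_weight G K i"
proof -
  have KRK: "((K j)\<^sup>T * Rmat G i j * K j)\<^sup>T = (K j)\<^sup>T * Rmat G i j * K j" "(K j)\<^sup>T * Rmat G i j * K j \<in> carrier_mat n n"
    if j: "j \<in> players G" for j
  proof -
    note Kj = gainsD[OF K j] and R = pos_semidefD(1,2)[OF R_semidef[OF i j]]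
    have KT: "(K j)\<^sup>T \<in> carrier_mat n (udim G j)" using Kj by simp
    show "((K j)\<^sup>T * Rmat G i j * K j)\<^sup>T = (K j)\<^sup>T * Rmat G i j * K j"
      unfolding transpose_mult[OF mult_carrier_mat[OF KT R(1)] Kj] transpose_mult[OF KT R(1)]
      by (simp add: R(2) assoc_mult_mat[OF KT R(1) Kj])
    show "(K j)\<^sup>T * Rmat G i j * K j \<in> carrier_mat n n" by (rule congruence_carrier[OF R(1) Kj])
  qed
  have "(mat_sum n n (\<lambda>j. (K j)\<^sup>T * Rmat G i j * K j) (players G))\<^sup>T = mat_sum n n (\<lambda>j. (K j)\<^sup>T * Rmat G i j * K j) (players G)"
  proof (rule eq_matI)
    fix a b assume "a < dim_row (mat_sum n n (\<lambda>j. (K j)\<^sup>T * Rmat G i j * K j) (players G))"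
      "b < dim_col (mat_sum n n (\<lambda>j. (K j)\<^sup>T * Rmat G i j * K j) (players G))"
    then have ab: "a < n" "b < n" by (simp_all add: mat_sum_def)
    have "((K j)\<^sup>T * Rmat G i j * K j) $$ (b, a) = ((K j)\<^sup>T * Rmat G i j * K j) $$ (a, b)" if "j \<in> players G" for j
      using KRK[OF that] ab by (metis carrier_matD index_transpose_mat(1))
    then show "(mat_sum n n (\<lambda>j. (K j)\<^sup>T * Rmat G i j * K j) (players G))\<^sup>T $$ (a, b)
        = mat_sum n n (\<lambda>j. (K j)\<^sup>T * Rmat G i j * K j) (players G) $$ (a, b)"
      using ab by (simp add: mat_sum_def)
  qed (simp_all add: mat_sum_def)
  then show ?thesis
    unfolding running_weight_def transpose_add[OF game_carriers(5)[OF i] mat_sum_carrier]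
    using pos_defD(2)[OF bspec[OF Q_pos i]] by simp
qed

lemma riccati_equation_iff:
  assumes P: "P i \<in> carrier_mat n n" and i: "i \<in> players G"
  shows "riccati_equation G K P i \<longleftrightarrow> lyapunov (A_cl G K) (C_cl G K) (P i) + running_weight G K i = 0\<^sub>m n n"
proof -
  have L: "lyapunov (A_cl G K) (C_cl G K) (P i) \<in> carrier_mat n n"
    by (rule lyapunov_carrier[OF cl_carrier P])
  show ?thesis
    unfolding riccati_equation_def running_weight_def
      assoc_add_mat[OF L game_carriers(5)[OF i] mat_sum_carrier, symmetric]
    unfolding lyapunov_def by (rule eq_commute)
qed

section \<open>The gain equation and deviations of a single player\<close>

definition gain_weight :: "nat \<Rightarrow> real mat \<Rightarrow> real mat" where
  "gain_weight i P = Rmat G i i + (Dmat G i)\<^sup>T * P * Dmat G i"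

text \<open>The gain equation (b) multiplied by the matrix that it inverts, with its right side
  brought to the left. The summand of player i inside \<open>C_cl\<close> supplies the term D_i' P
  D_i K_i. Applied to the state, it is half the gradient of the cost rate with respect to a
  deviation.\<close>

definition gain_defect :: "(nat \<Rightarrow> real mat) \<Rightarrow> nat \<Rightarrow> real mat \<Rightarrow> real mat" where
  "gain_defect K i P = Rmat G i i * K i - (Bmat G i)\<^sup>T * P - (Dmat G i)\<^sup>T * P * C_cl G K"

lemma gain_weight_pos_def:
  assumes i: "i \<in> players G" and P: "P \<in> pos_def_mats n"
  shows "gain_weight i P \<in> pos_def_mats (udim G i)"
proof -
  note R = bspec[OF R_pos i] and D = game_carriers(4)[OF i]
  have DT: "(Dmat G i)\<^sup>T \<in> carrier_mat (udim G i) n" using D by simp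
  note DPD = congruence_carrier[OF pos_defD(1)[OF P] D]
  have t: "((Dmat G i)\<^sup>T * P * Dmat G i)\<^sup>T = (Dmat G i)\<^sup>T * P * Dmat G i"
    unfolding transpose_mult[OF mult_carrier_mat[OF DT pos_defD(1)[OF P]] D] transpose_mult[OF DT pos_defD(1)[OF P]]
    by (simp add: pos_defD(2)[OF P] assoc_mult_mat[OF DT pos_defD(1)[OF P] D])
  have q: "quad_form (gain_weight i P) (v :: real vec) = quad_form (Rmat G i i) v + quad_form P (Dmat G i *\<^sub>v v)"
    if v: "v \<in> carrier_vec (udim G i)" for v :: "real vec"
  proof -
    have c: "Rmat G i i *\<^sub>v v \<in> carrier_vec (udim G i)" "((Dmat G i)\<^sup>T * P * Dmat G i) *\<^sub>v v \<in> carrier_vec (udim G i)"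
      using pos_defD(1)[OF R] DPD v by (auto intro: mult_mat_vec_carrier)
    show ?thesis
      unfolding gain_weight_def quad_form_congruence[OF pos_defD(1)[OF P] D v, symmetric]
      unfolding quad_form_def add_mult_distrib_mat_vec[OF pos_defD(1)[OF R] DPD v]
      by (rule scalar_prod_add_distrib[OF v c])
  qed
  show ?thesis
    unfolding pos_def_mats_def
  proof (intro CollectI conjI ballI impI)
    show "gain_weight i P \<in> carrier_mat (udim G i) (udim G i)"
      unfolding gain_weight_def using pos_defD(1)[OF R] DPD by (intro add_carrier_mat)
    show "(gain_weight i P)\<^sup>T = gain_weight i P"
      unfolding gain_weight_def transpose_add[OF pos_defD(1)[OF R] DPD] t pos_defD(2)[OF R] ..
    fix v :: "real vec" assume v: "v \<in> carrier_vec (udim G i)" "v \<noteq> 0\<^sub>v (udim G i)"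
    have "0 \<le> quad_form P (Dmat G i *\<^sub>v v)"
      by (rule pos_defD(4)[OF P mult_mat_vec_carrier[OF D v(1)]])
    then show "0 < quad_form (gain_weight i P) v"
      unfolding q[OF v(1)] using pos_defD(3)[OF R v] by simp
  qed
qed

lemma gain_defect_carrier:
  assumes K: "K \<in> gains" and i: "i \<in> players G" and P: "P \<in> carrier_mat n n"
  shows "gain_defect K i P \<in> carrier_mat (udim G i) n"
  unfolding gain_defect_def using game_carriers(3,4)[OF i] P cl_carrier(2)[of K]
  by (intro minus_carrier_mat mult_carrier_mat[of _ _ n]) auto

lemma gain_defect_apply:
  assumes K: "K \<in> gains" and i: "i \<in> players G" and P: "P \<in> carrier_mat n n" and v: "v \<in> carrier_vec n"
  shows "gain_defect K i P *\<^sub>v v = Rmat G i i *\<^sub>v (K i *\<^sub>v v) - (Bmat G i)\<^sup>T *\<^sub>v (P *\<^sub>v v)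
     - (Dmat G i)\<^sup>T *\<^sub>v (P *\<^sub>v (C_cl G K *\<^sub>v v))"
proof -
  note R = game_carriers(6)[OF i i] and Ki = gainsD[OF K i] and C = cl_carrier(2)[of K]
  have BT: "(Bmat G i)\<^sup>T \<in> carrier_mat (udim G i) n" and DT: "(Dmat G i)\<^sup>T \<in> carrier_mat (udim G i) n"
    using game_carriers(3,4)[OF i] by simp_all
  note c1 = mult_carrier_mat[OF R Ki] and c2 = mult_carrier_mat[OF BT P] and c3 = mult_carrier_mat[OF DT P]
  note c4 = mult_carrier_mat[OF c3 C]
  have c12: "Rmat G i i * K i - (Bmat G i)\<^sup>T * P \<in> carrier_mat (udim G i) n" using c2 by (rule minus_carrier_mat)
  show ?thesis
    unfolding gain_defect_def minus_mult_distrib_mat_vec[OF c12 c4 v] minus_mult_distrib_mat_vec[OF c1 c2 v]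
      assoc_mult_mat_vec[OF R Ki v] assoc_mult_mat_vec[OF BT P v] assoc_mult_mat_vec[OF c3 C v]
      assoc_mult_mat_vec[OF DT P mult_mat_vec_carrier[OF C v]] ..
qed

text \<open>The matrix S is positive definite, so \<open>mat_inverse\<close> returns its inverse and
  (b) may be multiplied by S. The result is compared with the defect entry by entry, once the
  summand of player i has been split off.\<close>

lemma riccati_gain_iff:
  assumes K: "K \<in> gains" and i: "i \<in> players G" and P: "P i \<in> pos_def_mats n"
  shows "riccati_gain G K P i \<longleftrightarrow> gain_defect K i (P i) = 0\<^sub>m (udim G i) n"
proof -
  define m where "m = udim G i"
  define S where "S = gain_weight i (P i)"
  define DP where "DP = (Dmat G i)\<^sup>T * P i"
  define N where "N = (Bmat G i)\<^sup>T * P i + DP * Cmat G - mat_sum m n (\<lambda>k. DP * Dmat G k * K k) (players G - {i})"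
  note Pc = pos_defD(1)[OF P]
  have DT: "(Dmat G i)\<^sup>T \<in> carrier_mat m n" and BT: "(Bmat G i)\<^sup>T \<in> carrier_mat m n"
    using game_carriers(3,4)[OF i] by (simp_all add: m_def)
  have DP: "DP \<in> carrier_mat m n" unfolding DP_def by (rule mult_carrier_mat[OF DT Pc])
  have BP: "(Bmat G i)\<^sup>T * P i \<in> carrier_mat m n" by (rule mult_carrier_mat[OF BT Pc])
  have Ki: "K i \<in> carrier_mat m n" using gainsD[OF K i] by (simp add: m_def)
  have R: "Rmat G i i \<in> carrier_mat m m" using game_carriers(6)[OF i i] by (simp add: m_def)
  have D: "Dmat G i \<in> carrier_mat n m" using game_carriers(4)[OF i] by (simp add: m_def)
  have Dk: "DP * Dmat G k * K k = DP * (Dmat G k * K k)" "Dmat G k * K k \<in> carrier_mat n n"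
    if "k \<in> players G" for k
    using assoc_mult_mat[OF DP game_carriers(4)[OF that] gainsD[OF K that]]
      mult_carrier_mat[OF game_carriers(4)[OF that] gainsD[OF K that]] by auto
  have Npc: "N \<in> carrier_mat m n" unfolding N_def by (rule minus_carrier_mat[OF mat_sum_carrier])
  have S: "S \<in> pos_def_mats m" unfolding S_def m_def by (rule gain_weight_pos_def[OF i P])
  have defect: "gain_defect K i (P i) = S * K i - N"
  proof (rule eq_matI)
    fix a b assume "a < dim_row (S * K i - N)" "b < dim_col (S * K i - N)"
    then have ab: "a < m" "b < n" using Npc by auto
    have 1: "(DP * C_cl G K) $$ (a, b) = (DP * Cmat G) $$ (a, b) - (\<Sum>k\<in>players G. (DP * Dmat G k * K k) $$ (a, b))"
    proof -
      have "DP * C_cl G K = DP * Cmat G - DP * mat_sum n n (\<lambda>j. Dmat G j * K j) (players G)"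
        unfolding C_cl_def by (rule mult_minus_distrib_mat[OF DP game_carriers(2) mat_sum_carrier])
      also have "DP * mat_sum n n (\<lambda>j. Dmat G j * K j) (players G) = mat_sum m n (\<lambda>j. DP * (Dmat G j * K j)) (players G)"
        by (rule mult_mat_sum[OF DP Dk(2)])
      finally have "(DP * C_cl G K) $$ (a, b) = (DP * Cmat G) $$ (a, b)
          - mat_sum m n (\<lambda>j. DP * (Dmat G j * K j)) (players G) $$ (a, b)"
        using index_mat_carrier(2)[OF mat_sum_carrier ab] by simp
      also have "mat_sum m n (\<lambda>j. DP * (Dmat G j * K j)) (players G) $$ (a, b)
          = (\<Sum>k\<in>players G. (DP * (Dmat G k * K k)) $$ (a, b))"
        unfolding mat_sum_def using ab by simp
      also have "\<dots> = (\<Sum>k\<in>players G. (DP * Dmat G k * K k) $$ (a, b))"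
        by (intro sum.cong refl) (simp only: Dk(1))
      finally show ?thesis .
    qed
    have 2: "(S * K i) $$ (a, b) = (Rmat G i i * K i) $$ (a, b) + (DP * Dmat G i * K i) $$ (a, b)"
    proof -
      have "S * K i = Rmat G i i * K i + DP * Dmat G i * K i"
        unfolding S_def gain_weight_def DP_def[symmetric]
        by (rule add_mult_distrib_mat[OF R mult_carrier_mat[OF DP D] Ki])
      then show ?thesis
        using index_mat_carrier(1)[OF mult_carrier_mat[OF mult_carrier_mat[OF DP D] Ki] ab] by simp
    qed
    have 3: "(\<Sum>k\<in>players G. (DP * Dmat G k * K k) $$ (a, b)) = (DP * Dmat G i * K i) $$ (a, b)
        + (\<Sum>k\<in>players G - {i}. (DP * Dmat G k * K k) $$ (a, b))"
      by (rule sum.remove[OF finite_players i])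
    have 4: "N $$ (a, b) = ((Bmat G i)\<^sup>T * P i) $$ (a, b) + (DP * Cmat G) $$ (a, b)
       - (\<Sum>k\<in>players G - {i}. (DP * Dmat G k * K k) $$ (a, b))"
      unfolding N_def index_mat_carrier(2)[OF mat_sum_carrier ab]
        index_mat_carrier(1)[OF mult_carrier_mat[OF DP game_carriers(2)] ab]
      unfolding mat_sum_def using ab by simp
    have "gain_defect K i (P i) $$ (a, b) = (Rmat G i i * K i) $$ (a, b) - ((Bmat G i)\<^sup>T * P i) $$ (a, b) - (DP * C_cl G K) $$ (a, b)"
      unfolding gain_defect_def DP_def[symmetric]
        index_mat_carrier(2)[OF mult_carrier_mat[OF DP cl_carrier(2)[of K]] ab]
        index_mat_carrier(2)[OF BP ab] ..
    also have "\<dots> = (S * K i - N) $$ (a, b)"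
      unfolding index_mat_carrier(2)[OF Npc ab] using 1 2 3 4 by linarith
    finally show "gain_defect K i (P i) $$ (a, b) = (S * K i - N) $$ (a, b)" .
  qed (use gain_defect_carrier[OF K i Pc] Npc in \<open>auto simp: m_def\<close>)
  obtain B where B: "mat_inverse S = Some B" "B \<in> carrier_mat m m" "S * B = 1\<^sub>m m" "B * S = 1\<^sub>m m"
    by (rule pos_def_inverse[OF S])
  note Sc = pos_defD(1)[OF S]
  have "riccati_gain G K P i \<longleftrightarrow> K i = B * N"
    unfolding riccati_gain_def N_def DP_def using B(1) by (simp add: S_def gain_weight_def m_def)
  also have "\<dots> \<longleftrightarrow> S * K i = N"
  proof
    assume "K i = B * N"
    then show "S * K i = N" using assoc_mult_mat[OF Sc B(2) Npc] B(3) Npc by simp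
  next
    assume "S * K i = N"
    then have "B * N = B * (S * K i)" by simp
    also have "\<dots> = K i" using assoc_mult_mat[OF B(2) Sc Ki] B(4) Ki by simp
    finally show "K i = B * N" by simp
  qed
  also have "\<dots> \<longleftrightarrow> S * K i - N = 0\<^sub>m m n"
  proof
    assume z: "S * K i - N = 0\<^sub>m m n"
    show "S * K i = N"
    proof (rule eq_matI)
      fix a b assume "a < dim_row N" "b < dim_col N"
      then have ab: "a < m" "b < n" using Npc by auto
      from index_mat_carrier(2)[OF Npc ab, of "S * K i"]
      have "(S * K i) $$ (a, b) - N $$ (a, b) = 0" unfolding z using ab by simp
      then show "(S * K i) $$ (a, b) = N $$ (a, b)" by (simp only: right_minus_eq)
    qed (use mult_carrier_mat[OF Sc Ki] Npc in auto)
  qed (use Npc in simp)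
  finally show ?thesis by (simp only: defect m_def)
qed

text \<open>Completing the square in the deviation of player i.\<close>

lemma deviation_identity:
  assumes K: "K \<in> gains" and i: "i \<in> players G" and P: "P \<in> pos_def_mats n"
    and Ki: "Ki \<in> carrier_mat (udim G i) n" and v: "v \<in> carrier_vec n"
  defines "\<delta> \<equiv> Ki *\<^sub>v v - K i *\<^sub>v v" and "K' \<equiv> K(i := Ki)"
  shows "quad_form (lyapunov (A_cl G K') (C_cl G K') P) v + quad_form (running_weight G K' i) v
    = quad_form (lyapunov (A_cl G K) (C_cl G K) P) v + quad_form (running_weight G K i) v
      + 2 * (\<delta> \<bullet> (gain_defect K i P *\<^sub>v v)) + quad_form (gain_weight i P) \<delta>"
proof -
  define m where "m = udim G i"
  note Pc = pos_defD(1,2)[OF P]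
  note R = pos_defD(1,2)[OF bspec[OF R_pos i], folded m_def]
  have B: "Bmat G i \<in> carrier_mat n m" and D: "Dmat G i \<in> carrier_mat n m"
    using game_carriers(3,4)[OF i] by (simp_all add: m_def)
  define y where "y = A_cl G K *\<^sub>v v"
  define z where "z = C_cl G K *\<^sub>v v"
  define k where "k = K i *\<^sub>v v"
  have y: "y \<in> carrier_vec n" and z: "z \<in> carrier_vec n"
    unfolding y_def z_def using cl_carrier v by (auto intro: mult_mat_vec_carrier)
  have k: "k \<in> carrier_vec m" and k': "Ki *\<^sub>v v \<in> carrier_vec m"
    unfolding k_def m_def using gainsD[OF K i] Ki v by (auto intro: mult_mat_vec_carrier)
  have d: "\<delta> \<in> carrier_vec m" unfolding \<delta>_def by (rule minus_carrier_vec[OF k' k[unfolded k_def]])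
  \<comment> \<open>Differences are written as sums with factor - 1, the shape that
    \<open>quad_form_add\<close> and \<open>quad_form_smult\<close> accept.\<close>
  have y': "A_cl G K' *\<^sub>v v = y + (- 1) \<cdot>\<^sub>v (Bmat G i *\<^sub>v \<delta>)"
    and z': "C_cl G K' *\<^sub>v v = z + (- 1) \<cdot>\<^sub>v (Dmat G i *\<^sub>v \<delta>)"
    unfolding K'_def y_def z_def \<delta>_def cl_update[OF K i Ki v] by (auto intro!: eq_vecI)
  have k'_eq: "Ki *\<^sub>v v = k + \<delta>"
  proof -
    have "u = k + (u - k)" if "u \<in> carrier_vec m" for u
      using that k by (intro eq_vecI) auto
    from this[OF k'] show ?thesis by (simp only: \<delta>_def k_def)
  qed
  have Bd: "Bmat G i *\<^sub>v \<delta> \<in> carrier_vec n" and Dd: "Dmat G i *\<^sub>v \<delta> \<in> carrier_vec n"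
    using B D d by (auto intro: mult_mat_vec_carrier)
  have Pv: "P *\<^sub>v v \<in> carrier_vec n" and Pz: "P *\<^sub>v z \<in> carrier_vec n" and Py: "P *\<^sub>v y \<in> carrier_vec n"
    using Pc v z y by (auto intro: mult_mat_vec_carrier)
  \<comment> \<open>For symmetric P the two drift terms of the Lyapunov form coincide.\<close>
  have lyap: "quad_form (lyapunov A C P) v = 2 * ((A *\<^sub>v v) \<bullet> (P *\<^sub>v v)) + quad_form P (C *\<^sub>v v)"
    if "A \<in> carrier_mat n n" "C \<in> carrier_mat n n" for A C
    unfolding quad_form_lyapunov[OF that Pc(1) v]
    using symmetric_scalar_prod[OF Pc v mult_mat_vec_carrier[OF that(1) v]] by (simp add: quad_form_def)
  have L: "quad_form (lyapunov (A_cl G K) (C_cl G K) P) v = 2 * (y \<bullet> (P *\<^sub>v v)) + quad_form P z"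
    unfolding lyap[OF cl_carrier] y_def z_def ..
  have "quad_form (lyapunov (A_cl G K') (C_cl G K') P) v
      = 2 * ((y + (- 1) \<cdot>\<^sub>v (Bmat G i *\<^sub>v \<delta>)) \<bullet> (P *\<^sub>v v)) + quad_form P (z + (- 1) \<cdot>\<^sub>v (Dmat G i *\<^sub>v \<delta>))"
    unfolding lyap[OF cl_carrier] y' z' ..
  also have "(y + (- 1) \<cdot>\<^sub>v (Bmat G i *\<^sub>v \<delta>)) \<bullet> (P *\<^sub>v v) = y \<bullet> (P *\<^sub>v v) - \<delta> \<bullet> ((Bmat G i)\<^sup>T *\<^sub>v (P *\<^sub>v v))"
    using add_scalar_prod_distrib[OF y _ Pv, of "(- 1) \<cdot>\<^sub>v (Bmat G i *\<^sub>v \<delta>)"]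
      smult_scalar_prod_distrib[OF Bd Pv, of "- 1"] Bd scalar_prod_transpose[OF B Pv d] by simp
  also have "quad_form P (z + (- 1) \<cdot>\<^sub>v (Dmat G i *\<^sub>v \<delta>))
      = quad_form P z - 2 * (\<delta> \<bullet> ((Dmat G i)\<^sup>T *\<^sub>v (P *\<^sub>v z))) + quad_form P (Dmat G i *\<^sub>v \<delta>)"
  proof -
    have mDd: "(- 1) \<cdot>\<^sub>v (Dmat G i *\<^sub>v \<delta>) \<in> carrier_vec n" using Dd by simp
    have PDd: "P *\<^sub>v (Dmat G i *\<^sub>v \<delta>) \<in> carrier_vec n" using Pc Dd by (auto intro: mult_mat_vec_carrier)
    have "z \<bullet> (P *\<^sub>v ((- 1) \<cdot>\<^sub>v (Dmat G i *\<^sub>v \<delta>))) = - (z \<bullet> (P *\<^sub>v (Dmat G i *\<^sub>v \<delta>)))"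
      unfolding mult_mat_vec[OF Pc(1) Dd] scalar_prod_smult_distrib[OF z PDd] by simp
    also have "z \<bullet> (P *\<^sub>v (Dmat G i *\<^sub>v \<delta>)) = (Dmat G i *\<^sub>v \<delta>) \<bullet> (P *\<^sub>v z)"
      by (rule symmetric_scalar_prod[OF Pc z Dd])
    also have "\<dots> = \<delta> \<bullet> ((Dmat G i)\<^sup>T *\<^sub>v (P *\<^sub>v z))"
      by (rule scalar_prod_transpose[OF D Pz d, symmetric])
    finally show ?thesis
      unfolding quad_form_add[OF Pc z mDd] quad_form_smult[OF Pc(1) Dd] by simp
  qed
  finally have L': "quad_form (lyapunov (A_cl G K') (C_cl G K') P) v
     = 2 * (y \<bullet> (P *\<^sub>v v)) - 2 * (\<delta> \<bullet> ((Bmat G i)\<^sup>T *\<^sub>v (P *\<^sub>v v)))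
       + quad_form P z - 2 * (\<delta> \<bullet> ((Dmat G i)\<^sup>T *\<^sub>v (P *\<^sub>v z))) + quad_form P (Dmat G i *\<^sub>v \<delta>)"
    by (simp add: algebra_simps)
  have W: "quad_form (running_weight G K' i) v - quad_form (running_weight G K i) v
     = 2 * (\<delta> \<bullet> (Rmat G i i *\<^sub>v k)) + quad_form (Rmat G i i) \<delta>"
  proof -
    have "quad_form (running_weight G K' i) v - quad_form (running_weight G K i) v
      = quad_form (Rmat G i i) (Ki *\<^sub>v v) - quad_form (Rmat G i i) (K i *\<^sub>v v)"
      unfolding K'_def quad_form_running_weight[OF gains_update[OF K Ki] i v] quad_form_running_weight[OF K i v]
        sum.remove[OF finite_players i, of "\<lambda>j. quad_form (Rmat G i j) ((K(i := Ki)) j *\<^sub>v v)"]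
        sum.remove[OF finite_players i, of "\<lambda>j. quad_form (Rmat G i j) (K j *\<^sub>v v)"]
      by simp
    also have "\<dots> = 2 * (k \<bullet> (Rmat G i i *\<^sub>v \<delta>)) + quad_form (Rmat G i i) \<delta>"
      unfolding k'_eq k_def[symmetric] quad_form_add[OF R k d] by simp
    finally show ?thesis using symmetric_scalar_prod[OF R k d] by simp
  qed
  have S: "quad_form (gain_weight i P) \<delta> = quad_form (Rmat G i i) \<delta> + quad_form P (Dmat G i *\<^sub>v \<delta>)"
  proof -
    note DPD = congruence_carrier[OF Pc(1) D]
    have c: "Rmat G i i *\<^sub>v \<delta> \<in> carrier_vec m" "((Dmat G i)\<^sup>T * P * Dmat G i) *\<^sub>v \<delta> \<in> carrier_vec m"
      using R DPD d by (auto intro: mult_mat_vec_carrier)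
    show ?thesis
      unfolding gain_weight_def quad_form_congruence[OF Pc(1) D d, symmetric]
      unfolding quad_form_def add_mult_distrib_mat_vec[OF R(1) DPD d]
      by (rule scalar_prod_add_distrib[OF d c])
  qed
  have G: "\<delta> \<bullet> (gain_defect K i P *\<^sub>v v) = \<delta> \<bullet> (Rmat G i i *\<^sub>v k) - \<delta> \<bullet> ((Bmat G i)\<^sup>T *\<^sub>v (P *\<^sub>v v))
     - \<delta> \<bullet> ((Dmat G i)\<^sup>T *\<^sub>v (P *\<^sub>v z))"
  proof -
    have BT: "(Bmat G i)\<^sup>T \<in> carrier_mat m n" and DT: "(Dmat G i)\<^sup>T \<in> carrier_mat m n"
      using B D by simp_all
    note c = mult_mat_vec_carrier[OF R(1) k] mult_mat_vec_carrier[OF BT Pv] mult_mat_vec_carrier[OF DT Pz]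
    have c12: "Rmat G i i *\<^sub>v k - (Bmat G i)\<^sup>T *\<^sub>v (P *\<^sub>v v) \<in> carrier_vec m" using c by simp
    show ?thesis
      unfolding gain_defect_apply[OF K i Pc(1) v] k_def[symmetric] z_def[symmetric]
        scalar_prod_minus_distrib[OF d c12 c(3)] scalar_prod_minus_distrib[OF d c(1,2)] ..
  qed
  show ?thesis unfolding L L' S G using W by (simp add: algebra_simps)
qed

end

section \<open>The closed loop\<close>

lemma quad_form_uminus:
  fixes R :: "real mat"
  assumes R: "R \<in> carrier_mat m m" and u: "u \<in> carrier_vec m"
  shows "quad_form R (- u) = quad_form R u"
proof -
  have "- u = (- 1) \<cdot>\<^sub>v u" by (intro eq_vecI) auto
  then show ?thesis using quad_form_smult[OF R u, of "- 1"] by simp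
qed

context wiener_setting
begin

text \<open>The carrier conditions on a state hold only for nonnegative times and points of the
  space, so the closed-loop diffusion can be replaced by its coordinate formula only there.\<close>

lemma has_ito_integral_cong:
  assumes ito: "has_ito_integral M F w T H Y" and T: "0 \<le> T"
    and eq: "\<And>t \<omega>. 0 \<le> t \<Longrightarrow> t \<le> T \<Longrightarrow> \<omega> \<in> space M \<Longrightarrow> H t \<omega> = H' t \<omega>"
  shows "has_ito_integral M F w T H' Y"
proof -
  from ito obtain m \<tau> \<xi> where H: "square_integrable_adapted M F T H" and Y: "Y \<in> borel_measurable M"
    and sp: "\<And>l. simple_process M F T (m l) (\<tau> l) (\<xi> l)"
    and lim1: "(\<lambda>l. \<integral>\<^sup>+\<omega>. (\<integral>\<^sup>+t\<in>{0..T}. ennreal ((H t \<omega> - simple_value (m l) (\<tau> l) (\<xi> l) t \<omega>)\<^sup>2) \<partial>lborel) \<partial>M)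
          \<longlonglongrightarrow> 0"
    and lim2: "(\<lambda>l. \<integral>\<^sup>+\<omega>. ennreal ((Y \<omega> - simple_integral w (m l) (\<tau> l) (\<xi> l) \<omega>)\<^sup>2) \<partial>M) \<longlonglongrightarrow> 0"
    unfolding has_ito_integral_def by blast
  have "square_integrable (time_space T) (\<lambda>(t, \<omega>). H' t \<omega>)"
  proof (rule square_integrable_cong)
    show "square_integrable (time_space T) (\<lambda>(t, \<omega>). H t \<omega>)"
      using H by (simp only: square_integrable_adapted_iff)
    fix z assume "z \<in> space (time_space T)"
    then have "0 \<le> fst z" "fst z \<le> T" "snd z \<in> space M" by (auto simp: space_pair_measure space_restrict_space)
    then show "(case z of (t, \<omega>) \<Rightarrow> H t \<omega>) = (case z of (t, \<omega>) \<Rightarrow> H' t \<omega>)"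
      unfolding split_beta by (rule eq)
  qed
  moreover have "H' t \<in> borel_measurable (F t)" if t: "t \<in> {0..T}" for t
  proof (rule measurable_cong[THEN iffD1])
    show "H t \<in> borel_measurable (F t)" using H t by (simp add: square_integrable_adapted_def)
    show "H t \<omega> = H' t \<omega>" if "\<omega> \<in> space (F t)" for \<omega>
      using that t space_F[of t] by (intro eq) auto
  qed
  ultimately have H': "square_integrable_adapted M F T H'" by (simp add: square_integrable_adapted_iff)
  have "(\<integral>\<^sup>+\<omega>. (\<integral>\<^sup>+t\<in>{0..T}. ennreal ((H t \<omega> - simple_value (m l) (\<tau> l) (\<xi> l) t \<omega>)\<^sup>2) \<partial>lborel) \<partial>M)
      = (\<integral>\<^sup>+\<omega>. (\<integral>\<^sup>+t\<in>{0..T}. ennreal ((H' t \<omega> - simple_value (m l) (\<tau> l) (\<xi> l) t \<omega>)\<^sup>2) \<partial>lborel) \<partial>M)" for l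
  proof (intro nn_integral_cong)
    fix \<omega> and t :: real assume w: "\<omega> \<in> space M"
    show "ennreal ((H t \<omega> - simple_value (m l) (\<tau> l) (\<xi> l) t \<omega>)\<^sup>2) * indicator {0..T} t
       = ennreal ((H' t \<omega> - simple_value (m l) (\<tau> l) (\<xi> l) t \<omega>)\<^sup>2) * indicator {0..T} t"
      using eq[OF _ _ w, of t] by (cases "t \<in> {0..T}") simp_all
  qed
  with lim1 have lim1': "(\<lambda>l. \<integral>\<^sup>+\<omega>. (\<integral>\<^sup>+t\<in>{0..T}. ennreal ((H' t \<omega> - simple_value (m l) (\<tau> l) (\<xi> l) t \<omega>)\<^sup>2) \<partial>lborel) \<partial>M)
      \<longlonglongrightarrow> 0"
    by (simp only:)
  show ?thesis
    unfolding has_ito_integral_def using H' Y sp lim1' lim2 by blast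
qed

end

section \<open>The closed-loop state as a solution of a linear equation\<close>

locale stochastic_lq_game = wiener_setting M F w + lq_setting G
  for M :: "'a measure" and F :: "real \<Rightarrow> 'a measure" and w :: "real \<Rightarrow> 'a \<Rightarrow> real" and G :: lq_game
begin

text \<open>Translates the vector dynamics of the game into the coefficients of
  \<open>linear_sde\<close>; the sign of the feedback is absorbed by the closed-loop
  matrices.\<close>

lemma feedback_coefficient:
  assumes K: "K \<in> gains" and v: "v \<in> carrier_vec n" and r: "r < n"
  shows "drift G v (\<lambda>j. - (K j *\<^sub>v v)) $ r = (\<Sum>q<n. A_cl G K $$ (r, q) * v $ q)"
    and "diffusion G v (\<lambda>j. - (K j *\<^sub>v v)) $ r = (\<Sum>q<n. C_cl G K $$ (r, q) * v $ q)"
proof -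
  have *: "(u + finsum_vec TYPE(real) n (\<lambda>j. B j *\<^sub>v - (K j *\<^sub>v v)) (players G)) $ r
     = u $ r - (\<Sum>j\<in>players G. (B j *\<^sub>v (K j *\<^sub>v v)) $ r)"
    if B: "\<And>j. j \<in> players G \<Longrightarrow> B j \<in> carrier_mat n (udim G j)" for B :: "nat \<Rightarrow> real mat" and u
  proof -
    have Kv: "K j *\<^sub>v v \<in> carrier_vec (udim G j)" if "j \<in> players G" for j
      by (rule mult_mat_vec_carrier[OF gainsD[OF K that] v])
    have c: "(\<lambda>j. B j *\<^sub>v - (K j *\<^sub>v v)) \<in> players G \<rightarrow> carrier_vec n"
      using B Kv by (intro Pi_I mult_mat_vec_carrier) auto
    have neg: "(B j *\<^sub>v - (K j *\<^sub>v v)) $ r = - (B j *\<^sub>v (K j *\<^sub>v v)) $ r" if "j \<in> players G" for j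
    proof -
      have r': "r < dim_row (B j)" using r by (simp only: carrier_matD[OF B[OF that]])
      have d: "dim_vec (Matrix.row (B j) r) = dim_vec (K j *\<^sub>v v)"
        by (simp only: index_row(2) carrier_matD[OF B[OF that]] carrier_vecD[OF Kv[OF that]])
      show ?thesis
        unfolding index_mult_mat_vec[OF r'] by (rule scalar_prod_uminus_right[OF d])
    qed
    have "r < dim_vec (finsum_vec TYPE(real) n (\<lambda>j. B j *\<^sub>v - (K j *\<^sub>v v)) (players G))"
      using carrier_vecD[OF finsum_vec_closed[OF c]] r by simp
    then have "(u + finsum_vec TYPE(real) n (\<lambda>j. B j *\<^sub>v - (K j *\<^sub>v v)) (players G)) $ r
      = u $ r + (\<Sum>j\<in>players G. (B j *\<^sub>v - (K j *\<^sub>v v)) $ r)"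
      unfolding index_finsum_vec[OF finite_players r c, symmetric] by (rule index_add_vec(1))
    also have "\<dots> = u $ r + (\<Sum>j\<in>players G. - (B j *\<^sub>v (K j *\<^sub>v v)) $ r)"
      by (intro arg_cong2[of _ _ _ _ "(+)"] sum.cong refl neg)
    finally show ?thesis by (simp only: sum_negf diff_conv_add_uminus)
  qed
  show "drift G v (\<lambda>j. - (K j *\<^sub>v v)) $ r = (\<Sum>q<n. A_cl G K $$ (r, q) * v $ q)"
  proof -
    have "drift G v (\<lambda>j. - (K j *\<^sub>v v)) $ r = (A_cl G K *\<^sub>v v) $ r"
      unfolding drift_def cl_apply(1)[OF K v r] by (rule *[of "Bmat G"]) (rule game_carriers(3))
    also have "\<dots> = (\<Sum>q<n. A_cl G K $$ (r, q) * v $ q)"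
      by (rule mult_mat_vec_expand[OF cl_carrier(1) v r])
    finally show ?thesis .
  qed
  show "diffusion G v (\<lambda>j. - (K j *\<^sub>v v)) $ r = (\<Sum>q<n. C_cl G K $$ (r, q) * v $ q)"
  proof -
    have "diffusion G v (\<lambda>j. - (K j *\<^sub>v v)) $ r = (C_cl G K *\<^sub>v v) $ r"
      unfolding diffusion_def cl_apply(2)[OF K v r] by (rule *[of "Dmat G"]) (rule game_carriers(4))
    also have "\<dots> = (\<Sum>q<n. C_cl G K $$ (r, q) * v $ q)"
      by (rule mult_mat_vec_expand[OF cl_carrier(2) v r])
    finally show ?thesis .
  qed
qed

abbreviation cl_sde :: "(nat \<Rightarrow> real mat) \<Rightarrow> real vec \<Rightarrow> (nat \<Rightarrow> real \<Rightarrow> 'a \<Rightarrow> real) \<Rightarrow> bool" where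
  "cl_sde K x0 X \<equiv> linear_sde n (\<lambda>r q. A_cl G K $$ (r, q)) (\<lambda>r q. C_cl G K $$ (r, q)) (\<lambda>r. x0 $ r) X"

lemma state_process_of_linear_sde:
  assumes K: "K \<in> gains" and Z: "cl_sde K x0 Z"
  shows "state_process M F w G x0 (\<lambda>j t \<omega>. - (K j *\<^sub>v vec n (\<lambda>r. Z r t \<omega>))) (\<lambda>t \<omega>. vec n (\<lambda>r. Z r t \<omega>))"
proof -
  note Zd = Z[unfolded linear_sde_def]
  define x where "x t \<omega> = vec n (\<lambda>r. Z r t \<omega>)" for t \<omega>
  have x: "x t \<omega> \<in> carrier_vec n" "r < n \<Longrightarrow> x t \<omega> $ r = Z r t \<omega>" for t \<omega> r by (simp_all add: x_def)
  have sqZ: "square_integrable_adapted M F T (Z r)" if "0 \<le> T" "r < n" for T r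
    using Zd that by blast
  have drift: "drift G (x s \<omega>) (\<lambda>j. - (K j *\<^sub>v x s \<omega>)) $ r = (\<Sum>q<n. A_cl G K $$ (r, q) * Z q s \<omega>)"
    and diff: "diffusion G (x s \<omega>) (\<lambda>j. - (K j *\<^sub>v x s \<omega>)) $ r = (\<Sum>q<n. C_cl G K $$ (r, q) * Z q s \<omega>)" if "r < n" for s \<omega> r
    unfolding feedback_coefficient[OF K x(1) that] by (intro sum.cong refl; simp add: x(2))+
  show ?thesis
    unfolding x_def[symmetric] state_process_def
  proof (intro conjI allI impI ballI)
    show "x t \<omega> \<in> carrier_vec n" for t \<omega> by (rule x(1))
    show "- (K j *\<^sub>v x t \<omega>) \<in> carrier_vec (udim G j)" if "j \<in> players G" for j t \<omega>
      using mult_mat_vec_carrier[OF gainsD[OF K that] x(1)] by simp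
    show "square_integrable_adapted M F T (\<lambda>t \<omega>. x t \<omega> $ r)" if "0 \<le> T" "r < n" for T r
      using sqZ[OF that] by (simp only: x(2)[OF that(2)])
    show "square_integrable_adapted M F T (\<lambda>t \<omega>. (- (K j *\<^sub>v x t \<omega>)) $ r)"
      if T: "0 \<le> T" and j: "j \<in> players G" and r: "r < udim G j" for T j r
    proof -
      have "(- (K j *\<^sub>v x t \<omega>)) $ r = (\<Sum>q<n. - K j $$ (r, q) * Z q t \<omega>)" for t \<omega>
      proof -
        have "r < dim_vec (K j *\<^sub>v x t \<omega>)" using gainsD[OF K j] r by simp
        then have "(- (K j *\<^sub>v x t \<omega>)) $ r = - ((K j *\<^sub>v x t \<omega>) $ r)" by (rule index_uminus_vec(1))
        also have "(K j *\<^sub>v x t \<omega>) $ r = (\<Sum>q<n. K j $$ (r, q) * Z q t \<omega>)"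
          unfolding mult_mat_vec_expand[OF gainsD[OF K j] x(1) r] by (intro sum.cong refl) (simp add: x(2))
        finally show ?thesis by (simp only: sum_negf mult_minus_left)
      qed
      moreover have "square_integrable_adapted M F T (\<lambda>t \<omega>. \<Sum>q<n. - K j $$ (r, q) * Z q t \<omega>)"
        by (rule square_integrable_adapted_linear[OF sqZ[OF T]])
      ultimately show ?thesis by (simp only:)
    qed
    show "continuous_on {0..} (\<lambda>t. x t \<omega> $ r)" if "\<omega> \<in> space M" "r < n" for \<omega> r
      using Zd that by (simp only: x(2)[OF that(2)])
    show "\<exists>Y. has_ito_integral M F w t (\<lambda>s \<omega>. diffusion G (x s \<omega>) (\<lambda>j. - (K j *\<^sub>v x s \<omega>)) $ r) Y \<and>
        (AE \<omega> in M. x t \<omega> $ r = x0 $ r + (LBINT s:{0..t}. drift G (x s \<omega>) (\<lambda>j. - (K j *\<^sub>v x s \<omega>)) $ r) + Y \<omega>)"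
      if "0 \<le> t" "r < n" for t r
      unfolding drift[OF that(2)] diff[OF that(2)] x(2)[OF that(2)] using Zd that by blast
  qed
qed

text \<open>The reverse of \<open>state_process_of_linear_sde\<close>, to be applied to whatever
  solution the choice operator returns.\<close>

lemma linear_sde_of_state_process:
  assumes K: "K \<in> gains" and x: "state_process M F w G x0 (\<lambda>j t \<omega>. - (K j *\<^sub>v x t \<omega>)) x"
  shows "cl_sde K x0 (\<lambda>r t \<omega>. x t \<omega> $ r)"
  unfolding linear_sde_def
proof (intro conjI allI impI ballI)
  note xd = x[unfolded state_process_def]
  have xc: "x t \<omega> \<in> carrier_vec n" if "0 \<le> t" "\<omega> \<in> space M" for t \<omega>
    using conjunct1[OF xd] that by blast
  show "square_integrable_adapted M F T (\<lambda>t \<omega>. x t \<omega> $ r)" if "0 \<le> T" "r < n" for T r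
    using conjunct1[OF conjunct2[OF xd]] that by blast
  show "continuous_on {0..} (\<lambda>t. x t \<omega> $ r)" if "\<omega> \<in> space M" "r < n" for \<omega> r
    using conjunct1[OF conjunct2[OF conjunct2[OF conjunct2[OF xd]]]] that by blast
  fix t r assume t: "0 \<le> (t :: real)" and r: "r < n"
  obtain Y where Y: "has_ito_integral M F w t (\<lambda>s \<omega>. diffusion G (x s \<omega>) (\<lambda>j. - (K j *\<^sub>v x s \<omega>)) $ r) Y"
    and eq: "AE \<omega> in M. x t \<omega> $ r = x0 $ r + (LBINT s:{0..t}. drift G (x s \<omega>) (\<lambda>j. - (K j *\<^sub>v x s \<omega>)) $ r) + Y \<omega>"
    using conjunct2[OF conjunct2[OF conjunct2[OF conjunct2[OF xd]]]] t r by blast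
  have "has_ito_integral M F w t (\<lambda>s \<omega>. \<Sum>q<n. C_cl G K $$ (r, q) * x s \<omega> $ q) Y"
    by (rule has_ito_integral_cong[OF Y t]) (rule feedback_coefficient(2)[OF K xc r])
  moreover have "AE \<omega> in M. x t \<omega> $ r = x0 $ r + (LBINT s:{0..t}. \<Sum>q<n. A_cl G K $$ (r, q) * x s \<omega> $ q) + Y \<omega>"
    using eq AE_space
  proof eventually_elim
    case (elim \<omega>)
    have "(LBINT s:{0..t}. drift G (x s \<omega>) (\<lambda>j. - (K j *\<^sub>v x s \<omega>)) $ r)
        = (LBINT s:{0..t}. \<Sum>q<n. A_cl G K $$ (r, q) * x s \<omega> $ q)"
    proof (rule set_lebesgue_integral_cong)
      show "\<forall>s. s \<in> {0..t} \<longrightarrow> drift G (x s \<omega>) (\<lambda>j. - (K j *\<^sub>v x s \<omega>)) $ r = (\<Sum>q<n. A_cl G K $$ (r, q) * x s \<omega> $ q)"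
        using feedback_coefficient(1)[OF K xc[OF _ elim(2)] r] by simp
    qed simp
    with elim(1) show ?case by (simp only:)
  qed
  ultimately show "\<exists>Y. has_ito_integral M F w t (\<lambda>s \<omega>. \<Sum>q<n. C_cl G K $$ (r, q) * x s \<omega> $ q) Y \<and>
      (AE \<omega> in M. x t \<omega> $ r = x0 $ r + (LBINT s:{0..t}. \<Sum>q<n. A_cl G K $$ (r, q) * x s \<omega> $ q) + Y \<omega>)"
    by (intro exI[of _ Y] conjI)
qed

definition coord :: "(nat \<Rightarrow> real mat) \<Rightarrow> real vec \<Rightarrow> nat \<Rightarrow> real \<Rightarrow> 'a \<Rightarrow> real" where
  "coord K x0 r t \<omega> = closed_loop_state M F w G K x0 t \<omega> $ r"

text \<open>Existence makes the choice in \<open>closed_loop_state\<close> a solution, whichever one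
  it is. The later estimates start from these three facts.\<close>

lemma closed_loop:
  assumes K: "K \<in> gains"
  shows "cl_sde K x0 (coord K x0)"
    and "0 \<le> t \<Longrightarrow> \<omega> \<in> space M \<Longrightarrow> closed_loop_state M F w G K x0 t \<omega> \<in> carrier_vec n"
    and "0 \<le> t \<Longrightarrow> \<omega> \<in> space M \<Longrightarrow> vec n (\<lambda>r. coord K x0 r t \<omega>) = closed_loop_state M F w G K x0 t \<omega>"
proof -
  obtain Z where "cl_sde K x0 Z" using linear_sde_exists by blast
  from state_process_of_linear_sde[OF K this]
  have "\<exists>x. state_process M F w G x0 (\<lambda>j t \<omega>. - (K j *\<^sub>v x t \<omega>)) x"
    by (rule exI[of _ "\<lambda>t \<omega>. vec n (\<lambda>r. Z r t \<omega>)"])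
  then have sp: "state_process M F w G x0 (\<lambda>j t \<omega>. - (K j *\<^sub>v closed_loop_state M F w G K x0 t \<omega>)) (closed_loop_state M F w G K x0)"
    unfolding closed_loop_state_def by (rule someI_ex)
  show "cl_sde K x0 (coord K x0)"
    unfolding coord_def[abs_def] by (rule linear_sde_of_state_process[OF K sp])
  show c: "closed_loop_state M F w G K x0 t \<omega> \<in> carrier_vec n" if "0 \<le> t" "\<omega> \<in> space M"
    using conjunct1[OF sp[unfolded state_process_def]] that by blast
  show "vec n (\<lambda>r. coord K x0 r t \<omega>) = closed_loop_state M F w G K x0 t \<omega>" if "0 \<le> t" "\<omega> \<in> space M"
    using c[OF that] unfolding coord_def by (intro eq_vecI) auto
qed

end

section \<open>Costs, stability and equilibria\<close>

lemma half_line_integral_ge: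
  fixes g :: "real \<Rightarrow> real"
  assumes g: "set_integrable lborel {0..T} g" and nonneg: "\<And>t. 0 \<le> t \<Longrightarrow> 0 \<le> g t"
  shows "ennreal (LBINT t:{0..T}. g t) \<le> (\<integral>\<^sup>+t\<in>{0..}. ennreal (g t) \<partial>lborel)"
proof -
  have "ennreal (LBINT t:{0..T}. g t) = (\<integral>\<^sup>+t. ennreal (indicator {0..T} t *\<^sub>R g t) \<partial>lborel)"
    unfolding set_lebesgue_integral_def
    by (rule nn_integral_eq_integral[symmetric])
      (use g nonneg in \<open>auto simp: set_integrable_def indicator_def\<close>)
  also have "\<dots> \<le> (\<integral>\<^sup>+t\<in>{0..}. ennreal (g t) \<partial>lborel)"
    by (intro nn_integral_mono) (simp add: indicator_def)
  finally show ?thesis .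
qed

text \<open>Fatou's lemma along integer horizons. The bound is asked for T \<ge> 1 only, since the
  surplus in \<open>cost_le\<close> is counted on [0, 1].\<close>

lemma half_line_integral_le:
  fixes g :: "real \<Rightarrow> real"
  assumes g: "\<And>T. 0 \<le> T \<Longrightarrow> set_integrable lborel {0..T} g" and nonneg: "\<And>t. 0 \<le> t \<Longrightarrow> 0 \<le> g t"
    and B: "\<And>T. 1 \<le> T \<Longrightarrow> (LBINT t:{0..T}. g t) \<le> B"
  shows "(\<integral>\<^sup>+t\<in>{0..}. ennreal (g t) \<partial>lborel) \<le> ennreal B"
proof -
  define f where "f m t = ennreal (indicator {0..real m} t *\<^sub>R g t)" for m :: nat and t
  have fm: "f m \<in> borel_measurable lborel" for m
    unfolding f_def[abs_def] using g[of "real m"] by (auto simp: set_integrable_def)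
  have "(\<integral>\<^sup>+t\<in>{0..}. ennreal (g t) \<partial>lborel) = (\<integral>\<^sup>+t. liminf (\<lambda>m. f m t) \<partial>lborel)"
  proof (rule nn_integral_cong)
    fix t :: real
    obtain k :: nat where k: "t \<le> real k" using real_arch_simple by blast
    have "\<forall>\<^sub>F m in sequentially. f m t = ennreal (g t) * indicator {0..} t"
    proof (rule eventually_sequentiallyI)
      fix m assume "k \<le> m"
      then have "t \<le> real m" using k by linarith
      then show "f m t = ennreal (g t) * indicator {0..} t" by (simp add: f_def indicator_def)
    qed
    then have "(\<lambda>m. f m t) \<longlonglongrightarrow> ennreal (g t) * indicator {0..} t" by (rule tendsto_eventually)
    then show "ennreal (g t) * indicator {0..} t = liminf (\<lambda>m. f m t)"
      by (rule lim_imp_Liminf[OF sequentially_bot, symmetric])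
  qed
  also have "\<dots> \<le> liminf (\<lambda>m. \<integral>\<^sup>+t. f m t \<partial>lborel)" by (rule nn_integral_liminf[OF fm])
  also have "\<dots> \<le> ennreal B"
  proof (rule Liminf_le[OF sequentially_bot eventually_sequentiallyI[of 1]])
    fix m :: nat assume m: "1 \<le> m"
    have "(\<integral>\<^sup>+t. f m t \<partial>lborel) = ennreal (LBINT t:{0..real m}. g t)"
      unfolding f_def set_lebesgue_integral_def
      by (rule nn_integral_eq_integral) (use g[of "real m"] nonneg in \<open>auto simp: set_integrable_def indicator_def\<close>)
    then show "(\<integral>\<^sup>+t. f m t \<partial>lborel) \<le> ennreal B" using B[of "real m"] m by (simp add: ennreal_leI)
  qed
  finally show ?thesis .
qed

lemma time_integral_mono_time:
  fixes g :: "real \<Rightarrow> real"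
  assumes g: "set_integrable lborel {0..t} g" and st: "s \<le> t" and nonneg: "\<And>u. 0 \<le> u \<Longrightarrow> 0 \<le> g u"
  shows "(LBINT u:{0..s}. g u) \<le> (LBINT u:{0..t}. g u)"
proof -
  have gs: "set_integrable lborel {0..s} g"
    by (rule set_integrable_subset[OF g]) (use st in auto)
  show ?thesis
    unfolding set_lebesgue_integral_def
    by (rule integral_mono[OF gs[unfolded set_integrable_def] g[unfolded set_integrable_def]])
      (use st nonneg in \<open>auto simp: indicator_def\<close>)
qed

text \<open>A continuous nonnegative function with integral 0 vanishes. This leads from a vanishing
  moment integral back to the initial state, because at time 0 a moment is the form at
  \<open>x0\<close>.\<close>

lemma time_integral_pos:
  fixes g :: "real \<Rightarrow> real"
  assumes c: "continuous_on {0..1} g" and nonneg: "\<And>u. 0 \<le> u \<Longrightarrow> 0 \<le> g u" and z: "(LBINT u:{0..1}. g u) \<le> 0"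
  shows "g 0 = 0"
proof -
  have "0 \<le> (LBINT u:{0..1}. g u)"
    unfolding set_lebesgue_integral_def using nonneg
    by (intro Bochner_Integration.integral_nonneg) (simp add: indicator_def)
  with z have "integral {0..1} g = 0"
    using set_borel_integral_eq_integral(2)[OF borel_integrable_atLeastAtMost'[OF c]] by simp
  then have "\<forall>u\<in>{0..1}. g u = 0"
    using integral_eq_0_iff[OF c] nonneg by simp
  then show ?thesis by simp
qed

text \<open>Polarization at pairs of unit vectors recovers the entries.\<close>

lemma symmetric_zero_of_quad_form:
  assumes P: "P \<in> carrier_mat n n" "P\<^sup>T = P" and z: "\<And>v. v \<in> carrier_vec n \<Longrightarrow> quad_form P v = 0"
  shows "P = 0\<^sub>m n n"
proof (rule eq_matI)
  fix i j assume "i < dim_row (0\<^sub>m n n :: real mat)" "j < dim_col (0\<^sub>m n n :: real mat)"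
  then have ij: "i < n" "j < n" by simp_all
  define u where "u = (unit_vec n i :: real vec)"
  define v where "v = (unit_vec n j :: real vec)"
  have u: "u \<in> carrier_vec n" and v: "v \<in> carrier_vec n" by (simp_all add: u_def v_def)
  have "u \<bullet> (P *\<^sub>v v) = 0"
    using quad_form_add[OF P u v] z[OF u] z[OF v] z[OF add_carrier_vec[OF u v]] by simp
  moreover have "u \<bullet> (P *\<^sub>v v) = P $$ (i, j)"
  proof -
    have "u \<bullet> (P *\<^sub>v v) = (\<Sum>a<n. \<Sum>b<n. if a = i \<and> b = j then P $$ (i, j) else 0)"
      unfolding bilinear_expand[OF P(1) u v] by (intro sum.cong refl) (auto simp: u_def v_def unit_vec_def)
    also have "\<dots> = (\<Sum>a<n. if a = i then P $$ (i, j) else 0)"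
      using ij by (intro sum.cong refl) auto
    also have "\<dots> = P $$ (i, j)" using ij by simp
    finally show ?thesis .
  qed
  ultimately show "P $$ (i, j) = 0\<^sub>m n n $$ (i, j)" using ij by simp
qed (use P in auto)

section \<open>Moments and cost of the closed-loop state\<close>

context stochastic_lq_game
begin

definition state_moment :: "(nat \<Rightarrow> real mat) \<Rightarrow> real vec \<Rightarrow> real mat \<Rightarrow> real \<Rightarrow> real" where
  "state_moment K x0 = moment n (coord K x0)"

context
  fixes K :: "nat \<Rightarrow> real mat" and x0 :: "real vec"
  assumes K: "K \<in> gains" and x0: "x0 \<in> carrier_vec n"
begin

lemma state_moment_evolution: "P \<in> carrier_mat n n \<Longrightarrow> 0 \<le> t \<Longrightarrow> state_moment K x0 P t = quad_form P x0 + (LBINT s:{0..t}. state_moment K x0 (lyapunov (A_cl G K) (C_cl G K) P) s)"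
  unfolding state_moment_def by (rule moment_evolution(2)[OF cl_carrier x0 closed_loop(1)[OF K]])

lemma state_moment_continuous: "P \<in> carrier_mat n n \<Longrightarrow> 0 \<le> T \<Longrightarrow> continuous_on {0..T} (state_moment K x0 P)"
  unfolding state_moment_def by (rule moment_continuous[OF cl_carrier x0 closed_loop(1)[OF K]])

lemma state_moment_integrable: "P \<in> carrier_mat n n \<Longrightarrow> 0 \<le> T \<Longrightarrow> set_integrable lborel {0..T} (state_moment K x0 P)"
  by (rule borel_integrable_atLeastAtMost'[OF state_moment_continuous])

lemma quad_integrable: "P \<in> carrier_mat n n \<Longrightarrow> 0 \<le> t \<Longrightarrow> integrable M (\<lambda>\<omega>. quad_form P (vec n (\<lambda>r. coord K x0 r t \<omega>)))"
  by (rule moment_integrable[OF cl_carrier x0 closed_loop(1)[OF K]])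

text \<open>The factors \<open>c\<close> and \<open>c'\<close> take the place of scaled matrices and
  allow both signs of a bound.\<close>

lemma state_moment_mono:
  assumes P: "P \<in> carrier_mat n n" "P' \<in> carrier_mat n n" and t: "0 \<le> t"
    and le: "\<And>v. v \<in> carrier_vec n \<Longrightarrow> c * quad_form P v \<le> c' * quad_form P' v"
  shows "c * state_moment K x0 P t \<le> c' * state_moment K x0 P' t"
proof -
  have "expectation (\<lambda>\<omega>. c * quad_form P (vec n (\<lambda>r. coord K x0 r t \<omega>)))
     \<le> expectation (\<lambda>\<omega>. c' * quad_form P' (vec n (\<lambda>r. coord K x0 r t \<omega>)))"
    by (intro integral_mono integrable_mult_right quad_integrable P t le vec_carrier)
  then show ?thesis by (simp add: state_moment_def moment_def)
qed

text \<open>A two-term version of the monotonicity, for the sum of Lyapunov form and running weight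
  that \<open>energy_balance\<close> compares.\<close>

lemma state_moment_sum_mono:
  assumes P: "P \<in> carrier_mat n n" "W \<in> carrier_mat n n" "E \<in> carrier_mat n n" and t: "0 \<le> t"
  shows "(\<And>v. v \<in> carrier_vec n \<Longrightarrow> quad_form P v + quad_form W v \<le> c * quad_form E v)
      \<Longrightarrow> state_moment K x0 P t + state_moment K x0 W t \<le> c * state_moment K x0 E t"
    and "(\<And>v. v \<in> carrier_vec n \<Longrightarrow> c * quad_form E v \<le> quad_form P v + quad_form W v)
      \<Longrightarrow> c * state_moment K x0 E t \<le> state_moment K x0 P t + state_moment K x0 W t"
proof -
  note i = quad_integrable[OF P(1) t] quad_integrable[OF P(2) t] quad_integrable[OF P(3) t]
  have s: "state_moment K x0 P t + state_moment K x0 W t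
     = expectation (\<lambda>\<omega>. quad_form P (vec n (\<lambda>r. coord K x0 r t \<omega>)) + quad_form W (vec n (\<lambda>r. coord K x0 r t \<omega>)))"
    unfolding state_moment_def moment_def by (rule Bochner_Integration.integral_add[OF i(1,2), symmetric])
  have e: "c * state_moment K x0 E t = expectation (\<lambda>\<omega>. c * quad_form E (vec n (\<lambda>r. coord K x0 r t \<omega>)))"
    unfolding state_moment_def moment_def by simp
  show "state_moment K x0 P t + state_moment K x0 W t \<le> c * state_moment K x0 E t"
    if "\<And>v. v \<in> carrier_vec n \<Longrightarrow> quad_form P v + quad_form W v \<le> c * quad_form E v"
    unfolding s e using that
    by (intro integral_mono Bochner_Integration.integrable_add integrable_mult_right i) (rule that[OF vec_carrier])
  show "c * state_moment K x0 E t \<le> state_moment K x0 P t + state_moment K x0 W t"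
    if "\<And>v. v \<in> carrier_vec n \<Longrightarrow> c * quad_form E v \<le> quad_form P v + quad_form W v"
    unfolding s e
    by (intro integral_mono Bochner_Integration.integrable_add integrable_mult_right i) (rule that[OF vec_carrier])
qed

lemma state_moment_nonneg:
  assumes "\<And>v. v \<in> carrier_vec n \<Longrightarrow> 0 \<le> quad_form P v"
  shows "0 \<le> state_moment K x0 P t"
  unfolding state_moment_def moment_def by (rule Bochner_Integration.integral_nonneg[OF assms[OF vec_carrier]])

lemma state_moment_initial: "P \<in> carrier_mat n n \<Longrightarrow> state_moment K x0 P 0 = quad_form P x0"
  using state_moment_evolution[of P 0] by (simp only: time_integral_0 order_refl add_0_right)

lemma mean_square_eq:
  assumes t: "0 \<le> t"
  shows "(\<integral>\<^sup>+\<omega>. ennreal (closed_loop_state M F w G K x0 t \<omega> \<bullet> closed_loop_state M F w G K x0 t \<omega>) \<partial>M)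
    = ennreal (state_moment K x0 (1\<^sub>m n) t)"
proof -
  have "(\<integral>\<^sup>+\<omega>. ennreal (closed_loop_state M F w G K x0 t \<omega> \<bullet> closed_loop_state M F w G K x0 t \<omega>) \<partial>M)
    = (\<integral>\<^sup>+\<omega>. ennreal (quad_form (1\<^sub>m n) (vec n (\<lambda>r. coord K x0 r t \<omega>))) \<partial>M)"
    by (rule nn_integral_cong) (simp add: closed_loop(3)[OF K t] quad_form_one[OF closed_loop(2)[OF K t]])
  also have "\<dots> = ennreal (state_moment K x0 (1\<^sub>m n) t)"
    unfolding state_moment_def moment_def
    by (rule nn_integral_eq_integral[OF quad_integrable[OF one_carrier_mat t]])
      (intro AE_I2, simp add: quad_form_one scalar_prod_self_nonneg[OF vec_carrier])
  finally show ?thesis .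
qed

text \<open>Tonelli moves the expectation inside the time integral. Joint measurability comes from
  path continuity, and time is clamped at 0 to have it on the whole line.\<close>

lemma cost_eq:
  assumes i: "i \<in> players G"
  shows "feedback_cost M F w G i x0 K = (\<integral>\<^sup>+t\<in>{0..}. ennreal (state_moment K x0 (running_weight G K i) t) \<partial>lborel)"
proof -
  interpret LM: pair_sigma_finite lborel M ..
  define W where "W = running_weight G K i"
  have Wc: "W \<in> carrier_mat n n" unfolding W_def by (rule running_weight_carrier[OF i])
  have Wpos: "0 \<le> quad_form W v" if "v \<in> carrier_vec n" for v
    using running_weight_ge[OF K i that] pos_defD(4)[OF bspec[OF Q_pos i] that] unfolding W_def by linarith
  define x where "x t \<omega> = vec n (\<lambda>r. coord K x0 r t \<omega>)" for t \<omega>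
  have q: "quad_form W (x t \<omega>) = (\<Sum>a<n. \<Sum>b<n. W $$ (a, b) * (coord K x0 a t \<omega> * coord K x0 b t \<omega>))" for t \<omega>
    using quad_form_expand[OF Wc, of "x t \<omega>"] by (simp add: x_def)
  note sde = closed_loop(1)[OF K, of x0, unfolded linear_sde_def]
  have cont: "continuous_on {0..} (\<lambda>t. coord K x0 r t \<omega>)" if "\<omega> \<in> space M" "r < n" for \<omega> r
    using sde that by blast
  have meas: "coord K x0 r t \<in> borel_measurable M" if "0 \<le> t" "r < n" for t r
    using sde that by (intro measurable_F[OF that(1)]) (auto simp: square_integrable_adapted_def)
  have joint: "(\<lambda>(t, \<omega>). quad_form W (x (max 0 t) \<omega>)) \<in> borel_measurable (lborel \<Otimes>\<^sub>M M)"
  proof (rule continuous_process_measurable)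
    show "(\<lambda>\<omega>. quad_form W (x (max 0 t) \<omega>)) \<in> borel_measurable M" for t
      unfolding q by (intro borel_measurable_sum borel_measurable_times borel_measurable_const meas) auto
    show "continuous_on UNIV (\<lambda>t. quad_form W (x (max 0 t) \<omega>))" if w: "\<omega> \<in> space M" for \<omega>
    proof -
      have "continuous_on UNIV (\<lambda>t. coord K x0 r (max 0 t) \<omega>)" if "r < n" for r
        by (rule continuous_on_compose2[OF cont[OF w that]]) (auto intro!: continuous_intros)
      then show ?thesis unfolding q by (intro continuous_intros) auto
    qed
  qed
  have m2: "(\<lambda>z. ennreal (case z of (t, \<omega>) \<Rightarrow> quad_form W (x (max 0 t) \<omega>)) * indicator ({0..} \<times> space M) z)
      \<in> borel_measurable (lborel \<Otimes>\<^sub>M M)"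
    using joint by (intro borel_measurable_times_ennreal measurable_compose[OF _ measurable_ennreal] borel_measurable_indicator) auto
  have "feedback_cost M F w G i x0 K = (\<integral>\<^sup>+\<omega>. (\<integral>\<^sup>+t. ennreal (case (t, \<omega>) of (t, \<omega>) \<Rightarrow> quad_form W (x (max 0 t) \<omega>))
      * indicator ({0..} \<times> space M) (t, \<omega>) \<partial>lborel) \<partial>M)"
    unfolding feedback_cost_def cost_def Let_def
  proof (intro nn_integral_cong)
    fix \<omega> and t :: real assume w: "\<omega> \<in> space M"
    define y where "y = closed_loop_state M F w G K x0 t \<omega>"
    show "ennreal (quad_form (Qmat G i) (closed_loop_state M F w G K x0 t \<omega>)
        + (\<Sum>j\<in>players G. quad_form (Rmat G i j) (- (K j *\<^sub>v closed_loop_state M F w G K x0 t \<omega>)))) * indicator {0..} t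
      = ennreal (case (t, \<omega>) of (t, \<omega>) \<Rightarrow> quad_form W (x (max 0 t) \<omega>)) * indicator ({0..} \<times> space M) (t, \<omega>)"
    proof (cases "0 \<le> t")
      case True
      have y: "y \<in> carrier_vec n" "x t \<omega> = y"
        unfolding y_def x_def by (rule closed_loop(2,3)[OF K True w])+
      have "quad_form (Qmat G i) y + (\<Sum>j\<in>players G. quad_form (Rmat G i j) (- (K j *\<^sub>v y))) = quad_form W y"
        unfolding W_def quad_form_running_weight[OF K i y(1)]
        by (intro arg_cong2[of _ _ _ _ "(+)"] sum.cong refl quad_form_uminus[OF game_carriers(6)[OF i] mult_mat_vec_carrier[OF gainsD[OF K] y(1)]])
      then show ?thesis using True w y(2) by (simp add: y_def[symmetric] max_def indicator_def)
    qed (simp add: indicator_def)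
  qed
  also have "\<dots> = (\<integral>\<^sup>+t. (\<integral>\<^sup>+\<omega>. ennreal (case (t, \<omega>) of (t, \<omega>) \<Rightarrow> quad_form W (x (max 0 t) \<omega>))
      * indicator ({0..} \<times> space M) (t, \<omega>) \<partial>M) \<partial>lborel)"
    by (rule LM.Fubini[OF m2])
  also have "\<dots> = (\<integral>\<^sup>+t\<in>{0..}. ennreal (state_moment K x0 W t) \<partial>lborel)"
  proof (rule nn_integral_cong)
    fix t :: real
    show "(\<integral>\<^sup>+\<omega>. ennreal (case (t, \<omega>) of (t, \<omega>) \<Rightarrow> quad_form W (x (max 0 t) \<omega>)) * indicator ({0..} \<times> space M) (t, \<omega>) \<partial>M)
       = ennreal (state_moment K x0 W t) * indicator {0..} t"
    proof (cases "0 \<le> t")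
      case True
      have "(\<integral>\<^sup>+\<omega>. ennreal (case (t, \<omega>) of (t, \<omega>) \<Rightarrow> quad_form W (x (max 0 t) \<omega>)) * indicator ({0..} \<times> space M) (t, \<omega>) \<partial>M)
        = (\<integral>\<^sup>+\<omega>. ennreal (quad_form W (x t \<omega>)) \<partial>M)"
        using True by (intro nn_integral_cong) (simp add: indicator_def max_def)
      also have "\<dots> = ennreal (state_moment K x0 W t)"
        unfolding state_moment_def moment_def x_def
        by (rule nn_integral_eq_integral[OF quad_integrable[OF Wc True]]) (intro AE_I2 Wpos vec_carrier)
      finally show ?thesis using True by simp
    qed (simp add: indicator_def)
  qed
  finally show ?thesis by (simp only: W_def)
qed

end

definition stable :: "(nat \<Rightarrow> real mat) \<Rightarrow> bool" where
  "stable K \<longleftrightarrow> (\<forall>x0\<in>carrier_vec n. (state_moment K x0 (1\<^sub>m n) \<longlongrightarrow> 0) at_top)"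

lemma one_quad_nonneg: "v \<in> carrier_vec n \<Longrightarrow> 0 \<le> quad_form (1\<^sub>m n) v"
  by (simp add: quad_form_one scalar_prod_self_nonneg)

lemma stabilizing_iff: "K \<in> stabilizing_tuples M F w G \<longleftrightarrow> K \<in> gains \<and> stable K"
proof -
  have "((\<lambda>t. \<integral>\<^sup>+\<omega>. ennreal (closed_loop_state M F w G K x0 t \<omega> \<bullet> closed_loop_state M F w G K x0 t \<omega>) \<partial>M) \<longlongrightarrow> 0) at_top
      \<longleftrightarrow> (state_moment K x0 (1\<^sub>m n) \<longlongrightarrow> 0) at_top" if K: "K \<in> gains" and x0: "x0 \<in> carrier_vec n" for x0
  proof -
    have "((\<lambda>t. \<integral>\<^sup>+\<omega>. ennreal (closed_loop_state M F w G K x0 t \<omega> \<bullet> closed_loop_state M F w G K x0 t \<omega>) \<partial>M) \<longlongrightarrow> 0) at_top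
      \<longleftrightarrow> ((\<lambda>t. ennreal (state_moment K x0 (1\<^sub>m n) t)) \<longlongrightarrow> ennreal 0) at_top"
      unfolding ennreal_0
      by (rule filterlim_cong[OF refl refl eventually_mono[OF eventually_ge_at_top[of 0]]]) (rule mean_square_eq[OF K x0])
    also have "\<dots> \<longleftrightarrow> (state_moment K x0 (1\<^sub>m n) \<longlongrightarrow> 0) at_top"
      by (rule tendsto_ennreal_iff[OF always_eventually]) (simp_all add: state_moment_nonneg[OF K x0 one_quad_nonneg])
    finally show ?thesis .
  qed
  then show ?thesis
    unfolding stabilizing_tuples_def mean_square_stable_def stable_def gains_def by auto
qed

text \<open>Every quadratic form is dominated by a multiple of the squared norm, so mean-square
  stability controls all second moments.\<close>

lemma state_moment_tendsto_0:
  assumes K: "K \<in> gains" "stable K" and x0: "x0 \<in> carrier_vec n" and P: "P \<in> carrier_mat n n"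
  shows "(state_moment K x0 P \<longlongrightarrow> 0) at_top"
proof -
  obtain c where c: "0 < c" "\<And>v. v \<in> carrier_vec n \<Longrightarrow> \<bar>quad_form P v\<bar> \<le> c * (v \<bullet> v)"
    using quad_form_bound[OF P] by blast
  have b: "\<bar>state_moment K x0 P t\<bar> \<le> c * state_moment K x0 (1\<^sub>m n) t" if t: "0 \<le> t" for t
  proof -
    have le: "1 * quad_form P v \<le> c * quad_form (1\<^sub>m n) v" "(- 1) * quad_form P v \<le> c * quad_form (1\<^sub>m n) v"
      if "v \<in> carrier_vec n" for v
      using c(2)[OF that] by (simp_all add: quad_form_one[OF that] abs_le_iff)
    show ?thesis
      using state_moment_mono[OF K(1) x0 P one_carrier_mat t le(1)] state_moment_mono[OF K(1) x0 P one_carrier_mat t le(2)]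
      by (simp add: abs_le_iff)
  qed
  have "((\<lambda>t. c * state_moment K x0 (1\<^sub>m n) t) \<longlongrightarrow> 0) at_top"
    using K(2) x0 by (intro tendsto_mult_right_zero) (simp add: stable_def)
  then show ?thesis
    by (rule Lim_null_comparison[rotated]) (use b in \<open>auto intro: eventually_mono[OF eventually_ge_at_top[of 0]]\<close>)
qed

end

section \<open>Sums, kernels and perturbations of matrices\<close>

lemma quad_form_mat_add:
  assumes "X \<in> carrier_mat m m" "Y \<in> carrier_mat m m" "v \<in> carrier_vec m"
  shows "quad_form (X + Y) v = quad_form X v + quad_form Y v"
  unfolding quad_form_def add_mult_distrib_mat_vec[OF assms]
  by (rule scalar_prod_add_distrib[OF assms(3) mult_mat_vec_carrier[OF assms(1,3)] mult_mat_vec_carrier[OF assms(2,3)]])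

lemma quad_form_zero_mat:
  assumes v: "v \<in> carrier_vec m"
  shows "quad_form (0\<^sub>m m m) v = 0"
  unfolding quad_form_expand[OF zero_carrier_mat v] by (intro sum.neutral ballI) simp

lemma zero_mat_of_kernel:
  fixes X :: "real mat"
  assumes X: "X \<in> carrier_mat r c" and z: "\<And>v. v \<in> carrier_vec c \<Longrightarrow> X *\<^sub>v v = 0\<^sub>v r"
  shows "X = 0\<^sub>m r c"
proof (rule eq_matI)
  fix a b assume "a < dim_row (0\<^sub>m r c :: real mat)" "b < dim_col (0\<^sub>m r c :: real mat)"
  then have ab: "a < r" "b < c" by simp_all
  have "X $$ (a, b) = (\<Sum>k<c. if k = b then X $$ (a, b) else 0)" using ab by simp
  also have "\<dots> = (X *\<^sub>v unit_vec c b) $ a"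
    unfolding mult_mat_vec_expand[OF X unit_vec_carrier ab(1)] by (intro sum.cong refl) (auto simp: unit_vec_def)
  also have "\<dots> = 0" using z[OF unit_vec_carrier] ab(1) by simp
  finally show "X $$ (a, b) = 0\<^sub>m r c $$ (a, b)" using ab by simp
qed (use X in auto)

lemma add_smult_mult_vec:
  fixes X Y :: "real mat"
  assumes X: "X \<in> carrier_mat r c" and Y: "Y \<in> carrier_mat r c" and v: "v \<in> carrier_vec c"
  shows "(X + k \<cdot>\<^sub>m Y) *\<^sub>v v - X *\<^sub>v v = k \<cdot>\<^sub>v (Y *\<^sub>v v)"
proof (rule eq_vecI)
  have Xv: "X *\<^sub>v v \<in> carrier_vec r" and Yv: "Y *\<^sub>v v \<in> carrier_vec r"
    using X Y v by (auto intro: mult_mat_vec_carrier)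
  show "dim_vec ((X + k \<cdot>\<^sub>m Y) *\<^sub>v v - X *\<^sub>v v) = dim_vec (k \<cdot>\<^sub>v (Y *\<^sub>v v))" using X Y by simp
  fix a assume "a < dim_vec (k \<cdot>\<^sub>v (Y *\<^sub>v v))"
  then have a: "a < r" using Y by simp
  note c = add_carrier_mat[OF smult_carrier_mat[OF Y]]
  have "((X + k \<cdot>\<^sub>m Y) *\<^sub>v v - X *\<^sub>v v) $ a = ((X + k \<cdot>\<^sub>m Y) *\<^sub>v v) $ a - (X *\<^sub>v v) $ a"
    by (rule index_minus_carrier[OF Xv a])
  also have "\<dots> = k * (Y *\<^sub>v v) $ a"
    unfolding mult_mat_vec_expand[OF c v a] mult_mat_vec_expand[OF X v a] mult_mat_vec_expand[OF Y v a]
      sum_distrib_left sum_subtractf[symmetric]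
    using X Y a by (intro sum.cong refl) (simp add: algebra_simps)
  finally show "((X + k \<cdot>\<^sub>m Y) *\<^sub>v v - X *\<^sub>v v) $ a = (k \<cdot>\<^sub>v (Y *\<^sub>v v)) $ a"
    by (simp only: index_smult_vec(1)[of a "Y *\<^sub>v v" k] carrier_vecD[OF Yv] a)
qed

section \<open>Energy balance and the two directions of the equivalence\<close>

context stochastic_lq_game
begin

abbreviation lyap_cl :: "(nat \<Rightarrow> real mat) \<Rightarrow> real mat \<Rightarrow> real mat" where
  "lyap_cl K P \<equiv> lyapunov (A_cl G K) (C_cl G K) P"

text \<open>The dissipation inequality integrated over [0, T]. The term with \<open>c\<close> and
  \<open>E\<close> records a surplus over exact balance; c = 0 gives the plain comparison of P with
  the accumulated cost.\<close>

lemma energy_balance: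
  assumes K: "K \<in> gains" and x0: "x0 \<in> carrier_vec n" and P: "P \<in> carrier_mat n n" and W: "W \<in> carrier_mat n n"
    and E: "E \<in> carrier_mat n n" and T: "0 \<le> T"
  shows "(\<And>v. v \<in> carrier_vec n \<Longrightarrow> c * quad_form E v \<le> quad_form (lyap_cl K P) v + quad_form W v)
      \<Longrightarrow> quad_form P x0 + c * (LBINT t:{0..T}. state_moment K x0 E t) \<le> state_moment K x0 P T + (LBINT t:{0..T}. state_moment K x0 W t)"
    and "(\<And>v. v \<in> carrier_vec n \<Longrightarrow> quad_form (lyap_cl K P) v + quad_form W v \<le> c * quad_form E v)
      \<Longrightarrow> state_moment K x0 P T + (LBINT t:{0..T}. state_moment K x0 W t) \<le> quad_form P x0 + c * (LBINT t:{0..T}. state_moment K x0 E t)"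
proof -
  note LP = lyapunov_carrier[OF cl_carrier(1)[of K] cl_carrier(2)[of K] P]
  note i = state_moment_integrable[OF K x0 LP T] state_moment_integrable[OF K x0 W T] state_moment_integrable[OF K x0 E T]
  note iLW = set_integral_add(1)[OF i(1,2)]
  have iE: "set_integrable lborel {0..T} (\<lambda>t. c * state_moment K x0 E t)" using i(3) by simp
  have s: "state_moment K x0 P T + (LBINT t:{0..T}. state_moment K x0 W t)
      = quad_form P x0 + (LBINT t:{0..T}. state_moment K x0 (lyap_cl K P) t + state_moment K x0 W t)"
    unfolding state_moment_evolution[OF K x0 P T] set_integral_add(2)[OF i(1,2)] by (rule add.assoc)
  have e: "c * (LBINT t:{0..T}. state_moment K x0 E t) = (LBINT t:{0..T}. c * state_moment K x0 E t)"
    by (rule set_integral_mult_right[symmetric])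
  show "quad_form P x0 + c * (LBINT t:{0..T}. state_moment K x0 E t) \<le> state_moment K x0 P T + (LBINT t:{0..T}. state_moment K x0 W t)"
    if h: "\<And>v. v \<in> carrier_vec n \<Longrightarrow> c * quad_form E v \<le> quad_form (lyap_cl K P) v + quad_form W v"
    unfolding s e
    by (rule add_left_mono[OF set_integral_mono[OF iE iLW]])
      (rule state_moment_sum_mono(2)[OF K x0 LP W E], simp, rule h)
  show "state_moment K x0 P T + (LBINT t:{0..T}. state_moment K x0 W t) \<le> quad_form P x0 + c * (LBINT t:{0..T}. state_moment K x0 E t)"
    if h: "\<And>v. v \<in> carrier_vec n \<Longrightarrow> quad_form (lyap_cl K P) v + quad_form W v \<le> c * quad_form E v"
    unfolding s e
    by (rule add_left_mono[OF set_integral_mono[OF iLW iE]])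
      (rule state_moment_sum_mono(1)[OF K x0 LP W E], simp, rule h)
qed

lemma running_weight_nonneg:
  assumes "K \<in> gains" "i \<in> players G" "v \<in> carrier_vec n"
  shows "0 \<le> quad_form (running_weight G K i) v"
  using running_weight_ge[OF assms] pos_defD(4)[OF bspec[OF Q_pos assms(2)] assms(3)] by linarith

text \<open>By stability the terminal moment of P fades as T grows, and the energy balance turns
  into a lower bound of the cost.\<close>

lemma cost_ge:
  assumes K: "K \<in> gains" "stable K" and x0: "x0 \<in> carrier_vec n" and i: "i \<in> players G" and P: "P \<in> carrier_mat n n"
    and h: "\<And>v. v \<in> carrier_vec n \<Longrightarrow> 0 \<le> quad_form (lyap_cl K P) v + quad_form (running_weight G K i) v"
  shows "ennreal (quad_form P x0) \<le> feedback_cost M F w G i x0 K"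
proof -
  note W = running_weight_carrier[OF i, of K]
  have "((\<lambda>T. ennreal (quad_form P x0 - state_moment K x0 P T)) \<longlongrightarrow> ennreal (quad_form P x0 - 0)) at_top"
    by (intro tendsto_ennrealI tendsto_diff tendsto_const state_moment_tendsto_0[OF K x0 P])
  moreover have "\<forall>\<^sub>F T in at_top. ennreal (quad_form P x0 - state_moment K x0 P T) \<le> feedback_cost M F w G i x0 K"
  proof (rule eventually_mono[OF eventually_ge_at_top[of 0]])
    fix T :: real assume T: "0 \<le> T"
    have "quad_form P x0 + 0 * (LBINT t:{0..T}. state_moment K x0 P t) \<le> state_moment K x0 P T + (LBINT t:{0..T}. state_moment K x0 (running_weight G K i) t)"
      by (rule energy_balance(1)[OF K(1) x0 P W P T]) (simp add: h)
    then have "ennreal (quad_form P x0 - state_moment K x0 P T) \<le> ennreal (LBINT t:{0..T}. state_moment K x0 (running_weight G K i) t)"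
      by (intro ennreal_leI) simp
    also have "\<dots> \<le> feedback_cost M F w G i x0 K"
      unfolding cost_eq[OF K(1) x0 i]
      by (rule half_line_integral_ge[OF state_moment_integrable[OF K(1) x0 W T] state_moment_nonneg[OF K(1) x0 running_weight_nonneg[OF K(1) i]]])
    finally show "ennreal (quad_form P x0 - state_moment K x0 P T) \<le> feedback_cost M F w G i x0 K" .
  qed
  ultimately show ?thesis
    using tendsto_upperbound[OF _ _ trivial_limit_at_top_linorder] by fastforce
qed

lemma cost_le:
  assumes K: "K \<in> gains" and x0: "x0 \<in> carrier_vec n" and i: "i \<in> players G" and P: "P \<in> pos_def_mats n"
    and E: "E \<in> carrier_mat n n" "\<And>v. v \<in> carrier_vec n \<Longrightarrow> 0 \<le> quad_form E v" and e: "0 \<le> e"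
    and h: "\<And>v. v \<in> carrier_vec n \<Longrightarrow> quad_form (lyap_cl K P) v + quad_form (running_weight G K i) v \<le> - e * quad_form E v"
  shows "0 \<le> quad_form P x0 - e * (LBINT t:{0..1}. state_moment K x0 E t)"
    and "feedback_cost M F w G i x0 K \<le> ennreal (quad_form P x0 - e * (LBINT t:{0..1}. state_moment K x0 E t))"
proof -
  note W = running_weight_carrier[OF i, of K]
  note Wn = state_moment_nonneg[OF K x0 running_weight_nonneg[OF K i]]
  have b: "(LBINT t:{0..T}. state_moment K x0 (running_weight G K i) t) \<le> quad_form P x0 - e * (LBINT t:{0..1}. state_moment K x0 E t)"
    if T: "1 \<le> T" for T
  proof -
    have T0: "0 \<le> T" using T by simp
    have "state_moment K x0 P T + (LBINT t:{0..T}. state_moment K x0 (running_weight G K i) t)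
        \<le> quad_form P x0 + - e * (LBINT t:{0..T}. state_moment K x0 E t)"
      by (rule energy_balance(2)[OF K x0 pos_defD(1)[OF P] W E(1) T0 h])
    moreover have "0 \<le> state_moment K x0 P T" by (rule state_moment_nonneg[OF K x0 pos_defD(4)[OF P]])
    moreover have "e * (LBINT t:{0..1}. state_moment K x0 E t) \<le> e * (LBINT t:{0..T}. state_moment K x0 E t)"
      by (rule mult_left_mono[OF time_integral_mono_time[OF state_moment_integrable[OF K x0 E(1) T0] T state_moment_nonneg[OF K x0 E(2)]] e])
    ultimately show ?thesis by simp
  qed
  have "0 \<le> (LBINT t:{0..1}. state_moment K x0 (running_weight G K i) t)"
    unfolding set_lebesgue_integral_def using Wn
    by (intro Bochner_Integration.integral_nonneg) (simp add: indicator_def)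
  then show "0 \<le> quad_form P x0 - e * (LBINT t:{0..1}. state_moment K x0 E t)" using b[of 1] by simp
  show "feedback_cost M F w G i x0 K \<le> ennreal (quad_form P x0 - e * (LBINT t:{0..1}. state_moment K x0 E t))"
    unfolding cost_eq[OF K x0 i] by (rule half_line_integral_le[OF state_moment_integrable[OF K x0 W] Wn b])
qed

text \<open>The Lyapunov function decreases and has a finite time integral, so it decays like 1 / t.\<close>

lemma stable_of_lyapunov:
  assumes K: "K \<in> gains" and P: "P \<in> pos_def_mats n" and Q: "Q \<in> pos_def_mats n"
    and h: "\<And>v. v \<in> carrier_vec n \<Longrightarrow> quad_form (lyap_cl K P) v \<le> - quad_form Q v"
  shows "stable K"
  unfolding stable_def
proof
  fix x0 :: "real vec" assume x0: "x0 \<in> carrier_vec n"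
  note Pc = pos_defD(1)[OF P] and Qc = pos_defD(1)[OF Q]
  note LP = lyapunov_carrier[OF cl_carrier(1)[of K] cl_carrier(2)[of K] Pc]
  obtain c1 where c1: "0 < c1" "\<And>v. v \<in> carrier_vec n \<Longrightarrow> v \<bullet> v \<le> c1 * quad_form Q v"
    using pos_def_coercive[OF Q] by blast
  obtain c2 where c2: "0 < c2" "\<And>v. v \<in> carrier_vec n \<Longrightarrow> \<bar>quad_form P v\<bar> \<le> c2 * (v \<bullet> v)"
    using quad_form_bound[OF Pc] by blast
  obtain c3 where c3: "0 < c3" "\<And>v. v \<in> carrier_vec n \<Longrightarrow> v \<bullet> v \<le> c3 * quad_form P v"
    using pos_def_coercive[OF P] by blast
  define p where "p = state_moment K x0 P"
  \<comment> \<open>The bound on P followed by the coercivity of Q.\<close>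
  have PQ: "1 * quad_form P v \<le> (c2 * c1) * quad_form Q v" if v: "v \<in> carrier_vec n" for v
  proof -
    have "quad_form P v \<le> c2 * (v \<bullet> v)" using c2(2)[OF v] by linarith
    also have "\<dots> \<le> c2 * (c1 * quad_form Q v)" by (rule mult_left_mono[OF c1(2)[OF v]]) (use c2(1) in simp)
    finally show ?thesis by (simp add: mult.assoc)
  qed
  have bound: "(LBINT t:{0..T}. state_moment K x0 Q t) \<le> quad_form P x0" if T: "0 \<le> T" for T
  proof -
    have "state_moment K x0 P T + (LBINT t:{0..T}. state_moment K x0 Q t) \<le> quad_form P x0 + 0 * (LBINT t:{0..T}. state_moment K x0 Q t)"
      by (rule energy_balance(2)[OF K x0 Pc Qc Qc T]) (use h in force)
    moreover have "0 \<le> state_moment K x0 P T" by (rule state_moment_nonneg[OF K x0 pos_defD(4)[OF P]])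
    ultimately show ?thesis by simp
  qed
  have decr: "p T \<le> p s" if s: "0 \<le> s" "s \<le> T" for s T
  proof -
    have T: "0 \<le> T" using s by simp
    \<comment> \<open>Minus the derivative of the Lyapunov moment, clamped at time 0 so as to be
      nonnegative everywhere.\<close>
    define g where "g t = (- 1) * state_moment K x0 (lyap_cl K P) (max 0 t)" for t
    have gi: "set_integrable lborel {0..t} g \<and> (LBINT u:{0..t}. g u) = (- 1) * (LBINT u:{0..t}. state_moment K x0 (lyap_cl K P) u)"
      if "0 \<le> t" for t
    proof -
      have c: "set_integrable lborel {0..t} (\<lambda>u. (- 1) * state_moment K x0 (lyap_cl K P) u)"
        by (rule set_integrable_mult_right) (rule state_moment_integrable[OF K x0 LP that])
      have eq: "\<And>u. u \<in> {0..t} \<Longrightarrow> g u = (- 1) * state_moment K x0 (lyap_cl K P) u" by (simp add: g_def)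
      have "set_integrable lborel {0..t} g \<longleftrightarrow> set_integrable lborel {0..t} (\<lambda>u. (- 1) * state_moment K x0 (lyap_cl K P) u)"
        by (rule set_integrable_cong[OF refl refl eq])
      with c have "set_integrable lborel {0..t} g" by (simp only:)
      moreover have "(LBINT u:{0..t}. g u) = (LBINT u:{0..t}. (- 1) * state_moment K x0 (lyap_cl K P) u)"
        by (rule set_lebesgue_integral_cong) (use eq in auto)
      ultimately show ?thesis by (simp only: set_integral_mult_right)
    qed
    have g: "0 \<le> g u" for u
    proof -
      have "1 * state_moment K x0 (lyap_cl K P) (max 0 u) \<le> 0 * state_moment K x0 Q (max 0 u)"
      proof (rule state_moment_mono[OF K x0 LP Qc])
        fix v :: "real vec" assume v: "v \<in> carrier_vec n"
        show "1 * quad_form (lyap_cl K P) v \<le> 0 * quad_form Q v"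
          using h[OF v] pos_defD(4)[OF Q v] by linarith
      qed (rule max.cobounded1)
      then show ?thesis by (simp add: g_def)
    qed
    have "(LBINT u:{0..s}. g u) \<le> (LBINT u:{0..T}. g u)"
      by (rule time_integral_mono_time[OF conjunct1[OF gi[OF T]] s(2) g])
    then have "(LBINT u:{0..T}. state_moment K x0 (lyap_cl K P) u) \<le> (LBINT u:{0..s}. state_moment K x0 (lyap_cl K P) u)"
      using gi[OF s(1)] gi[OF T] by linarith
    then show ?thesis
      unfolding p_def state_moment_evolution[OF K x0 Pc T] state_moment_evolution[OF K x0 Pc s(1)] by (rule add_left_mono)
  qed
  define B where "B = c3 * (c2 * c1 * quad_form P x0)"
  have dec: "norm (state_moment K x0 (1\<^sub>m n) T) \<le> B / T" if T: "0 < T" for T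
  proof -
    have T0: "0 \<le> T" using T by simp
    \<comment> \<open>Since \<open>p\<close> decreases, T p(T) is at most its integral over [0, T];
      \<open>PQ\<close> bounds that by a multiple of the integral for Q, and \<open>bound\<close>
      bounds the latter by the initial value.\<close>
    have "T * p T = (LBINT t:{0..T}. p T)"
      using T by (simp add: set_lebesgue_integral_def)
    also have "\<dots> \<le> (LBINT t:{0..T}. (c2 * c1) * state_moment K x0 Q t)"
    proof (rule set_integral_mono)
      show "set_integrable lborel {0..T} (\<lambda>t. p T)"
        by (rule borel_integrable_atLeastAtMost'[OF continuous_on_const])
      show "set_integrable lborel {0..T} (\<lambda>t. (c2 * c1) * state_moment K x0 Q t)"
        using state_moment_integrable[OF K x0 Qc T0] by simp
      fix t assume t: "t \<in> {0..T}"
      have "p T \<le> p t" using t by (intro decr) auto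
      also have "p t \<le> (c2 * c1) * state_moment K x0 Q t"
        using state_moment_mono[OF K x0 Pc Qc _ PQ, of t] t by (simp add: p_def)
      finally show "p T \<le> (c2 * c1) * state_moment K x0 Q t" .
    qed
    also have "\<dots> = (c2 * c1) * (LBINT t:{0..T}. state_moment K x0 Q t)" by (rule set_integral_mult_right)
    also have "\<dots> \<le> (c2 * c1) * quad_form P x0"
      by (rule mult_left_mono[OF bound[OF T0]]) (use c1(1) c2(1) in simp)
    finally have pT: "T * p T \<le> c2 * c1 * quad_form P x0" .
    have le: "1 * quad_form (1\<^sub>m n) v \<le> c3 * quad_form P v" if "v \<in> carrier_vec n" for v
      using c3(2)[OF that] by (simp add: quad_form_one[OF that])
    have "state_moment K x0 (1\<^sub>m n) T \<le> c3 * p T"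
      using state_moment_mono[OF K x0 one_carrier_mat Pc T0 le] by (simp add: p_def)
    then have "T * state_moment K x0 (1\<^sub>m n) T \<le> T * (c3 * p T)" by (rule mult_left_mono[OF _ T0])
    also have "\<dots> = c3 * (T * p T)" by simp
    also have "\<dots> \<le> B" unfolding B_def by (rule mult_left_mono[OF pT]) (use c3(1) in simp)
    finally have "state_moment K x0 (1\<^sub>m n) T \<le> B / T" using T by (simp add: pos_le_divide_eq mult.commute)
    then show ?thesis using state_moment_nonneg[OF K x0 one_quad_nonneg, of T] by simp
  qed
  have "((\<lambda>T. B / T) \<longlongrightarrow> 0) at_top"
    by (rule real_tendsto_divide_at_top[OF tendsto_const filterlim_ident])
  then show "(state_moment K x0 (1\<^sub>m n) \<longlongrightarrow> 0) at_top"
    by (rule Lim_null_comparison[rotated]) (rule eventually_mono[OF eventually_gt_at_top[of 0] dec])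
qed

lemma lyapunov_equation_quad_form:
  assumes P: "P \<in> carrier_mat n n" and i: "i \<in> players G"
    and eq: "lyap_cl K P + running_weight G K i = 0\<^sub>m n n" and v: "v \<in> carrier_vec n"
  shows "quad_form (lyap_cl K P) v + quad_form (running_weight G K i) v = 0"
  using quad_form_mat_add[OF lyapunov_carrier[OF cl_carrier(1)[of K] cl_carrier(2)[of K] P] running_weight_carrier[OF i, of K] v]
  by (simp add: eq quad_form_zero_mat[OF v])

text \<open>Exact balance yields both cost bounds, with surplus 0. Under a deviation the linear term
  vanishes with the defect and the quadratic term is nonnegative, so the same value remains a lower
  bound of the cost.\<close>

lemma riccati_sufficient:
  assumes K: "K \<in> gains" "stable K" and i: "i \<in> players G" and P: "P \<in> pos_def_mats n" and x0: "x0 \<in> carrier_vec n"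
    and eq: "lyap_cl K P + running_weight G K i = 0\<^sub>m n n" and gain: "gain_defect K i P = 0\<^sub>m (udim G i) n"
  shows "feedback_cost M F w G i x0 K = ennreal (quad_form P x0)"
    and "K(i := Ki) \<in> stabilizing_tuples M F w G
      \<Longrightarrow> feedback_cost M F w G i x0 K \<le> feedback_cost M F w G i x0 (K(i := Ki))"
proof -
  note Pc = pos_defD(1)[OF P]
  note z = lyapunov_equation_quad_form[OF Pc i eq]
  show c: "feedback_cost M F w G i x0 K = ennreal (quad_form P x0)"
  proof (rule antisym)
    have "feedback_cost M F w G i x0 K \<le> ennreal (quad_form P x0 - 0 * (LBINT t:{0..1}. state_moment K x0 (1\<^sub>m n) t))"
      by (rule cost_le(2)[OF K(1) x0 i P one_carrier_mat one_quad_nonneg order_refl]) (simp_all add: z)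
    then show "feedback_cost M F w G i x0 K \<le> ennreal (quad_form P x0)" by simp
    show "ennreal (quad_form P x0) \<le> feedback_cost M F w G i x0 K"
      by (rule cost_ge[OF K x0 i Pc]) (simp add: z)
  qed
  assume st: "K(i := Ki) \<in> stabilizing_tuples M F w G"
  then have K': "K(i := Ki) \<in> gains" "stable (K(i := Ki))" unfolding stabilizing_iff by auto
  have Ki: "Ki \<in> carrier_mat (udim G i) n" using gainsD[OF K'(1) i] by simp
  show "feedback_cost M F w G i x0 K \<le> feedback_cost M F w G i x0 (K(i := Ki))"
    unfolding c
  proof (rule cost_ge[OF K' x0 i Pc])
    fix v :: "real vec" assume v: "v \<in> carrier_vec n"
    define d where "d = Ki *\<^sub>v v - K i *\<^sub>v v"
    have d: "d \<in> carrier_vec (udim G i)"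
      unfolding d_def by (rule minus_carrier_vec[OF mult_mat_vec_carrier[OF Ki v] mult_mat_vec_carrier[OF gainsD[OF K(1) i] v]])
    have "0\<^sub>m (udim G i) n *\<^sub>v v = 0\<^sub>v (udim G i)" using v by auto
    then have "d \<bullet> (gain_defect K i P *\<^sub>v v) = 0" using d by (simp add: gain)
    moreover have "0 \<le> quad_form (gain_weight i P) d" by (rule pos_defD(4)[OF gain_weight_pos_def[OF i P] d])
    ultimately show "0 \<le> quad_form (lyap_cl (K(i := Ki)) P) v + quad_form (running_weight G (K(i := Ki)) i) v"
      using deviation_identity[OF K(1) i P Ki v, folded d_def] z[OF v] by linarith
  qed
qed

text \<open>If L(P) = 0, the moment of P is constant in time and tends to 0, so P = 0: this is the
  injectivity. For positivity, the form of P at \<open>v\<close> is at least the cost accumulated on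
  [0, 1] from \<open>v\<close>, which cannot vanish for v \<noteq> 0 because the running weight
  dominates Q.\<close>

lemma lyapunov_equation_solution:
  assumes K: "K \<in> gains" "stable K" and i: "i \<in> players G"
  obtains P where "P \<in> pos_def_mats n" "lyap_cl K P + running_weight G K i = 0\<^sub>m n n"
proof -
  define W where "W = running_weight G K i"
  have W: "W \<in> carrier_mat n n" "W\<^sup>T = W"
    unfolding W_def by (rule running_weight_carrier[OF i], rule running_weight_symmetric[OF K(1) i])
  have inj: "P = 0\<^sub>m n n" if P: "P \<in> carrier_mat n n" "P\<^sup>T = P" and z: "lyap_cl K P = 0\<^sub>m n n" for P
  proof (rule symmetric_zero_of_quad_form[OF P])
    fix v :: "real vec" assume v: "v \<in> carrier_vec n"
    have "\<forall>\<^sub>F T in at_top. state_moment K v P T = quad_form P v"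
    proof (rule eventually_mono[OF eventually_ge_at_top[of 0]])
      fix T :: real assume T: "0 \<le> T"
      have "state_moment K v (0\<^sub>m n n) t = 0" for t by (simp add: state_moment_def moment_def quad_form_zero_mat)
      then show "state_moment K v P T = quad_form P v"
        unfolding state_moment_evolution[OF K(1) v P(1) T] z by (simp add: set_lebesgue_integral_def)
    qed
    from tendsto_eventually[OF this] state_moment_tendsto_0[OF K v P(1)] show "quad_form P v = 0"
      by (rule tendsto_unique[OF trivial_limit_at_top_linorder])
  qed
  obtain P where P: "P \<in> carrier_mat n n" "P\<^sup>T = P" "lyap_cl K P = - W"
    using lyapunov_solvable[OF cl_carrier inj W] by blast
  have eq: "lyap_cl K P + running_weight G K i = 0\<^sub>m n n"
    unfolding P(3) W_def[symmetric] by (rule uminus_l_inv_mat[OF W(1)])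
  note z = lyapunov_equation_quad_form[OF P(1) i eq, folded W_def]
  have "0 < quad_form P v" if v: "v \<in> carrier_vec n" and nz: "v \<noteq> 0\<^sub>v n" for v
  proof (rule ccontr)
    assume neg: "\<not> 0 < quad_form P v"
    have nonneg: "0 \<le> state_moment K v W t" for t
      unfolding W_def by (rule state_moment_nonneg[OF K(1) v running_weight_nonneg[OF K(1) i]])
    have "((\<lambda>T. quad_form P v - state_moment K v P T) \<longlongrightarrow> quad_form P v - 0) at_top"
      by (intro tendsto_diff tendsto_const state_moment_tendsto_0[OF K v P(1)])
    moreover have "\<forall>\<^sub>F T in at_top. (LBINT t:{0..1}. state_moment K v W t) \<le> quad_form P v - state_moment K v P T"
    proof (rule eventually_mono[OF eventually_ge_at_top[of 1]])
      fix T :: real assume T: "1 \<le> T"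
      then have T0: "0 \<le> T" by simp
      have "state_moment K v P T + (LBINT t:{0..T}. state_moment K v W t) \<le> quad_form P v + 0 * (LBINT t:{0..T}. state_moment K v W t)"
        by (rule energy_balance(2)[OF K(1) v P(1) W(1) W(1) T0]) (simp add: z)
      moreover have "(LBINT t:{0..1}. state_moment K v W t) \<le> (LBINT t:{0..T}. state_moment K v W t)"
        by (rule time_integral_mono_time[OF state_moment_integrable[OF K(1) v W(1) T0] T nonneg])
      ultimately show "(LBINT t:{0..1}. state_moment K v W t) \<le> quad_form P v - state_moment K v P T" by linarith
    qed
    ultimately have "(LBINT t:{0..1}. state_moment K v W t) \<le> quad_form P v - 0"
      by (rule tendsto_lowerbound[OF _ _ trivial_limit_at_top_linorder])
    then have "(LBINT t:{0..1}. state_moment K v W t) \<le> 0" using neg by linarith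
    then have "state_moment K v W 0 = 0"
      by (rule time_integral_pos[OF state_moment_continuous[OF K(1) v W(1) zero_le_one] nonneg])
    then have "quad_form W v = 0" by (simp only: state_moment_initial[OF K(1) v W(1)])
    then show False
      using running_weight_ge[OF K(1) i v] pos_defD(3)[OF bspec[OF Q_pos i] v nz] by (simp add: W_def)
  qed
  then have "P \<in> pos_def_mats n" using P by (simp add: pos_def_mats_def)
  with eq show ?thesis by (rule that[rotated])
qed

text \<open>Moving the gain of player i a little against the defect would lower his cost at first order,
  so the defect of an equilibrium vanishes.\<close>

lemma riccati_necessary:
  assumes nash: "feedback_nash_equilibrium M F w G K" and K: "K \<in> gains" "stable K" and i: "i \<in> players G"
    and P: "P \<in> pos_def_mats n" and eq: "lyap_cl K P + running_weight G K i = 0\<^sub>m n n"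
  shows "gain_defect K i P = 0\<^sub>m (udim G i) n"
proof -
  note Pc = pos_defD(1)[OF P]
  note z = lyapunov_equation_quad_form[OF Pc i eq]
  define m where "m = udim G i"
  define D where "D = gain_defect K i P"
  have D: "D \<in> carrier_mat m n" unfolding D_def m_def by (rule gain_defect_carrier[OF K(1) i Pc])
  obtain c where c: "0 < c" "\<And>u. u \<in> carrier_vec m \<Longrightarrow> \<bar>quad_form (gain_weight i P) u\<bar> \<le> c * (u \<bullet> u)"
    using quad_form_bound[OF pos_defD(1)[OF gain_weight_pos_def[OF i P]], folded m_def] by blast
  \<comment> \<open>With \<open>c\<close> a bound of the quadratic term, - 2 e + e^2 c = - e: half
    of the first-order gain is left as surplus.\<close>
  define e where "e = 1 / c"
  have e: "0 < e" "e * c = 1" using c(1) by (simp_all add: e_def)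
  \<comment> \<open>D' D, so that its form at \<open>v\<close> is the squared norm of the defect
    applied to \<open>v\<close>.\<close>
  define E where "E = D\<^sup>T * 1\<^sub>m m * D"
  have E: "E \<in> carrier_mat n n" unfolding E_def by (rule congruence_carrier[OF one_carrier_mat D])
  have Dv: "D *\<^sub>v v \<in> carrier_vec m" if "v \<in> carrier_vec n" for v
    using D that by (rule mult_mat_vec_carrier)
  have qE: "quad_form E v = (D *\<^sub>v v) \<bullet> (D *\<^sub>v v)" if v: "v \<in> carrier_vec n" for v
    unfolding E_def quad_form_congruence[OF one_carrier_mat D v] by (rule quad_form_one[OF Dv[OF v]])
  have En: "0 \<le> quad_form E v" if "v \<in> carrier_vec n" for v
    unfolding qE[OF that] by (rule scalar_prod_self_nonneg[OF Dv[OF that]])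
  define Ki where "Ki = K i + (- e) \<cdot>\<^sub>m D"
  have Kc: "K i \<in> carrier_mat m n" using gainsD[OF K(1) i] by (simp add: m_def)
  have Ki: "Ki \<in> carrier_mat (udim G i) n"
    unfolding Ki_def m_def[symmetric] by (rule add_carrier_mat[OF smult_carrier_mat[OF D]])
  define K' where "K' = K(i := Ki)"
  have K'g: "K' \<in> gains" unfolding K'_def by (rule gains_update[OF K(1) Ki])
  have dec: "quad_form (lyap_cl K' P) v + quad_form (running_weight G K' i) v \<le> - e * quad_form E v"
    if v: "v \<in> carrier_vec n" for v
  proof -
    define d where "d = D *\<^sub>v v"
    have d: "d \<in> carrier_vec m" unfolding d_def by (rule Dv[OF v])
    have delta: "Ki *\<^sub>v v - K i *\<^sub>v v = (- e) \<cdot>\<^sub>v d"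
      unfolding Ki_def d_def by (rule add_smult_mult_vec[OF Kc D v])
    have "quad_form (lyap_cl K' P) v + quad_form (running_weight G K' i) v
        = 2 * (((- e) \<cdot>\<^sub>v d) \<bullet> d) + quad_form (gain_weight i P) ((- e) \<cdot>\<^sub>v d)"
      using deviation_identity[OF K(1) i P Ki v, folded K'_def D_def, unfolded delta] z[OF v] by (simp add: d_def)
    also have "((- e) \<cdot>\<^sub>v d) \<bullet> d = - e * (d \<bullet> d)"
      by (rule smult_scalar_prod_distrib[OF d d])
    also have "quad_form (gain_weight i P) ((- e) \<cdot>\<^sub>v d) = e\<^sup>2 * quad_form (gain_weight i P) d"
      unfolding quad_form_smult[OF pos_defD(1)[OF gain_weight_pos_def[OF i P]] d[unfolded m_def]] by simp
    also have "e\<^sup>2 * quad_form (gain_weight i P) d \<le> e\<^sup>2 * (c * (d \<bullet> d))"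
      using c(2)[OF d] by (intro mult_left_mono) auto
    also have "e\<^sup>2 * (c * (d \<bullet> d)) = (e * c) * (e * (d \<bullet> d))" by (simp add: power2_eq_square)
    also have "\<dots> = e * (d \<bullet> d)" by (simp only: e(2) mult_1)
    finally show ?thesis unfolding qE[OF v] d_def[symmetric] by simp
  qed
  \<comment> \<open>The equilibrium condition speaks of stabilizing tuples only, so the perturbed
    tuple must be shown to be one. The decrease is at least Q because the new running weight
    dominates Q.\<close>
  have "stable K'"
  proof (rule stable_of_lyapunov[OF K'g P bspec[OF Q_pos i]])
    fix v :: "real vec" assume v: "v \<in> carrier_vec n"
    have "0 \<le> e * quad_form E v" using e(1) En[OF v] by simp
    then show "quad_form (lyap_cl K' P) v \<le> - quad_form (Qmat G i) v"
      using dec[OF v] running_weight_ge[OF K'g i v] by linarith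
  qed
  then have st: "K' \<in> stabilizing_tuples M F w G" using K'g unfolding stabilizing_iff by simp
  have "D *\<^sub>v v = 0\<^sub>v m" if v: "v \<in> carrier_vec n" for v
  proof -
    define J where "J = (LBINT t:{0..1}. state_moment K' v E t)"
    note cl = cost_le[OF K'g v i P E En less_imp_le[OF e(1)] dec, folded J_def]
    have "ennreal (quad_form P v) \<le> feedback_cost M F w G i v K"
      by (rule cost_ge[OF K v i Pc]) (simp add: z)
    also have "\<dots> \<le> feedback_cost M F w G i v K'"
      using nash st i v unfolding feedback_nash_equilibrium_def K'_def by blast
    also note cl(2)
    \<comment> \<open>Nonnegativity of the right side, \<open>cl(1)\<close>, is what allows the
      comparison to be read in the reals.\<close>
    finally have "quad_form P v \<le> quad_form P v - e * J" using cl(1) by (simp only: ennreal_le_iff)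
    then have "e * J \<le> 0" by simp
    then have "J \<le> 0" using e(1) by (simp add: mult_le_0_iff)
    then have "state_moment K' v E 0 = 0"
      unfolding J_def
      by (rule time_integral_pos[OF state_moment_continuous[OF K'g v E zero_le_one] state_moment_nonneg[OF K'g v En], rotated]) auto
    then have "(D *\<^sub>v v) \<bullet> (D *\<^sub>v v) = 0" by (simp only: state_moment_initial[OF K'g v E] qE[OF v])
    then show ?thesis by (rule scalar_prod_self_zero[OF Dv[OF v]])
  qed
  then show ?thesis using zero_mat_of_kernel[OF D] by (simp add: D_def m_def)
qed

end

theorem lemma2:
  fixes M :: "'a measure" and F :: "real \<Rightarrow> 'a measure" and w :: "real \<Rightarrow> 'a \<Rightarrow> real"
    and G :: lq_game and K :: "nat \<Rightarrow> real mat"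
  assumes "wiener_setting M F w"
    and "game_dims G"
    and "mean_square_stabilizable M F w G"
    and "\<forall>i\<in>players G. Qmat G i \<in> pos_def_mats (xdim G)"
    and "\<forall>i\<in>players G. Rmat G i i \<in> pos_def_mats (udim G i)"
    and "\<forall>i\<in>players G. \<forall>j\<in>players G - {i}. Rmat G i j \<in> pos_semidef_mats (udim G j)"
    and "K \<in> stabilizing_tuples M F w G"
  shows
    "(\<forall>P. (\<forall>i\<in>players G. P i \<in> pos_def_mats (xdim G)) \<and>
          (\<forall>i\<in>players G. riccati_equation G K P i \<and> riccati_gain G K P i) \<longrightarrow>
        feedback_nash_equilibrium M F w G K \<and>
        (\<forall>i\<in>players G. \<forall>x0\<in>carrier_vec (xdim G).
           feedback_cost M F w G i x0 K = ennreal (quad_form (P i) x0)))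
     \<and>
     (feedback_nash_equilibrium M F w G K \<longrightarrow>
        (\<exists>P. (\<forall>i\<in>players G. P i \<in> pos_def_mats (xdim G)) \<and>
             (\<forall>i\<in>players G. riccati_equation G K P i \<and> riccati_gain G K P i)))"
proof -
  interpret stochastic_lq_game M F w G
    unfolding stochastic_lq_game_def lq_setting_def using assms by blast
  have K: "K \<in> gains" "stable K" using assms(7) unfolding stabilizing_iff by auto
  show ?thesis
  proof (intro conjI allI impI)
    fix P assume h: "(\<forall>i\<in>players G. P i \<in> pos_def_mats (xdim G)) \<and>
          (\<forall>i\<in>players G. riccati_equation G K P i \<and> riccati_gain G K P i)"
    have P: "P i \<in> pos_def_mats n" and eq: "lyap_cl K (P i) + running_weight G K i = 0\<^sub>m n n"
      and gain: "gain_defect K i (P i) = 0\<^sub>m (udim G i) n" if i: "i \<in> players G" for i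
    proof -
      show P: "P i \<in> pos_def_mats n" using h i by blast
      show "lyap_cl K (P i) + running_weight G K i = 0\<^sub>m n n"
        using h i riccati_equation_iff[where P = P and i = i and K = K, OF pos_defD(1)[OF P] i] by blast
      show "gain_defect K i (P i) = 0\<^sub>m (udim G i) n"
        using h i riccati_gain_iff[where P = P and i = i and K = K, OF K(1) i P] by blast
    qed
    show "feedback_nash_equilibrium M F w G K"
      unfolding feedback_nash_equilibrium_def
      using assms(7) riccati_sufficient(2)[OF K _ P _ eq gain] by blast
    show "\<forall>i\<in>players G. \<forall>x0\<in>carrier_vec (xdim G). feedback_cost M F w G i x0 K = ennreal (quad_form (P i) x0)"
      using riccati_sufficient(1)[OF K _ P _ eq gain] by blast
  next
    assume nash: "feedback_nash_equilibrium M F w G K"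
    \<comment> \<open>With \<open>K\<close> fixed the equations (a) decouple into one linear
      Lyapunov equation per player, so the matrices are chosen independently; the coupling lies in
      (b) alone.\<close>
    have "\<forall>i\<in>players G. \<exists>P. P \<in> pos_def_mats n \<and> lyap_cl K P + running_weight G K i = 0\<^sub>m n n"
      using lyapunov_equation_solution[OF K] by metis
    then obtain P where P: "\<And>i. i \<in> players G \<Longrightarrow> P i \<in> pos_def_mats n"
      and eq: "\<And>i. i \<in> players G \<Longrightarrow> lyap_cl K (P i) + running_weight G K i = 0\<^sub>m n n"
      by metis
    have "riccati_equation G K P i \<and> riccati_gain G K P i" if i: "i \<in> players G" for i
      unfolding riccati_equation_iff[where P = P and i = i and K = K, OF pos_defD(1)[OF P[OF i]] i] riccati_gain_iff[where P = P and i = i and K = K, OF K(1) i P[OF i]]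
      by (intro conjI eq[OF i] riccati_necessary[OF nash K i P[OF i] eq[OF i]])
    then show "\<exists>P. (\<forall>i\<in>players G. P i \<in> pos_def_mats (xdim G)) \<and>
             (\<forall>i\<in>players G. riccati_equation G K P i \<and> riccati_gain G K P i)"
      using P by blast
  qed
qed

end
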